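(* Assume that $(M,d,\mu,L)$ satisfies $(H)$ and that $(M,d,\mu)$ satisfies the volume doubling property: there is $C>0$ with $V(x,2r)\le C\,V(x,r)$ for all $x\in M$, $r>0$. Let $v:M\times\mathbb{R}_+\to\mathbb{R}_+$ satisfy $(A)$, $(D_v)$ and $(D'_v)$. Then the upper bound $(DUE^v)$ is equivalent to the inhomogeneous relative Faber-Krahn inequality $(\widetilde{FK}^v)$.
   Context: $B(x,r)$ denotes the open ball of the metric $d$, and $V(x,r):=\mu(B(x,r))$, assumed finite and positive for all $x\in M,r>0$. $(H)$: $(M,d,\mu)$ is a locally compact, separable and complete metric space endowed with a Borel measure $\mu$ which is finite on compact sets and strictly positive on non-empty open sets; $L$ is a non-negative self-adjoint operator on $L^2(M,\mu)$ whose associated quadratic form $\mathcal{E}$, $\mathcal{E}(f)=\|L^{1/2}f\|_2^2$ with domain $\mathcal{F}$, is a strongly local and regular Dirichlet form, with energy measure $d\Gamma$ (so $\mathcal{E}(f,g)=\int_M d\Gamma(f,g)$ for $f,g\in\mathcal{F}$); and for every $x\in M$ the function $d_x(y):=d(x,y)$ belongs to $\mathcal{F}_{loc}$ (the functions that coincide locally with elements of $\mathcal F$) and satisfies $d\Gamma(d_x,d_x)\le d\mu$. Conditions on $v$ (write $v_r(x)=v(x,r)$): - $(A)$: $v(x,r)$ is measurable in $x$, a.e. finite and positive, and non-decreasing in $r$ for a.e. fixed $x$. - $(D_v)$: there is $C>0$ with $v(x,2r)\le C\,v(x,r)$ for all $r>0$ and $\mu$-a.e. $x$. - $(D'_v)$: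 there is $C>0$ with $v(y,r)\le C\,v(x,r)$ for all $x,y\in M$, $r>0$ with $d(x,y)\le r$. $(DUE^v)$: $(e^{-tL})_{t>0}$ has a measurable kernel $p_t$, and there exist $C,c>0$ such that $|p_t(x,y)|\le C\left(v(x,c\sqrt t)\,v(y,c\sqrt t)\right)^{-1/2}$ for all $t>0$ and $\mu$-a.e. $x,y\in M$. For an open set $\Omega\subset M$, $\mathcal{F}_c(\Omega)$ is the set of functions in $\mathcal{F}$ compactly supported in $\Omega$ and $\lambda_1(\Omega):=\inf\{\mathcal{E}(f)/\|f\|_2^2:\ f\in\mathcal{F}_c(\Omega),\ f\ne0\}$. $(\widetilde{FK}^v)$: there exist $\alpha,c>0$ such that for any ball $B(x,r)\subset M$ and any (non-empty) relatively compact open set $\Omega\subset B(x,r)$, $r^2\lambda_1(\Omega)+1\ge c\left(\dfrac{v_r(x)}{\mu(\Omega)}\right)^\alpha$. *)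

theory Defs
  imports "HOL-Analysis.Analysis"
begin

section \<open>The real Hilbert space of square-integrable functions\<close>

text \<open>Elements of the space are represented by functions; all notions below respect equality
  almost everywhere. Operators, possibly unbounded, are given by their graphs: relations between
  square-integrable functions that are closed under a.e. modification on both sides.\<close>

definition L2_space :: "'a measure \<Rightarrow> ('a \<Rightarrow> real) set" where
  "L2_space \<mu> = {f \<in> borel_measurable \<mu>. integrable \<mu> (\<lambda>x. (f x)\<^sup>2)}"

definition L2_inner :: "'a measure \<Rightarrow> ('a \<Rightarrow> real) \<Rightarrow> ('a \<Rightarrow> real) \<Rightarrow> real" where
  "L2_inner \<mu> f g = (\<integral>x. f x * g x \<partial>\<mu>)"

definition L2_norm :: "'a measure \<Rightarrow> ('a \<Rightarrow> real) \<Rightarrow> real" where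
  "L2_norm \<mu> f = sqrt (\<integral>x. (f x)\<^sup>2 \<partial>\<mu>)"

definition ae_eq :: "'a measure \<Rightarrow> ('a \<Rightarrow> real) \<Rightarrow> ('a \<Rightarrow> real) \<Rightarrow> bool" where
  "ae_eq \<mu> f g \<longleftrightarrow> (AE x in \<mu>. f x = g x)"

definition L2_dense :: "'a measure \<Rightarrow> ('a \<Rightarrow> real) set \<Rightarrow> bool" where
  "L2_dense \<mu> D \<longleftrightarrow> (\<forall>f\<in>L2_space \<mu>. \<forall>e>0. \<exists>g\<in>D. L2_norm \<mu> (\<lambda>x. f x - g x) < e)"

definition lin_subspace :: "('a \<Rightarrow> real) set \<Rightarrow> bool" where
  "lin_subspace D \<longleftrightarrow> (\<lambda>_. 0) \<in> D \<and>
     (\<forall>f\<in>D. \<forall>g\<in>D. \<forall>a b. (\<lambda>x. a * f x + b * g x) \<in> D)"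


section \<open>Self-adjoint operators and their functional calculus\<close>

type_synonym 'a op_graph = "(('a \<Rightarrow> real) \<times> ('a \<Rightarrow> real)) set"

definition linear_op :: "'a measure \<Rightarrow> 'a op_graph \<Rightarrow> bool" where
  "linear_op \<mu> T \<longleftrightarrow>
     T \<subseteq> L2_space \<mu> \<times> L2_space \<mu> \<and>
     (\<forall>f g f' g'. (f, g) \<in> T \<and> f' \<in> L2_space \<mu> \<and> g' \<in> L2_space \<mu> \<and>
        ae_eq \<mu> f f' \<and> ae_eq \<mu> g g' \<longrightarrow> (f', g') \<in> T) \<and>
     (\<forall>f g g'. (f, g) \<in> T \<and> (f, g') \<in> T \<longrightarrow> ae_eq \<mu> g g') \<and>
     ((\<lambda>_. 0), (\<lambda>_. 0)) \<in> T \<and>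
     (\<forall>f g f' g' a b. (f, g) \<in> T \<and> (f', g') \<in> T \<longrightarrow>
        ((\<lambda>x. a * f x + b * f' x), (\<lambda>x. a * g x + b * g' x)) \<in> T)"

definition adjoint_op :: "'a measure \<Rightarrow> 'a op_graph \<Rightarrow> 'a op_graph" where
  "adjoint_op \<mu> T = {(h, k). h \<in> L2_space \<mu> \<and> k \<in> L2_space \<mu> \<and>
     (\<forall>(f, g)\<in>T. L2_inner \<mu> g h = L2_inner \<mu> f k)}"

definition self_adjoint :: "'a measure \<Rightarrow> 'a op_graph \<Rightarrow> bool" where
  "self_adjoint \<mu> T \<longleftrightarrow> linear_op \<mu> T \<and> L2_dense \<mu> (Domain T) \<and> adjoint_op \<mu> T = T"

definition nonneg_op :: "'a measure \<Rightarrow> 'a op_graph \<Rightarrow> bool" where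
  "nonneg_op \<mu> T \<longleftrightarrow> (\<forall>(f, g)\<in>T. 0 \<le> L2_inner \<mu> g f)"

text \<open>The symmetry condition is required on all of the space, and hence forces linearity,
  boundedness and compatibility with a.e. equality.\<close>

definition orth_projection :: "'a measure \<Rightarrow> (('a \<Rightarrow> real) \<Rightarrow> ('a \<Rightarrow> real)) \<Rightarrow> bool" where
  "orth_projection \<mu> P \<longleftrightarrow>
     (\<forall>f\<in>L2_space \<mu>. P f \<in> L2_space \<mu> \<and> ae_eq \<mu> (P (P f)) (P f)) \<and>
     (\<forall>f\<in>L2_space \<mu>. \<forall>g\<in>L2_space \<mu>. L2_inner \<mu> (P f) g = L2_inner \<mu> f (P g))"

definition projection_valued_measure ::
  "'a measure \<Rightarrow> (real set \<Rightarrow> ('a \<Rightarrow> real) \<Rightarrow> ('a \<Rightarrow> real)) \<Rightarrow> bool" where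
  "projection_valued_measure \<mu> Q \<longleftrightarrow>
     (\<forall>B\<in>sets borel. orth_projection \<mu> (Q B)) \<and>
     (\<forall>f\<in>L2_space \<mu>. ae_eq \<mu> (Q UNIV f) f) \<and>
     (\<forall>f\<in>L2_space \<mu>. \<forall>A::nat \<Rightarrow> real set. range A \<subseteq> sets borel \<and> disjoint_family A \<longrightarrow>
        (\<lambda>n. L2_inner \<mu> (Q (A n) f) f) sums L2_inner \<mu> (Q (\<Union>n. A n) f) f)"

text \<open>The finite measure that sends \<open>B\<close> to the inner product of \<open>Q B f\<close> and \<open>f\<close>.\<close>

definition scalar_spectral_measure ::
  "'a measure \<Rightarrow> (real set \<Rightarrow> ('a \<Rightarrow> real) \<Rightarrow> ('a \<Rightarrow> real)) \<Rightarrow> ('a \<Rightarrow> real) \<Rightarrow> real measure" where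
  "scalar_spectral_measure \<mu> Q f =
     measure_of UNIV (sets borel) (\<lambda>B. ennreal (L2_inner \<mu> (Q B f) f))"

text \<open>The graph of the integral of \<open>\<phi>\<close> against \<open>Q\<close>. Its domain consists of the \<open>f\<close> for which
  \<open>\<phi>\<^sup>2\<close> is integrable against the measure of \<open>f\<close>; the value \<open>g\<close> is fixed by its inner products
  with the (dense) domain, where the integral against the signed measure sending \<open>B\<close> to the
  inner product of \<open>Q B f\<close> and \<open>h\<close> is written by polarization.\<close>

definition spectral_integral ::
  "'a measure \<Rightarrow> (real set \<Rightarrow> ('a \<Rightarrow> real) \<Rightarrow> ('a \<Rightarrow> real)) \<Rightarrow> (real \<Rightarrow> real) \<Rightarrow> 'a op_graph" where
  "spectral_integral \<mu> Q \<phi> = {(f, g).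
     f \<in> L2_space \<mu> \<and> g \<in> L2_space \<mu> \<and>
     integrable (scalar_spectral_measure \<mu> Q f) (\<lambda>s. (\<phi> s)\<^sup>2) \<and>
     (\<forall>h\<in>L2_space \<mu>. integrable (scalar_spectral_measure \<mu> Q h) (\<lambda>s. (\<phi> s)\<^sup>2) \<longrightarrow>
        L2_inner \<mu> g h =
          ((\<integral>s. \<phi> s \<partial>scalar_spectral_measure \<mu> Q (\<lambda>x. f x + h x))
           - (\<integral>s. \<phi> s \<partial>scalar_spectral_measure \<mu> Q (\<lambda>x. f x - h x))) / 4)}"

definition spectral_resolution ::
  "'a measure \<Rightarrow> 'a op_graph \<Rightarrow> (real set \<Rightarrow> ('a \<Rightarrow> real) \<Rightarrow> ('a \<Rightarrow> real)) \<Rightarrow> bool" where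
  "spectral_resolution \<mu> L Q \<longleftrightarrow>
     projection_valued_measure \<mu> Q \<and> spectral_integral \<mu> Q (\<lambda>s. s) = L"

text \<open>The operator \<open>\<phi>(L)\<close>. By the spectral theorem a self-adjoint \<open>L\<close> has a spectral resolution,
  unique up to a.e. equality, so neither the choice nor the else-branch matters.\<close>

definition functional_calculus ::
  "'a measure \<Rightarrow> 'a op_graph \<Rightarrow> (real \<Rightarrow> real) \<Rightarrow> 'a op_graph" where
  "functional_calculus \<mu> L \<phi> =
     (if \<exists>Q. spectral_resolution \<mu> L Q
      then spectral_integral \<mu> (SOME Q. spectral_resolution \<mu> L Q) \<phi> else {})"

definition sqrt_op :: "'a measure \<Rightarrow> 'a op_graph \<Rightarrow> 'a op_graph" where
  "sqrt_op \<mu> L = functional_calculus \<mu> L sqrt"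

definition heat_op :: "'a measure \<Rightarrow> 'a op_graph \<Rightarrow> real \<Rightarrow> 'a op_graph" where
  "heat_op \<mu> L t = functional_calculus \<mu> L (\<lambda>s. exp (- (t * s)))"

definition op_apply :: "'a op_graph \<Rightarrow> ('a \<Rightarrow> real) \<Rightarrow> ('a \<Rightarrow> real)" where
  "op_apply T f = (SOME g. (f, g) \<in> T)"

definition form_dom :: "'a measure \<Rightarrow> 'a op_graph \<Rightarrow> ('a \<Rightarrow> real) set" where
  "form_dom \<mu> L = Domain (sqrt_op \<mu> L)"

text \<open>The symmetric bilinear form whose diagonal \<open>op_form \<mu> L f f\<close> is the squared norm of the
  square root of \<open>L\<close> applied to \<open>f\<close>.\<close>

definition op_form :: "'a measure \<Rightarrow> 'a op_graph \<Rightarrow> ('a \<Rightarrow> real) \<Rightarrow> ('a \<Rightarrow> real) \<Rightarrow> real" where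
  "op_form \<mu> L f g = L2_inner \<mu> (op_apply (sqrt_op \<mu> L) f) (op_apply (sqrt_op \<mu> L) g)"


section \<open>Dirichlet forms\<close>

type_synonym 'a bform = "('a \<Rightarrow> real) \<Rightarrow> ('a \<Rightarrow> real) \<Rightarrow> real"

definition form_energy1 :: "'a measure \<Rightarrow> 'a bform \<Rightarrow> ('a \<Rightarrow> real) \<Rightarrow> real" where
  "form_energy1 \<mu> \<E> f = \<E> f f + (L2_norm \<mu> f)\<^sup>2"

definition symmetric_form :: "'a measure \<Rightarrow> ('a \<Rightarrow> real) set \<Rightarrow> 'a bform \<Rightarrow> bool" where
  "symmetric_form \<mu> \<F> \<E> \<longleftrightarrow>
     \<F> \<subseteq> L2_space \<mu> \<and> lin_subspace \<F> \<and> L2_dense \<mu> \<F> \<and>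
     (\<forall>f\<in>\<F>. \<forall>g\<in>borel_measurable \<mu>. ae_eq \<mu> f g \<longrightarrow> g \<in> \<F> \<and> (\<forall>h\<in>\<F>. \<E> g h = \<E> f h)) \<and>
     (\<forall>f\<in>\<F>. \<forall>g\<in>\<F>. \<E> f g = \<E> g f) \<and>
     (\<forall>f\<in>\<F>. \<forall>g\<in>\<F>. \<forall>h\<in>\<F>. \<forall>a b. \<E> (\<lambda>x. a * f x + b * g x) h = a * \<E> f h + b * \<E> g h) \<and>
     (\<forall>f\<in>\<F>. 0 \<le> \<E> f f)"

definition closed_form :: "'a measure \<Rightarrow> ('a \<Rightarrow> real) set \<Rightarrow> 'a bform \<Rightarrow> bool" where
  "closed_form \<mu> \<F> \<E> \<longleftrightarrow>
     (\<forall>u::nat \<Rightarrow> 'a \<Rightarrow> real. (\<forall>n. u n \<in> \<F>) \<and>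
        (\<forall>e>0. \<exists>N. \<forall>m\<ge>N. \<forall>n\<ge>N. form_energy1 \<mu> \<E> (\<lambda>x. u m x - u n x) < e) \<longrightarrow>
        (\<exists>f\<in>\<F>. (\<lambda>n. form_energy1 \<mu> \<E> (\<lambda>x. u n x - f x)) \<longlonglongrightarrow> 0))"

definition markovian_form :: "('a \<Rightarrow> real) set \<Rightarrow> 'a bform \<Rightarrow> bool" where
  "markovian_form \<F> \<E> \<longleftrightarrow>
     (\<forall>f\<in>\<F>. (\<lambda>x. min 1 (max 0 (f x))) \<in> \<F> \<and>
        \<E> (\<lambda>x. min 1 (max 0 (f x))) (\<lambda>x. min 1 (max 0 (f x))) \<le> \<E> f f)"

definition dirichlet_form :: "'a measure \<Rightarrow> ('a \<Rightarrow> real) set \<Rightarrow> 'a bform \<Rightarrow> bool" where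
  "dirichlet_form \<mu> \<F> \<E> \<longleftrightarrow>
     symmetric_form \<mu> \<F> \<E> \<and> closed_form \<mu> \<F> \<E> \<and> markovian_form \<F> \<E>"

definition cont_compact_support :: "('a::topological_space \<Rightarrow> real) set" where
  "cont_compact_support = {f. continuous_on UNIV f \<and> compact (closure {x. f x \<noteq> 0})}"

definition regular_form ::
  "'a::topological_space measure \<Rightarrow> ('a \<Rightarrow> real) set \<Rightarrow> 'a bform \<Rightarrow> bool" where
  "regular_form \<mu> \<F> \<E> \<longleftrightarrow>
     (\<forall>f\<in>\<F>. \<forall>e>0. \<exists>\<phi>\<in>\<F> \<inter> cont_compact_support. form_energy1 \<mu> \<E> (\<lambda>x. f x - \<phi> x) < e) \<and>
     (\<forall>f\<in>cont_compact_support. \<forall>e>0. \<exists>\<phi>\<in>\<F> \<inter> cont_compact_support. \<forall>x. \<bar>f x - \<phi> x\<bar> < e)"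

text \<open>The support of a class of functions modulo a.e. equality.\<close>

definition ess_support :: "'a::topological_space measure \<Rightarrow> ('a \<Rightarrow> real) \<Rightarrow> 'a set" where
  "ess_support \<mu> f = - \<Union>{U. open U \<and> (AE x in \<mu>. x \<in> U \<longrightarrow> f x = 0)}"

definition strongly_local_form ::
  "'a::topological_space measure \<Rightarrow> ('a \<Rightarrow> real) set \<Rightarrow> 'a bform \<Rightarrow> bool" where
  "strongly_local_form \<mu> \<F> \<E> \<longleftrightarrow>
     (\<forall>f\<in>\<F>. \<forall>g\<in>\<F>. compact (ess_support \<mu> f) \<and> compact (ess_support \<mu> g) \<and>
        (\<exists>U a. open U \<and> ess_support \<mu> g \<subseteq> U \<and> (AE x in \<mu>. x \<in> U \<longrightarrow> f x = a)) \<longrightarrow>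
        \<E> f g = 0)"

definition compactly_supported_dom ::
  "'a::topological_space measure \<Rightarrow> ('a \<Rightarrow> real) set \<Rightarrow> 'a set \<Rightarrow> ('a \<Rightarrow> real) set" where
  "compactly_supported_dom \<mu> \<F> \<Omega> =
     {f \<in> \<F>. compact (ess_support \<mu> f) \<and> ess_support \<mu> f \<subseteq> \<Omega>}"

definition local_dom ::
  "'a::topological_space measure \<Rightarrow> ('a \<Rightarrow> real) set \<Rightarrow> ('a \<Rightarrow> real) set" where
  "local_dom \<mu> \<F> = {f \<in> borel_measurable \<mu>.
     \<forall>U. open U \<and> compact (closure U) \<longrightarrow> (\<exists>h\<in>\<F>. AE x in \<mu>. x \<in> U \<longrightarrow> f x = h x)}"

text \<open>The three predicates below say that \<open>\<nu>\<close> is the energy measure \<open>\<Gamma>(f, f)\<close>: for bounded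
  \<open>f \<in> \<F>\<close>, where it is the Radon measure given by the Leibniz-type formula
  (normalized so that the total mass is \<open>\<E> f f\<close>); for all \<open>f \<in> \<F>\<close>, by truncation; and for
  \<open>f\<close> locally in \<open>\<F>\<close>, by the local character of energy measures.\<close>

definition bounded_energy_measure ::
  "('a::topological_space \<Rightarrow> real) set \<Rightarrow> 'a bform \<Rightarrow> ('a \<Rightarrow> real) \<Rightarrow> 'a measure \<Rightarrow> bool" where
  "bounded_energy_measure \<F> \<E> f \<nu> \<longleftrightarrow>
     sets \<nu> = sets borel \<and> (\<forall>K. compact K \<longrightarrow> emeasure \<nu> K < \<infinity>) \<and>
     (\<forall>\<phi>\<in>\<F> \<inter> cont_compact_support.
        (\<integral>x. \<phi> x \<partial>\<nu>) = \<E> (\<lambda>x. \<phi> x * f x) f - \<E> (\<lambda>x. (f x)\<^sup>2) \<phi> / 2)"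

definition energy_measure ::
  "('a::topological_space \<Rightarrow> real) set \<Rightarrow> 'a bform \<Rightarrow> ('a \<Rightarrow> real) \<Rightarrow> 'a measure \<Rightarrow> bool" where
  "energy_measure \<F> \<E> f \<nu> \<longleftrightarrow>
     sets \<nu> = sets borel \<and>
     (\<exists>\<rho>::nat \<Rightarrow> 'a measure.
        (\<forall>n. bounded_energy_measure \<F> \<E> (\<lambda>x. max (- real n) (min (real n) (f x))) (\<rho> n)) \<and>
        (\<forall>B\<in>sets borel. (\<lambda>n. emeasure (\<rho> n) B) \<longlonglongrightarrow> emeasure \<nu> B))"

definition local_energy_measure ::
  "'a::topological_space measure \<Rightarrow> ('a \<Rightarrow> real) set \<Rightarrow> 'a bform \<Rightarrow> ('a \<Rightarrow> real) \<Rightarrow>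
     'a measure \<Rightarrow> bool" where
  "local_energy_measure \<mu> \<F> \<E> f \<nu> \<longleftrightarrow>
     sets \<nu> = sets borel \<and>
     (\<forall>U. \<forall>h\<in>\<F>. open U \<and> compact (closure U) \<and> (AE x in \<mu>. x \<in> U \<longrightarrow> f x = h x) \<longrightarrow>
        (\<exists>\<rho>. energy_measure \<F> \<E> h \<rho> \<and>
          (\<forall>B\<in>sets borel. B \<subseteq> U \<longrightarrow> emeasure \<nu> B = emeasure \<rho> B)))"


section \<open>The standing hypotheses\<close>

text \<open>The space \<open>M\<close> is the whole type; completeness and separability are the class
  \<open>polish_space\<close> (for metric spaces, second countability is separability).\<close>

definition borel_measure_hyp :: "'a::polish_space measure \<Rightarrow> bool" where
  "borel_measure_hyp \<mu> \<longleftrightarrow>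
     locally compact (UNIV :: 'a set) \<and>
     sets \<mu> = sets borel \<and>
     (\<forall>K. compact K \<longrightarrow> emeasure \<mu> K < \<infinity>) \<and>
     (\<forall>U. open U \<and> U \<noteq> {} \<longrightarrow> 0 < emeasure \<mu> U)"

definition hyp_H :: "'a::polish_space measure \<Rightarrow> 'a op_graph \<Rightarrow> bool" where
  "hyp_H \<mu> L \<longleftrightarrow>
     borel_measure_hyp \<mu> \<and>
     self_adjoint \<mu> L \<and> nonneg_op \<mu> L \<and>
     dirichlet_form \<mu> (form_dom \<mu> L) (op_form \<mu> L) \<and>
     regular_form \<mu> (form_dom \<mu> L) (op_form \<mu> L) \<and>
     strongly_local_form \<mu> (form_dom \<mu> L) (op_form \<mu> L) \<and>
     (\<forall>x. dist x \<in> local_dom \<mu> (form_dom \<mu> L) \<and>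
        (\<exists>\<nu>. local_energy_measure \<mu> (form_dom \<mu> L) (op_form \<mu> L) (dist x) \<nu> \<and>
          (\<forall>B\<in>sets borel. emeasure \<nu> B \<le> emeasure \<mu> B)))"

definition volume :: "'a::metric_space measure \<Rightarrow> 'a \<Rightarrow> real \<Rightarrow> real" where
  "volume \<mu> x r = measure \<mu> (ball x r)"

definition volume_doubling :: "'a::metric_space measure \<Rightarrow> bool" where
  "volume_doubling \<mu> \<longleftrightarrow> (\<exists>C>0. \<forall>x. \<forall>r>0. volume \<mu> x (2 * r) \<le> C * volume \<mu> x r)"

definition cond_A :: "'a measure \<Rightarrow> ('a \<Rightarrow> real \<Rightarrow> real) \<Rightarrow> bool" where
  "cond_A \<mu> v \<longleftrightarrow>
     (\<forall>r>0. (\<lambda>x. v x r) \<in> borel_measurable \<mu> \<and> (AE x in \<mu>. 0 < v x r)) \<and>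
     (AE x in \<mu>. mono_on {0<..} (v x))"

definition cond_Dv :: "'a measure \<Rightarrow> ('a \<Rightarrow> real \<Rightarrow> real) \<Rightarrow> bool" where
  "cond_Dv \<mu> v \<longleftrightarrow> (\<exists>C>0. \<forall>r>0. AE x in \<mu>. v x (2 * r) \<le> C * v x r)"

definition cond_Dv' :: "('a::metric_space \<Rightarrow> real \<Rightarrow> real) \<Rightarrow> bool" where
  "cond_Dv' v \<longleftrightarrow> (\<exists>C>0. \<forall>x y. \<forall>r>0. dist x y \<le> r \<longrightarrow> v y r \<le> C * v x r)"


section \<open>Heat kernel bounds and Faber-Krahn inequalities\<close>

definition integral_kernel ::
  "'a measure \<Rightarrow> 'a op_graph \<Rightarrow> ('a \<Rightarrow> 'a \<Rightarrow> real) \<Rightarrow> bool" where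
  "integral_kernel \<mu> T k \<longleftrightarrow>
     case_prod k \<in> borel_measurable (\<mu> \<Otimes>\<^sub>M \<mu>) \<and>
     (\<forall>(f, g)\<in>T. AE x in \<mu>. integrable \<mu> (\<lambda>y. k x y * f y) \<and> g x = (\<integral>y. k x y * f y \<partial>\<mu>))"

definition DUE :: "'a measure \<Rightarrow> 'a op_graph \<Rightarrow> ('a \<Rightarrow> real \<Rightarrow> real) \<Rightarrow> bool" where
  "DUE \<mu> L v \<longleftrightarrow>
     (\<exists>p. (\<forall>t>0. integral_kernel \<mu> (heat_op \<mu> L t) (p t)) \<and>
        (\<exists>C>0. \<exists>c>0. \<forall>t>0. AE (x, y) in \<mu> \<Otimes>\<^sub>M \<mu>.
           \<bar>p t x y\<bar> \<le> C * (v x (c * sqrt t) * v y (c * sqrt t)) powr (- (1 / 2))))"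

definition first_eigenvalue ::
  "'a::topological_space measure \<Rightarrow> 'a op_graph \<Rightarrow> 'a set \<Rightarrow> ereal" where
  "first_eigenvalue \<mu> L \<Omega> =
     Inf {ereal (op_form \<mu> L f f / (L2_norm \<mu> f)\<^sup>2) | f.
       f \<in> compactly_supported_dom \<mu> (form_dom \<mu> L) \<Omega> \<and> \<not> ae_eq \<mu> f (\<lambda>_. 0)}"

definition FK_inhom :: "'a::metric_space measure \<Rightarrow> 'a op_graph \<Rightarrow> ('a \<Rightarrow> real \<Rightarrow> real) \<Rightarrow> bool" where
  "FK_inhom \<mu> L v \<longleftrightarrow>
     (\<exists>\<alpha>>0. \<exists>c>0. \<forall>x. \<forall>r>0. \<forall>\<Omega>.
        open \<Omega> \<and> \<Omega> \<noteq> {} \<and> compact (closure \<Omega>) \<and> \<Omega> \<subseteq> ball x r \<longrightarrow>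
        ereal (r\<^sup>2) * first_eigenvalue \<mu> L \<Omega> + 1
          \<ge> ereal (c * (v x r / measure \<mu> \<Omega>) powr \<alpha>))"

end

theory Submission
  imports Defs
begin

text \<open>On-diagonal bounds give Faber--Krahn through Jensen's inequality for the spectral measure of
  \<open>f\<close>: \<open>\<langle>P t f, f\<rangle> \<ge> \<parallel>f\<parallel>\<^sup>2 exp (- t \<E>(f) / \<parallel>f\<parallel>\<^sup>2)\<close>, while the kernel bound gives
  \<open>\<langle>P t f, f\<rangle> \<le> C \<parallel>f\<parallel>\<^sub>1\<^sup>2 / v\<close> on a ball; the time is optimised along the sequence \<open>r\<^sup>2 / 4^j\<close>.

  Conversely, the Faber--Krahn inequality for the superlevel sets of \<open>u\<^sub>t = P t f\<close> is the nonlinear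
  ingredient of a parabolic De Giorgi iteration with cutoffs built from distance functions; these
  satisfy Caccioppoli's inequality because their energy measure is dominated by \<open>\<mu>\<close>. The outcome is
  \<open>\<bar>P t f\<bar>\<^sup>2 \<le> C \<parallel>f\<parallel>\<^sub>2\<^sup>2 / v\<close> almost everywhere, and for an orthonormal system \<open>e\<^sub>i\<close> it makes the kernel
  \<open>\<Sum>\<^sub>i P (t/2) e\<^sub>i(x) P (t/2) e\<^sub>i(y)\<close> converge with the required bound. Energy inequalities for compositions
  are reduced to pointwise algebraic inequalities between jumps, by approximating \<open>\<E>\<close> by the forms
  \<open>\<beta> \<langle>f - R \<beta> f, g\<rangle>\<close> of the positive contractions \<open>R \<beta> = \<beta> / (\<beta> + L)\<close>.\<close>

section \<open>Square-integrable functions\<close>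

text \<open>Chain and Leibniz rules for energy measures do not enter: inequalities between jumps
  take their place, and these hold for any Dirichlet form. Strong locality enters in
  \<open>E_local\<close>, where it localises the functional \<open>K\<close> of a truncated
  distance; that is where the hypothesis on distance functions is felt. Jump inequalities are
  applied to functions bounded at every point, so the De Giorgi estimate is proved for bounded data;
  their bound \<open>M\<close> is qualitative and enters no constant. This is why the orthonormal
  system has to consist of bounded functions. The Faber--Krahn hypothesis speaks of open sets, while
  the superlevel sets of \<open>P t f\<close> are merely measurable; a Nash-type inequality, whose
  two norms are stable under approximation, bridges the gap. The additive 1 in the hypothesis makes
  it void unless \<open>v / \<mu>(\<Omega>)\<close> is large, and the top level of the iteration is
  chosen so high that every step stays in the useful range. Almost-everywhere bounds have null sets
  depending on the function and on the centre, so they are combined over countable families: dense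
  centres and rational coefficients.\<close>

locale l2_setting = sigma_finite_measure \<mu> for \<mu> :: "'a measure"
begin

abbreviation "H \<equiv> L2_space \<mu>"
abbreviation "ip \<equiv> L2_inner \<mu>"

lemma H_meas [measurable_dest]: "f \<in> H \<Longrightarrow> f \<in> borel_measurable \<mu>"
  by (simp add: L2_space_def)

lemma H_sq: "f \<in> H \<Longrightarrow> integrable \<mu> (\<lambda>x. (f x)\<^sup>2)"
  by (simp add: L2_space_def)

lemma H_mult: "f \<in> H \<Longrightarrow> g \<in> H \<Longrightarrow> integrable \<mu> (\<lambda>x. f x * g x)"
proof (rule Bochner_Integration.integrable_bound)
  assume f: "f \<in> H" and g: "g \<in> H"
  show "integrable \<mu> (\<lambda>x. (f x)\<^sup>2 + (g x)\<^sup>2)"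
    using f g by (simp add: H_sq)
  show "(\<lambda>x. f x * g x) \<in> borel_measurable \<mu>"
    using f[THEN H_meas] g[THEN H_meas] by simp
  have "\<bar>a * b\<bar> \<le> a\<^sup>2 + b\<^sup>2" for a b :: real
  proof -
    have "2 * \<bar>a * b\<bar> \<le> a\<^sup>2 + b\<^sup>2"
      using sum_squares_bound[of "\<bar>a\<bar>" "\<bar>b\<bar>"] by (simp add: abs_mult mult.assoc)
    then show ?thesis using abs_ge_zero[of "a * b"] by linarith
  qed
  then show "AE x in \<mu>. norm (f x * g x) \<le> norm ((f x)\<^sup>2 + (g x)\<^sup>2)" by simp
qed

lemma H_zero [simp]: "(\<lambda>_. 0) \<in> H"
  by (simp add: L2_space_def)

lemma H_cmult: "f \<in> H \<Longrightarrow> (\<lambda>x. a * f x) \<in> H"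
  by (auto simp: L2_space_def power_mult_distrib)

lemma H_add: "f \<in> H \<Longrightarrow> g \<in> H \<Longrightarrow> (\<lambda>x. f x + g x) \<in> H"
  using H_mult[of f g] by (auto simp: L2_space_def power2_sum mult.assoc)

lemma H_diff: "f \<in> H \<Longrightarrow> g \<in> H \<Longrightarrow> (\<lambda>x. f x - g x) \<in> H"
  using H_mult[of f g] by (auto simp: L2_space_def power2_diff mult.assoc)

lemma H_uminus: "f \<in> H \<Longrightarrow> (\<lambda>x. - f x) \<in> H"
  by (auto simp: L2_space_def)

lemma H_lin: "f \<in> H \<Longrightarrow> g \<in> H \<Longrightarrow> (\<lambda>x. a * f x + b * g x) \<in> H"
  by (intro H_add H_cmult)

lemma H_sum: "(\<And>i. i \<in> I \<Longrightarrow> f i \<in> H) \<Longrightarrow> (\<lambda>x. \<Sum>i\<in>I. f i x) \<in> H"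
  by (induction I rule: infinite_finite_induct) (auto intro: H_add)

lemma H_bound:
  assumes "g \<in> H" "f \<in> borel_measurable \<mu>" "AE x in \<mu>. \<bar>f x\<bar> \<le> \<bar>g x\<bar>"
  shows "f \<in> H"
proof -
  have "integrable \<mu> (\<lambda>x. (f x)\<^sup>2)"
    by (rule Bochner_Integration.integrable_bound[OF H_sq[OF assms(1)]])
      (use assms in \<open>auto simp: abs_le_square_iff\<close>)
  then show ?thesis using assms by (simp add: L2_space_def)
qed

lemma H_bmult:
  assumes "f \<in> H" "g \<in> borel_measurable \<mu>" "\<And>x. \<bar>g x\<bar> \<le> c"
  shows "(\<lambda>x. g x * f x) \<in> H"
proof (rule H_bound[OF H_cmult[OF assms(1), of c]])
  have "\<bar>g x * f x\<bar> \<le> \<bar>c * f x\<bar>" for x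
    using mult_right_mono[OF order_trans[OF assms(3) abs_ge_self[of c]], of "\<bar>f x\<bar>" x]
    by (simp add: abs_mult)
  then show "AE x in \<mu>. \<bar>g x * f x\<bar> \<le> \<bar>c * f x\<bar>" by simp
qed (use assms H_meas in auto)

lemma H_cong: "f \<in> H \<Longrightarrow> g \<in> borel_measurable \<mu> \<Longrightarrow> AE x in \<mu>. f x = g x \<Longrightarrow> g \<in> H"
  by (rule H_bound[of f]) auto

lemma H_indicator: "A \<in> sets \<mu> \<Longrightarrow> emeasure \<mu> A < \<infinity> \<Longrightarrow> indicator A \<in> H"
  by (simp add: L2_space_def power2_eq_square indicator_inter_arith[symmetric] integrable_indicator_iff less_top)

lemma ip_comm: "ip f g = ip g f"
  by (simp add: L2_inner_def mult.commute)

lemma ip_add: "f \<in> H \<Longrightarrow> g \<in> H \<Longrightarrow> h \<in> H \<Longrightarrow> ip (\<lambda>x. f x + g x) h = ip f h + ip g h"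
  by (simp add: L2_inner_def distrib_right H_mult)

lemma ip_diff: "f \<in> H \<Longrightarrow> g \<in> H \<Longrightarrow> h \<in> H \<Longrightarrow> ip (\<lambda>x. f x - g x) h = ip f h - ip g h"
  by (simp add: L2_inner_def left_diff_distrib H_mult)

lemma ip_cmult: "ip (\<lambda>x. a * f x) h = a * ip f h"
  by (simp add: L2_inner_def mult.assoc)

lemma ip_uminus: "ip (\<lambda>x. - f x) h = - ip f h"
  by (simp add: L2_inner_def)

lemma ip_add_r: "f \<in> H \<Longrightarrow> g \<in> H \<Longrightarrow> h \<in> H \<Longrightarrow> ip h (\<lambda>x. f x + g x) = ip h f + ip h g"
  by (simp add: ip_add ip_comm[of h])

lemma ip_diff_r: "f \<in> H \<Longrightarrow> g \<in> H \<Longrightarrow> h \<in> H \<Longrightarrow> ip h (\<lambda>x. f x - g x) = ip h f - ip h g"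
  by (simp add: ip_diff ip_comm[of h])

lemma ip_cmult_r: "ip h (\<lambda>x. a * f x) = a * ip h f"
  by (simp add: ip_cmult ip_comm[of h])

lemma ip_uminus_r: "ip h (\<lambda>x. - f x) = - ip h f"
  by (simp add: ip_uminus ip_comm[of h])

lemma ip_zero [simp]: "ip (\<lambda>_. 0) h = 0" "ip h (\<lambda>_. 0) = 0"
  by (simp_all add: L2_inner_def)

lemma ip_sum:
  "(\<And>i. i \<in> I \<Longrightarrow> f i \<in> H) \<Longrightarrow> h \<in> H \<Longrightarrow> ip (\<lambda>x. \<Sum>i\<in>I. f i x) h = (\<Sum>i\<in>I. ip (f i) h)"
  by (simp add: L2_inner_def sum_distrib_right H_mult)

lemma ip_self: "ip f f = (\<integral>x. (f x)\<^sup>2 \<partial>\<mu>)"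
  by (simp add: L2_inner_def power2_eq_square)

lemma ip_ge0 [simp]: "0 \<le> ip f f"
  by (simp add: ip_self)

lemma L2_norm_sq: "(L2_norm \<mu> f)\<^sup>2 = ip f f"
  by (simp add: L2_norm_def ip_self)

lemma ip_cong:
  assumes "AE x in \<mu>. f x = f' x" "AE x in \<mu>. g x = g' x"
    "f \<in> borel_measurable \<mu>" "f' \<in> borel_measurable \<mu>"
    "g \<in> borel_measurable \<mu>" "g' \<in> borel_measurable \<mu>"
  shows "ip f g = ip f' g'"
  unfolding L2_inner_def by (rule integral_cong_AE) (use assms in auto)

lemma ip_self_zero: "f \<in> H \<Longrightarrow> ip f f = 0 \<longleftrightarrow> (AE x in \<mu>. f x = 0)"
  by (simp add: ip_self integral_nonneg_eq_0_iff_AE H_sq)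

lemma ip_eqI:
  assumes "f \<in> H" "g \<in> H" "\<And>h. h \<in> H \<Longrightarrow> ip f h = ip g h"
  shows "AE x in \<mu>. f x = g x"
proof -
  let ?d = "\<lambda>x. f x - g x"
  have "?d \<in> H" using assms by (simp add: H_diff)
  then have "ip ?d ?d = 0" using assms by (simp add: ip_diff)
  with \<open>?d \<in> H\<close> show ?thesis by (auto simp: ip_self_zero)
qed

lemma ip_expand_add:
  "f \<in> H \<Longrightarrow> g \<in> H \<Longrightarrow> ip (\<lambda>x. f x + g x) (\<lambda>x. f x + g x) = ip f f + 2 * ip f g + ip g g"
  by (simp add: ip_add ip_add_r H_add ip_comm[of g f])

lemma ip_expand_diff:
  "f \<in> H \<Longrightarrow> g \<in> H \<Longrightarrow> ip (\<lambda>x. f x - g x) (\<lambda>x. f x - g x) = ip f f - 2 * ip f g + ip g g"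
  by (simp add: ip_diff ip_diff_r H_diff ip_comm[of g f])

lemma ip_CS_sq:
  assumes "f \<in> H" "g \<in> H" shows "(ip f g)\<^sup>2 \<le> ip f f * ip g g"
proof (cases "ip g g = 0")
  case True
  then have "AE x in \<mu>. g x = 0" using assms ip_self_zero by blast
  then have "ip f g = ip f (\<lambda>_. 0)" using assms H_meas by (intro ip_cong) auto
  then show ?thesis using True by simp
next
  case False
  then have pos: "0 < ip g g" using ip_ge0[of g] by linarith
  define a where "a = ip f g / ip g g"
  have "0 \<le> ip (\<lambda>x. f x - a * g x) (\<lambda>x. f x - a * g x)" by simp
  also have "\<dots> = ip f f - 2 * (a * ip f g) + a * (a * ip g g)"
    using assms by (subst ip_expand_diff) (auto simp: H_cmult ip_cmult ip_cmult_r)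
  also have "\<dots> = ip f f - (ip f g)\<^sup>2 / ip g g"
    using pos by (simp add: a_def field_simps power2_eq_square)
  finally show ?thesis using pos by (simp add: field_simps)
qed

lemma ip_CS: "f \<in> H \<Longrightarrow> g \<in> H \<Longrightarrow> \<bar>ip f g\<bar> \<le> sqrt (ip f f) * sqrt (ip g g)"
  using ip_CS_sq[of f g] real_le_rsqrt[of "\<bar>ip f g\<bar>" "ip f f * ip g g"] by (simp add: real_sqrt_mult)

lemma ip_triangle: "f \<in> H \<Longrightarrow> g \<in> H \<Longrightarrow>
  ip (\<lambda>x. f x + g x) (\<lambda>x. f x + g x) \<le> 2 * ip f f + 2 * ip g g"
  using ip_ge0[of "\<lambda>x. f x - g x"] by (simp add: ip_expand_add ip_expand_diff)

lemma ip_triangle_diff: "f \<in> H \<Longrightarrow> g \<in> H \<Longrightarrow>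
  ip (\<lambda>x. f x - g x) (\<lambda>x. f x - g x) \<le> 2 * ip f f + 2 * ip g g"
  using ip_ge0[of "\<lambda>x. f x + g x"] by (simp add: ip_expand_add ip_expand_diff)

definition L2_lim :: "(nat \<Rightarrow> 'a \<Rightarrow> real) \<Rightarrow> ('a \<Rightarrow> real) \<Rightarrow> bool" where
  "L2_lim u f \<longleftrightarrow> (\<forall>n. u n \<in> H) \<and> f \<in> H \<and> (\<lambda>n. ip (\<lambda>x. u n x - f x) (\<lambda>x. u n x - f x)) \<longlonglongrightarrow> 0"

lemma L2_limD: "L2_lim u f \<Longrightarrow> u n \<in> H" "L2_lim u f \<Longrightarrow> f \<in> H"
  "L2_lim u f \<Longrightarrow> (\<lambda>n. ip (\<lambda>x. u n x - f x) (\<lambda>x. u n x - f x)) \<longlonglongrightarrow> 0"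
  by (auto simp: L2_lim_def)

lemma L2_lim_ip_const:
  assumes "L2_lim u f" "g \<in> H"
  shows "(\<lambda>n. ip (u n) g) \<longlonglongrightarrow> ip f g"
proof -
  have "(\<lambda>n. ip (u n) g - ip f g) \<longlonglongrightarrow> 0"
  proof (rule Lim_null_comparison)
    show "\<forall>\<^sub>F n in sequentially. norm (ip (u n) g - ip f g)
        \<le> sqrt (ip (\<lambda>x. u n x - f x) (\<lambda>x. u n x - f x)) * sqrt (ip g g)"
      using ip_CS[OF H_diff, of "u _" f g] assms by (auto simp: L2_lim_def ip_diff)
    have "(\<lambda>n. sqrt (ip (\<lambda>x. u n x - f x) (\<lambda>x. u n x - f x)) * sqrt (ip g g)) \<longlonglongrightarrow> sqrt 0 * sqrt (ip g g)"
      using assms by (intro tendsto_intros) (auto simp: L2_lim_def)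
    then show "(\<lambda>n. sqrt (ip (\<lambda>x. u n x - f x) (\<lambda>x. u n x - f x)) * sqrt (ip g g)) \<longlonglongrightarrow> 0" by simp
  qed
  then show ?thesis by (simp add: LIM_zero_iff)
qed

lemma L2_lim_ip:
  assumes "L2_lim u f" "L2_lim w g"
  shows "(\<lambda>n. ip (u n) (w n)) \<longlonglongrightarrow> ip f g"
proof -
  let ?U = "\<lambda>n x. u n x - f x" let ?W = "\<lambda>n x. w n x - g x"
  have m: "u n \<in> H" "w n \<in> H" "f \<in> H" "g \<in> H" for n using assms by (auto simp: L2_lim_def)
  have eq: "ip (u n) (w n) = ip (?U n) (?W n) + ip (u n) g + (ip f (w n)) - ip f g" for n
    using m by (simp add: ip_diff ip_diff_r H_diff)
  have "(\<lambda>n. ip (?U n) (?W n)) \<longlonglongrightarrow> 0"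
  proof (rule Lim_null_comparison)
    show "\<forall>\<^sub>F n in sequentially. norm (ip (?U n) (?W n)) \<le> sqrt (ip (?U n) (?U n)) * sqrt (ip (?W n) (?W n))"
      using ip_CS[OF H_diff[OF m(1,3)] H_diff[OF m(2,4)]] by simp
    have "(\<lambda>n. sqrt (ip (?U n) (?U n)) * sqrt (ip (?W n) (?W n))) \<longlonglongrightarrow> sqrt 0 * sqrt 0"
      using assms by (intro tendsto_intros) (auto simp: L2_lim_def)
    then show "(\<lambda>n. sqrt (ip (?U n) (?U n)) * sqrt (ip (?W n) (?W n))) \<longlonglongrightarrow> 0" by simp
  qed
  moreover have "(\<lambda>n. ip (u n) g) \<longlonglongrightarrow> ip f g" "(\<lambda>n. ip f (w n)) \<longlonglongrightarrow> ip f g"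
    using L2_lim_ip_const[OF assms(1) m(4)] L2_lim_ip_const[OF assms(2) m(3)] by (simp_all add: ip_comm[of f])
  ultimately have "(\<lambda>n. ip (?U n) (?W n) + ip (u n) g + (ip f (w n)) - ip f g) \<longlonglongrightarrow> 0 + ip f g + ip f g - ip f g"
    by (intro tendsto_intros)
  then show ?thesis by (simp add: eq)
qed

lemma L2_lim_dominated:
  assumes "F \<in> H" "\<And>n. u n \<in> borel_measurable \<mu>" "f \<in> borel_measurable \<mu>"
    "\<And>n. AE x in \<mu>. \<bar>u n x\<bar> \<le> \<bar>F x\<bar>" "AE x in \<mu>. (\<lambda>n. u n x) \<longlonglongrightarrow> f x"
  shows "L2_lim u f"
proof -
  have allb: "AE x in \<mu>. \<forall>n. \<bar>u n x\<bar> \<le> \<bar>F x\<bar>" using assms(4) by (simp add: AE_all_countable)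
  have fb: "AE x in \<mu>. \<bar>f x\<bar> \<le> \<bar>F x\<bar>"
    using allb assms(5)
  proof eventually_elim
    case (elim x)
    then show ?case
      by (intro LIMSEQ_le_const2[OF tendsto_rabs]) auto
  qed
  have m: "u n \<in> H" "f \<in> H" for n using assms fb by (auto intro: H_bound[OF assms(1)])
  have "(\<lambda>n. \<integral>x. (u n x - f x)\<^sup>2 \<partial>\<mu>) \<longlonglongrightarrow> (\<integral>x. 0 \<partial>\<mu>)"
  proof (rule integral_dominated_convergence)
    show "integrable \<mu> (\<lambda>x. 4 * (F x)\<^sup>2)" using H_sq[OF assms(1)] by simp
    show "AE x in \<mu>. (\<lambda>n. (u n x - f x)\<^sup>2) \<longlonglongrightarrow> 0"
      using assms(5)
    proof eventually_elim
      case (elim x)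
      then have "(\<lambda>n. (u n x - f x)\<^sup>2) \<longlonglongrightarrow> (f x - f x)\<^sup>2" by (intro tendsto_intros)
      then show ?case by simp
    qed
    show "AE x in \<mu>. norm ((u n x - f x)\<^sup>2) \<le> 4 * (F x)\<^sup>2" for n
      using allb fb
    proof eventually_elim
      case (elim x)
      then have "\<bar>u n x\<bar> \<le> \<bar>F x\<bar>" by blast
      with \<open>\<bar>f x\<bar> \<le> \<bar>F x\<bar>\<close> have "\<bar>u n x - f x\<bar> \<le> \<bar>2 * F x\<bar>" by linarith
      then have "(u n x - f x)\<^sup>2 \<le> (2 * F x)\<^sup>2" by (simp only: abs_le_square_iff)
      then show ?case by (simp add: power_mult_distrib)
    qed
  qed (use assms in auto)
  then show ?thesis using m by (simp add: L2_lim_def ip_self)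
qed

lemma L2_lim_unique:
  assumes "L2_lim u f" "L2_lim u g" shows "AE x in \<mu>. f x = g x"
proof (rule ip_eqI)
  show "f \<in> H" "g \<in> H" using assms by (auto simp: L2_lim_def)
  show "ip f h = ip g h" if "h \<in> H" for h
    using L2_lim_ip_const[OF assms(1) that] L2_lim_ip_const[OF assms(2) that] LIMSEQ_unique by blast
qed

lemma L2_lim_bmult:
  assumes "L2_lim u f" "g \<in> borel_measurable \<mu>" "\<And>x. \<bar>g x\<bar> \<le> c"
  shows "L2_lim (\<lambda>n x. g x * u n x) (\<lambda>x. g x * f x)"
proof -
  have m: "u n \<in> H" "f \<in> H" for n using assms by (auto simp: L2_lim_def)
  have "(\<lambda>n. ip (\<lambda>x. g x * u n x - g x * f x) (\<lambda>x. g x * u n x - g x * f x)) \<longlonglongrightarrow> 0"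
  proof (rule Lim_null_comparison)
    have "ip (\<lambda>x. g x * u n x - g x * f x) (\<lambda>x. g x * u n x - g x * f x)
        \<le> c\<^sup>2 * ip (\<lambda>x. u n x - f x) (\<lambda>x. u n x - f x)" for n
    proof -
      have "(g x * u n x - g x * f x)\<^sup>2 \<le> c\<^sup>2 * (u n x - f x)\<^sup>2" for x
      proof -
        have "(g x)\<^sup>2 \<le> c\<^sup>2" using order_trans[OF assms(3) abs_ge_self[of c]] by (simp only: abs_le_square_iff)
        then show ?thesis
          by (simp add: right_diff_distrib[symmetric] power_mult_distrib mult_right_mono)
      qed
      moreover have "integrable \<mu> (\<lambda>x. (g x * u n x - g x * f x)\<^sup>2)"
        using H_sq[OF H_diff[OF H_bmult[OF m(1) assms(2,3)] H_bmult[OF m(2) assms(2,3)]]] .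
      moreover have "integrable \<mu> (\<lambda>x. c\<^sup>2 * (u n x - f x)\<^sup>2)"
        using H_sq[OF H_diff[OF m]] by simp
      ultimately show ?thesis
        unfolding ip_self integral_mult_right_zero[symmetric] by (intro integral_mono) auto
    qed
    then show "\<forall>\<^sub>F n in sequentially. norm (ip (\<lambda>x. g x * u n x - g x * f x) (\<lambda>x. g x * u n x - g x * f x))
        \<le> c\<^sup>2 * ip (\<lambda>x. u n x - f x) (\<lambda>x. u n x - f x)" by simp
    show "(\<lambda>n. c\<^sup>2 * ip (\<lambda>x. u n x - f x) (\<lambda>x. u n x - f x)) \<longlonglongrightarrow> 0"
      using tendsto_mult_left[OF L2_limD(3)[OF assms(1)], of "c\<^sup>2"] by simp
  qed
  then show ?thesis using m assms by (auto simp: L2_lim_def intro: H_bmult)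
qed

lemma L2_lim_lin:
  assumes "L2_lim u f" "L2_lim w g"
  shows "L2_lim (\<lambda>n x. a * u n x + b * w n x) (\<lambda>x. a * f x + b * g x)"
proof -
  let ?U = "\<lambda>n x. u n x - f x" let ?W = "\<lambda>n x. w n x - g x"
  have m: "u n \<in> H" "w n \<in> H" "f \<in> H" "g \<in> H" for n using assms by (auto simp: L2_lim_def)
  have "(\<lambda>n. ip (\<lambda>x. (a * u n x + b * w n x) - (a * f x + b * g x)) (\<lambda>x. (a * u n x + b * w n x) - (a * f x + b * g x))) \<longlonglongrightarrow> 0"
  proof (rule Lim_null_comparison)
    have "ip (\<lambda>x. (a * u n x + b * w n x) - (a * f x + b * g x)) (\<lambda>x. (a * u n x + b * w n x) - (a * f x + b * g x))
      = ip (\<lambda>x. a * ?U n x + b * ?W n x) (\<lambda>x. a * ?U n x + b * ?W n x)" for n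
      by (simp add: algebra_simps)
    also have "\<dots> n \<le> 2 * (a * (a * ip (?U n) (?U n))) + 2 * (b * (b * ip (?W n) (?W n)))" for n
      using ip_triangle[OF H_cmult[OF H_diff[OF m(1,3)]] H_cmult[OF H_diff[OF m(2,4)]], of a n b n]
      by (simp add: ip_cmult ip_cmult_r)
    finally show "\<forall>\<^sub>F n in sequentially. norm (ip (\<lambda>x. (a * u n x + b * w n x) - (a * f x + b * g x)) (\<lambda>x. (a * u n x + b * w n x) - (a * f x + b * g x))) \<le> 2 * (a * (a * ip (?U n) (?U n))) + 2 * (b * (b * ip (?W n) (?W n)))"
      by simp
    have "(\<lambda>n. 2 * (a * (a * ip (?U n) (?U n))) + 2 * (b * (b * ip (?W n) (?W n)))) \<longlonglongrightarrow> 2 * (a * (a * 0)) + 2 * (b * (b * 0))"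
      using assms by (intro tendsto_intros) (auto simp: L2_lim_def)
    then show "(\<lambda>n. 2 * (a * (a * ip (?U n) (?U n))) + 2 * (b * (b * ip (?W n) (?W n)))) \<longlonglongrightarrow> 0" by simp
  qed
  then show ?thesis using m by (auto simp: L2_lim_def intro: H_lin)
qed

text \<open>Serves to pass L2 convergence to Lipschitz images: truncations, absolute values, squares
  of uniformly bounded functions, products with cutoffs.\<close>

lemma L2_lim_contraction:
  assumes "L2_lim u f" "\<And>n. w n \<in> borel_measurable \<mu>" "g \<in> H"
    "\<And>n. AE x in \<mu>. \<bar>w n x - g x\<bar> \<le> c * \<bar>u n x - f x\<bar>"
  shows "L2_lim w g"
proof -
  have m: "u n \<in> H" "f \<in> H" for n using assms by (auto simp: L2_lim_def)
  have d: "(\<lambda>x. w n x - g x) \<in> H" for n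
  proof (rule H_bound[OF H_cmult[OF H_diff[OF m(1,2), of n], of c]])
    show "AE x in \<mu>. \<bar>w n x - g x\<bar> \<le> \<bar>c * (u n x - f x)\<bar>"
      using assms(4)[of n]
    proof eventually_elim
      case (elim x)
      have "c * \<bar>u n x - f x\<bar> \<le> \<bar>c\<bar> * \<bar>u n x - f x\<bar>" by (intro mult_right_mono) auto
      with elim show ?case by (simp add: abs_mult)
    qed
  qed (use assms H_meas in auto)
  have w: "w n \<in> H" for n using H_add[OF d assms(3), of n] by simp
  have "(\<lambda>n. ip (\<lambda>x. w n x - g x) (\<lambda>x. w n x - g x)) \<longlonglongrightarrow> 0"
  proof (rule Lim_null_comparison)
    have "ip (\<lambda>x. w n x - g x) (\<lambda>x. w n x - g x) \<le> c\<^sup>2 * ip (\<lambda>x. u n x - f x) (\<lambda>x. u n x - f x)" for n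
      unfolding ip_self integral_mult_right_zero[symmetric]
    proof (rule integral_mono_AE)
      show "integrable \<mu> (\<lambda>x. (w n x - g x)\<^sup>2)" using H_sq[OF d] .
      show "integrable \<mu> (\<lambda>x. c\<^sup>2 * (u n x - f x)\<^sup>2)" using H_sq[OF H_diff[OF m]] by simp
      show "AE x in \<mu>. (w n x - g x)\<^sup>2 \<le> c\<^sup>2 * (u n x - f x)\<^sup>2"
        using assms(4)[of n]
      proof eventually_elim
        case (elim x)
        have "(w n x - g x)\<^sup>2 \<le> (c * \<bar>u n x - f x\<bar>)\<^sup>2" using elim abs_le_square_iff by fastforce
        then show ?case by (simp add: power_mult_distrib)
      qed
    qed
    then show "\<forall>\<^sub>F n in sequentially. norm (ip (\<lambda>x. w n x - g x) (\<lambda>x. w n x - g x)) \<le> c\<^sup>2 * ip (\<lambda>x. u n x - f x) (\<lambda>x. u n x - f x)"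
      by simp
    show "(\<lambda>n. c\<^sup>2 * ip (\<lambda>x. u n x - f x) (\<lambda>x. u n x - f x)) \<longlonglongrightarrow> 0"
      using tendsto_mult_left[OF L2_limD(3)[OF assms(1)], of "c\<^sup>2"] by simp
  qed
  then show ?thesis using w assms(3) by (simp add: L2_lim_def)
qed

lemma L2_fatou:
  assumes "\<And>n. u n \<in> H" "f \<in> borel_measurable \<mu>" "AE x in \<mu>. (\<lambda>n. u n x) \<longlonglongrightarrow> f x"
    "\<And>n. ip (u n) (u n) \<le> C"
  shows "f \<in> H" "ip f f \<le> C"
proof -
  have [measurable]: "u n \<in> borel_measurable \<mu>" for n using assms H_meas by auto
  have C0: "0 \<le> C" using assms(4)[of 0] ip_ge0 order_trans by blast
  have "(\<integral>\<^sup>+x. ennreal ((f x)\<^sup>2) \<partial>\<mu>) = (\<integral>\<^sup>+x. liminf (\<lambda>n. ennreal ((u n x)\<^sup>2)) \<partial>\<mu>)"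
  proof (rule nn_integral_cong_AE)
    show "AE x in \<mu>. ennreal ((f x)\<^sup>2) = liminf (\<lambda>n. ennreal ((u n x)\<^sup>2))"
      using assms(3)
    proof eventually_elim
      case (elim x)
      then have "(\<lambda>n. ennreal ((u n x)\<^sup>2)) \<longlonglongrightarrow> ennreal ((f x)\<^sup>2)" by (intro tendsto_intros)
      then show ?case by (metis lim_imp_Liminf trivial_limit_sequentially)
    qed
  qed
  also have "\<dots> \<le> liminf (\<lambda>n. \<integral>\<^sup>+x. ennreal ((u n x)\<^sup>2) \<partial>\<mu>)" by (rule nn_integral_liminf) simp
  also have "\<dots> = liminf (\<lambda>n. ennreal (ip (u n) (u n)))"
    using assms(1) by (subst nn_integral_eq_integral) (auto simp: ip_self H_sq)
  also have "\<dots> \<le> liminf (\<lambda>n. ennreal C)"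
    using assms(4) by (intro Liminf_mono always_eventually) (auto intro: ennreal_leI)
  also have "\<dots> = ennreal C" by (simp add: Liminf_const)
  finally have le: "(\<integral>\<^sup>+x. ennreal ((f x)\<^sup>2) \<partial>\<mu>) \<le> ennreal C" .
  then have "integrable \<mu> (\<lambda>x. (f x)\<^sup>2)"
    using assms(2) by (intro integrableI_bounded) (auto simp: order.strict_trans1[OF le])
  then show fH: "f \<in> H" using assms(2) by (simp add: L2_space_def)
  then have "ennreal (ip f f) \<le> ennreal C"
    using le by (subst (asm) nn_integral_eq_integral) (auto simp: ip_self H_sq)
  then show "ip f f \<le> C" using C0 by (simp add: ennreal_le_iff)
qed

text \<open>Fatou's lemma on the tails of \<open>u n - f\<close>, whose norms are eventually below
  any \<open>e\<close>, identifies the two limits without passing to a subsequence.\<close>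

lemma L2_lim_AE_lim:
  assumes "L2_lim u f" "g \<in> borel_measurable \<mu>" "AE x in \<mu>. (\<lambda>n. u n x) \<longlonglongrightarrow> g x"
  shows "AE x in \<mu>. f x = g x"
proof -
  have m: "u n \<in> H" "f \<in> H" for n using assms by (auto simp: L2_lim_def)
  have small: "ip (\<lambda>x. g x - f x) (\<lambda>x. g x - f x) \<le> e \<and> (\<lambda>x. g x - f x) \<in> H" if "0 < e" for e
  proof -
    have "\<forall>\<^sub>F n in sequentially. ip (\<lambda>x. u n x - f x) (\<lambda>x. u n x - f x) < e"
      using L2_limD(3)[OF assms(1)] that order_tendstoD(2) by blast
    then obtain N where N: "\<And>n. n \<ge> N \<Longrightarrow> ip (\<lambda>x. u n x - f x) (\<lambda>x. u n x - f x) < e"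
      by (auto simp: eventually_sequentially)
    have l: "AE x in \<mu>. (\<lambda>n. u (n + N) x - f x) \<longlonglongrightarrow> g x - f x"
      using assms(3)
    proof eventually_elim
      case (elim x)
      then show ?case by (intro tendsto_intros LIMSEQ_ignore_initial_segment)
    qed
    have "(\<lambda>x. g x - f x) \<in> borel_measurable \<mu>" using assms(2) H_meas[OF m(2)] by simp
    moreover have "(\<lambda>x. u (n + N) x - f x) \<in> H"
      "ip (\<lambda>x. u (n + N) x - f x) (\<lambda>x. u (n + N) x - f x) \<le> e" for n
      using m N[of "n + N"] by (auto intro: H_diff)
    ultimately show ?thesis
      using L2_fatou[of "\<lambda>n x. u (n + N) x - f x", OF _ _ l, of e] by blast
  qed
  have "ip (\<lambda>x. g x - f x) (\<lambda>x. g x - f x) \<le> 0"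
    by (rule field_le_epsilon) (use small in auto)
  then have "ip (\<lambda>x. g x - f x) (\<lambda>x. g x - f x) = 0" by (simp add: antisym)
  then show ?thesis using small[of 1] by (auto simp: ip_self_zero)
qed

text \<open>Riesz--Fischer. A strictly positive weight \<open>w\<close> in \<open>H\<close>,
  available by sigma-finiteness, turns an L2-Cauchy sequence into the L1-Cauchy sequence
  \<open>w * u n\<close> by Cauchy--Schwarz. An a.e. convergent subsequence of the latter is divided
  by \<open>w\<close>, and Fatou's lemma shows that its limit is the norm limit of the full
  sequence.\<close>

lemma L2_complete:
  assumes u: "\<And>n. u n \<in> H"
    and cauchy: "\<And>e. 0 < e \<Longrightarrow> \<exists>N. \<forall>m\<ge>N. \<forall>n\<ge>N. ip (\<lambda>x. u m x - u n x) (\<lambda>x. u m x - u n x) < e"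
  shows "\<exists>f. L2_lim u f"
proof -
  obtain w0 where w0: "w0 \<in> borel_measurable \<mu>" "\<And>x. 0 < (w0 x :: real)" "integrable \<mu> w0"
    using obtain_positive_integrable_function by metis
  define w where "w = (\<lambda>x. sqrt (w0 x))"
  have wpos: "0 < w x" for x using w0 by (simp add: w_def)
  have wH: "w \<in> H" using w0 by (auto simp: L2_space_def w_def less_imp_le)
  have um [measurable]: "u n \<in> borel_measurable \<mu>" for n using u H_meas by auto
  have [measurable]: "w \<in> borel_measurable \<mu>" using wH H_meas by auto
  \<comment> \<open>The added 1 keeps the quotient \<open>e\<^sup>2 / K\<close> meaningful when
    \<open>ip w w\<close> vanishes.\<close>
  define K where "K = ip w w + 1"
  have K: "0 < K" "ip w w \<le> K" using ip_ge0[of w] unfolding K_def by linarith+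
  obtain r where r: "strict_mono r" "AE x in \<mu>. Cauchy (\<lambda>i. w x * u (r i) x)"
  proof (rule cauchy_L1_AE_cauchy_subseq[of \<mu> "\<lambda>n x. w x * u n x"])
    show "integrable \<mu> (\<lambda>x. w x * u n x)" for n using H_mult[OF wH u] .
    fix e :: real assume e: "0 < e"
    have "0 < e\<^sup>2 / K" using e K by simp
    from cauchy[OF this] obtain N where N: "\<And>m n. m \<ge> N \<Longrightarrow> n \<ge> N \<Longrightarrow>
      ip (\<lambda>x. u m x - u n x) (\<lambda>x. u m x - u n x) < e\<^sup>2 / K" by blast
    have "(LINT x|\<mu>. norm (w x * u i x - w x * u j x)) < e" if "i \<ge> N" "j \<ge> N" for i j
    proof -
      let ?a = "\<lambda>x. \<bar>u i x - u j x\<bar>"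
      have aH: "?a \<in> H" by (rule H_bound[OF H_diff[OF u u, of i j]]) auto
      have "(LINT x|\<mu>. norm (w x * u i x - w x * u j x)) = ip w ?a"
        unfolding L2_inner_def using wpos
        by (auto simp: abs_mult right_diff_distrib[symmetric] less_imp_le intro!: Bochner_Integration.integral_cong)
      moreover have "(ip w ?a)\<^sup>2 < e\<^sup>2"
      proof -
        have "(ip w ?a)\<^sup>2 \<le> ip w w * ip ?a ?a" by (rule ip_CS_sq[OF wH aH])
        also have "\<dots> \<le> K * ip ?a ?a" by (rule mult_right_mono[OF K(2)]) simp
        also have "\<dots> < e\<^sup>2" using N[OF that] K by (simp add: ip_self field_simps)
        finally show ?thesis .
      qed
      ultimately show ?thesis using e power_less_imp_less_base[of "ip w ?a" 2 e] by simp
    qed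
    then show "\<exists>N. \<forall>i\<ge>N. \<forall>j\<ge>N. (LINT x|\<mu>. norm (w x * u i x - w x * u j x)) < e" by blast
  qed
  define f where "f = (\<lambda>x. lim (\<lambda>i. u (r i) x))"
  have fm [measurable]: "f \<in> borel_measurable \<mu>" unfolding f_def by simp
  have conv: "AE x in \<mu>. (\<lambda>i. u (r i) x) \<longlonglongrightarrow> f x"
    using r(2)
  proof eventually_elim
    case (elim x)
    then obtain l where "(\<lambda>i. w x * u (r i) x) \<longlonglongrightarrow> l" by (auto simp: Cauchy_convergent_iff convergent_def)
    then have "(\<lambda>i. (w x * u (r i) x) / w x) \<longlonglongrightarrow> l / w x" using wpos[of x] by (intro tendsto_intros) auto
    then have "(\<lambda>i. u (r i) x) \<longlonglongrightarrow> l / w x" using wpos[of x] by simp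
    then show ?case unfolding f_def by (metis limI)
  qed
  have fat: "(\<lambda>x. f x - u n x) \<in> H \<and> ip (\<lambda>x. f x - u n x) (\<lambda>x. f x - u n x) \<le> e"
    if "\<And>m. m \<ge> N \<Longrightarrow> ip (\<lambda>x. u m x - u n x) (\<lambda>x. u m x - u n x) < e" for n N e
  proof -
    have l: "AE x in \<mu>. (\<lambda>i. u (r (i + N)) x - u n x) \<longlonglongrightarrow> f x - u n x"
      using conv
    proof eventually_elim
      case (elim x)
      then show ?case by (intro tendsto_intros LIMSEQ_ignore_initial_segment[of "\<lambda>i. u (r i) x"])
    qed
    have "N \<le> r (i + N)" for i using seq_suble[OF r(1), of "i + N"] by simp
    then have "ip (\<lambda>x. u (r (i + N)) x - u n x) (\<lambda>x. u (r (i + N)) x - u n x) \<le> e" for i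
      using that less_imp_le by blast
    then show ?thesis using L2_fatou[of "\<lambda>i x. u (r (i + N)) x - u n x", OF _ _ l, of e] u
      by (auto intro: H_diff)
  qed
  have fH: "f \<in> H"
  proof -
    obtain N where "\<And>m n. m \<ge> N \<Longrightarrow> n \<ge> N \<Longrightarrow> ip (\<lambda>x. u m x - u n x) (\<lambda>x. u m x - u n x) < 1"
      using cauchy[of 1] by auto
    then have "(\<lambda>x. f x - u N x) \<in> H" using fat[of N N 1] by auto
    from H_add[OF this u[of N]] show ?thesis by simp
  qed
  have "(\<lambda>n. ip (\<lambda>x. u n x - f x) (\<lambda>x. u n x - f x)) \<longlonglongrightarrow> 0"
  proof (rule LIMSEQ_I)
    fix e :: real assume "0 < e"
    then obtain N where N: "\<And>m n. m \<ge> N \<Longrightarrow> n \<ge> N \<Longrightarrow> ip (\<lambda>x. u m x - u n x) (\<lambda>x. u m x - u n x) < e / 2"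
      using cauchy[of "e / 2"] by auto
    have "norm (ip (\<lambda>x. u n x - f x) (\<lambda>x. u n x - f x) - 0) < e" if "n \<ge> N" for n
    proof -
      have "ip (\<lambda>x. f x - u n x) (\<lambda>x. f x - u n x) \<le> e / 2" using fat[of N n "e / 2"] N that by auto
      moreover have "ip (\<lambda>x. u n x - f x) (\<lambda>x. u n x - f x) = ip (\<lambda>x. f x - u n x) (\<lambda>x. f x - u n x)"
        by (simp add: ip_self power2_commute)
      ultimately show ?thesis using \<open>0 < e\<close> by simp
    qed
    then show "\<exists>no. \<forall>n\<ge>no. norm (ip (\<lambda>x. u n x - f x) (\<lambda>x. u n x - f x) - 0) < e" by blast
  qed
  then show ?thesis using u fH by (auto simp: L2_lim_def)
qed

text \<open>The positive part of \<open>f - g\<close> is almost everywhere at most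
  \<open>\<bar>u n - f\<bar>\<close>, for every \<open>n\<close>, so its norm is 0.\<close>

lemma L2_lim_le:
  assumes "L2_lim u f" "\<And>n. AE x in \<mu>. u n x \<le> g x" "g \<in> borel_measurable \<mu>"
  shows "AE x in \<mu>. f x \<le> g x"
proof -
  have m: "u n \<in> H" "f \<in> H" for n using assms by (auto simp: L2_lim_def)
  have [measurable]: "f \<in> borel_measurable \<mu>" "g \<in> borel_measurable \<mu>" using m assms H_meas by auto
  let ?p = "\<lambda>x. max 0 (f x - g x)"
  have b: "AE x in \<mu>. \<bar>?p x\<bar> \<le> \<bar>u n x - f x\<bar>" for n
    using assms(2)[of n] by eventually_elim auto
  have pH: "?p \<in> H" by (rule H_bound[OF H_diff[OF m(1)[of 0] m(2)] _ b]) simp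
  have le: "ip ?p ?p \<le> ip (\<lambda>x. u n x - f x) (\<lambda>x. u n x - f x)" for n
    unfolding ip_self
  proof (rule integral_mono_AE[OF H_sq[OF pH] H_sq[OF H_diff[OF m]]])
    show "AE x in \<mu>. (?p x)\<^sup>2 \<le> (u n x - f x)\<^sup>2"
      using b[of n] by eventually_elim (simp only: abs_le_square_iff)
  qed
  have "ip ?p ?p \<le> 0"
    using LIMSEQ_le_const[OF L2_limD(3)[OF assms(1)]] le by blast
  then have "AE x in \<mu>. ?p x = 0" using ip_self_zero[OF pH] by (simp add: antisym)
  then show ?thesis by eventually_elim auto
qed

end

section \<open>Bounded Borel functional calculus of a projection-valued measure\<close>

definition bounded_borel :: "(real \<Rightarrow> real) \<Rightarrow> bool" where
  "bounded_borel \<phi> \<longleftrightarrow> \<phi> \<in> borel_measurable borel \<and> (\<exists>c. \<forall>s. \<bar>\<phi> s\<bar> \<le> c)"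

lemma bounded_borelI: "\<phi> \<in> borel_measurable borel \<Longrightarrow> (\<And>s. \<bar>\<phi> s\<bar> \<le> c) \<Longrightarrow> bounded_borel \<phi>"
  by (auto simp: bounded_borel_def)

lemma bounded_borel_meas [measurable_dest]: "bounded_borel \<phi> \<Longrightarrow> \<phi> \<in> borel_measurable borel"
  by (simp add: bounded_borel_def)

lemma bounded_borelE: 
  assumes "bounded_borel \<phi>" obtains c where "0 < c" "\<And>s. \<bar>\<phi> s\<bar> \<le> c"
proof -
  obtain c where "\<forall>s. \<bar>\<phi> s\<bar> \<le> c" using assms by (auto simp: bounded_borel_def)
  then have "\<bar>\<phi> s\<bar> \<le> \<bar>c\<bar> + 1" for s using abs_ge_self[of c] by (metis add_increasing2 order_trans zero_le_one)
  then show ?thesis using that[of "\<bar>c\<bar> + 1"] by simp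
qed

lemma bounded_borel_indicator: "B \<in> sets borel \<Longrightarrow> bounded_borel (indicator B)"
  by (rule bounded_borelI[of _ 1]) (auto simp: indicator_def)

lemma bounded_borel_const: "bounded_borel (\<lambda>_. a)"
  by (rule bounded_borelI[of _ "\<bar>a\<bar>"]) auto

lemma bounded_borel_mult:
  assumes "bounded_borel \<phi>" "bounded_borel \<psi>" shows "bounded_borel (\<lambda>s. \<phi> s * \<psi> s)"
proof -
  obtain c d where "0 < c" "0 < d" "\<And>s. \<bar>\<phi> s\<bar> \<le> c" "\<And>s. \<bar>\<psi> s\<bar> \<le> d"
    using assms by (metis bounded_borelE)
  then show ?thesis using assms
    by (intro bounded_borelI[of _ "c * d"]) (auto simp: bounded_borel_def abs_mult intro!: mult_mono)
qed

lemma bounded_borel_lin: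
  assumes "bounded_borel \<phi>" "bounded_borel \<psi>" shows "bounded_borel (\<lambda>s. a * \<phi> s + b * \<psi> s)"
proof -
  obtain c d where cd: "\<And>s. \<bar>\<phi> s\<bar> \<le> c" "\<And>s. \<bar>\<psi> s\<bar> \<le> d" using assms by (metis bounded_borelE)
  have "\<bar>a * \<phi> s + b * \<psi> s\<bar> \<le> \<bar>a\<bar> * c + \<bar>b\<bar> * d" for s
    by (rule order_trans[OF abs_triangle_ineq]) (auto simp: abs_mult intro!: add_mono mult_left_mono cd)
  then show ?thesis using assms by (intro bounded_borelI) (auto simp: bounded_borel_def)
qed

text \<open>Rounding a bounded function down to multiples of \<open>1 / (n + 1)\<close> leaves
  finitely many values, hence a combination of indicators. The limit case is therefore about uniform
  limits with an explicit rate, which later makes the represented operators Cauchy in norm.\<close>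

lemma bounded_borel_induct [consumes 1, case_names indicator lin lim]:
  assumes "bounded_borel \<phi>"
    and ind: "\<And>B. B \<in> sets borel \<Longrightarrow> P (indicator B)"
    and lin: "\<And>\<phi> \<psi> a b. bounded_borel \<phi> \<Longrightarrow> bounded_borel \<psi> \<Longrightarrow> P \<phi> \<Longrightarrow> P \<psi> \<Longrightarrow> P (\<lambda>s. a * \<phi> s + b * \<psi> s)"
    and lim: "\<And>u \<phi>. (\<And>n. bounded_borel (u n)) \<Longrightarrow> (\<And>n. P (u n)) \<Longrightarrow> bounded_borel \<phi> \<Longrightarrow>
      (\<And>n s. \<bar>u n s - \<phi> s\<bar> \<le> 1 / (real n + 1)) \<Longrightarrow> P \<phi>"
  shows "P \<phi>"
proof -
  have [measurable]: "\<phi> \<in> borel_measurable borel" using assms(1) by (rule bounded_borel_meas)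
  obtain c where c: "0 < c" "\<And>s. \<bar>\<phi> s\<bar> \<le> c" using assms(1) by (metis bounded_borelE)
  have sum: "bounded_borel (\<lambda>s. \<Sum>k\<in>I. a k * indicator (B k) s) \<and> P (\<lambda>s. \<Sum>k\<in>I. a k * indicator (B k) s)"
    if "finite I" "\<And>k. k \<in> I \<Longrightarrow> B k \<in> sets borel" for I :: "int set" and a :: "int \<Rightarrow> real" and B
    using that
  proof (induction I rule: finite_induct)
    case empty
    have "(indicator {} :: real \<Rightarrow> real) = (\<lambda>s. 0)" by auto
    then show ?case using ind[of "{}"] bounded_borel_const[of 0] by simp
  next
    case (insert k I)
    then have "bounded_borel (\<lambda>s. \<Sum>k\<in>I. a k * indicator (B k) s)" "P (\<lambda>s. \<Sum>k\<in>I. a k * indicator (B k) s)"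
      and B: "B k \<in> sets borel" by auto
    from bounded_borel_lin[OF bounded_borel_indicator[OF B] this(1), of "a k" 1]
      lin[OF bounded_borel_indicator[OF B] this(1) ind[OF B] this(2), of "a k" 1]
    show ?case by (simp only: sum.insert[OF insert.hyps] mult_1)
  qed
  define u where "u = (\<lambda>n s. of_int \<lfloor>(real n + 1) * \<phi> s\<rfloor> / (real n + 1))"
  have bP: "bounded_borel (u n) \<and> P (u n)" for n
  proof -
    define K where "K = \<lceil>(real n + 1) * c\<rceil> + 1"
    let ?B = "\<lambda>k. {s. \<lfloor>(real n + 1) * \<phi> s\<rfloor> = k}"
    have mem: "\<lfloor>(real n + 1) * \<phi> s\<rfloor> \<in> {-K..K}" for s
    proof -
      have "\<bar>(real n + 1) * \<phi> s\<bar> \<le> (real n + 1) * c" using c(2)[of s] by (simp add: abs_mult)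
      then show ?thesis unfolding K_def by simp linarith
    qed
    have "u n = (\<lambda>s. \<Sum>k\<in>{-K..K}. (of_int k / (real n + 1)) * indicator (?B k) s)"
    proof
      fix s
      have "(\<Sum>k\<in>{-K..K}. (of_int k / (real n + 1)) * indicator (?B k) s)
        = (\<Sum>k\<in>{-K..K}. if k = \<lfloor>(real n + 1) * \<phi> s\<rfloor> then of_int k / (real n + 1) else 0)"
        by (intro sum.cong) (auto simp: indicator_def)
      also have "\<dots> = u n s" using mem[of s] by (simp add: u_def)
      finally show "u n s = (\<Sum>k\<in>{-K..K}. (of_int k / (real n + 1)) * indicator (?B k) s)" by simp
    qed
    moreover have "?B k \<in> sets borel" for k
    proof -
      have "?B k = (\<lambda>s. \<lfloor>(real n + 1) * \<phi> s\<rfloor>) -` {k} \<inter> space borel" by auto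
      also have "\<dots> \<in> sets borel" by measurable
      finally show ?thesis .
    qed
    ultimately show ?thesis using sum[of "{-K..K}" ?B "\<lambda>k. of_int k / (real n + 1)"] by simp
  qed
  have "\<bar>u n s - \<phi> s\<bar> \<le> 1 / (real n + 1)" for n s
  proof -
    have "u n s - \<phi> s = (of_int \<lfloor>(real n + 1) * \<phi> s\<rfloor> - (real n + 1) * \<phi> s) / (real n + 1)"
      by (simp add: u_def field_simps)
    moreover have "\<bar>of_int \<lfloor>(real n + 1) * \<phi> s\<rfloor> - (real n + 1) * \<phi> s\<bar> \<le> 1" by linarith
    ultimately show ?thesis by (simp add: divide_right_mono)
  qed
  then show ?thesis using lim[of u \<phi>] bP assms(1) by blast
qed

locale pvm_setting = l2_setting \<mu> for \<mu> :: "'a measure" +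
  fixes Q :: "real set \<Rightarrow> ('a \<Rightarrow> real) \<Rightarrow> ('a \<Rightarrow> real)"
  assumes pvm: "projection_valued_measure \<mu> Q"
begin

abbreviation "sm \<equiv> scalar_spectral_measure \<mu> Q"

lemma Q_H: "B \<in> sets borel \<Longrightarrow> f \<in> H \<Longrightarrow> Q B f \<in> H"
  using pvm by (auto simp: projection_valued_measure_def orth_projection_def)

lemma Q_sym: "B \<in> sets borel \<Longrightarrow> f \<in> H \<Longrightarrow> g \<in> H \<Longrightarrow> ip (Q B f) g = ip f (Q B g)"
  using pvm by (auto simp: projection_valued_measure_def orth_projection_def)

lemma Q_idem: "B \<in> sets borel \<Longrightarrow> f \<in> H \<Longrightarrow> g \<in> H \<Longrightarrow> ip (Q B (Q B f)) g = ip (Q B f) g"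
proof (rule ip_cong)
  assume "B \<in> sets borel" "f \<in> H"
  then show "AE x in \<mu>. Q B (Q B f) x = Q B f x"
    using pvm by (auto simp: projection_valued_measure_def orth_projection_def ae_eq_def)
qed (auto simp: H_meas Q_H)

lemma Q_self: "B \<in> sets borel \<Longrightarrow> f \<in> H \<Longrightarrow> ip (Q B f) f = ip (Q B f) (Q B f)"
  using Q_sym[of B "Q B f" f] Q_idem[of B f f] by (simp add: Q_H)

lemma Q_pos: "B \<in> sets borel \<Longrightarrow> f \<in> H \<Longrightarrow> 0 \<le> ip (Q B f) f"
  by (simp add: Q_self)

lemma Q_add: "B \<in> sets borel \<Longrightarrow> f \<in> H \<Longrightarrow> g \<in> H \<Longrightarrow> h \<in> H \<Longrightarrow>
  ip (Q B (\<lambda>x. f x + g x)) h = ip (Q B f) h + ip (Q B g) h"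
  by (simp add: Q_sym H_add ip_add Q_H)

lemma Q_diff: "B \<in> sets borel \<Longrightarrow> f \<in> H \<Longrightarrow> g \<in> H \<Longrightarrow> h \<in> H \<Longrightarrow>
  ip (Q B (\<lambda>x. f x - g x)) h = ip (Q B f) h - ip (Q B g) h"
  by (simp add: Q_sym H_diff ip_diff Q_H)

text \<open>A projection-valued measure is countably additive on the diagonal by definition; this
  identity carries additivity over to pairs \<open>f\<close>, \<open>h\<close>.\<close>

lemma Q_polar: 
  assumes "B \<in> sets borel" "f \<in> H" "h \<in> H"
  shows "ip (Q B f) h = (ip (Q B (\<lambda>x. f x + h x)) (\<lambda>x. f x + h x)
    - ip (Q B (\<lambda>x. f x - h x)) (\<lambda>x. f x - h x)) / 4"
proof -
  have "ip (Q B h) f = ip (Q B f) h" using assms Q_sym[of B f h] ip_comm[of f "Q B h"] by simp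
  then show ?thesis using assms
    by (simp add: Q_add Q_diff H_add H_diff ip_add_r ip_diff_r Q_H)
qed

lemma Q_sums:
  assumes "f \<in> H" "h \<in> H" "range A \<subseteq> sets borel" "disjoint_family A"
  shows "(\<lambda>n::nat. ip (Q (A n) f) h) sums ip (Q (\<Union>n. A n) f) h"
proof -
  have sq: "(\<lambda>n. ip (Q (A n) g) g) sums ip (Q (\<Union>n. A n) g) g" if "g \<in> H" for g
    using pvm that assms by (auto simp: projection_valued_measure_def)
  have A: "A n \<in> sets borel" "(\<Union>n. A n) \<in> sets borel" for n using assms by auto
  have "(\<lambda>n. (ip (Q (A n) (\<lambda>x. f x + h x)) (\<lambda>x. f x + h x)
    - ip (Q (A n) (\<lambda>x. f x - h x)) (\<lambda>x. f x - h x)) / 4) sums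
    ((ip (Q (\<Union>n. A n) (\<lambda>x. f x + h x)) (\<lambda>x. f x + h x)
    - ip (Q (\<Union>n. A n) (\<lambda>x. f x - h x)) (\<lambda>x. f x - h x)) / 4)"
    using assms by (intro sums_divide sums_diff sq H_add H_diff)
  then show ?thesis using A assms by (simp add: Q_polar[symmetric])
qed

lemma Q_empty: assumes "f \<in> H" "h \<in> H" shows "ip (Q {} f) h = 0"
proof -
  have "(\<lambda>n::nat. ip (Q {} f) h) sums ip (Q (\<Union>n::nat. {}) f) h"
    using Q_sums[OF assms, of "\<lambda>_. {}"] by (simp add: disjoint_family_on_def)
  then have "(\<lambda>n::nat. ip (Q {} f) h) \<longlonglongrightarrow> 0" by (intro summable_LIMSEQ_zero) (auto simp: sums_iff)
  then show ?thesis by (simp add: LIMSEQ_const_iff)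
qed

lemma Q_Un:
  assumes "f \<in> H" "h \<in> H" "A \<in> sets borel" "B \<in> sets borel" "A \<inter> B = {}"
  shows "ip (Q (A \<union> B) f) h = ip (Q A f) h + ip (Q B f) h"
proof -
  have "(\<lambda>n. ip (Q (binaryset A B n) f) h) sums ip (Q (\<Union>n. binaryset A B n) f) h"
  proof (rule Q_sums[OF assms(1,2)])
    show "range (binaryset A B) \<subseteq> sets borel" using assms by (auto simp: range_binaryset_eq)
    show "disjoint_family (binaryset A B)"
      unfolding disjoint_family_on_def
    proof (intro ballI impI)
      fix m n :: nat assume "m \<noteq> n"
      then show "binaryset A B m \<inter> binaryset A B n = {}"
        using assms(5) by (cases m; cases n) (auto simp: binaryset_def)
    qed
  qed
  moreover have "(\<lambda>n. ip (Q (binaryset A B n) f) h) sums (ip (Q A f) h + ip (Q B f) h)"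
    by (rule binaryset_sums) (simp add: Q_empty assms)
  ultimately show ?thesis by (simp add: UN_binaryset_eq sums_iff)
qed

lemma Q_le: "B \<in> sets borel \<Longrightarrow> f \<in> H \<Longrightarrow> ip (Q B f) f \<le> ip f f"
  using ip_ge0[of "\<lambda>x. f x - Q B f x"] by (simp add: ip_expand_diff Q_H Q_self[symmetric] ip_comm[of f "Q B f"])

text \<open>Multiplicativity is not part of the definition. With \<open>g = Q B h\<close>,
  additivity and \<open>Q_le\<close> give \<open>ip (Q A g) g + ip (Q B g) g \<le> ip g g\<close>,
  and the second summand already exhausts the right-hand side; hence \<open>Q A g\<close> has norm
  0.\<close>

lemma Q_disjoint:
  assumes "f \<in> H" "h \<in> H" "A \<in> sets borel" "B \<in> sets borel" "A \<inter> B = {}"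
  shows "ip (Q A f) (Q B h) = 0"
proof -
  let ?g = "Q B h"
  have g: "?g \<in> H" using assms Q_H by auto
  have "ip (Q A ?g) ?g + ip (Q B ?g) ?g \<le> ip ?g ?g"
    using Q_le[of "A \<union> B" ?g] Q_Un[OF g g assms(3-5)] g assms by auto
  moreover have "ip (Q B ?g) ?g = ip ?g ?g" using Q_idem assms g by auto
  ultimately have "ip (Q A ?g) (Q A ?g) = 0" using Q_self[of A ?g] assms g ip_ge0[of "Q A ?g"] by auto
  then have "(ip (Q A ?g) f)\<^sup>2 \<le> 0" using ip_CS_sq[of "Q A ?g" f] Q_H assms g by auto
  then show ?thesis using Q_sym[of A f ?g] assms g by (simp add: ip_comm)
qed

lemma Q_mult:
  assumes "f \<in> H" "h \<in> H" "A \<in> sets borel" "B \<in> sets borel"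
  shows "ip (Q A f) (Q B h) = ip (Q (A \<inter> B) f) h"
proof -
  have split: "ip (Q X k) l = ip (Q (X \<inter> Y) k) l + ip (Q (X - Y) k) l"
    if "X \<in> sets borel" "Y \<in> sets borel" "k \<in> H" "l \<in> H" for X Y k l
    using Q_Un[of k l "X \<inter> Y" "X - Y"] that by (auto simp: Int_Diff_Un Int_Diff)
  have BH: "Q B h \<in> H" using assms Q_H by auto
  have ABH: "Q (A \<inter> B) f \<in> H" using assms Q_H by auto
  have "ip (Q A f) (Q B h) = ip (Q (A \<inter> B) f) (Q B h) + ip (Q (A - B) f) (Q B h)"
    by (rule split) (use assms BH in auto)
  also have "ip (Q (A - B) f) (Q B h) = 0" by (rule Q_disjoint) (use assms in auto)
  also have "ip (Q (A \<inter> B) f) (Q B h) = ip (Q B h) (Q (A \<inter> B) f)" by (rule ip_comm)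
  also have "\<dots> = ip (Q (B \<inter> A) h) (Q (A \<inter> B) f) + ip (Q (B - A) h) (Q (A \<inter> B) f)"
    by (rule split) (use assms ABH in auto)
  also have "ip (Q (B - A) h) (Q (A \<inter> B) f) = 0" by (rule Q_disjoint) (use assms in auto)
  also have "ip (Q (B \<inter> A) h) (Q (A \<inter> B) f) = ip (Q (A \<inter> B) f) h"
    using assms Q_sym[of "A \<inter> B" "Q (A \<inter> B) f" h] Q_idem[of "A \<inter> B" f h] Q_H[of "A \<inter> B" f]
    by (simp add: Int_commute ip_comm)
  finally show ?thesis by simp
qed

lemma sets_sm [simp, measurable_cong]: "sets (sm f) = sets borel"
  by (simp add: scalar_spectral_measure_def sets.sigma_sets_eq[of borel, simplified])

lemma space_sm [simp]: "space (sm f) = UNIV"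
  by (simp add: scalar_spectral_measure_def)

lemma emeasure_sm: assumes "f \<in> H" "B \<in> sets borel" shows "emeasure (sm f) B = ennreal (ip (Q B f) f)"
  unfolding scalar_spectral_measure_def
proof (rule emeasure_measure_of_sigma)
  show "sigma_algebra UNIV (sets (borel :: real measure))"
    using sets.sigma_algebra_axioms[of "borel :: real measure"] by simp
  show "positive (sets borel) (\<lambda>B. ennreal (ip (Q B f) f))"
    by (simp add: positive_def Q_empty assms)
  show "countably_additive (sets borel) (\<lambda>B. ennreal (ip (Q B f) f))"
  proof (rule countably_additiveI)
    fix A :: "nat \<Rightarrow> real set" assume A: "range A \<subseteq> sets borel" "disjoint_family A"
    then show "(\<Sum>i. ennreal (ip (Q (A i) f) f)) = ennreal (ip (Q (\<Union> (range A)) f) f)"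
      using Q_sums[OF assms(1) assms(1) A] assms by (intro suminf_ennreal_eq Q_pos) auto
  qed
qed (use assms in auto)

lemma measure_sm: "f \<in> H \<Longrightarrow> B \<in> sets borel \<Longrightarrow> measure (sm f) B = ip (Q B f) f"
  by (simp add: measure_def emeasure_sm Q_pos)

lemma finite_measure_sm: "f \<in> H \<Longrightarrow> finite_measure (sm f)"
  by (rule finite_measureI) (simp add: emeasure_sm)

lemma measure_sm_UNIV: assumes "f \<in> H" shows "measure (sm f) UNIV = ip f f"
proof -
  have "ip (Q UNIV f) f = ip f f"
    using pvm assms by (intro ip_cong) (auto simp: projection_valued_measure_def ae_eq_def H_meas Q_H)
  then show ?thesis using assms by (simp add: measure_sm)
qed

lemma integrable_sm: assumes "f \<in> H" "bounded_borel \<phi>" shows "integrable (sm f) \<phi>"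
proof -
  interpret finite_measure "sm f" using assms finite_measure_sm by auto
  obtain c where "\<And>s. \<bar>\<phi> s\<bar> \<le> c" using assms(2) by (metis bounded_borelE)
  then show ?thesis using assms(2)
    by (intro integrable_const_bound[of _ c]) (auto intro: bounded_borel_meas)
qed

lemma integral_sm_bound:
  assumes "f \<in> H" "bounded_borel \<phi>" "\<And>s. \<bar>\<phi> s\<bar> \<le> c" shows "\<bar>\<integral>s. \<phi> s \<partial>sm f\<bar> \<le> c * ip f f"
proof -
  interpret finite_measure "sm f" using assms finite_measure_sm by auto
  have "\<bar>\<integral>s. \<phi> s \<partial>sm f\<bar> \<le> (\<integral>s. \<bar>\<phi> s\<bar> \<partial>sm f)" by (rule integral_abs_bound)
  also have "\<dots> \<le> (\<integral>s. c \<partial>sm f)"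
    using integrable_sm[OF assms(1,2)] assms(3) by (intro integral_mono) auto
  also have "\<dots> = c * ip f f" using measure_sm_UNIV[OF assms(1)] by simp
  finally show ?thesis .
qed

lemma integral_sm_lim:
  assumes "f \<in> H" "\<And>n. bounded_borel (u n)" "\<And>n s. \<bar>u n s\<bar> \<le> c" "\<And>s. (\<lambda>n. u n s) \<longlonglongrightarrow> \<phi> s"
  shows "(\<lambda>n. \<integral>s. u n s \<partial>sm f) \<longlonglongrightarrow> (\<integral>s. \<phi> s \<partial>sm f)"
proof (rule integral_dominated_convergence[where w="\<lambda>_. c"])
  interpret finite_measure "sm f" using assms finite_measure_sm by auto
  show "integrable (sm f) (\<lambda>_. c)" by simp
  have um [measurable]: "u n \<in> borel_measurable borel" for n using assms(2) by (rule bounded_borel_meas)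
  show "u n \<in> borel_measurable (sm f)" for n by measurable
  have "\<phi> \<in> borel_measurable borel" by (rule borel_measurable_LIMSEQ_real[OF assms(4) um])
  then show "\<phi> \<in> borel_measurable (sm f)" by measurable
qed (use assms in auto)

lemma uniform_approx:
  assumes "bounded_borel \<phi>" "\<And>n s. \<bar>u n s - \<phi> s\<bar> \<le> 1 / (real n + 1)"
  shows "\<exists>c. \<forall>n s. \<bar>u n s\<bar> \<le> c" "(\<lambda>n. u n s) \<longlonglongrightarrow> \<phi> s"
proof -
  obtain c where c: "\<And>s. \<bar>\<phi> s\<bar> \<le> c" using assms(1) by (metis bounded_borelE)
  have "\<bar>u n s\<bar> \<le> c + 1" for n s
  proof -
    have "1 / (real n + 1) \<le> 1" by simp
    then show ?thesis using assms(2)[of n s] c[of s] by linarith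
  qed
  then show "\<exists>c. \<forall>n s. \<bar>u n s\<bar> \<le> c" by blast
  have "(\<lambda>n. u n s - \<phi> s) \<longlonglongrightarrow> 0"
  proof (rule Lim_null_comparison)
    show "\<forall>\<^sub>F n in sequentially. norm (u n s - \<phi> s) \<le> 1 / (real n + 1)" using assms(2) by simp
    show "(\<lambda>n. 1 / (real n + 1)) \<longlonglongrightarrow> 0" using LIMSEQ_inverse_real_of_nat by (simp add: inverse_eq_divide add.commute)
  qed
  then show "(\<lambda>n. u n s) \<longlonglongrightarrow> \<phi> s" by (simp add: LIM_zero_iff)
qed

text \<open>The integral of \<open>\<phi>\<close> against the signed measure sending
  \<open>B\<close> to \<open>ip (Q B f) h\<close>, in the polarized form that
  \<open>spectral_integral\<close> uses. For bounded \<open>\<phi>\<close> no domain condition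
  arises.\<close>

definition S :: "(real \<Rightarrow> real) \<Rightarrow> ('a \<Rightarrow> real) \<Rightarrow> ('a \<Rightarrow> real) \<Rightarrow> real" where
  "S \<phi> f h = ((\<integral>s. \<phi> s \<partial>sm (\<lambda>x. f x + h x)) - (\<integral>s. \<phi> s \<partial>sm (\<lambda>x. f x - h x))) / 4"

lemma S_indicator: "f \<in> H \<Longrightarrow> h \<in> H \<Longrightarrow> B \<in> sets borel \<Longrightarrow> S (indicator B) f h = ip (Q B f) h"
  by (simp add: S_def measure_sm H_add H_diff Q_polar)

lemma S_lin: "f \<in> H \<Longrightarrow> h \<in> H \<Longrightarrow> bounded_borel \<phi> \<Longrightarrow> bounded_borel \<psi> \<Longrightarrow>
  S (\<lambda>s. a * \<phi> s + b * \<psi> s) f h = a * S \<phi> f h + b * S \<psi> f h"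
  by (simp add: S_def integrable_sm H_add H_diff algebra_simps add_divide_distrib diff_divide_distrib)

lemma S_lim:
  assumes "f \<in> H" "h \<in> H" "\<And>n. bounded_borel (u n)" "\<And>n s. \<bar>u n s\<bar> \<le> c" "\<And>s. (\<lambda>n. u n s) \<longlonglongrightarrow> \<phi> s"
  shows "(\<lambda>n. S (u n) f h) \<longlonglongrightarrow> S \<phi> f h"
  unfolding S_def using assms
  by (intro tendsto_intros integral_sm_lim[of _ u c] H_add H_diff) auto

lemma S_bound:
  assumes "f \<in> H" "h \<in> H" "bounded_borel \<phi>" "\<And>s. \<bar>\<phi> s\<bar> \<le> c"
  shows "\<bar>S \<phi> f h\<bar> \<le> c / 2 * (ip f f + ip h h)"
proof -
  have "\<bar>S \<phi> f h\<bar> \<le> (\<bar>\<integral>s. \<phi> s \<partial>sm (\<lambda>x. f x + h x)\<bar> + \<bar>\<integral>s. \<phi> s \<partial>sm (\<lambda>x. f x - h x)\<bar>) / 4"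
    unfolding S_def by (simp add: abs_divide divide_right_mono abs_triangle_ineq4)
  also have "\<dots> \<le> (c * ip (\<lambda>x. f x + h x) (\<lambda>x. f x + h x) + c * ip (\<lambda>x. f x - h x) (\<lambda>x. f x - h x)) / 4"
    using assms by (intro divide_right_mono add_mono integral_sm_bound H_add H_diff) auto
  also have "\<dots> = c / 2 * (ip f f + ip h h)"
    using assms(1,2) by (simp add: ip_expand_add ip_expand_diff algebra_simps)
  finally show ?thesis .
qed

text \<open>\<open>S_bound\<close> is not homogeneous in \<open>h\<close>. The test vector
  \<open>g / c\<close> is the scaling that balances its two terms and turns it into the operator
  norm bound \<open>c\<close>.\<close>

lemma rep_bound:
  assumes "f \<in> H" "g \<in> H" "bounded_borel \<phi>" "\<And>s. \<bar>\<phi> s\<bar> \<le> c" "0 < c" "\<And>h. h \<in> H \<Longrightarrow> ip g h = S \<phi> f h"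
  shows "ip g g \<le> c\<^sup>2 * ip f f"
proof -
  have "ip g (\<lambda>x. (1 / c) * g x) \<le> c / 2 * (ip f f + ip (\<lambda>x. (1 / c) * g x) (\<lambda>x. (1 / c) * g x))"
    using S_bound[OF assms(1) H_cmult[OF assms(2)] assms(3,4)] assms(6)[OF H_cmult[OF assms(2)]]
    by (metis abs_le_D1)
  then have "ip g g / c \<le> c / 2 * (ip f f + ip g g / c\<^sup>2)"
    by (simp only: ip_cmult ip_cmult_r power2_eq_square) simp
  then show ?thesis using assms(5) by (simp add: field_simps power2_eq_square)
qed

text \<open>The representing vector is \<open>Q B f\<close> for an indicator and is linear in the
  symbol. For a uniform limit of symbols, \<open>rep_bound\<close> applied to differences shows that
  the representing vectors are Cauchy, and completeness supplies the limit.\<close>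

lemma rep_exists:
  assumes "bounded_borel \<phi>"
  shows "\<forall>f\<in>H. \<exists>g\<in>H. \<forall>h\<in>H. ip g h = S \<phi> f h"
  using assms
proof (induction rule: bounded_borel_induct)
  case (indicator B)
  then show ?case by (metis S_indicator Q_H)
next
  case (lin \<phi> \<psi> a b)
  show ?case
  proof
    fix f assume f: "f \<in> H"
    then obtain g g' where "g \<in> H" "g' \<in> H" "\<forall>h\<in>H. ip g h = S \<phi> f h" "\<forall>h\<in>H. ip g' h = S \<psi> f h"
      using lin by metis
    then show "\<exists>g\<in>H. \<forall>h\<in>H. ip g h = S (\<lambda>s. a * \<phi> s + b * \<psi> s) f h"
      using f lin
      by (intro bexI[of _ "\<lambda>x. a * g x + b * g' x"]) (auto simp: S_lin ip_add ip_cmult H_cmult intro: H_lin)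
  qed
next
  case (lim u \<phi>)
  show ?case
  proof
    fix f assume f: "f \<in> H"
    have "\<exists>g\<in>H. \<forall>h\<in>H. ip g h = S (u n) f h" for n using lim.IH[of n] f by blast
    then obtain g where g: "\<And>n. g n \<in> H" "\<And>n h. h \<in> H \<Longrightarrow> ip (g n) h = S (u n) f h" by metis
    have diff: "ip (\<lambda>x. g m x - g n x) (\<lambda>x. g m x - g n x) \<le> (2 / (real N + 1))\<^sup>2 * ip f f"
      if "m \<ge> N" "n \<ge> N" for m n N
    proof (rule rep_bound[OF f H_diff[OF g(1) g(1)]])
      show "bounded_borel (\<lambda>s. 1 * u m s + (-1) * u n s)" by (rule bounded_borel_lin[OF lim.hyps(1) lim.hyps(1)])
      show "\<bar>1 * u m s + (-1) * u n s\<bar> \<le> 2 / (real N + 1)" for s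
      proof -
        have "1 / (real m + 1) \<le> 1 / (real N + 1)" "1 / (real n + 1) \<le> 1 / (real N + 1)"
          using that by (auto intro!: divide_left_mono)
        moreover have "2 / (real N + 1) = 1 / (real N + 1) + 1 / (real N + 1)" by simp
        ultimately show ?thesis using lim.hyps(3)[of m s] lim.hyps(3)[of n s] by linarith
      qed
      show "ip (\<lambda>x. g m x - g n x) h = S (\<lambda>s. 1 * u m s + (-1) * u n s) f h" if "h \<in> H" for h
        unfolding S_lin[OF f that lim.hyps(1) lim.hyps(1)] using that by (simp add: ip_diff g)
    qed simp
    have "\<exists>k. L2_lim g k"
    proof (rule L2_complete[OF g(1)])
      fix e :: real assume e: "0 < e"
      have "(\<lambda>N. (2 * (1 / (real N + 1)))\<^sup>2 * ip f f) \<longlonglongrightarrow> (2 * 0)\<^sup>2 * ip f f"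
        using LIMSEQ_inverse_real_of_nat
        by (intro tendsto_intros) (simp add: inverse_eq_divide add.commute)
      then have "\<forall>\<^sub>F N in sequentially. (2 * (1 / (real N + 1)))\<^sup>2 * ip f f < e"
        using e order_tendstoD(2) by fastforce
      then obtain N where "(2 / (real N + 1))\<^sup>2 * ip f f < e"
        by (auto simp: eventually_sequentially)
      then show "\<exists>N. \<forall>m\<ge>N. \<forall>n\<ge>N. ip (\<lambda>x. g m x - g n x) (\<lambda>x. g m x - g n x) < e"
        using diff order.strict_trans1 by blast
    qed
    then obtain k where k: "L2_lim g k" by blast
    obtain c where c: "\<And>n s. \<bar>u n s\<bar> \<le> c" using uniform_approx(1)[OF lim.hyps(2,3)] by blast
    have "ip k h = S \<phi> f h" if h: "h \<in> H" for h
    proof -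
      have "(\<lambda>n. S (u n) f h) \<longlonglongrightarrow> S \<phi> f h"
        by (rule S_lim[OF f h lim.hyps(1) c uniform_approx(2)[OF lim.hyps(2,3)]])
      moreover have "(\<lambda>n. S (u n) f h) \<longlonglongrightarrow> ip k h" using L2_lim_ip_const[OF k h] g h by simp
      ultimately show ?thesis using LIMSEQ_unique by blast
    qed
    then show "\<exists>g\<in>H. \<forall>h\<in>H. ip g h = S \<phi> f h" using L2_limD(2)[OF k] by blast
  qed
qed

text \<open>A chosen representative of \<open>\<phi>(L) f\<close>, determined only up to null sets;
  identities for \<open>fc\<close> are therefore stated almost everywhere or inside an inner
  product.\<close>

definition fc :: "(real \<Rightarrow> real) \<Rightarrow> ('a \<Rightarrow> real) \<Rightarrow> ('a \<Rightarrow> real)" where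
  "fc \<phi> f = (SOME g. g \<in> H \<and> (\<forall>h\<in>H. ip g h = S \<phi> f h))"

lemma fc: 
  assumes "bounded_borel \<phi>" "f \<in> H"
  shows fc_H: "fc \<phi> f \<in> H" and fc_ip: "h \<in> H \<Longrightarrow> ip (fc \<phi> f) h = S \<phi> f h"
proof -
  have "fc \<phi> f \<in> H \<and> (\<forall>h\<in>H. ip (fc \<phi> f) h = S \<phi> f h)"
  proof -
    have "\<exists>g. g \<in> H \<and> (\<forall>h\<in>H. ip g h = S \<phi> f h)" using rep_exists[OF assms(1)] assms(2) by blast
    from someI_ex[OF this] show ?thesis unfolding fc_def .
  qed
  then show "fc \<phi> f \<in> H" "h \<in> H \<Longrightarrow> ip (fc \<phi> f) h = S \<phi> f h" by blast+
qed

lemma S_sym: assumes "bounded_borel \<phi>" "f \<in> H" "h \<in> H" shows "S \<phi> f h = S \<phi> h f"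
  using assms(1)
proof (induction rule: bounded_borel_induct)
  case (indicator B)
  then show ?case using assms Q_sym[of B f h] ip_comm[of f "Q B h"] by (simp add: S_indicator)
next
  case (lin \<phi> \<psi> a b)
  then show ?case using assms by (simp add: S_lin)
next
  case (lim u \<phi>)
  obtain c where c: "\<And>n s. \<bar>u n s\<bar> \<le> c" using uniform_approx(1)[OF lim.hyps(2,3)] by blast
  note l = S_lim[OF _ _ lim.hyps(1) c uniform_approx(2)[OF lim.hyps(2,3)]]
  show ?case using l[OF assms(2,3)] l[OF assms(3,2)] lim.IH LIMSEQ_unique by simp
qed

lemma fc_sym: "bounded_borel \<phi> \<Longrightarrow> f \<in> H \<Longrightarrow> h \<in> H \<Longrightarrow> ip (fc \<phi> f) h = ip f (fc \<phi> h)"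
  by (simp add: fc_ip ip_comm[of f "fc \<phi> h"] S_sym)

lemma fc_indicator: "B \<in> sets borel \<Longrightarrow> f \<in> H \<Longrightarrow> h \<in> H \<Longrightarrow> ip (fc (indicator B) f) h = ip (Q B f) h"
  by (simp add: fc_ip bounded_borel_indicator S_indicator)

lemma fc_lin: 
  assumes "bounded_borel \<phi>" "f \<in> H" "g \<in> H"
  shows "AE x in \<mu>. fc \<phi> (\<lambda>x. a * f x + b * g x) x = a * fc \<phi> f x + b * fc \<phi> g x"
  by (rule ip_eqI) (use assms in \<open>auto simp: fc_sym fc_H H_cmult H_lin ip_add ip_cmult intro: fc_H H_lin\<close>)

lemma fc_symbol_lin:
  assumes "bounded_borel \<phi>" "bounded_borel \<psi>" "f \<in> H"
  shows "AE x in \<mu>. fc (\<lambda>s. a * \<phi> s + b * \<psi> s) f x = a * fc \<phi> f x + b * fc \<psi> f x"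
  by (rule ip_eqI)
    (use assms in \<open>auto simp: fc_ip bounded_borel_lin S_lin fc_H H_cmult ip_add ip_cmult intro: fc_H H_lin bounded_borel_lin\<close>)

lemma fc_lim_weak:
  assumes "f \<in> H" "h \<in> H" "\<And>n. bounded_borel (u n)" "\<And>n s. \<bar>u n s\<bar> \<le> c" "\<And>s. (\<lambda>n. u n s) \<longlonglongrightarrow> \<phi> s"
    "bounded_borel \<phi>"
  shows "(\<lambda>n. ip (fc (u n) f) h) \<longlonglongrightarrow> ip (fc \<phi> f) h"
  using S_lim[OF assms(1-5)] assms by (simp add: fc_ip)

text \<open>Two successive inductions on symbols: for an indicator on the left, over the right
  symbol, with base case \<open>Q_mult\<close>; then over the left symbol. Pairing with a fixed
  \<open>h\<close> keeps the limit cases scalar.\<close>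

lemma fc_mult:
  assumes "bounded_borel \<phi>" "bounded_borel \<psi>" "f \<in> H" "h \<in> H"
  shows "ip (fc \<phi> (fc \<psi> f)) h = ip (fc (\<lambda>s. \<phi> s * \<psi> s) f) h"
proof -
  have ind: "ip (Q B (fc \<psi> f)) h = ip (fc (\<lambda>s. indicator B s * \<psi> s) f) h"
    if B: "B \<in> sets borel" and "f \<in> H" "h \<in> H" for B f h
    using assms(2)
  proof (induction rule: bounded_borel_induct)
    case (indicator A)
    have "ip (Q B (fc (indicator A) f)) h = ip (Q (A \<inter> B) f) h"
    proof -
      have "ip (Q B (fc (indicator A) f)) h = ip (Q A f) (Q B h)"
        using indicator that by (simp add: Q_sym[of B "fc (indicator A) f"] fc_indicator Q_H fc_H bounded_borel_indicator)
      then show ?thesis using indicator that by (simp add: Q_mult)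
    qed
    moreover have "(\<lambda>s. indicator B s * indicator A s) = (indicator (A \<inter> B) :: real \<Rightarrow> real)"
      by (auto simp: indicator_def)
    ultimately show ?case using indicator that by (simp add: fc_indicator)
  next
    case (lin \<phi> \<psi> a b)
    let ?p = "\<lambda>s. indicator B s * \<phi> s" let ?q = "\<lambda>s. indicator B s * \<psi> s"
    have bb: "bounded_borel ?p" "bounded_borel ?q" "bounded_borel (\<lambda>s. a * ?p s + b * ?q s)"
      using lin B by (auto intro!: bounded_borel_mult bounded_borel_lin bounded_borel_indicator)
    have "ip (Q B (fc (\<lambda>s. a * \<phi> s + b * \<psi> s) f)) h = a * ip (Q B (fc \<phi> f)) h + b * ip (Q B (fc \<psi> f)) h"
      using lin that by (simp add: Q_sym fc_H bounded_borel_lin fc_ip Q_H S_lin)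
    also have "\<dots> = ip (fc (\<lambda>s. a * ?p s + b * ?q s) f) h"
      using lin bb that by (simp add: fc_ip S_lin)
    finally show ?case by (simp add: algebra_simps)
  next
    case (lim u \<phi>)
    obtain c where c: "\<And>n s. \<bar>u n s\<bar> \<le> c" using uniform_approx(1)[OF lim.hyps(2,3)] by blast
    have "(\<lambda>n. ip (fc (u n) f) (Q B h)) \<longlonglongrightarrow> ip (fc \<phi> f) (Q B h)"
      by (rule fc_lim_weak[OF that(2) Q_H[OF B that(3)] lim.hyps(1) c uniform_approx(2)[OF lim.hyps(2,3)] lim.hyps(2)])
    then have "(\<lambda>n. ip (Q B (fc (u n) f)) h) \<longlonglongrightarrow> ip (Q B (fc \<phi> f)) h"
      using lim that by (simp add: Q_sym fc_H)
    moreover have "(\<lambda>n. ip (fc (\<lambda>s. indicator B s * u n s) f) h) \<longlonglongrightarrow> ip (fc (\<lambda>s. indicator B s * \<phi> s) f) h"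
    proof (rule fc_lim_weak[OF that(2,3)])
      show "\<bar>indicator B s * u n s\<bar> \<le> c" for n s using c[of n s] abs_ge_zero[of "u n s"] by (auto simp: indicator_def)
      show "(\<lambda>n. indicator B s * u n s) \<longlonglongrightarrow> indicator B s * \<phi> s" for s
        by (intro tendsto_intros uniform_approx(2)[OF lim.hyps(2,3)])
    qed (use lim B in \<open>auto intro!: bounded_borel_mult bounded_borel_indicator\<close>)
    ultimately show ?case using lim.IH LIMSEQ_unique by simp
  qed
  show ?thesis using assms(1)
  proof (induction rule: bounded_borel_induct)
    case (indicator A)
    then show ?case using assms by (simp add: fc_indicator fc_H ind)
  next
    case (lin \<phi>1 \<phi>2 a b)
    let ?p = "\<lambda>s. \<phi>1 s * \<psi> s" let ?q = "\<lambda>s. \<phi>2 s * \<psi> s"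
    have bb: "bounded_borel ?p" "bounded_borel ?q" "bounded_borel (\<lambda>s. a * ?p s + b * ?q s)"
      using lin assms by (auto intro!: bounded_borel_mult bounded_borel_lin)
    have "ip (fc (\<lambda>s. a * \<phi>1 s + b * \<phi>2 s) (fc \<psi> f)) h = a * ip (fc \<phi>1 (fc \<psi> f)) h + b * ip (fc \<phi>2 (fc \<psi> f)) h"
      using lin assms by (simp add: fc_H bounded_borel_lin fc_ip S_lin)
    also have "\<dots> = ip (fc (\<lambda>s. a * ?p s + b * ?q s) f) h"
      using lin bb assms by (simp add: fc_ip[of ?p] fc_ip[of ?q] fc_ip[of "\<lambda>s. a * ?p s + b * ?q s"] S_lin)
    finally show ?case by (simp add: algebra_simps)
  next
    case (lim u \<phi>)
    obtain c where c: "\<And>n s. \<bar>u n s\<bar> \<le> c" using uniform_approx(1)[OF lim.hyps(2,3)] by blast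
    obtain d where d: "0 < d" "\<And>s. \<bar>\<psi> s\<bar> \<le> d" using assms(2) by (metis bounded_borelE)
    have c0: "0 \<le> c" using c[of 0 0] by linarith
    have "(\<lambda>n. ip (fc (u n) (fc \<psi> f)) h) \<longlonglongrightarrow> ip (fc \<phi> (fc \<psi> f)) h"
      by (rule fc_lim_weak[OF fc_H[OF assms(2,3)] assms(4) lim.hyps(1) c uniform_approx(2)[OF lim.hyps(2,3)] lim.hyps(2)])
    moreover have "(\<lambda>n. ip (fc (\<lambda>s. u n s * \<psi> s) f) h) \<longlonglongrightarrow> ip (fc (\<lambda>s. \<phi> s * \<psi> s) f) h"
    proof (rule fc_lim_weak[OF assms(3,4)])
      show "\<bar>u n s * \<psi> s\<bar> \<le> c * d" for n s using c d c0 by (auto simp: abs_mult intro!: mult_mono)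
      show "(\<lambda>n. u n s * \<psi> s) \<longlonglongrightarrow> \<phi> s * \<psi> s" for s
        by (intro tendsto_intros uniform_approx(2)[OF lim.hyps(2,3)])
    qed (use lim assms in \<open>auto intro!: bounded_borel_mult\<close>)
    ultimately show ?case using lim.IH LIMSEQ_unique by simp
  qed
qed

lemma fc_mult_AE:
  assumes "bounded_borel \<phi>" "bounded_borel \<psi>" "f \<in> H"
  shows "AE x in \<mu>. fc \<phi> (fc \<psi> f) x = fc (\<lambda>s. \<phi> s * \<psi> s) f x"
  by (rule ip_eqI) (use assms fc_mult in \<open>auto intro!: fc_H bounded_borel_mult\<close>)

lemma fc_quad: assumes "bounded_borel \<phi>" "f \<in> H" shows "ip (fc \<phi> f) f = (\<integral>s. \<phi> s \<partial>sm f)"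
  using assms(1)
proof (induction rule: bounded_borel_induct)
  case (indicator B)
  then show ?case using assms by (simp add: fc_indicator measure_sm)
next
  case (lin \<phi> \<psi> a b)
  then show ?case using assms by (simp add: fc_ip bounded_borel_lin S_lin integrable_sm)
next
  case (lim u \<phi>)
  obtain c where c: "\<And>n s. \<bar>u n s\<bar> \<le> c" using uniform_approx(1)[OF lim.hyps(2,3)] by blast
  have "(\<lambda>n. ip (fc (u n) f) f) \<longlonglongrightarrow> ip (fc \<phi> f) f"
    by (rule fc_lim_weak[OF assms(2) assms(2) lim.hyps(1) c uniform_approx(2)[OF lim.hyps(2,3)] lim.hyps(2)])
  moreover have "(\<lambda>n. \<integral>s. u n s \<partial>sm f) \<longlonglongrightarrow> (\<integral>s. \<phi> s \<partial>sm f)"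
    by (rule integral_sm_lim[OF assms(2) lim.hyps(1) c uniform_approx(2)[OF lim.hyps(2,3)]])
  ultimately show ?case using lim.IH LIMSEQ_unique by simp
qed

lemma fc_prod: assumes "bounded_borel \<phi>" "bounded_borel \<psi>" "f \<in> H"
  shows "ip (fc \<phi> f) (fc \<psi> f) = (\<integral>s. \<phi> s * \<psi> s \<partial>sm f)"
proof -
  have "ip (fc \<phi> f) (fc \<psi> f) = ip (fc \<psi> (fc \<phi> f)) f" using assms by (simp add: fc_sym fc_H)
  also have "\<dots> = (\<integral>s. \<psi> s * \<phi> s \<partial>sm f)"
    using assms by (simp add: fc_mult fc_quad bounded_borel_mult)
  finally show ?thesis by (simp add: mult.commute)
qed

lemma fc_norm_le: assumes "bounded_borel \<phi>" "f \<in> H" "\<And>s. \<bar>\<phi> s\<bar> \<le> c" "0 < c"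
  shows "ip (fc \<phi> f) (fc \<phi> f) \<le> c\<^sup>2 * ip f f"
  by (rule rep_bound) (use assms fc in auto)

text \<open>Reduces every question about the spectral measure of \<open>fc \<psi> f\<close>, such as
  membership in the form domain or its energy, to a weighted integral against the measure of
  \<open>f\<close>.\<close>

lemma sm_fc: assumes "bounded_borel \<psi>" "f \<in> H"
  shows "sm (fc \<psi> f) = density (sm f) (\<lambda>s. ennreal ((\<psi> s)\<^sup>2))"
proof (rule measure_eqI)
  fix B assume "B \<in> sets (sm (fc \<psi> f))"
  then have B: "B \<in> sets borel" by simp
  have [measurable]: "\<psi> \<in> borel_measurable borel" using assms by (auto intro: bounded_borel_meas)
  have bb: "bounded_borel (\<lambda>s. indicator B s * \<psi> s)"
    using assms B by (auto intro!: bounded_borel_mult bounded_borel_indicator)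
  have "ip (Q B (fc \<psi> f)) (fc \<psi> f) = ip (fc (\<lambda>s. indicator B s * \<psi> s) f) (fc \<psi> f)"
    using assms B by (simp add: fc_indicator[symmetric] fc_H fc_mult bounded_borel_indicator)
  also have "\<dots> = (\<integral>s. indicator B s * (\<psi> s)\<^sup>2 \<partial>sm f)"
    using fc_prod[OF bb assms(1,2)] by (simp add: power2_eq_square mult.assoc)
  finally have "emeasure (sm (fc \<psi> f)) B = ennreal (\<integral>s. indicator B s * (\<psi> s)\<^sup>2 \<partial>sm f)"
    using assms B by (simp add: emeasure_sm fc_H)
  also have "\<dots> = (\<integral>\<^sup>+s. ennreal (indicator B s * (\<psi> s)\<^sup>2) \<partial>sm f)"
  proof (rule nn_integral_eq_integral[symmetric])
    show "integrable (sm f) (\<lambda>s. indicator B s * (\<psi> s)\<^sup>2)"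
      unfolding power2_eq_square using assms B
      by (intro integrable_sm bounded_borel_mult bounded_borel_indicator)
  qed simp
  also have "\<dots> = emeasure (density (sm f) (\<lambda>s. ennreal ((\<psi> s)\<^sup>2))) B"
    using B by (subst emeasure_density) (auto intro!: nn_integral_cong simp: indicator_def)
  finally show "emeasure (sm (fc \<psi> f)) B = emeasure (density (sm f) (\<lambda>s. ennreal ((\<psi> s)\<^sup>2))) B" .
qed simp

end

section \<open>Spectral integrals of unbounded functions\<close>

context pvm_setting
begin

lemma sm_uminus: assumes "f \<in> H" shows "sm (\<lambda>x. - f x) = sm f"
proof (rule measure_eqI)
  fix B assume "B \<in> sets (sm (\<lambda>x. - f x))"
  then have B: "B \<in> sets borel" by simp
  show "emeasure (sm (\<lambda>x. - f x)) B = emeasure (sm f) B"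
    using assms B by (simp add: emeasure_sm H_uminus Q_sym ip_uminus ip_uminus_r Q_H
        Q_sym[symmetric, of B f "\<lambda>x. - f x"])
qed simp

lemma integrable_sm_sq:
  fixes \<phi> :: "real \<Rightarrow> real"
  assumes "f \<in> H" "\<phi> \<in> borel_measurable borel" "integrable (sm f) (\<lambda>s. (\<phi> s)\<^sup>2)"
  shows "integrable (sm f) \<phi>"
proof -
  interpret finite_measure "sm f" using assms finite_measure_sm by auto
  show ?thesis
  proof (rule Bochner_Integration.integrable_bound)
    show "integrable (sm f) (\<lambda>s. 1 + (\<phi> s)\<^sup>2)" using assms by simp
    have "\<bar>a\<bar> \<le> 1 + a\<^sup>2" for a :: real
    proof -
      have "0 \<le> (\<bar>a\<bar> - 1)\<^sup>2" by simp
      then have "2 * \<bar>a\<bar> \<le> 1 + a\<^sup>2" by (simp add: power2_diff)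
      then show ?thesis by linarith
    qed
    then show "AE x in sm f. norm (\<phi> x) \<le> norm (1 + (\<phi> x)\<^sup>2)" by simp
    show "\<phi> \<in> borel_measurable (sm f)" using assms(2) by measurable
  qed
qed

text \<open>Cut off by a set instead of clamping, so that truncating the symbol amounts to composing
  with the spectral projection of that set.\<close>

abbreviation trunc :: "(real \<Rightarrow> real) \<Rightarrow> nat \<Rightarrow> real \<Rightarrow> real" where
  "trunc \<phi> N \<equiv> (\<lambda>s. indicator {s. \<bar>\<phi> s\<bar> \<le> real N} s * \<phi> s)"

lemma bounded_borel_trunc:
  assumes [measurable]: "\<phi> \<in> borel_measurable borel" shows "bounded_borel (trunc \<phi> N)"
  by (rule bounded_borelI[of _ "real N"]) (measurable, auto simp: indicator_def)

lemma bounded_borel_ex: "bounded_borel \<phi> \<Longrightarrow> \<exists>c>0. \<forall>s. \<bar>\<phi> s\<bar> \<le> c"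
  by (erule bounded_borelE) auto

lemma trunc_lim: "(\<lambda>N. trunc \<phi> N s) \<longlonglongrightarrow> \<phi> s"
proof (rule tendsto_eventually)
  obtain N where "\<bar>\<phi> s\<bar> \<le> real N" using real_arch_simple by blast
  then have "\<forall>n\<ge>N. trunc \<phi> n s = \<phi> s" by (auto simp: indicator_def)
  then show "\<forall>\<^sub>F n in sequentially. trunc \<phi> n s = \<phi> s" by (auto simp: eventually_sequentially)
qed

lemma trunc_sq_le: "(trunc \<phi> N s)\<^sup>2 \<le> (\<phi> s)\<^sup>2"
  by (auto simp: indicator_def)

lemma integrable_bounded_approx:
  assumes "f \<in> H" "\<And>N. bounded_borel (w N)" "\<And>N s. 0 \<le> w N s" "\<And>s. (\<lambda>N. w N s) \<longlonglongrightarrow> \<phi> s"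
    "\<And>N::nat. (\<integral>s. w N s \<partial>sm f) \<le> C"
  shows "integrable (sm f) \<phi>"
proof -
  have [measurable]: "w N \<in> borel_measurable borel" for N using assms(2) by (rule bounded_borel_meas)
  have [measurable]: "\<phi> \<in> borel_measurable borel" by (rule borel_measurable_LIMSEQ_real[OF assms(4)]) simp
  have pos: "0 \<le> \<phi> s" for s by (rule LIMSEQ_le_const[OF assms(4)]) (use assms(3) in auto)
  have "(\<integral>\<^sup>+s. ennreal (\<phi> s) \<partial>sm f) = (\<integral>\<^sup>+s. liminf (\<lambda>N. ennreal (w N s)) \<partial>sm f)"
    by (intro nn_integral_cong) (metis assms(4) tendsto_ennrealI lim_imp_Liminf trivial_limit_sequentially)
  also have "\<dots> \<le> liminf (\<lambda>N. \<integral>\<^sup>+s. ennreal (w N s) \<partial>sm f)" by (rule nn_integral_liminf) simp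
  also have "\<dots> = liminf (\<lambda>N. ennreal (\<integral>s. w N s \<partial>sm f))"
    using assms by (subst nn_integral_eq_integral) (auto simp: integrable_sm)
  also have "\<dots> \<le> liminf (\<lambda>N. ennreal C)"
    using assms(5) by (intro Liminf_mono always_eventually) (auto intro: ennreal_leI)
  also have "\<dots> = ennreal C" by (simp add: Liminf_const)
  finally have le: "(\<integral>\<^sup>+s. ennreal (\<phi> s) \<partial>sm f) \<le> ennreal C" .
  show ?thesis
    by (rule integrableI_bounded) (use pos in \<open>auto simp: order.strict_trans1[OF le]\<close>)
qed

text \<open>The measure of a vector depends quadratically on it, so additivity of the domain is not
  immediate. For truncated symbols the integral of the square is the squared norm of a linear
  operator, and the parallelogram bound is uniform in the truncation.\<close>

lemma spectral_dom_add:
  fixes \<phi> :: "real \<Rightarrow> real"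
  assumes [measurable]: "\<phi> \<in> borel_measurable borel"
    and f: "f \<in> H" "integrable (sm f) (\<lambda>s. (\<phi> s)\<^sup>2)"
    and g: "g \<in> H" "integrable (sm g) (\<lambda>s. (\<phi> s)\<^sup>2)"
  shows "integrable (sm (\<lambda>x. f x + g x)) (\<lambda>s. (\<phi> s)\<^sup>2)"
proof (rule integrable_bounded_approx[OF H_add[OF f(1) g(1)], where w="\<lambda>N s. trunc \<phi> N s * trunc \<phi> N s"])
  note bb = bounded_borel_trunc[OF assms(1)]
  show "bounded_borel (\<lambda>s. trunc \<phi> N s * trunc \<phi> N s)" for N by (intro bounded_borel_mult bb)
  show "(\<lambda>N. trunc \<phi> N s * trunc \<phi> N s) \<longlonglongrightarrow> (\<phi> s)\<^sup>2" for s
    unfolding power2_eq_square by (intro tendsto_mult trunc_lim)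
  have le: "(\<integral>s. trunc \<phi> N s * trunc \<phi> N s \<partial>sm k) \<le> (\<integral>s. (\<phi> s)\<^sup>2 \<partial>sm k)"
    if "k \<in> H" "integrable (sm k) (\<lambda>s. (\<phi> s)\<^sup>2)" for k N
  proof (rule integral_mono)
    show "integrable (sm k) (\<lambda>s. trunc \<phi> N s * trunc \<phi> N s)"
      by (rule integrable_sm[OF that(1) bounded_borel_mult[OF bb bb]])
    show "trunc \<phi> N s * trunc \<phi> N s \<le> (\<phi> s)\<^sup>2" for s
      using trunc_sq_le[of \<phi> N s] by (simp only: power2_eq_square)
  qed (use that in auto)
  show "(\<integral>s. trunc \<phi> N s * trunc \<phi> N s \<partial>sm (\<lambda>x. f x + g x)) \<le>
    2 * (\<integral>s. (\<phi> s)\<^sup>2 \<partial>sm f) + 2 * (\<integral>s. (\<phi> s)\<^sup>2 \<partial>sm g)" for N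
  proof -
    let ?t = "trunc \<phi> N"
    have "(\<integral>s. ?t s * ?t s \<partial>sm (\<lambda>x. f x + g x)) = ip (fc ?t (\<lambda>x. f x + g x)) (fc ?t (\<lambda>x. f x + g x))"
      by (rule fc_prod[OF bb bb H_add[OF f(1) g(1)], symmetric])
    also have "\<dots> = ip (\<lambda>x. fc ?t f x + fc ?t g x) (\<lambda>x. fc ?t f x + fc ?t g x)"
      using fc_lin[OF bb f(1) g(1), of N 1 1] f(1) g(1)
      by (intro ip_cong) (auto intro!: H_meas fc_H bb H_add)
    also have "\<dots> \<le> 2 * ip (fc ?t f) (fc ?t f) + 2 * ip (fc ?t g) (fc ?t g)"
      by (rule ip_triangle[OF fc_H[OF bb f(1)] fc_H[OF bb g(1)]])
    also have "\<dots> \<le> 2 * (\<integral>s. (\<phi> s)\<^sup>2 \<partial>sm f) + 2 * (\<integral>s. (\<phi> s)\<^sup>2 \<partial>sm g)"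
      unfolding fc_prod[OF bb bb f(1)] fc_prod[OF bb bb g(1)] using le f g by (intro add_mono) auto
    finally show ?thesis .
  qed
qed simp

lemma spectral_dom_diff:
  fixes \<phi> :: "real \<Rightarrow> real"
  assumes "\<phi> \<in> borel_measurable borel"
    and "f \<in> H" "integrable (sm f) (\<lambda>s. (\<phi> s)\<^sup>2)" "g \<in> H" "integrable (sm g) (\<lambda>s. (\<phi> s)\<^sup>2)"
  shows "integrable (sm (\<lambda>x. f x - g x)) (\<lambda>s. (\<phi> s)\<^sup>2)"
  using spectral_dom_add[of \<phi> f "\<lambda>x. - g x"] assms by (simp add: H_uminus sm_uminus)

lemma trunc_integral_lim:
  assumes [measurable]: "\<phi> \<in> borel_measurable borel" and "f \<in> H" "integrable (sm f) \<phi>"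
  shows "(\<lambda>N. \<integral>s. trunc \<phi> N s \<partial>sm f) \<longlonglongrightarrow> (\<integral>s. \<phi> s \<partial>sm f)"
proof (rule integral_dominated_convergence[where w="\<lambda>s. \<bar>\<phi> s\<bar>"])
  show "integrable (sm f) (\<lambda>s. \<bar>\<phi> s\<bar>)" using assms by simp
  show "AE x in sm f. (\<lambda>N. trunc \<phi> N x) \<longlonglongrightarrow> \<phi> x" using trunc_lim[of \<phi>] by simp
  show "AE x in sm f. norm (trunc \<phi> N x) \<le> \<bar>\<phi> x\<bar>" for N by (auto simp: indicator_def)
qed (measurable)

lemma integrable_sm_fc:
  assumes "bounded_borel \<theta>" "f \<in> H" and [measurable]: "\<psi> \<in> borel_measurable borel"
  shows "integrable (sm (fc \<theta> f)) \<psi> \<longleftrightarrow> integrable (sm f) (\<lambda>s. (\<theta> s)\<^sup>2 * \<psi> s)"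
    and "(\<integral>s. \<psi> s \<partial>sm (fc \<theta> f)) = (\<integral>s. (\<theta> s)\<^sup>2 * \<psi> s \<partial>sm f)"
proof -
  have [measurable]: "\<theta> \<in> borel_measurable borel" using assms(1) by (rule bounded_borel_meas)
  show "integrable (sm (fc \<theta> f)) \<psi> \<longleftrightarrow> integrable (sm f) (\<lambda>s. (\<theta> s)\<^sup>2 * \<psi> s)"
    unfolding sm_fc[OF assms(1,2)] by (subst integrable_real_density) auto
  show "(\<integral>s. \<psi> s \<partial>sm (fc \<theta> f)) = (\<integral>s. (\<theta> s)\<^sup>2 * \<psi> s \<partial>sm f)"
    unfolding sm_fc[OF assms(1,2)] by (subst integral_real_density) auto
qed

text \<open>For the truncated symbols the identity is \<open>fc_mult\<close>. One side converges by
  dominated convergence for the two polarized measures, where \<open>\<phi>\<close> itself is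
  integrable because \<open>\<phi>\<^sup>2\<close> is and the measures are finite; the other
  converges because \<open>\<phi> * \<theta>\<close> is bounded.\<close>

lemma spectral_integral_fc:
  assumes \<theta>: "bounded_borel \<theta>" and m [measurable]: "\<phi> \<in> borel_measurable borel"
    and b: "bounded_borel (\<lambda>s. \<phi> s * \<theta> s)" and f: "f \<in> H"
  shows "(fc \<theta> f, fc (\<lambda>s. \<phi> s * \<theta> s) f) \<in> spectral_integral \<mu> Q \<phi>"
proof -
  let ?p = "fc \<theta> f"
  have p: "?p \<in> H" using fc_H[OF \<theta> f] .
  have dom: "integrable (sm ?p) (\<lambda>s. (\<phi> s)\<^sup>2)"
  proof -
    have "integrable (sm f) (\<lambda>s. (\<phi> s * \<theta> s) * (\<phi> s * \<theta> s))"
      by (intro integrable_sm f bounded_borel_mult b)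
    then have "integrable (sm f) (\<lambda>s. (\<theta> s)\<^sup>2 * (\<phi> s)\<^sup>2)" by (simp add: power2_eq_square mult_ac)
    then show ?thesis by (subst integrable_sm_fc(1)[OF \<theta> f]) auto
  qed
  have main: "ip (fc (\<lambda>s. \<phi> s * \<theta> s) f) h =
      ((\<integral>s. \<phi> s \<partial>sm (\<lambda>x. ?p x + h x)) - (\<integral>s. \<phi> s \<partial>sm (\<lambda>x. ?p x - h x))) / 4"
    if h: "h \<in> H" and ih: "integrable (sm h) (\<lambda>s. (\<phi> s)\<^sup>2)" for h
  proof -
    have i1: "integrable (sm (\<lambda>x. ?p x + h x)) \<phi>"
      by (rule integrable_sm_sq[OF H_add[OF p h] m spectral_dom_add[OF m p dom h ih]])
    have i2: "integrable (sm (\<lambda>x. ?p x - h x)) \<phi>"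
      by (rule integrable_sm_sq[OF H_diff[OF p h] m spectral_dom_diff[OF m p dom h ih]])
    have l1: "(\<lambda>N. S (trunc \<phi> N) ?p h) \<longlonglongrightarrow>
      ((\<integral>s. \<phi> s \<partial>sm (\<lambda>x. ?p x + h x)) - (\<integral>s. \<phi> s \<partial>sm (\<lambda>x. ?p x - h x))) / 4"
      unfolding S_def
      by (intro tendsto_divide tendsto_diff tendsto_const trunc_integral_lim[OF m H_add[OF p h] i1] trunc_integral_lim[OF m H_diff[OF p h] i2]) simp
    have eq: "S (trunc \<phi> N) ?p h = ip (fc (\<lambda>s. trunc \<phi> N s * \<theta> s) f) h" for N
      using fc_mult[OF bounded_borel_trunc[OF m] \<theta> f h] fc_ip[OF bounded_borel_trunc[OF m] p h] by simp
    have "(\<lambda>N. ip (fc (\<lambda>s. trunc \<phi> N s * \<theta> s) f) h) \<longlonglongrightarrow> ip (fc (\<lambda>s. \<phi> s * \<theta> s) f) h"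
    proof -
      obtain c where c: "0 < c" "\<And>s. \<bar>\<phi> s * \<theta> s\<bar> \<le> c" using bounded_borel_ex[OF b] by blast
      show ?thesis
      proof (rule fc_lim_weak[OF f h _ _ _ b])
        show "bounded_borel (\<lambda>s. trunc \<phi> N s * \<theta> s)" for N
          by (intro bounded_borel_mult bounded_borel_trunc[OF m] \<theta>)
        show "\<bar>trunc \<phi> N s * \<theta> s\<bar> \<le> c" for N s using c(1) c(2)[of s] by (auto simp: indicator_def)
        show "(\<lambda>N. trunc \<phi> N s * \<theta> s) \<longlonglongrightarrow> \<phi> s * \<theta> s" for s
          by (intro tendsto_mult trunc_lim tendsto_const)
      qed
    qed
    then have "(\<lambda>N. S (trunc \<phi> N) ?p h) \<longlonglongrightarrow> ip (fc (\<lambda>s. \<phi> s * \<theta> s) f) h" by (simp only: eq)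
    from LIMSEQ_unique[OF this l1] show ?thesis .
  qed
  show ?thesis
    unfolding spectral_integral_def using p f dom fc_H[OF b f] main by auto
qed

lemma ip_fc_tail:
  assumes "f \<in> H" and m [measurable]: "\<phi> \<in> borel_measurable borel"
  shows "L2_lim (\<lambda>N. fc (indicator {s. \<bar>\<phi> s\<bar> \<le> real N}) f) f"
proof -
  let ?B = "\<lambda>N. {s. \<bar>\<phi> s\<bar> \<le> real N}"
  have B: "?B N \<in> sets borel" for N by measurable
  note bb = bounded_borel_indicator[OF B]
  have lim: "(\<lambda>N. indicator (?B N) s :: real) \<longlonglongrightarrow> 1" for s
  proof (rule tendsto_eventually)
    obtain N where "\<bar>\<phi> s\<bar> \<le> real N" using real_arch_simple by blast
    then have "\<forall>n\<ge>N. indicator (?B n) s = (1 :: real)" by (auto simp: indicator_def)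
    then show "\<forall>\<^sub>F n in sequentially. indicator (?B n) s = (1 :: real)" by (auto simp: eventually_sequentially)
  qed
  have eq: "ip (\<lambda>x. fc (indicator (?B N)) f x - f x) (\<lambda>x. fc (indicator (?B N)) f x - f x) =
     ip f f - (\<integral>s. indicator (?B N) s \<partial>sm f)" for N
  proof -
    have "(\<lambda>s. indicator (?B N) s * indicator (?B N) s) = (indicator (?B N) :: real \<Rightarrow> real)"
      by (auto simp: indicator_def)
    then have "ip (fc (indicator (?B N)) f) (fc (indicator (?B N)) f) = (\<integral>s. indicator (?B N) s \<partial>sm f)"
      using fc_prod[OF bb bb assms(1), of N N] by simp
    then show ?thesis
      using fc_quad[OF bb assms(1), of N] by (simp add: ip_expand_diff fc_H bb assms(1))
  qed
  have "(\<lambda>N. ip f f - (\<integral>s. indicator (?B N) s \<partial>sm f)) \<longlonglongrightarrow> ip f f - (\<integral>s. 1 \<partial>sm f)"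
    by (intro tendsto_intros integral_sm_lim[OF assms(1) bb, of _ 1] lim) (auto simp: indicator_def)
  then have "(\<lambda>N. ip f f - (\<integral>s. indicator (?B N) s \<partial>sm f)) \<longlonglongrightarrow> 0"
    using measure_sm_UNIV[OF assms(1)] by simp
  then show ?thesis unfolding L2_lim_def eq using assms(1) fc_H[OF bb] by auto
qed

text \<open>Only inner products of \<open>g\<close> with domain vectors are prescribed. Testing with
  vectors compressed to the set where \<open>\<bar>\<phi>\<bar> \<le> N\<close> identifies the
  compression of \<open>g\<close> as \<open>fc\<close> of the truncated symbol, whose norm is known;
  then \<open>N\<close> tends to infinity.\<close>

lemma spectral_integral_norm:
  assumes m [measurable]: "\<phi> \<in> borel_measurable borel" and fg: "(f, g) \<in> spectral_integral \<mu> Q \<phi>"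
  shows "ip g g = (\<integral>s. (\<phi> s)\<^sup>2 \<partial>sm f)"
proof -
  let ?B = "\<lambda>N. {s. \<bar>\<phi> s\<bar> \<le> real N}"
  have f: "f \<in> H" and g: "g \<in> H" and dom: "integrable (sm f) (\<lambda>s. (\<phi> s)\<^sup>2)"
    and rep: "\<And>h. h \<in> H \<Longrightarrow> integrable (sm h) (\<lambda>s. (\<phi> s)\<^sup>2) \<Longrightarrow> ip g h =
      ((\<integral>s. \<phi> s \<partial>sm (\<lambda>x. f x + h x)) - (\<integral>s. \<phi> s \<partial>sm (\<lambda>x. f x - h x))) / 4"
    using fg by (auto simp: spectral_integral_def)
  have B: "?B N \<in> sets borel" for N by measurable
  note bb = bounded_borel_indicator[OF B]
  have bt: "bounded_borel (\<lambda>s. \<phi> s * indicator (?B N) s)" for N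
    using bounded_borel_trunc[OF m, of N] by (simp add: mult.commute)
  have eq: "ip (fc (indicator (?B N)) g) (fc (indicator (?B N)) g) = (\<integral>s. (trunc \<phi> N s)\<^sup>2 \<partial>sm f)" for N
  proof -
    have weak: "ip (fc (indicator (?B N)) g) h = ip (fc (\<lambda>s. \<phi> s * indicator (?B N) s) f) h" if h: "h \<in> H" for h
    proof -
      let ?p = "fc (indicator (?B N)) h"
      have p: "?p \<in> H" using fc_H[OF bb h] .
      from spectral_integral_fc[OF bb m bt h]
      have mem: "(?p, fc (\<lambda>s. \<phi> s * indicator (?B N) s) h) \<in> spectral_integral \<mu> Q \<phi>" .
      then have "ip (fc (\<lambda>s. \<phi> s * indicator (?B N) s) h) f =
        ((\<integral>s. \<phi> s \<partial>sm (\<lambda>x. ?p x + f x)) - (\<integral>s. \<phi> s \<partial>sm (\<lambda>x. ?p x - f x))) / 4"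
        using f dom by (auto simp: spectral_integral_def)
      moreover have "ip g ?p = ((\<integral>s. \<phi> s \<partial>sm (\<lambda>x. f x + ?p x)) - (\<integral>s. \<phi> s \<partial>sm (\<lambda>x. f x - ?p x))) / 4"
        using mem by (intro rep[OF p]) (auto simp: spectral_integral_def)
      moreover have "sm (\<lambda>x. ?p x - f x) = sm (\<lambda>x. f x - ?p x)"
        using sm_uminus[OF H_diff[OF f p]] by simp
      ultimately have "ip g ?p = ip (fc (\<lambda>s. \<phi> s * indicator (?B N) s) h) f" by (simp add: add.commute)
      also have "\<dots> = ip (fc (\<lambda>s. \<phi> s * indicator (?B N) s) f) h"
        using fc_sym[OF bt h f] by (simp add: ip_comm)
      finally show ?thesis using fc_sym[OF bb g h] by simp
    qed
    have "AE x in \<mu>. fc (indicator (?B N)) g x = fc (\<lambda>s. \<phi> s * indicator (?B N) s) f x"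
      by (rule ip_eqI[OF fc_H[OF bb g] fc_H[OF bt f] weak])
    then have "ip (fc (indicator (?B N)) g) (fc (indicator (?B N)) g) =
      ip (fc (\<lambda>s. \<phi> s * indicator (?B N) s) f) (fc (\<lambda>s. \<phi> s * indicator (?B N) s) f)"
      by (intro ip_cong) (auto intro!: H_meas fc_H bb bt f g)
    then show ?thesis unfolding fc_prod[OF bt bt f] by (simp add: power2_eq_square mult_ac)
  qed
  have "(\<lambda>N. ip (fc (indicator (?B N)) g) (fc (indicator (?B N)) g)) \<longlonglongrightarrow> ip g g"
    by (rule L2_lim_ip[OF ip_fc_tail[OF g m] ip_fc_tail[OF g m]])
  moreover have "(\<lambda>N. \<integral>s. (trunc \<phi> N s)\<^sup>2 \<partial>sm f) \<longlonglongrightarrow> (\<integral>s. (\<phi> s)\<^sup>2 \<partial>sm f)"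
  proof (rule integral_dominated_convergence[where w="\<lambda>s. (\<phi> s)\<^sup>2"])
    show "AE x in sm f. (\<lambda>N. (trunc \<phi> N x)\<^sup>2) \<longlonglongrightarrow> (\<phi> x)\<^sup>2"
      by (rule AE_I2) (rule tendsto_power[OF trunc_lim])
    show "AE x in sm f. norm ((trunc \<phi> N x)\<^sup>2) \<le> (\<phi> x)\<^sup>2" for N by (auto simp: indicator_def)
    show "(\<lambda>s. (trunc \<phi> N s)\<^sup>2) \<in> borel_measurable (sm f)" for N by measurable
  qed (use dom in measurable)
  ultimately show ?thesis unfolding eq using LIMSEQ_unique by blast
qed

lemma fc_lim_strong:
  assumes f: "f \<in> H" and b: "\<And>n. bounded_borel (u n)" "bounded_borel \<phi>"
    and c: "\<And>n s. \<bar>u n s\<bar> \<le> c" and l: "\<And>s. (\<lambda>n. u n s) \<longlonglongrightarrow> \<phi> s"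
  shows "L2_lim (\<lambda>n. fc (u n) f) (fc \<phi> f)"
proof -
  have bd: "bounded_borel (\<lambda>s. u n s - \<phi> s)" for n using bounded_borel_lin[OF b, of 1 n "-1"] by simp
  have "ip (\<lambda>x. fc (u n) f x - fc \<phi> f x) (\<lambda>x. fc (u n) f x - fc \<phi> f x) =
    (\<integral>s. (u n s - \<phi> s) * (u n s - \<phi> s) \<partial>sm f)" for n
  proof -
    have "AE x in \<mu>. fc (\<lambda>s. u n s - \<phi> s) f x = fc (u n) f x - fc \<phi> f x"
      using fc_symbol_lin[OF b f, of 1 n "-1"] by simp
    then have "ip (\<lambda>x. fc (u n) f x - fc \<phi> f x) (\<lambda>x. fc (u n) f x - fc \<phi> f x) =
      ip (fc (\<lambda>s. u n s - \<phi> s) f) (fc (\<lambda>s. u n s - \<phi> s) f)"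
      by (intro ip_cong) (auto intro!: H_meas H_diff fc_H bd b f)
    then show ?thesis using fc_prod[OF bd bd f, of n n] by simp
  qed
  moreover have "(\<lambda>n. \<integral>s. (u n s - \<phi> s) * (u n s - \<phi> s) \<partial>sm f) \<longlonglongrightarrow> (\<integral>s. (\<phi> s - \<phi> s) * (\<phi> s - \<phi> s) \<partial>sm f)"
  proof (rule integral_sm_lim[OF f])
    show "bounded_borel (\<lambda>s. (u n s - \<phi> s) * (u n s - \<phi> s))" for n
      using bounded_borel_mult[OF bd bd, of n n] by simp
    have \<phi>c: "\<bar>\<phi> s\<bar> \<le> c" for s by (rule LIMSEQ_le_const2[OF tendsto_rabs[OF l]]) (use c in auto)
    show "\<bar>(u n s - \<phi> s) * (u n s - \<phi> s)\<bar> \<le> (2 * c) * (2 * c)" for n s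
    proof -
      have "\<bar>u n s - \<phi> s\<bar> \<le> 2 * c" using c[of n s] \<phi>c[of s] by linarith
      then show ?thesis unfolding abs_mult by (intro mult_mono) auto
    qed
    show "(\<lambda>n. (u n s - \<phi> s) * (u n s - \<phi> s)) \<longlonglongrightarrow> (\<phi> s - \<phi> s) * (\<phi> s - \<phi> s)" for s
      by (intro tendsto_intros l)
  qed
  ultimately show ?thesis using fc_H[OF b(1) f] fc_H[OF b(2) f] by (simp add: L2_lim_def)
qed

end

section \<open>The form and its resolvent\<close>

locale dirichlet_setting = l2_setting \<mu> for \<mu> :: "'a::polish_space measure" +
  fixes L :: "'a op_graph"
  assumes hyp_H: "hyp_H \<mu> L"
begin

text \<open>The same choice as in \<open>functional_calculus\<close>, so that square root and heat
  operator are integrals against this one resolution.\<close>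

definition Qr where "Qr = (SOME Q. spectral_resolution \<mu> L Q)"

abbreviation "\<F> \<equiv> form_dom \<mu> L"
abbreviation "\<E> \<equiv> op_form \<mu> L"

lemma sym_form: "symmetric_form \<mu> \<F> \<E>" and closed: "closed_form \<mu> \<F> \<E>"
  and markov: "markovian_form \<F> \<E>"
  using hyp_H by (auto simp: hyp_H_def dirichlet_form_def)

lemma F_zero: "(\<lambda>_. 0) \<in> \<F>"
  using sym_form by (simp add: symmetric_form_def lin_subspace_def)

text \<open>Without a spectral resolution the form domain would be empty.\<close>

lemma resolution_exists: "\<exists>Q. spectral_resolution \<mu> L Q"
proof (rule ccontr)
  assume "\<not> ?thesis"
  then have "\<F> = {}" unfolding form_dom_def sqrt_op_def functional_calculus_def by (simp only: if_False Domain_empty)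
  then show False using F_zero by auto
qed

lemma spectral_resolution_Qr: "spectral_resolution \<mu> L Qr"
  unfolding Qr_def using resolution_exists by (rule someI_ex)

sublocale pvm_setting \<mu> Qr
  by unfold_locales (use spectral_resolution_Qr in \<open>simp add: spectral_resolution_def\<close>)

lemma functional_calculus_Qr: "functional_calculus \<mu> L \<phi> = spectral_integral \<mu> Qr \<phi>"
  using resolution_exists by (simp add: functional_calculus_def Qr_def)

lemma F_H: "f \<in> \<F> \<Longrightarrow> f \<in> H"
  using sym_form by (auto simp: symmetric_form_def)

lemma F_meas: "f \<in> \<F> \<Longrightarrow> f \<in> borel_measurable \<mu>"
  by (rule H_meas[OF F_H])

lemma F_lin: "f \<in> \<F> \<Longrightarrow> g \<in> \<F> \<Longrightarrow> (\<lambda>x. a * f x + b * g x) \<in> \<F>"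
  using sym_form by (simp add: symmetric_form_def lin_subspace_def)

lemma F_add: "f \<in> \<F> \<Longrightarrow> g \<in> \<F> \<Longrightarrow> (\<lambda>x. f x + g x) \<in> \<F>"
  using F_lin[of f g 1 1] by simp

lemma F_diff: "f \<in> \<F> \<Longrightarrow> g \<in> \<F> \<Longrightarrow> (\<lambda>x. f x - g x) \<in> \<F>"
  using F_lin[of f g 1 "-1"] by simp

lemma F_cmult: "f \<in> \<F> \<Longrightarrow> (\<lambda>x. a * f x) \<in> \<F>"
  using F_lin[of f f a 0] by simp

lemma F_cong: "f \<in> \<F> \<Longrightarrow> g \<in> borel_measurable \<mu> \<Longrightarrow> AE x in \<mu>. f x = g x \<Longrightarrow> g \<in> \<F>"
  using sym_form unfolding symmetric_form_def ae_eq_def by blast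

lemma E_sym: "f \<in> \<F> \<Longrightarrow> g \<in> \<F> \<Longrightarrow> \<E> f g = \<E> g f"
  using sym_form by (simp add: symmetric_form_def)

lemma E_cong: "f \<in> \<F> \<Longrightarrow> g \<in> borel_measurable \<mu> \<Longrightarrow> AE x in \<mu>. f x = g x \<Longrightarrow> h \<in> \<F> \<Longrightarrow> \<E> g h = \<E> f h"
  using sym_form unfolding symmetric_form_def ae_eq_def by blast

lemma E_cong_self:
  assumes "f \<in> \<F>" "g \<in> borel_measurable \<mu>" "AE x in \<mu>. f x = g x" shows "\<E> g g = \<E> f f"
proof -
  have g: "g \<in> \<F>" using F_cong assms by blast
  have "\<E> g g = \<E> f g" using E_cong assms g by blast
  also have "\<dots> = \<E> g f" using E_sym assms g by blast
  also have "\<dots> = \<E> f f" using E_cong assms by blast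
  finally show ?thesis .
qed

lemma E_lin: "f \<in> \<F> \<Longrightarrow> g \<in> \<F> \<Longrightarrow> h \<in> \<F> \<Longrightarrow> \<E> (\<lambda>x. a * f x + b * g x) h = a * \<E> f h + b * \<E> g h"
  using sym_form by (simp add: symmetric_form_def)

lemma E_add: "f \<in> \<F> \<Longrightarrow> g \<in> \<F> \<Longrightarrow> h \<in> \<F> \<Longrightarrow> \<E> (\<lambda>x. f x + g x) h = \<E> f h + \<E> g h"
  using E_lin[of f g h 1 1] by simp

lemma E_diff: "f \<in> \<F> \<Longrightarrow> g \<in> \<F> \<Longrightarrow> h \<in> \<F> \<Longrightarrow> \<E> (\<lambda>x. f x - g x) h = \<E> f h - \<E> g h"
  using E_lin[of f g h 1 "-1"] by simp

lemma E_cmult: "f \<in> \<F> \<Longrightarrow> h \<in> \<F> \<Longrightarrow> \<E> (\<lambda>x. a * f x) h = a * \<E> f h"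
  using E_lin[of f f h a 0] by simp

lemma E_add_r: "f \<in> \<F> \<Longrightarrow> g \<in> \<F> \<Longrightarrow> h \<in> \<F> \<Longrightarrow> \<E> h (\<lambda>x. f x + g x) = \<E> h f + \<E> h g"
  using E_add[of f g h] E_sym[of h f] E_sym[of h g] E_sym[of h "\<lambda>x. f x + g x"] by (simp add: F_add)

lemma E_diff_r: "f \<in> \<F> \<Longrightarrow> g \<in> \<F> \<Longrightarrow> h \<in> \<F> \<Longrightarrow> \<E> h (\<lambda>x. f x - g x) = \<E> h f - \<E> h g"
  using E_diff[of f g h] E_sym[of h f] E_sym[of h g] E_sym[of h "\<lambda>x. f x - g x"] by (simp add: F_diff)

lemma E_cmult_r: "f \<in> \<F> \<Longrightarrow> h \<in> \<F> \<Longrightarrow> \<E> h (\<lambda>x. a * f x) = a * \<E> h f"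
  using E_cmult[of f h] E_sym[of h f] E_sym[of h "\<lambda>x. a * f x"] by (simp add: F_cmult)

lemma E_pos: "f \<in> \<F> \<Longrightarrow> 0 \<le> \<E> f f"
  using sym_form by (simp add: symmetric_form_def)

lemma E_expand_add: "f \<in> \<F> \<Longrightarrow> g \<in> \<F> \<Longrightarrow>
  \<E> (\<lambda>x. f x + g x) (\<lambda>x. f x + g x) = \<E> f f + 2 * \<E> f g + \<E> g g"
  by (simp add: E_add E_add_r F_add E_sym[of g f])

lemma E_expand_diff: "f \<in> \<F> \<Longrightarrow> g \<in> \<F> \<Longrightarrow>
  \<E> (\<lambda>x. f x - g x) (\<lambda>x. f x - g x) = \<E> f f - 2 * \<E> f g + \<E> g g"
  by (simp add: E_diff E_diff_r F_diff E_sym[of g f])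

lemma E_triangle_diff: "f \<in> \<F> \<Longrightarrow> g \<in> \<F> \<Longrightarrow>
  \<E> (\<lambda>x. f x - g x) (\<lambda>x. f x - g x) \<le> 2 * \<E> f f + 2 * \<E> g g"
  using E_pos[OF F_add, of f g] by (simp add: E_expand_add E_expand_diff)

lemma sqrt_apply: "f \<in> \<F> \<Longrightarrow> (f, op_apply (sqrt_op \<mu> L) f) \<in> spectral_integral \<mu> Qr sqrt"
  unfolding form_dom_def op_apply_def sqrt_op_def functional_calculus_Qr
  by (erule DomainE) (rule someI[of "\<lambda>g. (f, g) \<in> spectral_integral \<mu> Qr sqrt"])

lemma E_CS: assumes "f \<in> \<F>" "g \<in> \<F>" shows "(\<E> f g)\<^sup>2 \<le> \<E> f f * \<E> g g"
  unfolding op_form_def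
  using sqrt_apply[OF assms(1)] sqrt_apply[OF assms(2)] by (intro ip_CS_sq) (auto simp: spectral_integral_def)

lemma E_self_abs:
  assumes "f \<in> \<F>"
  shows "integrable (sm f) (\<lambda>s. \<bar>s\<bar>)" "\<E> f f = (\<integral>s. \<bar>s\<bar> \<partial>sm f)"
proof -
  \<comment> \<open>\<open>sqrt\<close> is an odd function in HOL, which produces the absolute value
    on the negative axis until \<open>sm_nonneg\<close> excludes that half line.\<close>
  have eq: "(\<lambda>s. (sqrt s)\<^sup>2) = (\<lambda>s::real. \<bar>s\<bar>)" by (rule ext) (simp add: real_sqrt_power[symmetric])
  have m: "sqrt \<in> borel_measurable borel" by (intro borel_measurable_continuous_onI continuous_intros)
  show "integrable (sm f) (\<lambda>s. \<bar>s\<bar>)"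
    using sqrt_apply[OF assms] unfolding spectral_integral_def eq[symmetric] by auto
  show "\<E> f f = (\<integral>s. \<bar>s\<bar> \<partial>sm f)"
    using spectral_integral_norm[OF m sqrt_apply[OF assms]] by (simp add: op_form_def eq)
qed

text \<open>For the spectral piece of \<open>f\<close> in \<open>[- N, 0)\<close>, nonnegativity of
  \<open>L\<close> says that the integral of \<open>s\<close> over that interval is nonnegative,
  although the integrand is negative there.\<close>

lemma sm_nonneg: assumes "f \<in> H" shows "AE s in sm f. 0 \<le> s"
proof -
  have "AE s in sm f. \<not> (- real N \<le> s \<and> s < 0)" for N :: nat
  proof -
    define B where "B = {- real N..<0}"
    have B: "B \<in> sets borel" by (simp add: B_def)
    note bb = bounded_borel_indicator[OF B]
    have bs: "bounded_borel (\<lambda>s. s * indicator B s)"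
      by (rule bounded_borelI[of _ "real N"]) (auto simp: B_def indicator_def)
    have "(fc (indicator B) f, fc (\<lambda>s. s * indicator B s) f) \<in> L"
      using spectral_integral_fc[OF bb _ bs assms] spectral_resolution_Qr
      by (simp add: spectral_resolution_def)
    then have "0 \<le> ip (fc (\<lambda>s. s * indicator B s) f) (fc (indicator B) f)"
      using hyp_H by (auto simp: hyp_H_def nonneg_op_def)
    also have "\<dots> = (\<integral>s. s * indicator B s * indicator B s \<partial>sm f)" by (rule fc_prod[OF bs bb assms])
    also have "\<dots> = (\<integral>s. s * indicator B s \<partial>sm f)"
      by (intro Bochner_Integration.integral_cong) (auto simp: indicator_def)
    finally have "(\<integral>s. - (s * indicator B s) \<partial>sm f) \<le> 0" by simp
    moreover have "0 \<le> (\<integral>s. - (s * indicator B s) \<partial>sm f)"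
      by (intro integral_nonneg_AE) (auto simp: B_def indicator_def)
    moreover have "integrable (sm f) (\<lambda>s. - (s * indicator B s))"
      using integrable_sm[OF assms bs] by simp
    ultimately have "AE s in sm f. - (s * indicator B s) = 0"
      by (subst integral_nonneg_eq_0_iff_AE[symmetric]) (auto simp: B_def indicator_def)
    then show ?thesis by eventually_elim (auto simp: B_def indicator_def)
  qed
  then have "AE s in sm f. \<forall>N::nat. \<not> (- real N \<le> s \<and> s < 0)" unfolding AE_all_countable by blast
  then show ?thesis
  proof eventually_elim
    case (elim s)
    obtain N :: nat where "- s \<le> real N" using real_arch_simple by blast
    then show ?case using elim[rule_format, of N] by linarith
  qed
qed

lemma E_self: 
  assumes "f \<in> \<F>"
  shows "integrable (sm f) (\<lambda>s. max 0 s)" "\<E> f f = (\<integral>s. max 0 s \<partial>sm f)"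
proof -
  have ae: "AE s in sm f. \<bar>s\<bar> = max 0 s" using sm_nonneg[OF F_H[OF assms]] by eventually_elim auto
  show "integrable (sm f) (\<lambda>s. max 0 s)"
    using E_self_abs(1)[OF assms] integrable_cong_AE[OF _ _ ae] by simp
  show "\<E> f f = (\<integral>s. max 0 s \<partial>sm f)"
    unfolding E_self_abs(2)[OF assms] by (rule integral_cong_AE) (use ae in auto)
qed

lemma fc_F:
  assumes "bounded_borel \<theta>" "bounded_borel (\<lambda>s. sqrt s * \<theta> s)" "f \<in> H"
  shows "fc \<theta> f \<in> \<F>"
proof -
  have "sqrt \<in> borel_measurable borel" by (intro borel_measurable_continuous_onI continuous_intros)
  from spectral_integral_fc[OF assms(1) this assms(2,3)]
  show ?thesis unfolding form_dom_def sqrt_op_def functional_calculus_Qr by auto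
qed

text \<open>The form domain is the domain of a graph, so a value of the square root has to exist.
  Closedness of the form provides it: the spectral truncations of \<open>f\<close> are Cauchy in the
  energy norm and converge to \<open>f\<close> in L2.\<close>

lemma F_I:
  assumes f: "f \<in> H" and i: "integrable (sm f) (\<lambda>s. max 0 s)"
  shows "f \<in> \<F>"
proof -
  define B where "B = (\<lambda>N::nat. {s::real. \<bar>s\<bar> \<le> real N})"
  define u where "u = (\<lambda>N. fc (indicator (B N)) f)"
  have B [measurable]: "B N \<in> sets borel" for N by (simp add: B_def)
  note bb = bounded_borel_indicator[OF B]
  have uF: "u N \<in> \<F>" for N
    unfolding u_def
  proof (rule fc_F[OF bb _ f])
    have [measurable]: "sqrt \<in> borel_measurable borel" by (intro borel_measurable_continuous_onI continuous_intros)
    have "\<bar>sqrt s * indicator (B N) s\<bar> \<le> sqrt (real N)" for s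
      by (auto simp: B_def indicator_def abs_le_iff real_sqrt_minus[symmetric] simp del: real_sqrt_minus)
    then show "bounded_borel (\<lambda>s. sqrt s * indicator (B N) s)" by (intro bounded_borelI) measurable
  qed
  have uH: "u N \<in> H" for N by (rule F_H[OF uF])
  have ulim: "L2_lim u f" unfolding u_def B_def using ip_fc_tail[OF f, of "\<lambda>s. s"] by simp
  interpret finite_measure "sm f" using f finite_measure_sm by auto
  have i1: "integrable (sm f) (\<lambda>s. max 0 s + 1)" using i by simp
  \<comment> \<open>Tail integral that dominates the energy norm of \<open>u m - u n\<close> for all
    \<open>m\<close>, \<open>n\<close> beyond \<open>N\<close>.\<close>
  define T where "T = (\<lambda>N. \<integral>s. (max 0 s + 1) * indicator (- B N) s \<partial>sm f)"
  have "T \<longlonglongrightarrow> (\<integral>s. 0 \<partial>sm f)"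
    unfolding T_def
  proof (rule integral_dominated_convergence[OF _ _ i1])
    show "AE s in sm f. (\<lambda>N. (max 0 s + 1) * indicator (- B N) s) \<longlonglongrightarrow> 0"
    proof (rule AE_I2, rule tendsto_eventually)
      fix s :: real
      obtain N where "\<bar>s\<bar> \<le> real N" using real_arch_simple by blast
      then have "\<forall>n\<ge>N. (max 0 s + 1) * indicator (- B n) s = 0" by (auto simp: B_def indicator_def)
      then show "\<forall>\<^sub>F n in sequentially. (max 0 s + 1) * indicator (- B n) s = 0" by (auto simp: eventually_sequentially)
    qed
    show "AE s in sm f. norm ((max 0 s + 1) * indicator (- B N) s) \<le> max 0 s + 1" for N
      by (auto simp: indicator_def)
  qed measurable
  then have T0: "T \<longlonglongrightarrow> 0" by simp
  have bound: "form_energy1 \<mu> \<E> (\<lambda>x. u m x - u n x) \<le> T N" if "m \<ge> N" "n \<ge> N" for m n N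
  proof -
    define \<psi> where "\<psi> = (\<lambda>s. indicator (B m) s - indicator (B n) s :: real)"
    have bp: "bounded_borel \<psi>" using bounded_borel_lin[OF bb bb, of 1 m "-1" n] by (simp add: \<psi>_def)
    have bpp: "bounded_borel (\<lambda>s. \<psi> s * \<psi> s)" by (intro bounded_borel_mult bp)
    have [measurable]: "\<psi> \<in> borel_measurable borel" using bp by (rule bounded_borel_meas)
    have ae: "AE x in \<mu>. fc \<psi> f x = u m x - u n x"
      using fc_symbol_lin[OF bb bb f, of 1 m "-1" n] by (simp add: \<psi>_def u_def)
    have d: "(\<lambda>x. u m x - u n x) \<in> \<F>" by (intro F_diff uF)
    have psi: "fc \<psi> f \<in> \<F>"
      by (rule F_cong[OF d H_meas[OF fc_H[OF bp f]]]) (use ae in \<open>auto elim: eventually_mono\<close>)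
    have "\<E> (\<lambda>x. u m x - u n x) (\<lambda>x. u m x - u n x) = \<E> (fc \<psi> f) (fc \<psi> f)"
      by (rule E_cong_self[OF psi F_meas[OF d] ae])
    also have "\<dots> = (\<integral>s. (\<psi> s)\<^sup>2 * max 0 s \<partial>sm f)"
      unfolding E_self(2)[OF psi] by (rule integrable_sm_fc(2)[OF bp f]) simp
    finally have E1: "\<E> (\<lambda>x. u m x - u n x) (\<lambda>x. u m x - u n x) = (\<integral>s. (\<psi> s)\<^sup>2 * max 0 s \<partial>sm f)" .
    have i2: "integrable (sm f) (\<lambda>s. (\<psi> s)\<^sup>2 * max 0 s)"
      using E_self(1)[OF psi] integrable_sm_fc(1)[OF bp f, of "\<lambda>s. max 0 s"] by simp
    have i3: "integrable (sm f) (\<lambda>s. (\<psi> s)\<^sup>2)" using integrable_sm[OF f bpp] by (simp add: power2_eq_square)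
    have "(L2_norm \<mu> (\<lambda>x. u m x - u n x))\<^sup>2 = ip (fc \<psi> f) (fc \<psi> f)"
      unfolding L2_norm_sq using ae by (intro ip_cong) (auto intro!: H_meas H_diff uH fc_H[OF bp f])
    also have "\<dots> = (\<integral>s. (\<psi> s)\<^sup>2 \<partial>sm f)" using fc_prod[OF bp bp f] by (simp add: power2_eq_square)
    finally have "form_energy1 \<mu> \<E> (\<lambda>x. u m x - u n x) = (\<integral>s. (\<psi> s)\<^sup>2 * max 0 s + (\<psi> s)\<^sup>2 \<partial>sm f)"
      unfolding form_energy1_def E1 using i2 i3 by simp
    also have "\<dots> \<le> T N"
      unfolding T_def
    proof (rule integral_mono)
      show "integrable (sm f) (\<lambda>s. (\<psi> s)\<^sup>2 * max 0 s + (\<psi> s)\<^sup>2)" using i2 i3 by simp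
      show "integrable (sm f) (\<lambda>s. (max 0 s + 1) * indicator (- B N) s)"
        using i1 by (intro integrable_real_mult_indicator) auto
      show "(\<psi> s)\<^sup>2 * max 0 s + (\<psi> s)\<^sup>2 \<le> (max 0 s + 1) * indicator (- B N) s" for s
        using that by (auto simp: \<psi>_def B_def indicator_def)
    qed
    finally show ?thesis .
  qed
  have "\<exists>N. \<forall>m\<ge>N. \<forall>n\<ge>N. form_energy1 \<mu> \<E> (\<lambda>x. u m x - u n x) < e" if "0 < e" for e
  proof -
    obtain N where "T N < e" using order_tendstoD(2)[OF T0 \<open>0 < e\<close>] by (auto simp: eventually_sequentially)
    then show ?thesis using bound order.strict_trans1 by blast
  qed
  then obtain g where g: "g \<in> \<F>" and lim: "(\<lambda>n. form_energy1 \<mu> \<E> (\<lambda>x. u n x - g x)) \<longlonglongrightarrow> 0"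
    using closed uF unfolding closed_form_def by blast
  have "L2_lim u g"
    unfolding L2_lim_def
  proof (intro conjI allI uH F_H[OF g] Lim_null_comparison[OF _ lim] always_eventually)
    fix n show "norm (ip (\<lambda>x. u n x - g x) (\<lambda>x. u n x - g x)) \<le> form_energy1 \<mu> \<E> (\<lambda>x. u n x - g x)"
      using E_pos[OF F_diff[OF uF g]] by (simp add: form_energy1_def L2_norm_sq)
  qed
  then have "AE x in \<mu>. g x = f x" using L2_lim_unique[OF _ ulim] by blast
  then show ?thesis using F_cong[OF g H_meas[OF f]] by blast
qed

end

section \<open>Resolvents, approximating forms and weak convergence of energies\<close>

context dirichlet_setting
begin

lemma E_lim_trunc:
  assumes "f \<in> \<F>"
  shows "(\<lambda>N::nat. \<integral>s. min (real N) (max 0 s) \<partial>sm f) \<longlonglongrightarrow> \<E> f f"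
  unfolding E_self(2)[OF assms]
proof (rule integral_dominated_convergence[OF _ _ E_self(1)[OF assms]])
  show "AE s in sm f. (\<lambda>N. min (real N) (max 0 s)) \<longlonglongrightarrow> max 0 s"
  proof (rule AE_I2, rule tendsto_eventually)
    fix s :: real
    obtain N where "\<bar>s\<bar> \<le> real N" using real_arch_simple by blast
    then have "\<forall>n\<ge>N. min (real n) (max 0 s) = max 0 s" by auto
    then show "\<forall>\<^sub>F n in sequentially. min (real n) (max 0 s) = max 0 s" by (auto simp: eventually_sequentially)
  qed
qed (auto simp: measurable_cong_sets[OF sets_sm])

text \<open>Formally \<open>\<E> (\<phi>(L) f) g = ip (L \<phi>(L) f) g\<close>, with
  \<open>g\<close> in the form domain only. After polarization the energy is a limit of integrals of
  the clamped symbol \<open>min N (max 0 s)\<close>, to which the bounded calculus applies.\<close>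

lemma E_fc:
  assumes \<phi>: "bounded_borel \<phi>" and b: "bounded_borel (\<lambda>s. max 0 s * \<phi> s)" and f: "f \<in> H"
  shows fc_in_F: "fc \<phi> f \<in> \<F>"
    and E_fc_ip: "g \<in> \<F> \<Longrightarrow> \<E> (fc \<phi> f) g = ip (fc (\<lambda>s. max 0 s * \<phi> s) f) g"
proof -
  let ?p = "fc \<phi> f"
  have p: "?p \<in> H" using fc_H[OF \<phi> f] .
  show pF: "?p \<in> \<F>"
  proof (rule F_I[OF p])
    have "integrable (sm f) (\<lambda>s. (max 0 s * \<phi> s) * \<phi> s)"
      by (intro integrable_sm f bounded_borel_mult[OF b \<phi>])
    then show "integrable (sm ?p) (\<lambda>s. max 0 s)"
      by (subst integrable_sm_fc(1)[OF \<phi> f]) (auto simp: power2_eq_square mult_ac)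
  qed
  assume g: "g \<in> \<F>"
  have bT: "bounded_borel (\<lambda>s. min (real N) (max 0 s))" for N
    by (rule bounded_borelI[of _ "real N"]) auto
  have polar: "\<E> ?p g = (\<E> (\<lambda>x. ?p x + g x) (\<lambda>x. ?p x + g x) - \<E> (\<lambda>x. ?p x - g x) (\<lambda>x. ?p x - g x)) / 4"
    using pF g by (simp add: E_expand_add E_expand_diff)
  have "(\<lambda>N. S (\<lambda>s. min (real N) (max 0 s)) ?p g) \<longlonglongrightarrow>
    (\<E> (\<lambda>x. ?p x + g x) (\<lambda>x. ?p x + g x) - \<E> (\<lambda>x. ?p x - g x) (\<lambda>x. ?p x - g x)) / 4"
    unfolding S_def by (intro tendsto_divide tendsto_diff tendsto_const E_lim_trunc F_add F_diff pF g) simp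
  then have l1: "(\<lambda>N. S (\<lambda>s. min (real N) (max 0 s)) ?p g) \<longlonglongrightarrow> \<E> ?p g" by (simp only: polar)
  have eq: "S (\<lambda>s. min (real N) (max 0 s)) ?p g = ip (fc (\<lambda>s. min (real N) (max 0 s) * \<phi> s) f) g" for N
    using fc_mult[OF bT \<phi> f F_H[OF g], of N] fc_ip[OF bT p F_H[OF g]] by simp
  obtain c where c: "\<And>s. \<bar>max 0 s * \<phi> s\<bar> \<le> c" using bounded_borel_ex[OF b] by blast
  have "(\<lambda>N. ip (fc (\<lambda>s. min (real N) (max 0 s) * \<phi> s) f) g) \<longlonglongrightarrow> ip (fc (\<lambda>s. max 0 s * \<phi> s) f) g"
  proof (rule fc_lim_weak[OF f F_H[OF g] _ _ _ b])
    show "bounded_borel (\<lambda>s. min (real N) (max 0 s) * \<phi> s)" for N by (intro bounded_borel_mult bT \<phi>)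
    show "\<bar>min (real N) (max 0 s) * \<phi> s\<bar> \<le> c" for N s
    proof (rule order_trans[OF _ c[of s]])
      show "\<bar>min (real N) (max 0 s) * \<phi> s\<bar> \<le> \<bar>max 0 s * \<phi> s\<bar>"
        unfolding abs_mult by (rule mult_right_mono) auto
    qed
    show "(\<lambda>N. min (real N) (max 0 s) * \<phi> s) \<longlonglongrightarrow> max 0 s * \<phi> s" for s
    proof (rule tendsto_mult[OF _ tendsto_const], rule tendsto_eventually)
      obtain N where "\<bar>s\<bar> \<le> real N" using real_arch_simple by blast
      then have "\<forall>n\<ge>N. min (real n) (max 0 s) = max 0 s" by auto
      then show "\<forall>\<^sub>F n in sequentially. min (real n) (max 0 s) = max 0 s" by (auto simp: eventually_sequentially)
    qed
  qed
  then have "(\<lambda>N. S (\<lambda>s. min (real N) (max 0 s)) ?p g) \<longlonglongrightarrow> ip (fc (\<lambda>s. max 0 s * \<phi> s) f) g"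
    by (simp only: eq)
  from LIMSEQ_unique[OF l1 this] show "\<E> ?p g = ip (fc (\<lambda>s. max 0 s * \<phi> s) f) g" .
qed

text \<open>Symbol of the resolvent \<open>\<beta> / (\<beta> + L)\<close>. By
  \<open>sm_nonneg\<close> the \<open>max 0\<close> changes it only on null sets of the spectral
  measures, and it makes the symbol bounded on the whole line.\<close>

definition rsym :: "real \<Rightarrow> real \<Rightarrow> real" where
  "rsym \<beta> s = \<beta> / (\<beta> + max 0 s)"

lemma rsym_bounds: "0 < \<beta> \<Longrightarrow> 0 \<le> rsym \<beta> s" "0 < \<beta> \<Longrightarrow> rsym \<beta> s \<le> 1" "0 < \<beta> \<Longrightarrow> \<bar>rsym \<beta> s\<bar> \<le> 1"
  by (auto simp: rsym_def divide_le_eq)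

lemma rsym_meas [measurable]: "rsym \<beta> \<in> borel_measurable borel"
  unfolding rsym_def by measurable

lemma bounded_borel_rsym: "0 < \<beta> \<Longrightarrow> bounded_borel (rsym \<beta>)"
  by (rule bounded_borelI[of _ 1]) (auto simp: rsym_bounds)

lemma rsym_eq: "0 < \<beta> \<Longrightarrow> max 0 s * rsym \<beta> s = \<beta> * 1 + (- \<beta>) * rsym \<beta> s"
  by (simp add: rsym_def field_simps)

lemma bounded_borel_rsym2: "0 < \<beta> \<Longrightarrow> bounded_borel (\<lambda>s. max 0 s * rsym \<beta> s)"
  unfolding rsym_eq by (intro bounded_borel_lin bounded_borel_const bounded_borel_rsym)

definition R :: "real \<Rightarrow> ('a \<Rightarrow> real) \<Rightarrow> ('a \<Rightarrow> real)" where
  "R \<beta> f = fc (rsym \<beta>) f"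

definition Eb :: "real \<Rightarrow> ('a \<Rightarrow> real) \<Rightarrow> ('a \<Rightarrow> real) \<Rightarrow> real" where
  "Eb \<beta> f g = \<beta> * (ip f g - ip (R \<beta> f) g)"

lemma R_H: "0 < \<beta> \<Longrightarrow> f \<in> H \<Longrightarrow> R \<beta> f \<in> H"
  unfolding R_def by (rule fc_H[OF bounded_borel_rsym])

lemma R_sym: "0 < \<beta> \<Longrightarrow> f \<in> H \<Longrightarrow> g \<in> H \<Longrightarrow> ip (R \<beta> f) g = ip f (R \<beta> g)"
  unfolding R_def by (rule fc_sym[OF bounded_borel_rsym])

lemma R_lin: "0 < \<beta> \<Longrightarrow> f \<in> H \<Longrightarrow> g \<in> H \<Longrightarrow>
  AE x in \<mu>. R \<beta> (\<lambda>x. a * f x + b * g x) x = a * R \<beta> f x + b * R \<beta> g x"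
  unfolding R_def by (rule fc_lin[OF bounded_borel_rsym])

lemma fc_one: assumes "f \<in> H" shows "AE x in \<mu>. fc (\<lambda>_. 1) f x = f x"
proof (rule ip_eqI[OF fc_H[OF bounded_borel_const assms] assms])
  fix h assume h: "h \<in> H"
  have 1: "(indicator UNIV :: real \<Rightarrow> real) = (\<lambda>_. 1)" by auto
  have "ip (fc (\<lambda>_. 1) f) h = ip (Qr UNIV f) h"
    using fc_indicator[of UNIV f h] assms h by (simp only: 1) simp
  also have "\<dots> = ip f h"
    using pvm assms h by (intro ip_cong) (auto simp: projection_valued_measure_def ae_eq_def H_meas Q_H)
  finally show "ip (fc (\<lambda>_. 1) f) h = ip f h" .
qed

lemma ip_fc_one: assumes "f \<in> H" "h \<in> H" shows "ip (fc (\<lambda>_. 1) f) h = ip f h"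
  by (rule ip_cong[OF fc_one[OF assms(1)]]) (use assms in \<open>auto intro: H_meas fc_H bounded_borel_const\<close>)

lemma ip_fc_rsym2: assumes "0 < \<beta>" "f \<in> H" "h \<in> H"
  shows "ip (fc (\<lambda>s. max 0 s * rsym \<beta> s) f) h = Eb \<beta> f h"
proof -
  have "ip (fc (\<lambda>s. max 0 s * rsym \<beta> s) f) h = S (\<lambda>s. \<beta> * 1 + (- \<beta>) * rsym \<beta> s) f h"
    using fc_ip[OF bounded_borel_rsym2] assms by (simp only: rsym_eq)
  also have "\<dots> = \<beta> * S (\<lambda>_. 1) f h + (- \<beta>) * S (rsym \<beta>) f h"
    by (rule S_lin[OF assms(2,3) bounded_borel_const bounded_borel_rsym[OF assms(1)]])
  also have "\<dots> = Eb \<beta> f h"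
    using assms by (simp add: Eb_def R_def fc_ip[OF bounded_borel_rsym, symmetric] right_diff_distrib
        fc_ip[OF bounded_borel_const, symmetric] ip_fc_one)
  finally show ?thesis .
qed

lemma R_F: "0 < \<beta> \<Longrightarrow> f \<in> H \<Longrightarrow> R \<beta> f \<in> \<F>"
  unfolding R_def by (rule fc_in_F[OF bounded_borel_rsym bounded_borel_rsym2])

lemma E_R: "0 < \<beta> \<Longrightarrow> f \<in> H \<Longrightarrow> g \<in> \<F> \<Longrightarrow> \<E> (R \<beta> f) g = Eb \<beta> f g"
  unfolding R_def by (simp add: E_fc_ip[OF bounded_borel_rsym bounded_borel_rsym2] ip_fc_rsym2 F_H)

text \<open>\<open>R \<beta> f\<close> minimises
  \<open>\<E> w w + \<beta> * ip (w - f) (w - f)\<close>, with Euler--Lagrange equation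
  \<open>E_R\<close>. Clipping to \<open>[0, 1]\<close> increases neither term when \<open>f\<close>
  has values there, so strict convexity forces the clipping error \<open>d\<close> to
  vanish.\<close>

lemma R_markov01:
  assumes \<beta>: "0 < \<beta>" and f: "f \<in> H" and f01: "AE x in \<mu>. 0 \<le> f x \<and> f x \<le> 1"
  shows "AE x in \<mu>. 0 \<le> R \<beta> f x \<and> R \<beta> f x \<le> 1"
proof -
  define g where "g = R \<beta> f"
  define v where "v = (\<lambda>x. min 1 (max 0 (g x)))"
  define d where "d = (\<lambda>x. v x - g x)"
  have gF: "g \<in> \<F>" using R_F[OF \<beta> f] by (simp add: g_def)
  have vF: "v \<in> \<F>" and vle: "\<E> v v \<le> \<E> g g" using markov gF by (auto simp: markovian_form_def v_def)
  have dF: "d \<in> \<F>" unfolding d_def by (intro F_diff vF gF)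
  have H: "f \<in> H" "g \<in> H" "v \<in> H" "d \<in> H" using F_H gF vF dF f by auto
  have Egd: "\<E> g d = \<beta> * (ip f d - ip g d)" using E_R[OF \<beta> f dF] by (simp add: Eb_def g_def)
  have "\<E> v v = \<E> g g + 2 * \<E> g d + \<E> d d"
    using E_expand_add[OF gF dF] by (simp add: d_def)
  then have 1: "2 * \<beta> * (ip f d - ip g d) + \<E> d d \<le> 0" using vle Egd by simp
  have "ip (\<lambda>x. v x - f x) (\<lambda>x. v x - f x) \<le> ip (\<lambda>x. g x - f x) (\<lambda>x. g x - f x)"
    unfolding ip_self
  proof (rule integral_mono_AE)
    show "AE x in \<mu>. (v x - f x)\<^sup>2 \<le> (g x - f x)\<^sup>2"
      using f01
    proof eventually_elim
      case (elim x)
      then show ?case unfolding abs_le_square_iff[symmetric] v_def by (auto simp: min_def max_def)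
    qed
  qed (use H in \<open>auto intro: H_sq H_diff\<close>)
  moreover have "ip (\<lambda>x. v x - f x) (\<lambda>x. v x - f x) =
      ip (\<lambda>x. g x - f x) (\<lambda>x. g x - f x) + 2 * ip (\<lambda>x. g x - f x) d + ip d d"
    using ip_expand_add[OF H_diff[OF H(2) H(1)] H(4)] by (simp add: d_def)
  moreover have "ip (\<lambda>x. g x - f x) d = ip g d - ip f d" using H by (simp add: ip_diff)
  ultimately have "2 * (ip g d - ip f d) + ip d d \<le> 0" by simp
  then have "\<beta> * (2 * (ip g d - ip f d) + ip d d) \<le> 0" using \<beta> by (simp add: mult_le_0_iff)
  then have "\<beta> * ip d d \<le> 0" using 1 E_pos[OF dF] by (simp add: algebra_simps)
  then have "ip d d = 0" using \<beta> ip_ge0[of d] by (simp add: mult_le_0_iff)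
  then have "AE x in \<mu>. d x = 0" using ip_self_zero H by blast
  then show ?thesis by eventually_elim (auto simp: d_def v_def g_def min_def max_def split: if_splits)
qed

lemma R_pos_le:
  assumes \<beta>: "0 < \<beta>" and f: "f \<in> H" and fM: "AE x in \<mu>. 0 \<le> f x \<and> f x \<le> M" and M: "0 < M"
  shows "AE x in \<mu>. 0 \<le> R \<beta> f x \<and> R \<beta> f x \<le> M"
proof -
  have "AE x in \<mu>. 0 \<le> R \<beta> (\<lambda>x. (1 / M) * f x) x \<and> R \<beta> (\<lambda>x. (1 / M) * f x) x \<le> 1"
    by (rule R_markov01[OF \<beta> H_cmult[OF f]]) (use fM M in \<open>auto simp: divide_le_eq elim: eventually_mono\<close>)
  moreover have "AE x in \<mu>. R \<beta> (\<lambda>x. (1 / M) * f x) x = (1 / M) * R \<beta> f x"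
    using R_lin[OF \<beta> f f, of "1 / M" 0] by simp
  ultimately show ?thesis
  proof eventually_elim
    case (elim x)
    then have "R \<beta> f x = M * R \<beta> (\<lambda>x. (1 / M) * f x) x" using M by simp
    then show ?case using elim M by (simp add: mult_left_le)
  qed
qed

lemma R_bounded:
  assumes \<beta>: "0 < \<beta>" and f: "f \<in> H" and fM: "AE x in \<mu>. \<bar>f x\<bar> \<le> M" and M: "0 < M"
  shows "AE x in \<mu>. \<bar>R \<beta> f x\<bar> \<le> M"
proof -
  let ?p = "\<lambda>x. max 0 (f x)" let ?n = "\<lambda>x. max 0 (- f x)"
  have [measurable]: "f \<in> borel_measurable \<mu>" using f by (rule H_meas)
  have p: "?p \<in> H" and n: "?n \<in> H" by (auto intro!: H_bound[OF f])
  have "AE x in \<mu>. 0 \<le> R \<beta> ?p x \<and> R \<beta> ?p x \<le> M"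
    by (rule R_pos_le[OF \<beta> p _ M]) (use fM M in \<open>auto elim: eventually_mono\<close>)
  moreover have "AE x in \<mu>. 0 \<le> R \<beta> ?n x \<and> R \<beta> ?n x \<le> M"
    by (rule R_pos_le[OF \<beta> n _ M]) (use fM M in \<open>auto elim: eventually_mono\<close>)
  moreover have "AE x in \<mu>. R \<beta> f x = R \<beta> ?p x - R \<beta> ?n x"
  proof -
    have "(\<lambda>x. 1 * ?p x + (-1) * ?n x) = f" by (auto simp: max_def)
    then show ?thesis using R_lin[OF \<beta> p n, of 1 "-1"] by simp
  qed
  ultimately show ?thesis by eventually_elim linarith
qed

lemma Eb_self: assumes "0 < \<beta>" "f \<in> H" shows "Eb \<beta> f f = (\<integral>s. max 0 s * rsym \<beta> s \<partial>sm f)"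
  using ip_fc_rsym2[OF assms(1,2,2)] fc_quad[OF bounded_borel_rsym2 assms(2)] assms by simp

lemma Eb_le_E: assumes "0 < \<beta>" "f \<in> \<F>" shows "Eb \<beta> f f \<le> \<E> f f"
  unfolding Eb_self[OF assms(1) F_H[OF assms(2)]] E_self(2)[OF assms(2)]
proof (rule integral_mono)
  show "integrable (sm f) (\<lambda>s. max 0 s * rsym \<beta> s)" by (rule integrable_sm[OF F_H[OF assms(2)] bounded_borel_rsym2[OF assms(1)]])
  show "max 0 s * rsym \<beta> s \<le> max 0 s" for s
    using rsym_bounds[OF assms(1), of s] by (intro mult_right_le_one_le) auto
qed (rule E_self[OF assms(2)])

lemma Eb_add: "0 < \<beta> \<Longrightarrow> f \<in> H \<Longrightarrow> g \<in> H \<Longrightarrow>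
  Eb \<beta> (\<lambda>x. f x + g x) (\<lambda>x. f x + g x) = Eb \<beta> f f + 2 * Eb \<beta> f g + Eb \<beta> g g"
proof -
  assume a: "0 < \<beta>" "f \<in> H" "g \<in> H"
  have "ip (R \<beta> (\<lambda>x. f x + g x)) h = ip (R \<beta> f) h + ip (R \<beta> g) h" if "h \<in> H" for h
    using a that by (simp add: R_sym H_add ip_add R_H)
  then have "ip (R \<beta> (\<lambda>x. f x + g x)) (\<lambda>x. f x + g x) =
      (ip (R \<beta> f) f + ip (R \<beta> g) f) + (ip (R \<beta> f) g + ip (R \<beta> g) g)"
    using a by (simp add: ip_add_r R_H H_add)
  moreover have "ip (R \<beta> g) f = ip (R \<beta> f) g"
    using a R_sym[of \<beta> g f] ip_comm[of g "R \<beta> f"] by simp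
  ultimately show ?thesis
    unfolding Eb_def using a by (simp only: ip_expand_add) (simp add: algebra_simps)
qed

lemma Eb_diff: "0 < \<beta> \<Longrightarrow> f \<in> H \<Longrightarrow> g \<in> H \<Longrightarrow>
  Eb \<beta> (\<lambda>x. f x - g x) (\<lambda>x. f x - g x) = Eb \<beta> f f - 2 * Eb \<beta> f g + Eb \<beta> g g"
proof -
  assume a: "0 < \<beta>" "f \<in> H" "g \<in> H"
  have "ip (R \<beta> (\<lambda>x. f x - g x)) h = ip (R \<beta> f) h - ip (R \<beta> g) h" if "h \<in> H" for h
    using a that by (simp add: R_sym H_diff ip_diff R_H)
  then have "ip (R \<beta> (\<lambda>x. f x - g x)) (\<lambda>x. f x - g x) =
      (ip (R \<beta> f) f - ip (R \<beta> g) f) - (ip (R \<beta> f) g - ip (R \<beta> g) g)"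
    using a by (simp add: ip_diff_r R_H H_diff)
  moreover have "ip (R \<beta> g) f = ip (R \<beta> f) g"
    using a R_sym[of \<beta> g f] ip_comm[of g "R \<beta> f"] by simp
  ultimately show ?thesis
    unfolding Eb_def using a by (simp only: ip_expand_diff) (simp add: algebra_simps)
qed

lemma rsym_lim: "(\<lambda>n. rsym (real n + 1) s) \<longlonglongrightarrow> 1"
proof -
  have "(\<lambda>n. 1 / (1 + max 0 s * (1 / (real n + 1)))) \<longlonglongrightarrow> 1 / (1 + max 0 s * 0)"
    using LIMSEQ_inverse_real_of_nat
    by (intro tendsto_intros) (auto simp: inverse_eq_divide add.commute)
  moreover have "1 / (1 + max 0 s * (1 / (real n + 1))) = rsym (real n + 1) s" for n
    by (simp add: rsym_def divide_simps add_nonneg_eq_0_iff)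
  ultimately show ?thesis by simp
qed

lemma Eb_lim_self: assumes "f \<in> \<F>" shows "(\<lambda>n. Eb (real n + 1) f f) \<longlonglongrightarrow> \<E> f f"
proof -
  have "(\<lambda>n. \<integral>s. max 0 s * rsym (real n + 1) s \<partial>sm f) \<longlonglongrightarrow> (\<integral>s. max 0 s \<partial>sm f)"
  proof (rule integral_dominated_convergence[OF _ _ E_self(1)[OF assms]])
    show "AE s in sm f. (\<lambda>n. max 0 s * rsym (real n + 1) s) \<longlonglongrightarrow> max 0 s"
      using tendsto_mult[OF tendsto_const rsym_lim] by (intro AE_I2) simp
    show "AE s in sm f. norm (max 0 s * rsym (real n + 1) s) \<le> max 0 s" for n
      using rsym_bounds[of "real n + 1"] by (intro AE_I2) (auto simp: abs_mult intro!: mult_right_le_one_le)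
  qed measurable
  then show ?thesis using F_H[OF assms] by (simp add: Eb_self E_self(2)[OF assms])
qed

lemma Eb_lim: assumes "f \<in> \<F>" "g \<in> \<F>" shows "(\<lambda>n. Eb (real n + 1) f g) \<longlonglongrightarrow> \<E> f g"
proof -
  have "(\<lambda>n. (Eb (real n + 1) (\<lambda>x. f x + g x) (\<lambda>x. f x + g x) - Eb (real n + 1) (\<lambda>x. f x - g x) (\<lambda>x. f x - g x)) / 4)
    \<longlonglongrightarrow> (\<E> (\<lambda>x. f x + g x) (\<lambda>x. f x + g x) - \<E> (\<lambda>x. f x - g x) (\<lambda>x. f x - g x)) / 4"
    using assms by (intro tendsto_divide tendsto_diff tendsto_const Eb_lim_self F_add F_diff) simp_all
  then show ?thesis
    using F_H[OF assms(1)] F_H[OF assms(2)] by (simp add: Eb_add Eb_diff E_expand_add E_expand_diff assms)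
qed

text \<open>The integrands in \<open>Eb_self\<close> converge to \<open>max 0 s\<close>, so Fatou's
  lemma turns a uniform bound on the approximating energies into finiteness of the energy integral.
  This is how compositions are shown to belong to the form domain.\<close>

lemma F_I_Eb: assumes "f \<in> H" "\<And>n::nat. Eb (real n + 1) f f \<le> C" shows "f \<in> \<F>"
proof (rule F_I[OF assms(1)], rule integrable_bounded_approx[OF assms(1)])
  show "bounded_borel (\<lambda>s. max 0 s * rsym (real n + 1) s)" for n by (rule bounded_borel_rsym2) simp
  show "0 \<le> max 0 s * rsym (real n + 1) s" for n s using rsym_bounds[of "real n + 1" s] by simp
  show "(\<lambda>n. max 0 s * rsym (real n + 1) s) \<longlonglongrightarrow> max 0 s" for s
    using tendsto_mult[OF tendsto_const rsym_lim, of "max 0 s" s] by simp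
  show "(\<integral>s. max 0 s * rsym (real n + 1) s \<partial>sm f) \<le> C" for n
    using assms(2)[of n] Eb_self[OF _ assms(1), of "real n + 1"] by simp
qed

lemma R_L2_lim: assumes "L2_lim u f" "0 < \<beta>" shows "L2_lim (\<lambda>n. R \<beta> (u n)) (R \<beta> f)"
proof -
  have H: "u n \<in> H" "f \<in> H" for n using L2_limD[OF assms(1)] by auto
  have "(\<lambda>n. ip (\<lambda>x. R \<beta> (u n) x - R \<beta> f x) (\<lambda>x. R \<beta> (u n) x - R \<beta> f x)) \<longlonglongrightarrow> 0"
  proof (rule Lim_null_comparison[OF always_eventually L2_limD(3)[OF assms(1)]], rule allI)
    fix n
    have "AE x in \<mu>. R \<beta> (\<lambda>x. u n x - f x) x = R \<beta> (u n) x - R \<beta> f x"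
      using R_lin[OF assms(2) H, of 1 n "-1"] by simp
    then have "ip (\<lambda>x. R \<beta> (u n) x - R \<beta> f x) (\<lambda>x. R \<beta> (u n) x - R \<beta> f x) =
      ip (R \<beta> (\<lambda>x. u n x - f x)) (R \<beta> (\<lambda>x. u n x - f x))"
      by (intro ip_cong) (auto intro!: H_meas H_diff R_H H assms(2))
    also have "\<dots> \<le> 1\<^sup>2 * ip (\<lambda>x. u n x - f x) (\<lambda>x. u n x - f x)"
      unfolding R_def using assms(2)
      by (intro fc_norm_le bounded_borel_rsym H_diff H) (auto simp: rsym_bounds)
    finally show "norm (ip (\<lambda>x. R \<beta> (u n) x - R \<beta> f x) (\<lambda>x. R \<beta> (u n) x - R \<beta> f x))
      \<le> ip (\<lambda>x. u n x - f x) (\<lambda>x. u n x - f x)" by simp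
  qed
  then show ?thesis using H assms(2) by (simp add: L2_lim_def R_H)
qed

lemma R_pos:
  assumes \<beta>: "0 < \<beta>" and f: "f \<in> H" and pos: "AE x in \<mu>. 0 \<le> f x"
  shows "AE x in \<mu>. 0 \<le> R \<beta> f x"
proof -
  have [measurable]: "f \<in> borel_measurable \<mu>" using f by (rule H_meas)
  let ?u = "\<lambda>n x. min (f x) (real (Suc n))"
  have lim: "L2_lim ?u f"
  proof (rule L2_lim_dominated[OF f])
    show "AE x in \<mu>. \<bar>?u n x\<bar> \<le> \<bar>f x\<bar>" for n using pos by eventually_elim auto
    show "AE x in \<mu>. (\<lambda>n. ?u n x) \<longlonglongrightarrow> f x"
    proof (rule AE_I2, rule tendsto_eventually)
      fix x
      obtain N where "f x \<le> real N" using real_arch_simple by blast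
      then have "\<forall>n\<ge>N. ?u n x = f x" by auto
      then show "\<forall>\<^sub>F n in sequentially. ?u n x = f x" by (auto simp: eventually_sequentially)
    qed
  qed simp_all
  have p: "AE x in \<mu>. - R \<beta> (?u n) x \<le> 0" for n
  proof -
    have "AE x in \<mu>. 0 \<le> ?u n x \<and> ?u n x \<le> real (Suc n)" using pos by eventually_elim auto
    from R_pos_le[OF \<beta> L2_limD(1)[OF lim] this] show ?thesis by (auto elim: eventually_mono)
  qed
  have "AE x in \<mu>. - R \<beta> f x \<le> 0"
    using R_L2_lim[OF lim \<beta>] by (intro L2_lim_le[OF L2_lim_lin[of _ _ _ _ "-1" 0, simplified] p]) auto
  then show ?thesis by eventually_elim simp
qed

lemma Eb_L2_lim2: assumes "L2_lim u f" "L2_lim w g" "0 < \<beta>"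
  shows "(\<lambda>n. Eb \<beta> (u n) (w n)) \<longlonglongrightarrow> Eb \<beta> f g"
  unfolding Eb_def
  by (intro tendsto_mult tendsto_const tendsto_diff L2_lim_ip assms R_L2_lim)

lemma Eb_L2_lim: assumes "L2_lim u f" "0 < \<beta>" shows "(\<lambda>n. Eb \<beta> (u n) (u n)) \<longlonglongrightarrow> Eb \<beta> f f"
  by (rule Eb_L2_lim2[OF assms(1,1,2)])

text \<open>Lower semicontinuity: each \<open>Eb \<beta>\<close> is continuous in L2 and lies below
  \<open>\<E>\<close>.\<close>

lemma F_closed:
  assumes "L2_lim u f" "\<And>n. u n \<in> \<F>" "\<And>n. \<E> (u n) (u n) \<le> C"
  shows "f \<in> \<F>" "\<E> f f \<le> C"
proof -
  have le: "Eb (real k + 1) f f \<le> C" for k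
  proof (rule LIMSEQ_le_const2[OF Eb_L2_lim[OF assms(1), of "real k + 1"]])
    show "\<exists>N. \<forall>n\<ge>N. Eb (real k + 1) (u n) (u n) \<le> C"
    proof (intro exI allI impI)
      fix n show "Eb (real k + 1) (u n) (u n) \<le> C"
        using Eb_le_E[OF _ assms(2), of "real k + 1" n] assms(3)[of n] by simp
    qed
  qed simp
  then show f: "f \<in> \<F>" using F_I_Eb[of f C] L2_limD(2)[OF assms(1)] by blast
  show "\<E> f f \<le> C" by (rule LIMSEQ_le_const2[OF Eb_lim_self[OF f]]) (use le in blast)
qed

text \<open>Provides test functions \<open>R \<beta> g\<close> close to \<open>g\<close> in energy,
  against which the energy is an L2 inner product.\<close>

lemma R_approx: assumes "g \<in> \<F>"
  shows "(\<lambda>n. \<E> (\<lambda>x. g x - R (real n + 1) g x) (\<lambda>x. g x - R (real n + 1) g x)) \<longlonglongrightarrow> 0"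
proof -
  let ?d = "\<lambda>n x. g x - R (real n + 1) g x"
  have H: "g \<in> H" using F_H assms .
  have dF: "?d n \<in> \<F>" for n by (intro F_diff assms R_F H) simp
  have e1: "\<E> (?d n) (?d n) = \<E> g g - \<E> (R (real n + 1) g) (?d n) - \<E> (R (real n + 1) g) g" for n
    using assms R_F[OF _ H, of "real n + 1"] E_sym[OF assms R_F[OF _ H, of "real n + 1"]]
    by (simp add: E_diff E_diff_r F_diff)
  have e2: "0 \<le> \<E> (R (real n + 1) g) (?d n)" for n
  proof -
    have "\<E> (R (real n + 1) g) (?d n) = Eb (real n + 1) g (?d n)" using E_R[OF _ H dF] by simp
    also have "\<dots> = (real n + 1) * ip (?d n) (?d n)"
      using H R_H[OF _ H, of "real n + 1"] F_H[OF dF[of n]] by (simp add: Eb_def ip_diff)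
    finally show ?thesis by simp
  qed
  have e3: "\<E> (R (real n + 1) g) g = Eb (real n + 1) g g" for n using E_R[OF _ H assms] by simp
  have le: "\<E> (?d n) (?d n) \<le> \<E> g g - Eb (real n + 1) g g" for n
    using e1[of n] e2[of n] e3[of n] by linarith
  have "(\<lambda>n. \<E> g g - Eb (real n + 1) g g) \<longlonglongrightarrow> \<E> g g - \<E> g g"
    by (intro tendsto_diff tendsto_const Eb_lim_self assms)
  then have l: "(\<lambda>n. \<E> g g - Eb (real n + 1) g g) \<longlonglongrightarrow> 0" by simp
  show ?thesis
    by (rule Lim_null_comparison[OF always_eventually l]) (use le E_pos[OF dF] in auto)
qed

text \<open>Replacing \<open>g\<close> by \<open>R \<beta> g\<close> costs little, uniformly in
  \<open>n\<close>, by Cauchy--Schwarz for the form and the energy bound \<open>C\<close>. After the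
  replacement the energy is an L2 pairing, which converges.\<close>

lemma E_weak_lim:
  assumes u: "L2_lim u f" and uF: "\<And>n. u n \<in> \<F>" and C: "\<And>n. \<E> (u n) (u n) \<le> C" and g: "g \<in> \<F>"
  shows "(\<lambda>n. \<E> (u n) g) \<longlonglongrightarrow> \<E> f g"
proof -
  have f: "f \<in> \<F>" and fC: "\<E> f f \<le> C" using F_closed[OF u uF C] by auto
  have gH: "g \<in> H" and fH: "f \<in> H" using F_H f g by auto
  have C0: "0 \<le> C" using C[of 0] E_pos[OF uF[of 0]] by linarith
  have d: "(\<lambda>x. u n x - f x) \<in> \<F>" for n by (intro F_diff uF f)
  have dC: "\<E> (\<lambda>x. u n x - f x) (\<lambda>x. u n x - f x) \<le> 4 * C" for n
    using E_triangle_diff[OF uF f, of n] C[of n] fC by linarith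
  have "(\<lambda>n. \<E> (\<lambda>x. u n x - f x) g) \<longlonglongrightarrow> 0"
  proof (rule LIMSEQ_I)
    fix e :: real assume e: "0 < e"
    \<comment> \<open>Chosen so that \<open>4 * C\<close> times it stays below
      \<open>(e / 2)\<^sup>2\<close>; the summand 4 covers \<open>C = 0\<close>.\<close>
    have "0 < e\<^sup>2 / (16 * C + 4)" using e C0 by simp
    from order_tendstoD(2)[OF R_approx[OF g] this] obtain k where
      k: "\<E> (\<lambda>x. g x - R (real k + 1) g x) (\<lambda>x. g x - R (real k + 1) g x) < e\<^sup>2 / (16 * C + 4)"
      by (auto simp: eventually_sequentially)
    define \<beta> where "\<beta> = real k + 1"
    have \<beta>: "0 < \<beta>" by (simp add: \<beta>_def)
    let ?q = "\<lambda>x. g x - R \<beta> g x"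
    have qF: "?q \<in> \<F>" by (intro F_diff g R_F gH \<beta>)
    have RF: "R \<beta> g \<in> \<F>" by (intro R_F gH \<beta>)
    have small: "\<bar>\<E> (\<lambda>x. u n x - f x) ?q\<bar> < e / 2" for n
    proof -
      have "(\<E> (\<lambda>x. u n x - f x) ?q)\<^sup>2 \<le> \<E> (\<lambda>x. u n x - f x) (\<lambda>x. u n x - f x) * \<E> ?q ?q"
        by (rule E_CS[OF d qF])
      also have "\<dots> \<le> (4 * C) * \<E> ?q ?q" by (rule mult_right_mono[OF dC E_pos[OF qF]])
      also have "\<dots> \<le> (4 * C) * (e\<^sup>2 / (16 * C + 4))" using k C0 by (intro mult_left_mono) (auto simp: \<beta>_def)
      also have "\<dots> < (e / 2)\<^sup>2" using e C0 by (simp add: field_simps power2_eq_square)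
      finally show ?thesis using e abs_le_square_iff[of "e / 2" "\<E> (\<lambda>x. u n x - f x) ?q"] by simp
    qed
    have "(\<lambda>n. \<E> (\<lambda>x. u n x - f x) (R \<beta> g)) \<longlonglongrightarrow> 0"
    proof -
      have "\<E> (\<lambda>x. u n x - f x) (R \<beta> g) = \<beta> * (ip (u n) ?q - ip f ?q)" for n
      proof -
        have "\<E> (\<lambda>x. u n x - f x) (R \<beta> g) = Eb \<beta> g (\<lambda>x. u n x - f x)"
          using E_sym[OF d RF] E_R[OF \<beta> gH d] by simp
        also have "\<dots> = \<beta> * ip ?q (\<lambda>x. u n x - f x)"
          using gH R_H[OF \<beta> gH] F_H[OF d[of n]] by (simp add: Eb_def ip_diff)
        also have "\<dots> = \<beta> * ip (\<lambda>x. u n x - f x) ?q" by (simp add: ip_comm)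
        also have "\<dots> = \<beta> * (ip (u n) ?q - ip f ?q)"
          using F_H[OF uF] fH F_H[OF qF] by (simp add: ip_diff)
        finally show ?thesis .
      qed
      moreover have "(\<lambda>n. \<beta> * (ip (u n) ?q - ip f ?q)) \<longlonglongrightarrow> \<beta> * (ip f ?q - ip f ?q)"
        by (intro tendsto_mult tendsto_diff tendsto_const L2_lim_ip_const[OF u F_H[OF qF]])
      ultimately show ?thesis by simp
    qed
    from LIMSEQ_D[OF this, of "e / 2"] e obtain N where
      N: "\<And>n. n \<ge> N \<Longrightarrow> \<bar>\<E> (\<lambda>x. u n x - f x) (R \<beta> g)\<bar> < e / 2" by auto
    have "norm (\<E> (\<lambda>x. u n x - f x) g - 0) < e" if "n \<ge> N" for n
    proof -
      have "\<E> (\<lambda>x. u n x - f x) g = \<E> (\<lambda>x. u n x - f x) ?q + \<E> (\<lambda>x. u n x - f x) (R \<beta> g)"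
        using E_diff_r[OF g RF d] by simp
      then show ?thesis using small[of n] N[OF that] by simp
    qed
    then show "\<exists>no. \<forall>n\<ge>no. norm (\<E> (\<lambda>x. u n x - f x) g - 0) < e" by blast
  qed
  then show ?thesis using uF f g by (simp add: E_diff LIM_zero_iff)
qed

end

section \<open>The heat semigroup\<close>

context dirichlet_setting
begin

definition hsym :: "real \<Rightarrow> real \<Rightarrow> real" where
  "hsym t s = exp (- (t * max 0 s))"

definition P :: "real \<Rightarrow> ('a \<Rightarrow> real) \<Rightarrow> ('a \<Rightarrow> real)" where
  "P t f = fc (hsym t) f"

definition LP :: "real \<Rightarrow> ('a \<Rightarrow> real) \<Rightarrow> ('a \<Rightarrow> real)" where
  "LP t f = fc (\<lambda>s. max 0 s * hsym t s) f"

lemma hsym_meas [measurable]: "hsym t \<in> borel_measurable borel"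
  unfolding hsym_def by measurable

lemma hsym_bound: "0 \<le> t \<Longrightarrow> \<bar>hsym t s\<bar> \<le> 1"
  by (simp add: hsym_def)

lemma bounded_borel_hsym: "0 \<le> t \<Longrightarrow> bounded_borel (hsym t)"
  by (rule bounded_borelI[of _ 1]) (auto simp: hsym_bound)

lemma bounded_borel_hsym2: assumes "0 < t" shows "bounded_borel (\<lambda>s. max 0 s * hsym t s)"
proof (rule bounded_borelI)
  show "\<bar>max 0 s * hsym t s\<bar> \<le> 1 / t" for s
  proof -
    have "t * max 0 s \<le> exp (t * max 0 s)" using exp_ge_add_one_self[of "t * max 0 s"] by linarith
    then show ?thesis using assms by (simp add: hsym_def abs_mult exp_minus field_simps)
  qed
qed measurable

lemma P_H: "0 \<le> t \<Longrightarrow> f \<in> H \<Longrightarrow> P t f \<in> H"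
  unfolding P_def by (rule fc_H[OF bounded_borel_hsym])

lemma P_sym: "0 \<le> t \<Longrightarrow> f \<in> H \<Longrightarrow> g \<in> H \<Longrightarrow> ip (P t f) g = ip f (P t g)"
  unfolding P_def by (rule fc_sym[OF bounded_borel_hsym])

lemma P_lin: "0 \<le> t \<Longrightarrow> f \<in> H \<Longrightarrow> g \<in> H \<Longrightarrow>
  AE x in \<mu>. P t (\<lambda>x. a * f x + b * g x) x = a * P t f x + b * P t g x"
  unfolding P_def by (rule fc_lin[OF bounded_borel_hsym])

lemma P_contraction: "0 \<le> t \<Longrightarrow> f \<in> H \<Longrightarrow> ip (P t f) (P t f) \<le> ip f f"
  using fc_norm_le[OF bounded_borel_hsym _ hsym_bound, of t f] by (simp add: P_def)

lemma P_semigroup: assumes "0 \<le> s" "0 \<le> t" "f \<in> H"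
  shows "AE x in \<mu>. P s (P t f) x = P (s + t) f x"
proof -
  have "(\<lambda>r. hsym s r * hsym t r) = hsym (s + t)"
    by (simp add: hsym_def fun_eq_iff exp_add[symmetric] algebra_simps)
  then show ?thesis
    using fc_mult_AE[OF bounded_borel_hsym[OF assms(1)] bounded_borel_hsym[OF assms(2)] assms(3)]
    by (simp add: P_def)
qed

lemma P_F: "0 < t \<Longrightarrow> f \<in> H \<Longrightarrow> P t f \<in> \<F>"
  unfolding P_def by (rule fc_in_F[OF bounded_borel_hsym bounded_borel_hsym2]) auto

lemma LP_H: "0 < t \<Longrightarrow> f \<in> H \<Longrightarrow> LP t f \<in> H"
  unfolding LP_def by (rule fc_H[OF bounded_borel_hsym2])

lemma E_P: "0 < t \<Longrightarrow> f \<in> H \<Longrightarrow> g \<in> \<F> \<Longrightarrow> \<E> (P t f) g = ip (LP t f) g"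
  unfolding P_def LP_def by (rule E_fc_ip[OF bounded_borel_hsym bounded_borel_hsym2]) auto

lemma exp_taylor2: "\<bar>exp y - 1 - y\<bar> \<le> y\<^sup>2 * exp \<bar>y\<bar>" for y :: real
proof -
  have a: "exp y - 1 \<le> y * exp y"
    using exp_ge_add_one_self[of "- y"] mult_left_mono[of "1 - y" "exp (- y)" "exp y"]
    by (simp add: algebra_simps exp_minus)
  have "0 \<le> exp y - 1 - y" using exp_ge_add_one_self[of y] by linarith
  moreover have "exp y - 1 - y \<le> y\<^sup>2 * exp \<bar>y\<bar>"
  proof (cases "0 \<le> y")
    case True
    have "exp y - 1 - y \<le> y * (exp y - 1)" using a by (simp add: algebra_simps)
    also have "\<dots> \<le> y * (y * exp y)" by (rule mult_left_mono[OF a True])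
    finally show ?thesis using True by (simp add: power2_eq_square mult.assoc)
  next
    case False
    have "exp y - 1 - y \<le> (- y) * (1 - exp y)" using a by (simp add: algebra_simps)
    also have "\<dots> \<le> (- y) * (- y)"
    proof (rule mult_left_mono)
      show "1 - exp y \<le> - y" using exp_ge_add_one_self[of y] by linarith
    qed (use False in simp)
    also have "\<dots> \<le> (- y) * (- y) * exp \<bar>y\<bar>" using mult_left_mono[of 1 "exp \<bar>y\<bar>" "(- y) * (- y)"] by simp
    finally show ?thesis by (simp add: power2_eq_square)
  qed
  ultimately show ?thesis by simp
qed

text \<open>The restriction on \<open>\<tau>\<close> leaves half of the decay,
  \<open>exp (- t z / 2)\<close> with \<open>z = max 0 s\<close>, to absorb the factor
  \<open>z\<^sup>2\<close>; the constant 16 comes from \<open>t z / 4 \<le> exp (t z / 4)\<close>,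
  squared. Uniformity in \<open>s\<close> is what yields differentiability in L2.\<close>

lemma hsym_taylor:
  assumes "0 < t" "\<bar>\<tau> - t\<bar> \<le> t / 2"
  shows "\<bar>hsym \<tau> s - hsym t s + (\<tau> - t) * (max 0 s * hsym t s)\<bar> \<le> 16 / t\<^sup>2 * (\<tau> - t)\<^sup>2"
proof -
  define z where "z = max 0 s"
  define h where "h = \<tau> - t"
  have z: "0 \<le> z" by (simp add: z_def)
  have "hsym \<tau> s - hsym t s + (\<tau> - t) * (max 0 s * hsym t s) = exp (- (t * z)) * (exp (- h * z) - 1 - (- h * z))"
    by (simp add: hsym_def h_def z_def algebra_simps exp_add[symmetric])
  then have "\<bar>hsym \<tau> s - hsym t s + (\<tau> - t) * (max 0 s * hsym t s)\<bar> = exp (- (t * z)) * \<bar>exp (- h * z) - 1 - (- h * z)\<bar>"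
    by (simp add: abs_mult)
  also have "\<dots> \<le> exp (- (t * z)) * ((- h * z)\<^sup>2 * exp \<bar>- h * z\<bar>)"
    by (intro mult_left_mono exp_taylor2) simp
  also have "\<dots> \<le> exp (- (t * z)) * ((- h * z)\<^sup>2 * exp (t / 2 * z))"
  proof -
    have "\<bar>- h * z\<bar> \<le> t / 2 * z" using mult_right_mono[OF assms(2) z] z
      by (simp add: abs_mult h_def abs_minus_commute)
    then show ?thesis by (intro mult_left_mono) auto
  qed
  also have "\<dots> = h\<^sup>2 * (z\<^sup>2 * exp (- (t * z / 2)))"
    by (simp add: power_mult_distrib exp_add[symmetric] mult_ac)
  also have "\<dots> \<le> h\<^sup>2 * (16 / t\<^sup>2)"
  proof (rule mult_left_mono)
    have w: "t * z / 4 \<le> exp (t * z / 4)" using exp_ge_add_one_self[of "t * z / 4"] by linarith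
    have "(t * z / 4)\<^sup>2 \<le> (exp (t * z / 4))\<^sup>2" using w z assms(1) by (intro power_mono) auto
    also have "\<dots> = exp (t * z / 2)" by (simp add: power2_eq_square exp_add[symmetric])
    finally have "z\<^sup>2 \<le> 16 / t\<^sup>2 * exp (t * z / 2)" using assms(1) by (simp add: field_simps power2_eq_square)
    then show "z\<^sup>2 * exp (- (t * z / 2)) \<le> 16 / t\<^sup>2" by (simp add: exp_minus field_simps)
  qed simp
  finally show ?thesis by (simp add: h_def mult.commute)
qed

lemma P_derivative:
  assumes t: "0 < t" and \<tau>: "\<bar>\<tau> - t\<bar> \<le> t / 2" and f: "f \<in> H"
  shows "ip (\<lambda>x. P \<tau> f x - P t f x + (\<tau> - t) * LP t f x) (\<lambda>x. P \<tau> f x - P t f x + (\<tau> - t) * LP t f x)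
    \<le> (16 / t\<^sup>2 * (\<tau> - t)\<^sup>2)\<^sup>2 * ip f f"
\<comment> \<open>\<open>fc_norm_le\<close> takes a strictly positive bound, which degenerates in
  this case.\<close>
proof (cases "\<tau> = t")
  case True
  then show ?thesis by (simp add: ip_ge0)
next
  case False
  have \<tau>0: "0 \<le> \<tau>" "0 \<le> t" using t \<tau> by linarith+
  let ?\<phi> = "\<lambda>s. 1 * (1 * hsym \<tau> s + (-1) * hsym t s) + (\<tau> - t) * (max 0 s * hsym t s)"
  note b1 = bounded_borel_hsym[OF \<tau>0(1)] and b2 = bounded_borel_hsym[OF \<tau>0(2)]
    and b3 = bounded_borel_hsym2[OF t]
  note b4 = bounded_borel_lin[OF b1 b2, of 1 "-1"]
  note b5 = bounded_borel_lin[OF b4 b3, of 1 "\<tau> - t"]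
  have "AE x in \<mu>. fc ?\<phi> f x = 1 * fc (\<lambda>s. 1 * hsym \<tau> s + (-1) * hsym t s) f x + (\<tau> - t) * LP t f x"
    using fc_symbol_lin[OF b4 b3 f, of 1 "\<tau> - t"] by (simp only: LP_def)
  moreover have "AE x in \<mu>. fc (\<lambda>s. 1 * hsym \<tau> s + (-1) * hsym t s) f x = 1 * P \<tau> f x + (-1) * P t f x"
    using fc_symbol_lin[OF b1 b2 f, of 1 "-1"] by (simp only: P_def)
  ultimately have "AE x in \<mu>. P \<tau> f x - P t f x + (\<tau> - t) * LP t f x = fc ?\<phi> f x"
    by eventually_elim simp
  then have "ip (\<lambda>x. P \<tau> f x - P t f x + (\<tau> - t) * LP t f x) (\<lambda>x. P \<tau> f x - P t f x + (\<tau> - t) * LP t f x)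
    = ip (fc ?\<phi> f) (fc ?\<phi> f)"
    using \<tau>0 t f by (intro ip_cong) (auto intro!: H_meas H_add H_diff H_cmult P_H LP_H fc_H[OF b5, simplified])
  also have "\<dots> \<le> (16 / t\<^sup>2 * (\<tau> - t)\<^sup>2)\<^sup>2 * ip f f"
    using hsym_taylor[OF t \<tau>] False t by (intro fc_norm_le[OF b5 f]) auto
  finally show ?thesis .
qed

text \<open>The symbol \<open>exp (- t s)\<close> is unbounded on the negative axis, but it agrees
  with the bounded \<open>hsym\<close> almost everywhere for each spectral measure; hence the heat
  operator is defined on all of \<open>H\<close> and has value \<open>P t f\<close> up to null
  sets.\<close>

lemma heat_op_P: assumes "0 < t" "f \<in> H" shows "(f, P t f) \<in> heat_op \<mu> L t"
  and heat_op_unique: "(f, g) \<in> heat_op \<mu> L t \<Longrightarrow> g \<in> H \<and> (AE x in \<mu>. g x = P t f x)"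
proof -
  let ?e = "\<lambda>s. exp (- (t * s))"
  have t0: "0 \<le> t" using assms by simp
  have ae: "AE s in sm h. ?e s = hsym t s" if "h \<in> H" for h
    using sm_nonneg[OF that] by eventually_elim (simp add: hsym_def)
  have int: "(\<integral>s. ?e s \<partial>sm h) = (\<integral>s. hsym t s \<partial>sm h)" if "h \<in> H" for h
    by (rule integral_cong_AE) (use ae[OF that] in auto)
  have dom: "integrable (sm h) (\<lambda>s. (?e s)\<^sup>2)" if "h \<in> H" for h
  proof -
    have "integrable (sm h) (\<lambda>s. hsym t s * hsym t s)"
      by (intro integrable_sm that bounded_borel_mult bounded_borel_hsym t0)
    moreover have "AE s in sm h. hsym t s * hsym t s = (?e s)\<^sup>2"
      using ae[OF that] by eventually_elim (simp add: power2_eq_square)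
    ultimately show ?thesis by (subst integrable_cong_AE[symmetric]) auto
  qed
  have rep: "ip (P t f) h = ((\<integral>s. ?e s \<partial>sm (\<lambda>x. f x + h x)) - (\<integral>s. ?e s \<partial>sm (\<lambda>x. f x - h x))) / 4"
    if "h \<in> H" for h
    using that assms(2) fc_ip[OF bounded_borel_hsym[OF t0] assms(2) that]
    by (simp add: P_def S_def int H_add H_diff)
  show "(f, P t f) \<in> heat_op \<mu> L t"
    unfolding heat_op_def functional_calculus_Qr spectral_integral_def
    using assms rep dom P_H[OF t0] by auto
  assume "(f, g) \<in> heat_op \<mu> L t"
  then have g: "g \<in> H" and gr: "\<And>h. h \<in> H \<Longrightarrow> ip g h =
    ((\<integral>s. ?e s \<partial>sm (\<lambda>x. f x + h x)) - (\<integral>s. ?e s \<partial>sm (\<lambda>x. f x - h x))) / 4"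
    using dom unfolding heat_op_def functional_calculus_Qr spectral_integral_def by auto
  then show "g \<in> H \<and> (AE x in \<mu>. g x = P t f x)"
    using ip_eqI[OF g P_H[OF t0 assms(2)]] rep by auto
qed

lemma heat_op_dom: "(f, g) \<in> heat_op \<mu> L t \<Longrightarrow> f \<in> H"
  unfolding heat_op_def functional_calculus_Qr spectral_integral_def by auto

text \<open>Exponential formula: the powers \<open>(1 + t L / n)\<close> to the \<open>- n\<close>
  converge strongly to the semigroup, and each factor is a resolvent with
  \<open>\<beta> = n / t\<close>, which preserves the bound \<open>M\<close> by
  \<open>R_bounded\<close>.\<close>

lemma P_bounded:
  assumes t: "0 < t" and f: "f \<in> H" and fM: "AE x in \<mu>. \<bar>f x\<bar> \<le> M" and M: "0 < M"
  shows "AE x in \<mu>. \<bar>P t f x\<bar> \<le> M"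
proof -
  have pw: "bounded_borel (\<lambda>s. (rsym \<beta> s) ^ k)" if "0 < \<beta>" for \<beta> k
    using that rsym_bounds[OF that] by (intro bounded_borelI[of _ 1]) (auto simp: power_le_one)
  have bd: "AE x in \<mu>. \<bar>fc (\<lambda>s. (rsym \<beta> s) ^ k) f x\<bar> \<le> M" if \<beta>: "0 < \<beta>" for \<beta> k
  proof (induction k)
    case 0
    then show ?case using fc_one[OF f] fM by (simp, eventually_elim) simp
  next
    case (Suc k)
    have "AE x in \<mu>. \<bar>R \<beta> (fc (\<lambda>s. (rsym \<beta> s) ^ k) f) x\<bar> \<le> M"
      by (rule R_bounded[OF \<beta> fc_H[OF pw[OF \<beta>] f] Suc M])
    moreover have "AE x in \<mu>. R \<beta> (fc (\<lambda>s. (rsym \<beta> s) ^ k) f) x = fc (\<lambda>s. rsym \<beta> s * (rsym \<beta> s) ^ k) f x"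
      unfolding R_def by (rule fc_mult_AE[OF bounded_borel_rsym[OF \<beta>] pw[OF \<beta>] f])
    ultimately show ?case by (simp, eventually_elim) simp
  qed
  define u where "u = (\<lambda>n s. (rsym (real (Suc n) / t) s) ^ Suc n)"
  have lim: "L2_lim (\<lambda>n. fc (u n) f) (fc (hsym t) f)"
  proof (rule fc_lim_strong[OF f])
    show "bounded_borel (u n)" for n unfolding u_def by (rule pw) (use t in simp)
    show "\<bar>u n s\<bar> \<le> 1" for n s
      using rsym_bounds[of "real (Suc n) / t" s] t by (simp add: u_def power_abs[symmetric] del: power_Suc) (simp add: power_le_one del: power_Suc)
    show "(\<lambda>n. u n s) \<longlonglongrightarrow> hsym t s" for s
    proof -
      have "(\<lambda>n. (1 + t * max 0 s / real n) ^ n) \<longlonglongrightarrow> exp (t * max 0 s)"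
        by (rule tendsto_exp_limit_sequentially)
      then have "(\<lambda>n. (1 + t * max 0 s / real (Suc n)) ^ Suc n) \<longlonglongrightarrow> exp (t * max 0 s)"
        by (rule LIMSEQ_Suc)
      then have "(\<lambda>n. inverse ((1 + t * max 0 s / real (Suc n)) ^ Suc n)) \<longlonglongrightarrow> inverse (exp (t * max 0 s))"
        by (rule tendsto_inverse) simp
      moreover have "inverse ((1 + t * max 0 s / real (Suc n)) ^ Suc n) = u n s" for n
      proof -
        have "inverse (1 + t * max 0 s / real (Suc n)) = rsym (real (Suc n) / t) s"
        proof -
          have "rsym (real (Suc n) / t) s = (real (Suc n) / t) / ((real (Suc n) / t) * (1 + t * max 0 s / real (Suc n)))"
            using t by (simp add: rsym_def distrib_left)
          also have "\<dots> = inverse (1 + t * max 0 s / real (Suc n))"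
            using t by (subst nonzero_divide_mult_cancel_left) (auto simp: inverse_eq_divide)
          finally show ?thesis by simp
        qed
        then show ?thesis unfolding u_def by (simp only: power_inverse[symmetric])
      qed
      ultimately show ?thesis by (simp add: hsym_def exp_minus)
    qed
  qed (rule bounded_borel_hsym, use t in simp)
  have b: "AE x in \<mu>. \<bar>fc (u n) f x\<bar> \<le> M" for n unfolding u_def by (rule bd) (use t in simp)
  have up: "AE x in \<mu>. fc (u n) f x \<le> M" and lo: "AE x in \<mu>. - fc (u n) f x \<le> M" for n
    using b[of n] by (eventually_elim, simp)+
  have "AE x in \<mu>. P t f x \<le> M"
    unfolding P_def by (rule L2_lim_le[OF lim up]) simp
  moreover have "AE x in \<mu>. - P t f x \<le> M"
    unfolding P_def by (rule L2_lim_le[OF L2_lim_lin[OF lim lim, of "-1" 0, simplified] lo]) simp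
  ultimately show ?thesis by eventually_elim auto
qed

end

section \<open>Beurling--Deny inequalities\<close>

context dirichlet_setting
begin

lemma R_sum:
  assumes "0 < \<beta>" "finite I" "\<And>i. i \<in> I \<Longrightarrow> f i \<in> H"
  shows "AE x in \<mu>. R \<beta> (\<lambda>x. \<Sum>i\<in>I. f i x) x = (\<Sum>i\<in>I. R \<beta> (f i) x)"
  using assms(2,3)
proof (induction I rule: finite_induct)
  case empty
  then show ?case using R_lin[OF assms(1) H_zero H_zero, of 0 0] by simp
next
  case (insert i I)
  have "AE x in \<mu>. R \<beta> (\<lambda>x. 1 * f i x + 1 * (\<Sum>j\<in>I. f j x)) x = 1 * R \<beta> (f i) x + 1 * R \<beta> (\<lambda>x. \<Sum>j\<in>I. f j x) x"
    using insert by (intro R_lin assms(1) H_sum) auto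
  moreover have "AE x in \<mu>. R \<beta> (\<lambda>x. \<Sum>j\<in>I. f j x) x = (\<Sum>j\<in>I. R \<beta> (f j) x)"
    using insert by auto
  ultimately show ?case unfolding sum.insert[OF insert.hyps] by eventually_elim simp
qed

lemma R_lin4:
  assumes \<beta>: "0 < \<beta>" and H: "f1 \<in> H" "f2 \<in> H" "f3 \<in> H" "f4 \<in> H"
  shows "AE x in \<mu>. R \<beta> (\<lambda>x. c * (f1 x - p * f2 x - q * f3 x + r * f4 x)) x =
    c * (R \<beta> f1 x - p * R \<beta> f2 x - q * R \<beta> f3 x + r * R \<beta> f4 x)"
proof -
  let ?g = "\<lambda>x. 1 * f1 x + (- p) * f2 x" let ?h = "\<lambda>x. (- q) * f3 x + r * f4 x"
  have eq: "(\<lambda>x. c * (f1 x - p * f2 x - q * f3 x + r * f4 x)) = (\<lambda>x. c * ?g x + c * ?h x)"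
    by (simp add: algebra_simps)
  have "AE x in \<mu>. R \<beta> (\<lambda>x. c * ?g x + c * ?h x) x = c * R \<beta> ?g x + c * R \<beta> ?h x"
    by (intro R_lin \<beta> H_lin H)
  moreover have "AE x in \<mu>. R \<beta> ?g x = 1 * R \<beta> f1 x + (- p) * R \<beta> f2 x" by (intro R_lin \<beta> H)
  moreover have "AE x in \<mu>. R \<beta> ?h x = (- q) * R \<beta> f3 x + r * R \<beta> f4 x" by (intro R_lin \<beta> H)
  ultimately show ?thesis unfolding eq
  proof eventually_elim
    case (elim x)
    show ?case unfolding elim by (simp add: algebra_simps)
  qed
qed

text \<open>The resolvent has no pointwise kernel here. Positivity of the resolvent gives, for each
  constant \<open>q\<close>, a pointwise inequality; it holds simultaneously for all \<open>q\<close> in a countable dense set,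
  hence for all \<open>q\<close>, and \<open>q\<close> can then be replaced by the point value \<open>(u1 x, u2 x)\<close>.\<close>

lemma Eb_BD_finite:
  fixes a b :: "nat \<Rightarrow> real \<times> real \<Rightarrow> real"
  assumes \<beta>: "0 < \<beta>"
    and um: "u1 \<in> borel_measurable \<mu>" "u2 \<in> borel_measurable \<mu>"
    and bd: "\<And>x. \<bar>u1 x\<bar> \<le> M" "\<And>x. \<bar>u2 x\<bar> \<le> M"
    and cont: "\<And>i. i < n \<Longrightarrow> continuous_on UNIV (a i)" "\<And>i. i < n \<Longrightarrow> continuous_on UNIV (b i)"
    and jump: "\<And>s s'. 0 \<le> (\<Sum>i<n. c i * ((a i s - a i s') * (b i s - b i s')))"
    and kill: "\<And>s. 0 \<le> (\<Sum>i<n. c i * (a i s * b i s))"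
    and X: "X \<in> sets \<mu>" "emeasure \<mu> X < \<infinity>"
  shows "0 \<le> (\<Sum>i<n. c i * Eb \<beta> (\<lambda>x. indicator X x * a i (u1 x, u2 x)) (\<lambda>x. indicator X x * b i (u1 x, u2 x)))"
proof -
  let ?X = "indicator X :: 'a \<Rightarrow> real"
  let ?A = "\<lambda>i x. ?X x * a i (u1 x, u2 x)" let ?B = "\<lambda>i x. ?X x * b i (u1 x, u2 x)"
  let ?AB = "\<lambda>i x. ?X x * (a i (u1 x, u2 x) * b i (u1 x, u2 x))"
  have XH: "?X \<in> H" by (rule H_indicator[OF X])
  have bdd: "\<exists>K. \<forall>x. \<bar>f (u1 x, u2 x)\<bar> \<le> K" if "continuous_on UNIV f" for f :: "real \<times> real \<Rightarrow> real"
  proof -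
    have "compact (f ` ({-M..M} \<times> {-M..M}))"
      by (rule compact_continuous_image[OF continuous_on_subset[OF that]]) (auto intro: compact_Times)
    then obtain K where K: "\<forall>y\<in>f ` ({-M..M} \<times> {-M..M}). norm y \<le> K"
      using compact_imp_bounded bounded_iff by blast
    have "\<bar>f (u1 x, u2 x)\<bar> \<le> K" for x
    proof -
      have "(u1 x, u2 x) \<in> {-M..M} \<times> {-M..M}" using bd[of x] by (simp add: abs_le_iff)
      then show ?thesis using K by (metis imageI real_norm_def)
    qed
    then show ?thesis by blast
  qed
  have meas: "(\<lambda>x. f (u1 x, u2 x)) \<in> borel_measurable \<mu>" if "continuous_on UNIV f" for f :: "real \<times> real \<Rightarrow> real"
    using borel_measurable_continuous_onI[OF that] um by measurable
  have inH: "(\<lambda>x. ?X x * f (u1 x, u2 x)) \<in> H" if "continuous_on UNIV f" for f :: "real \<times> real \<Rightarrow> real"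
  proof -
    obtain K where K: "\<And>x. \<bar>f (u1 x, u2 x)\<bar> \<le> K" using bdd[OF \<open>continuous_on UNIV f\<close>] by blast
    from H_bmult[OF XH meas[OF that] K] show ?thesis by (simp add: mult.commute)
  qed
  have AH: "?A i \<in> H" and BH: "?B i \<in> H" and ABH: "?AB i \<in> H" if "i < n" for i
    using inH[OF cont(1)[OF that]] inH[OF cont(2)[OF that]]
      inH[OF continuous_on_mult[OF cont(1)[OF that] cont(2)[OF that]]] by auto
  \<comment> \<open>For fixed \<open>q\<close>, this is \<open>R \<beta>\<close> applied to the jump
    expression between \<open>(u1, u2)\<close> and the constant \<open>q\<close>, restricted to
    \<open>X\<close> and expanded by linearity.\<close>
  define T where "T = (\<lambda>q x. \<Sum>i<n. c i * (R \<beta> (?AB i) x - a i q * R \<beta> (?B i) x - b i q * R \<beta> (?A i) x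
     + (a i q * b i q) * R \<beta> ?X x))"
  have T0: "AE x in \<mu>. 0 \<le> T q x" for q
  proof -
    let ?V = "\<lambda>i x. c i * (?AB i x - a i q * ?B i x - b i q * ?A i x + (a i q * b i q) * ?X x)"
    have VH: "?V i \<in> H" if "i < n" for i
      using that by (intro H_cmult H_add H_diff AH BH ABH XH)
    have GH: "(\<lambda>x. \<Sum>i<n. ?V i x) \<in> H" using VH by (intro H_sum) auto
    have "(\<Sum>i<n. ?V i x) = ?X x * (\<Sum>i<n. c i * ((a i (u1 x, u2 x) - a i q) * (b i (u1 x, u2 x) - b i q)))" for x
      unfolding sum_distrib_left by (intro sum.cong refl) (simp add: algebra_simps)
    then have "0 \<le> (\<Sum>i<n. ?V i x)" for x using jump by simp
    then have "AE x in \<mu>. 0 \<le> R \<beta> (\<lambda>x. \<Sum>i<n. ?V i x) x" by (intro R_pos[OF \<beta> GH]) simp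
    moreover have "AE x in \<mu>. R \<beta> (\<lambda>x. \<Sum>i<n. ?V i x) x = (\<Sum>i<n. R \<beta> (?V i) x)"
      using VH by (intro R_sum \<beta>) auto
    moreover have "AE x in \<mu>. \<forall>i\<in>{..<n}. R \<beta> (?V i) x = c i * (R \<beta> (?AB i) x - a i q * R \<beta> (?B i) x - b i q * R \<beta> (?A i) x
     + (a i q * b i q) * R \<beta> ?X x)"
      by (intro AE_finite_allI R_lin4 \<beta> AH BH ABH XH) auto
    ultimately show ?thesis by eventually_elim (simp add: T_def)
  qed
  obtain D :: "(real \<times> real) set" where D: "countable D" "\<And>U. open U \<Longrightarrow> U \<noteq> {} \<Longrightarrow> \<exists>d\<in>D. d \<in> U"
    using countable_dense_setE by blast
  have "AE x in \<mu>. \<forall>q\<in>D. 0 \<le> T q x" using T0 D(1) by (simp add: AE_ball_countable)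
  then have Tall: "AE x in \<mu>. \<forall>q. 0 \<le> T q x"
  proof eventually_elim
    case (elim x)
    have "open {q. T q x < 0}"
      unfolding T_def by (intro open_Collect_less continuous_intros cont) auto
    then have "{q. T q x < 0} = {}" using D(2) elim by force
    then show ?case by (auto simp: not_less)
  qed
  have RAH: "R \<beta> (?A i) \<in> H" "R \<beta> (?B i) \<in> H" "R \<beta> (?AB i) \<in> H" if "i < n" for i
    using that by (auto intro!: R_H \<beta> AH BH ABH)
  have RX: "R \<beta> ?X \<in> H" by (rule R_H[OF \<beta> XH])
  \<comment> \<open>With \<open>q\<close> set to the point value, symmetry of
    \<open>R \<beta>\<close> pairs the four terms into twice a diagonal minus twice an off-diagonal
    contribution.\<close>
  have intg: "(\<integral>x. ?X x * T (u1 x, u2 x) x \<partial>\<mu>) =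
    (\<Sum>i<n. c i * (2 * ip (?AB i) (R \<beta> ?X) - 2 * ip (R \<beta> (?A i)) (?B i)))"
  proof -
    let ?W = "\<lambda>i x. c i * (?X x * R \<beta> (?AB i) x - ?A i x * R \<beta> (?B i) x - ?B i x * R \<beta> (?A i) x + ?AB i x * R \<beta> ?X x)"
    have "(\<integral>x. ?X x * T (u1 x, u2 x) x \<partial>\<mu>) = (\<integral>x. (\<Sum>i<n. ?W i x) \<partial>\<mu>)"
      unfolding T_def sum_distrib_left by (intro Bochner_Integration.integral_cong sum.cong refl) (simp add: algebra_simps)
    also have "\<dots> = (\<Sum>i<n. \<integral>x. ?W i x \<partial>\<mu>)"
      by (intro Bochner_Integration.integral_sum integrable_mult_right Bochner_Integration.integrable_add
          Bochner_Integration.integrable_diff H_mult AH BH ABH XH RAH RX) auto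
    also have "\<dots> = (\<Sum>i<n. c i * (2 * ip (?AB i) (R \<beta> ?X) - 2 * ip (R \<beta> (?A i)) (?B i)))"
    proof (rule sum.cong[OF refl])
      fix i assume "i \<in> {..<n}" then have i: "i < n" by simp
      have "(\<integral>x. ?W i x \<partial>\<mu>) = c i * (ip ?X (R \<beta> (?AB i)) - ip (?A i) (R \<beta> (?B i)) - ip (?B i) (R \<beta> (?A i)) + ip (?AB i) (R \<beta> ?X))"
        unfolding L2_inner_def using i
        by (simp add: H_mult[OF XH RAH(3)] H_mult[OF AH RAH(2)] H_mult[OF BH RAH(1)] H_mult[OF ABH RX])
      moreover have "ip ?X (R \<beta> (?AB i)) = ip (?AB i) (R \<beta> ?X)"
        using R_sym[OF \<beta> ABH[OF i] XH] by (simp add: ip_comm)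
      moreover have "ip (?A i) (R \<beta> (?B i)) = ip (R \<beta> (?A i)) (?B i)" using R_sym[OF \<beta> AH[OF i] BH[OF i]] by simp
      moreover have "ip (?B i) (R \<beta> (?A i)) = ip (R \<beta> (?A i)) (?B i)" by (rule ip_comm)
      ultimately show "(\<integral>x. ?W i x \<partial>\<mu>) = c i * (2 * ip (?AB i) (R \<beta> ?X) - 2 * ip (R \<beta> (?A i)) (?B i))" by simp
    qed
    finally show ?thesis .
  qed
  have "0 \<le> (\<integral>x. ?X x * T (u1 x, u2 x) x \<partial>\<mu>)"
    by (rule integral_nonneg_AE) (use Tall in \<open>auto elim: eventually_mono\<close>)
  then have j: "(\<Sum>i<n. c i * ip (R \<beta> (?A i)) (?B i)) \<le> (\<Sum>i<n. c i * ip (?AB i) (R \<beta> ?X))"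
    unfolding intg by (simp add: right_diff_distrib sum_subtractf sum_distrib_left[symmetric] mult.left_commute[of _ 2])
  let ?K = "\<lambda>x. \<Sum>i<n. c i * ?AB i x"
  have KH: "?K \<in> H" using ABH by (intro H_sum H_cmult) auto
  have Kpos: "0 \<le> ?K x" for x
  proof -
    have "?K x = ?X x * (\<Sum>i<n. c i * (a i (u1 x, u2 x) * b i (u1 x, u2 x)))"
      unfolding sum_distrib_left by (intro sum.cong refl) (simp add: algebra_simps)
    then show ?thesis using kill by simp
  qed
  have Kip: "ip ?K h = (\<Sum>i<n. c i * ip (?AB i) h)" if "h \<in> H" for h
    using that ABH by (subst ip_sum) (auto intro!: H_cmult simp: ip_cmult)
  \<comment> \<open>The killing part: \<open>?K\<close> is nonnegative by \<open>kill\<close> and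
    vanishes off \<open>X\<close>, so replacing \<open>R \<beta> ?X\<close>, which is at most 1, by
    1 on \<open>X\<close> only increases the pairing.\<close>
  have "ip ?K (R \<beta> ?X) \<le> ip ?K ?X"
    unfolding L2_inner_def
  proof (rule integral_mono_AE[OF H_mult[OF KH RX] H_mult[OF KH XH]])
    have "AE x in \<mu>. 0 \<le> R \<beta> ?X x \<and> R \<beta> ?X x \<le> 1"
      by (rule R_markov01[OF \<beta> XH]) simp
    then show "AE x in \<mu>. ?K x * R \<beta> ?X x \<le> ?K x * ?X x"
    proof eventually_elim
      case (elim x)
      show ?case
      proof (cases "x \<in> X")
        case True
        then show ?thesis using mult_left_mono[OF _ Kpos[of x], of "R \<beta> ?X x" 1] elim by simp
      qed simp
    qed
  qed
  then have k: "(\<Sum>i<n. c i * ip (?AB i) (R \<beta> ?X)) \<le> (\<Sum>i<n. c i * ip (?AB i) ?X)"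
    using Kip[OF RX] Kip[OF XH] by simp
  have "ip (?AB i) ?X = ip (?A i) (?B i)" for i
    unfolding L2_inner_def by (intro Bochner_Integration.integral_cong) (auto simp: indicator_def)
  then have "(\<Sum>i<n. c i * Eb \<beta> (?A i) (?B i)) = \<beta> * ((\<Sum>i<n. c i * ip (?AB i) ?X) - (\<Sum>i<n. c i * ip (R \<beta> (?A i)) (?B i)))"
    unfolding Eb_def by (simp add: sum_subtractf[symmetric] sum_distrib_left algebra_simps)
  moreover have "0 \<le> \<beta> * ((\<Sum>i<n. c i * ip (?AB i) ?X) - (\<Sum>i<n. c i * ip (R \<beta> (?A i)) (?B i)))"
    using j k \<beta> by simp
  ultimately show ?thesis by simp
qed

text \<open>The finite-measure restriction, which put the constants \<open>a i q\<close> times the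
  indicator of \<open>X\<close> into \<open>H\<close>, is removed by exhaustion and L2 continuity of
  \<open>Eb \<beta>\<close>.\<close>

lemma Eb_BD:
  fixes a b :: "nat \<Rightarrow> real \<times> real \<Rightarrow> real"
  assumes \<beta>: "0 < \<beta>"
    and um: "u1 \<in> borel_measurable \<mu>" "u2 \<in> borel_measurable \<mu>"
    and bd: "\<And>x. \<bar>u1 x\<bar> \<le> M" "\<And>x. \<bar>u2 x\<bar> \<le> M"
    and cont: "\<And>i. i < n \<Longrightarrow> continuous_on UNIV (a i)" "\<And>i. i < n \<Longrightarrow> continuous_on UNIV (b i)"
    and aH: "\<And>i. i < n \<Longrightarrow> (\<lambda>x. a i (u1 x, u2 x)) \<in> H"
    and bH: "\<And>i. i < n \<Longrightarrow> (\<lambda>x. b i (u1 x, u2 x)) \<in> H"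
    and jump: "\<And>s s'. 0 \<le> (\<Sum>i<n. c i * ((a i s - a i s') * (b i s - b i s')))"
    and kill: "\<And>s. 0 \<le> (\<Sum>i<n. c i * (a i s * b i s))"
  shows "0 \<le> (\<Sum>i<n. c i * Eb \<beta> (\<lambda>x. a i (u1 x, u2 x)) (\<lambda>x. b i (u1 x, u2 x)))"
proof -
  obtain X :: "nat \<Rightarrow> 'a set" where X: "range X \<subseteq> sets \<mu>" "(\<Union>i. X i) = space \<mu>"
    "\<And>i. emeasure \<mu> (X i) \<noteq> \<infinity>" "incseq X" using sigma_finite_incseq by blast
  have lim: "L2_lim (\<lambda>m x. indicator (X m) x * f x) f" if f: "f \<in> H" for f
  proof (rule L2_lim_dominated[OF f])
    show "(\<lambda>x. indicator (X m) x * f x) \<in> borel_measurable \<mu>" for m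
      using H_meas[OF f] X(1) by (auto intro!: borel_measurable_times borel_measurable_indicator)
    show "AE x in \<mu>. \<bar>indicator (X m) x * f x\<bar> \<le> \<bar>f x\<bar>" for m by (auto simp: indicator_def)
    show "AE x in \<mu>. (\<lambda>m. indicator (X m) x * f x) \<longlonglongrightarrow> f x"
    proof (rule AE_I2, rule tendsto_eventually)
      fix x assume "x \<in> space \<mu>"
      then obtain N where "x \<in> X N" using X(2) by auto
      then have "\<forall>m\<ge>N. indicator (X m) x * f x = f x" using incseqD[OF X(4)] by (auto simp: indicator_def)
      then show "\<forall>\<^sub>F m in sequentially. indicator (X m) x * f x = f x" by (auto simp: eventually_sequentially)
    qed
  qed (use H_meas[OF f] in auto)
  have "0 \<le> (\<Sum>i<n. c i * Eb \<beta> (\<lambda>x. indicator (X m) x * a i (u1 x, u2 x)) (\<lambda>x. indicator (X m) x * b i (u1 x, u2 x)))" for m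
    by (rule Eb_BD_finite[OF \<beta> um bd cont jump kill]) (use X in \<open>auto simp: less_top\<close>)
  moreover have "(\<lambda>m. \<Sum>i<n. c i * Eb \<beta> (\<lambda>x. indicator (X m) x * a i (u1 x, u2 x)) (\<lambda>x. indicator (X m) x * b i (u1 x, u2 x)))
    \<longlonglongrightarrow> (\<Sum>i<n. c i * Eb \<beta> (\<lambda>x. a i (u1 x, u2 x)) (\<lambda>x. b i (u1 x, u2 x)))"
    using aH bH by (intro tendsto_sum tendsto_mult tendsto_const Eb_L2_lim2 lim \<beta>) auto
  ultimately show ?thesis by (intro LIMSEQ_le_const) auto
qed

end

section \<open>Normal contractions, products and Caccioppoli inequalities\<close>

context dirichlet_setting
begin

lemma less4: "i < (4::nat) \<longleftrightarrow> i = 0 \<or> i = 1 \<or> i = 2 \<or> i = 3"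
  by auto

lemma sum4: "(\<Sum>i<(4::nat). f i) = f 0 + f 1 + f 2 + f (3::nat)" for f :: "nat \<Rightarrow> real"
  by (simp add: eval_nat_numeral)

text \<open>Four products cover every application below; shorter inequalities are padded with
  coefficient 0.\<close>

lemma Eb_BD4:
  fixes a1 b1 a2 b2 a3 b3 a4 b4 :: "real \<Rightarrow> real \<Rightarrow> real"
  assumes \<beta>: "0 < \<beta>"
    and um: "u1 \<in> borel_measurable \<mu>" "u2 \<in> borel_measurable \<mu>"
    and bd: "\<And>x. \<bar>u1 x\<bar> \<le> M" "\<And>x. \<bar>u2 x\<bar> \<le> M"
    and cont: "continuous_on UNIV (\<lambda>z. a1 (fst z) (snd z))" "continuous_on UNIV (\<lambda>z. b1 (fst z) (snd z))"
      "continuous_on UNIV (\<lambda>z. a2 (fst z) (snd z))" "continuous_on UNIV (\<lambda>z. b2 (fst z) (snd z))"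
      "continuous_on UNIV (\<lambda>z. a3 (fst z) (snd z))" "continuous_on UNIV (\<lambda>z. b3 (fst z) (snd z))"
      "continuous_on UNIV (\<lambda>z. a4 (fst z) (snd z))" "continuous_on UNIV (\<lambda>z. b4 (fst z) (snd z))"
    and H: "(\<lambda>x. a1 (u1 x) (u2 x)) \<in> H" "(\<lambda>x. b1 (u1 x) (u2 x)) \<in> H"
      "(\<lambda>x. a2 (u1 x) (u2 x)) \<in> H" "(\<lambda>x. b2 (u1 x) (u2 x)) \<in> H"
      "(\<lambda>x. a3 (u1 x) (u2 x)) \<in> H" "(\<lambda>x. b3 (u1 x) (u2 x)) \<in> H"
      "(\<lambda>x. a4 (u1 x) (u2 x)) \<in> H" "(\<lambda>x. b4 (u1 x) (u2 x)) \<in> H"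
    and jump: "\<And>s t s' t'. 0 \<le> c1 * ((a1 s t - a1 s' t') * (b1 s t - b1 s' t'))
      + c2 * ((a2 s t - a2 s' t') * (b2 s t - b2 s' t'))
      + c3 * ((a3 s t - a3 s' t') * (b3 s t - b3 s' t'))
      + c4 * ((a4 s t - a4 s' t') * (b4 s t - b4 s' t'))"
    and kill: "\<And>s t. 0 \<le> c1 * (a1 s t * b1 s t) + c2 * (a2 s t * b2 s t)
      + c3 * (a3 s t * b3 s t) + c4 * (a4 s t * b4 s t)"
  shows "0 \<le> c1 * Eb \<beta> (\<lambda>x. a1 (u1 x) (u2 x)) (\<lambda>x. b1 (u1 x) (u2 x))
    + c2 * Eb \<beta> (\<lambda>x. a2 (u1 x) (u2 x)) (\<lambda>x. b2 (u1 x) (u2 x))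
    + c3 * Eb \<beta> (\<lambda>x. a3 (u1 x) (u2 x)) (\<lambda>x. b3 (u1 x) (u2 x))
    + c4 * Eb \<beta> (\<lambda>x. a4 (u1 x) (u2 x)) (\<lambda>x. b4 (u1 x) (u2 x))"
proof -
  let ?a = "\<lambda>i z. ([a1, a2, a3, a4] ! i) (fst z) (snd z)"
  let ?b = "\<lambda>i z. ([b1, b2, b3, b4] ! i) (fst z) (snd z)"
  let ?c = "\<lambda>i. [c1, c2, c3, c4] ! i"
  have "0 \<le> (\<Sum>i<4. ?c i * Eb \<beta> (\<lambda>x. ?a i (u1 x, u2 x)) (\<lambda>x. ?b i (u1 x, u2 x)))"
    by (rule Eb_BD[OF \<beta> um bd]) (use cont H jump kill in \<open>auto simp: less4 sum4\<close>)
  then show ?thesis by (simp add: sum4)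
qed

lemma E_BD4:
  fixes a1 b1 a2 b2 a3 b3 a4 b4 :: "real \<Rightarrow> real \<Rightarrow> real"
  assumes um: "u1 \<in> borel_measurable \<mu>" "u2 \<in> borel_measurable \<mu>"
    and bd: "\<And>x. \<bar>u1 x\<bar> \<le> M" "\<And>x. \<bar>u2 x\<bar> \<le> M"
    and cont: "continuous_on UNIV (\<lambda>z. a1 (fst z) (snd z))" "continuous_on UNIV (\<lambda>z. b1 (fst z) (snd z))"
      "continuous_on UNIV (\<lambda>z. a2 (fst z) (snd z))" "continuous_on UNIV (\<lambda>z. b2 (fst z) (snd z))"
      "continuous_on UNIV (\<lambda>z. a3 (fst z) (snd z))" "continuous_on UNIV (\<lambda>z. b3 (fst z) (snd z))"
      "continuous_on UNIV (\<lambda>z. a4 (fst z) (snd z))" "continuous_on UNIV (\<lambda>z. b4 (fst z) (snd z))"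
    and F: "(\<lambda>x. a1 (u1 x) (u2 x)) \<in> \<F>" "(\<lambda>x. b1 (u1 x) (u2 x)) \<in> \<F>"
      "(\<lambda>x. a2 (u1 x) (u2 x)) \<in> \<F>" "(\<lambda>x. b2 (u1 x) (u2 x)) \<in> \<F>"
      "(\<lambda>x. a3 (u1 x) (u2 x)) \<in> \<F>" "(\<lambda>x. b3 (u1 x) (u2 x)) \<in> \<F>"
      "(\<lambda>x. a4 (u1 x) (u2 x)) \<in> \<F>" "(\<lambda>x. b4 (u1 x) (u2 x)) \<in> \<F>"
    and jump: "\<And>s t s' t'. 0 \<le> c1 * ((a1 s t - a1 s' t') * (b1 s t - b1 s' t'))
      + c2 * ((a2 s t - a2 s' t') * (b2 s t - b2 s' t'))
      + c3 * ((a3 s t - a3 s' t') * (b3 s t - b3 s' t'))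
      + c4 * ((a4 s t - a4 s' t') * (b4 s t - b4 s' t'))"
    and kill: "\<And>s t. 0 \<le> c1 * (a1 s t * b1 s t) + c2 * (a2 s t * b2 s t)
      + c3 * (a3 s t * b3 s t) + c4 * (a4 s t * b4 s t)"
  shows "0 \<le> c1 * \<E> (\<lambda>x. a1 (u1 x) (u2 x)) (\<lambda>x. b1 (u1 x) (u2 x))
    + c2 * \<E> (\<lambda>x. a2 (u1 x) (u2 x)) (\<lambda>x. b2 (u1 x) (u2 x))
    + c3 * \<E> (\<lambda>x. a3 (u1 x) (u2 x)) (\<lambda>x. b3 (u1 x) (u2 x))
    + c4 * \<E> (\<lambda>x. a4 (u1 x) (u2 x)) (\<lambda>x. b4 (u1 x) (u2 x))"
proof -
  let ?Eb = "\<lambda>m. c1 * Eb (real m + 1) (\<lambda>x. a1 (u1 x) (u2 x)) (\<lambda>x. b1 (u1 x) (u2 x))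
    + c2 * Eb (real m + 1) (\<lambda>x. a2 (u1 x) (u2 x)) (\<lambda>x. b2 (u1 x) (u2 x))
    + c3 * Eb (real m + 1) (\<lambda>x. a3 (u1 x) (u2 x)) (\<lambda>x. b3 (u1 x) (u2 x))
    + c4 * Eb (real m + 1) (\<lambda>x. a4 (u1 x) (u2 x)) (\<lambda>x. b4 (u1 x) (u2 x))"
  have "?Eb \<longlonglongrightarrow> c1 * \<E> (\<lambda>x. a1 (u1 x) (u2 x)) (\<lambda>x. b1 (u1 x) (u2 x))
    + c2 * \<E> (\<lambda>x. a2 (u1 x) (u2 x)) (\<lambda>x. b2 (u1 x) (u2 x))
    + c3 * \<E> (\<lambda>x. a3 (u1 x) (u2 x)) (\<lambda>x. b3 (u1 x) (u2 x))
    + c4 * \<E> (\<lambda>x. a4 (u1 x) (u2 x)) (\<lambda>x. b4 (u1 x) (u2 x))"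
    by (intro tendsto_add tendsto_mult tendsto_const Eb_lim F)
  moreover have "0 \<le> ?Eb m" for m
    by (rule Eb_BD4[OF _ um bd cont F[THEN F_H] jump kill]) simp
  ultimately show ?thesis by (intro LIMSEQ_le_const) auto
qed

lemma contraction_continuous:
  fixes T :: "real \<Rightarrow> real"
  assumes "\<And>s s'. \<bar>T s - T s'\<bar> \<le> \<bar>s - s'\<bar>"
  shows "continuous_on Z T"
proof (rule lipschitz_on_continuous_on)
  show "1-lipschitz_on Z T" by (rule lipschitz_onI) (use assms in \<open>auto simp: dist_real_def\<close>)
qed

lemma contraction_abs: 
  fixes T :: "real \<Rightarrow> real"
  assumes "\<And>s s'. \<bar>T s - T s'\<bar> \<le> \<bar>s - s'\<bar>" "T 0 = 0" shows "\<bar>T s\<bar> \<le> \<bar>s\<bar>"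
  using assms(1)[of s 0] assms(2) by simp

text \<open>The Markov property in the hypotheses concerns clipping to \<open>[0, 1]\<close>; here
  the jump inequality \<open>(T s - T s')\<^sup>2 \<le> (s - s')\<^sup>2\<close> extends it to every
  normal contraction of a bounded function.\<close>

lemma F_contraction:
  fixes T :: "real \<Rightarrow> real"
  assumes u: "u \<in> \<F>" and bd: "\<And>x. \<bar>u x\<bar> \<le> M"
    and T: "\<And>s s'. \<bar>T s - T s'\<bar> \<le> \<bar>s - s'\<bar>" and T0: "T 0 = 0"
  shows "(\<lambda>x. T (u x)) \<in> \<F>" "\<E> (\<lambda>x. T (u x)) (\<lambda>x. T (u x)) \<le> \<E> u u"
proof -
  have c: "continuous_on Z T" for Z using contraction_continuous[OF T] .
  have um: "u \<in> borel_measurable \<mu>" using u by (rule F_meas)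
  have H: "(\<lambda>x. T (u x)) \<in> H"
    by (rule H_bound[OF F_H[OF u]])
      (use borel_measurable_continuous_onI[OF c] um contraction_abs[OF T T0] in auto)
  have le: "Eb (real n + 1) (\<lambda>x. T (u x)) (\<lambda>x. T (u x)) \<le> Eb (real n + 1) u u" for n
  proof -
    have "0 \<le> 1 * Eb (real n + 1) (\<lambda>x. u x) (\<lambda>x. u x) + (-1) * Eb (real n + 1) (\<lambda>x. T (u x)) (\<lambda>x. T (u x))
      + 0 * Eb (real n + 1) (\<lambda>x. u x) (\<lambda>x. u x) + 0 * Eb (real n + 1) (\<lambda>x. u x) (\<lambda>x. u x)"
    proof (rule Eb_BD4[OF _ um um bd bd, of _ "\<lambda>s t. s" "\<lambda>s t. s" "\<lambda>s t. T s" "\<lambda>s t. T s" "\<lambda>s t. s" "\<lambda>s t. s" "\<lambda>s t. s" "\<lambda>s t. s"])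
      show "continuous_on UNIV (\<lambda>z::real \<times> real. T (fst z))" "continuous_on UNIV (\<lambda>z::real \<times> real. T (fst z))"
        by (intro continuous_on_compose2[OF c[of UNIV]] continuous_intros; simp)+
      show "0 \<le> 1 * ((s - s') * (s - s')) + - 1 * ((T s - T s') * (T s - T s')) + 0 * ((s - s') * (s - s')) + 0 * ((s - s') * (s - s'))" for s t s' t' :: real
        using T[of s s'] unfolding abs_le_square_iff by (simp add: power2_eq_square)
      show "0 \<le> 1 * (s * s) + - 1 * (T s * T s) + 0 * (s * s) + 0 * (s * s)" for s t :: real
        using contraction_abs[OF T T0, of s] unfolding abs_le_square_iff by (simp add: power2_eq_square)
    qed (auto intro!: continuous_intros H F_H[OF u])
    then show ?thesis by simp
  qed
  have le': "Eb (real n + 1) (\<lambda>x. T (u x)) (\<lambda>x. T (u x)) \<le> \<E> u u" for n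
    using le[of n] Eb_le_E[OF _ u, of "real n + 1"] by simp
  show F: "(\<lambda>x. T (u x)) \<in> \<F>" by (rule F_I_Eb[OF H le'])
  show "\<E> (\<lambda>x. T (u x)) (\<lambda>x. T (u x)) \<le> \<E> u u"
    by (rule LIMSEQ_le_const2[OF Eb_lim_self[OF F]]) (use le' in blast)
qed

lemma F_mult:
  assumes f: "f \<in> \<F>" and g: "g \<in> \<F>" and bd: "\<And>x. \<bar>f x\<bar> \<le> M" "\<And>x. \<bar>g x\<bar> \<le> M"
  shows "(\<lambda>x. f x * g x) \<in> \<F>" "\<E> (\<lambda>x. f x * g x) (\<lambda>x. f x * g x) \<le> 2 * M\<^sup>2 * (\<E> f f + \<E> g g)"
proof -
  have M0: "0 \<le> M" using bd(1)[of undefined] by linarith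
  have fm: "f \<in> borel_measurable \<mu>" "g \<in> borel_measurable \<mu>" using f g by (auto intro: F_meas)
  have H: "(\<lambda>x. f x * g x) \<in> H" by (rule H_bmult[OF F_H[OF g] fm(1) bd(1)])
  \<comment> \<open>The jump inequality has to hold for all real arguments, while the product is
    Lipschitz only on bounded sets; clamping changes nothing on the ranges of \<open>f\<close> and
    \<open>g\<close>.\<close>
  define cl where "cl = (\<lambda>s::real. max (- M) (min M s))"
  have cl: "\<bar>cl s\<bar> \<le> M" "\<bar>cl s - cl s'\<bar> \<le> \<bar>s - s'\<bar>" "\<bar>cl s\<bar> \<le> \<bar>s\<bar>" for s s' using M0 by (auto simp: cl_def)
  have clid: "cl (f x) = f x" "cl (g x) = g x" for x using bd[of x] by (auto simp: cl_def abs_le_iff)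
  have c: "continuous_on Z cl" for Z unfolding cl_def by (intro continuous_intros)
  have le: "Eb (real n + 1) (\<lambda>x. f x * g x) (\<lambda>x. f x * g x) \<le> 2 * M\<^sup>2 * (Eb (real n + 1) f f + Eb (real n + 1) g g)" for n
  proof -
    have "0 \<le> (2 * M\<^sup>2) * Eb (real n + 1) (\<lambda>x. f x) (\<lambda>x. f x) + (2 * M\<^sup>2) * Eb (real n + 1) (\<lambda>x. g x) (\<lambda>x. g x)
      + (-1) * Eb (real n + 1) (\<lambda>x. cl (f x) * cl (g x)) (\<lambda>x. cl (f x) * cl (g x)) + 0 * Eb (real n + 1) (\<lambda>x. f x) (\<lambda>x. f x)"
    proof (rule Eb_BD4[OF _ fm bd, of _ "\<lambda>s t. s" "\<lambda>s t. s" "\<lambda>s t. t" "\<lambda>s t. t" "\<lambda>s t. cl s * cl t" "\<lambda>s t. cl s * cl t" "\<lambda>s t. s" "\<lambda>s t. s"])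
      show "continuous_on UNIV (\<lambda>z::real \<times> real. cl (fst z) * cl (snd z))" "continuous_on UNIV (\<lambda>z::real \<times> real. cl (fst z) * cl (snd z))"
        by (intro continuous_intros continuous_on_compose2[OF c[of UNIV]]; simp)+
      show "0 \<le> 2 * M\<^sup>2 * ((s - s') * (s - s')) + 2 * M\<^sup>2 * ((t - t') * (t - t')) + - 1 * ((cl s * cl t - cl s' * cl t') * (cl s * cl t - cl s' * cl t')) + 0 * ((s - s') * (s - s'))" for s t s' t'
      proof -
        have e: "cl s * cl t - cl s' * cl t' = cl s * (cl t - cl t') + cl t' * (cl s - cl s')" by (simp add: algebra_simps)
        have "\<bar>cl s * cl t - cl s' * cl t'\<bar> \<le> M * \<bar>t - t'\<bar> + M * \<bar>s - s'\<bar>"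
          unfolding e by (rule order_trans[OF abs_triangle_ineq]) (auto simp: abs_mult intro!: add_mono mult_mono cl M0)
        then have "(cl s * cl t - cl s' * cl t')\<^sup>2 \<le> (M * \<bar>t - t'\<bar> + M * \<bar>s - s'\<bar>)\<^sup>2"
          using power_mono[of "\<bar>cl s * cl t - cl s' * cl t'\<bar>" _ 2] by fastforce
        also have "\<dots> \<le> 2 * (M * \<bar>t - t'\<bar>)\<^sup>2 + 2 * (M * \<bar>s - s'\<bar>)\<^sup>2"
          using sum_squares_bound[of "M * \<bar>t - t'\<bar>" "M * \<bar>s - s'\<bar>"] by (simp add: power2_sum)
        also have "\<dots> = 2 * M\<^sup>2 * (s - s')\<^sup>2 + 2 * M\<^sup>2 * (t - t')\<^sup>2" by (simp add: power_mult_distrib)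
        finally show ?thesis by (simp add: power2_eq_square)
      qed
      show "0 \<le> 2 * M\<^sup>2 * (s * s) + 2 * M\<^sup>2 * (t * t) + - 1 * (cl s * cl t * (cl s * cl t)) + 0 * (s * s)" for s t
      proof -
        have "\<bar>cl s * cl t\<bar> \<le> M * \<bar>t\<bar>" unfolding abs_mult by (intro mult_mono cl M0) simp
        then have "(cl s * cl t)\<^sup>2 \<le> (M * \<bar>t\<bar>)\<^sup>2" using power_mono[of "\<bar>cl s * cl t\<bar>" "M * \<bar>t\<bar>" 2] by simp
        also have "\<dots> = M\<^sup>2 * t\<^sup>2" by (simp add: power_mult_distrib)
        finally have "cl s * cl t * (cl s * cl t) \<le> M\<^sup>2 * (t * t)" by (simp only: power2_eq_square)
        moreover have "0 \<le> M\<^sup>2 * (t * t)" "0 \<le> M\<^sup>2 * (s * s)" by simp_all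
        ultimately show ?thesis by linarith
      qed
    qed (auto intro!: continuous_intros F_H f g simp: clid H)
    then show ?thesis by (simp add: clid algebra_simps)
  qed
  have le': "Eb (real n + 1) (\<lambda>x. f x * g x) (\<lambda>x. f x * g x) \<le> 2 * M\<^sup>2 * (\<E> f f + \<E> g g)" for n
    using le[of n] mult_left_mono[OF add_mono[OF Eb_le_E[OF _ f] Eb_le_E[OF _ g], of "real n + 1" "real n + 1"], of "2 * M\<^sup>2"]
    by simp
  show F: "(\<lambda>x. f x * g x) \<in> \<F>" by (rule F_I_Eb[OF H le'])
  show "\<E> (\<lambda>x. f x * g x) (\<lambda>x. f x * g x) \<le> 2 * M\<^sup>2 * (\<E> f f + \<E> g g)"
    by (rule LIMSEQ_le_const2[OF Eb_lim_self[OF F]]) (use le' in blast)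
qed

lemma F_mult_bounded:
  assumes "f \<in> \<F>" "g \<in> \<F>" "\<And>x. \<bar>f x\<bar> \<le> M" "\<And>x. \<bar>g x\<bar> \<le> N"
  shows "(\<lambda>x. f x * g x) \<in> \<F>"
proof (rule F_mult(1)[OF assms(1,2)])
  show "\<bar>f x\<bar> \<le> max M N" "\<bar>g x\<bar> \<le> max M N" for x using assms(3,4)[of x] by linarith+
qed

lemma F_sq: "f \<in> \<F> \<Longrightarrow> (\<And>x. \<bar>f x\<bar> \<le> M) \<Longrightarrow> (\<lambda>x. (f x)\<^sup>2) \<in> \<F>"
  unfolding power2_eq_square by (rule F_mult(1))

text \<open>The density of the energy measure of \<open>h\<close>, as a functional of the test function.\<close>

definition K :: "('a \<Rightarrow> real) \<Rightarrow> ('a \<Rightarrow> real) \<Rightarrow> real" where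
  "K h \<phi> = \<E> (\<lambda>x. \<phi> x * h x) h - \<E> (\<lambda>x. (h x)\<^sup>2) \<phi> / 2"

text \<open>Each of the following estimates reduces to its jump form, where \<open>K h \<phi>\<close> contributes
  \<open>(\<phi> + \<phi>') (h - h')\<^sup>2 / 2\<close>.\<close>

lemma K_jump: "(p * t - p' * t') * (t - t') - (t\<^sup>2 - t'\<^sup>2) * (p - p') / 2 = (p + p') * (t - t')\<^sup>2 / 2" for p t :: real
  by (simp add: field_simps power2_eq_square)

lemma K_contraction:
  fixes T :: "real \<Rightarrow> real"
  assumes h: "h \<in> \<F>" and \<phi>: "\<phi> \<in> \<F>" and bd: "\<And>x. \<bar>h x\<bar> \<le> M" "\<And>x. \<bar>\<phi> x\<bar> \<le> M" and pos: "\<And>x. 0 \<le> \<phi> x"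
    and T: "\<And>s s'. \<bar>T s - T s'\<bar> \<le> \<bar>s - s'\<bar>" and T0: "T 0 = 0"
  shows "K (\<lambda>x. T (h x)) \<phi> \<le> K h \<phi>"
proof -
  have c: "continuous_on Z T" for Z using contraction_continuous[OF T] .
  have m: "h \<in> borel_measurable \<mu>" "\<phi> \<in> borel_measurable \<mu>" using h \<phi> by (auto intro: F_meas)
  have Tb: "\<bar>T (h x)\<bar> \<le> M" for x using contraction_abs[OF T T0, of "h x"] bd(1)[of x] by linarith
  have Th: "(\<lambda>x. T (h x)) \<in> \<F>" by (rule F_contraction(1)[OF h bd(1) T T0])
  \<comment> \<open>The \<open>max 0\<close> makes the jump inequality true for negative arguments
    too; it disappears because \<open>\<phi>\<close> is nonnegative.\<close>
  have "0 \<le> 1 * \<E> (\<lambda>x. max 0 (\<phi> x) * h x) (\<lambda>x. h x) + (- 1 / 2) * \<E> (\<lambda>x. (h x)\<^sup>2) (\<lambda>x. max 0 (\<phi> x))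
    + (- 1) * \<E> (\<lambda>x. max 0 (\<phi> x) * T (h x)) (\<lambda>x. T (h x)) + (1 / 2) * \<E> (\<lambda>x. (T (h x))\<^sup>2) (\<lambda>x. max 0 (\<phi> x))"
  proof (rule E_BD4[OF m bd, of "\<lambda>s t. max 0 t * s" "\<lambda>s t. s" "\<lambda>s t. s\<^sup>2" "\<lambda>s t. max 0 t" "\<lambda>s t. max 0 t * T s" "\<lambda>s t. T s" "\<lambda>s t. (T s)\<^sup>2" "\<lambda>s t. max 0 t"])
    show "0 \<le> 1 * ((max 0 t * s - max 0 t' * s') * (s - s')) + - 1 / 2 * ((s\<^sup>2 - s'\<^sup>2) * (max 0 t - max 0 t'))
      + - 1 * ((max 0 t * T s - max 0 t' * T s') * (T s - T s')) + 1 / 2 * (((T s)\<^sup>2 - (T s')\<^sup>2) * (max 0 t - max 0 t'))" for s t s' t' :: real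
    proof -
      have "(T s - T s')\<^sup>2 \<le> (s - s')\<^sup>2" using T[of s s'] unfolding abs_le_square_iff .
      then have "(max 0 t + max 0 t') * (T s - T s')\<^sup>2 / 2 \<le> (max 0 t + max 0 t') * (s - s')\<^sup>2 / 2"
        by (intro divide_right_mono mult_left_mono) auto
      then show ?thesis using K_jump[of "max 0 t" s "max 0 t'" s'] K_jump[of "max 0 t" "T s" "max 0 t'" "T s'"] by linarith
    qed
    show "0 \<le> 1 * (max 0 t * s * s) + - 1 / 2 * (s\<^sup>2 * max 0 t) + - 1 * (max 0 t * T s * T s) + 1 / 2 * ((T s)\<^sup>2 * max 0 t)" for s t :: real
    proof -
      have "(T s)\<^sup>2 \<le> s\<^sup>2" using contraction_abs[OF T T0, of s] unfolding abs_le_square_iff .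
      then have "max 0 t * (T s)\<^sup>2 \<le> max 0 t * s\<^sup>2" by (intro mult_left_mono) auto
      moreover have "max 0 t * s * s = max 0 t * s\<^sup>2" "max 0 t * T s * T s = max 0 t * (T s)\<^sup>2"
        "s\<^sup>2 * max 0 t = max 0 t * s\<^sup>2" "(T s)\<^sup>2 * max 0 t = max 0 t * (T s)\<^sup>2" by (simp_all add: power2_eq_square)
      ultimately show ?thesis by linarith
    qed
    show "(\<lambda>x. max 0 (\<phi> x) * h x) \<in> \<F>" "(\<lambda>x. max 0 (\<phi> x)) \<in> \<F>"  "(\<lambda>x. max 0 (\<phi> x)) \<in> \<F>" "(\<lambda>x. max 0 (\<phi> x) * T (h x)) \<in> \<F>"
      using pos F_mult(1)[OF \<phi> h bd(2,1)] F_mult(1)[OF \<phi> Th bd(2) Tb] \<phi> by (simp_all add: max_absorb2)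
    show "(\<lambda>x. (h x)\<^sup>2) \<in> \<F>" by (rule F_sq[OF h bd(1)])
    show "(\<lambda>x. (T (h x))\<^sup>2) \<in> \<F>" by (rule F_sq[OF Th Tb])
  qed (auto intro!: continuous_intros continuous_on_compose2[OF c[of UNIV]] h Th)
  then show ?thesis using pos by (simp add: K_def max_absorb2)
qed

text \<open>Composed with a tent function of height above \<open>\<delta>\<close> this is a plateau
  cutoff: equal to 1 where the tent exceeds \<open>\<delta>\<close>, with slope at most
  \<open>1 / \<delta>\<close> times that of the tent.\<close>

definition cut :: "real \<Rightarrow> real \<Rightarrow> real" where "cut \<delta> t = min 1 (max 0 (t / \<delta>))"

lemma cut_props:
  assumes "0 < \<delta>"
  shows "0 \<le> cut \<delta> t" "cut \<delta> t \<le> 1" "\<bar>cut \<delta> t\<bar> \<le> 1" "\<bar>cut \<delta> t - cut \<delta> t'\<bar> \<le> \<bar>t - t'\<bar> / \<delta>"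
    "(cut \<delta> t - cut \<delta> t')\<^sup>2 \<le> (t - t')\<^sup>2 / \<delta>\<^sup>2" "continuous_on Z (cut \<delta>)" "cut \<delta> 0 = 0"
proof -
  show "0 \<le> cut \<delta> t" "cut \<delta> t \<le> 1" "\<bar>cut \<delta> t\<bar> \<le> 1" "cut \<delta> 0 = 0" by (auto simp: cut_def)
  have "\<bar>cut \<delta> t - cut \<delta> t'\<bar> \<le> \<bar>t / \<delta> - t' / \<delta>\<bar>" by (auto simp: cut_def)
  then show 1: "\<bar>cut \<delta> t - cut \<delta> t'\<bar> \<le> \<bar>t - t'\<bar> / \<delta>" using assms by (simp add: diff_divide_distrib[symmetric] abs_divide)
  have "\<bar>cut \<delta> t - cut \<delta> t'\<bar>\<^sup>2 \<le> (\<bar>t - t'\<bar> / \<delta>)\<^sup>2" by (rule power_mono[OF 1]) simp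
  then show "(cut \<delta> t - cut \<delta> t')\<^sup>2 \<le> (t - t')\<^sup>2 / \<delta>\<^sup>2" by (simp add: power_divide)
  show "continuous_on Z (cut \<delta>)" unfolding cut_def using assms by (intro continuous_intros) auto
qed

lemma F_cut:
  assumes h: "h \<in> \<F>" and bd: "\<And>x. \<bar>h x\<bar> \<le> M" and \<delta>: "0 < \<delta>"
  shows "(\<lambda>x. cut \<delta> (h x)) \<in> \<F>"
proof -
  have "(\<lambda>x. cut \<delta> (\<delta> * ((1 / \<delta>) * h x))) \<in> \<F>"
  proof (rule F_contraction(1)[OF F_cmult[OF h], of "1 / \<delta>" "M / \<delta>" "\<lambda>s. cut \<delta> (\<delta> * s)"])
    show "\<bar>1 / \<delta> * h x\<bar> \<le> M / \<delta>" for x using bd[of x] \<delta> by (simp add: abs_divide divide_right_mono)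
    show "\<bar>cut \<delta> (\<delta> * s) - cut \<delta> (\<delta> * s')\<bar> \<le> \<bar>s - s'\<bar>" for s s'
      using cut_props(4)[OF \<delta>, of "\<delta> * s" "\<delta> * s'"] \<delta> by (simp add: right_diff_distrib[symmetric] abs_mult)
  qed (simp add: cut_props \<delta>)
  then show ?thesis using \<delta> by simp
qed

lemma pos_part_F:
  assumes u: "u \<in> \<F>" and bd: "\<And>x. \<bar>u x\<bar> \<le> M" and k: "0 \<le> k"
  shows "(\<lambda>x. max 0 (u x - k)) \<in> \<F>" "\<E> (\<lambda>x. max 0 (u x - k)) (\<lambda>x. max 0 (u x - k)) \<le> \<E> u u"
    "\<bar>max 0 (u x - k)\<bar> \<le> M"
proof -
  have T: "\<bar>max 0 (s - k) - max 0 (s' - k)\<bar> \<le> \<bar>s - s'\<bar>" "max 0 (0 - k) = 0" for s s' using k by auto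
  show "(\<lambda>x. max 0 (u x - k)) \<in> \<F>" "\<E> (\<lambda>x. max 0 (u x - k)) (\<lambda>x. max 0 (u x - k)) \<le> \<E> u u"
    by (rule F_contraction[OF u bd T])+
  show "\<bar>max 0 (u x - k)\<bar> \<le> M" using bd[of x] k by auto
qed

text \<open>Replacing \<open>w s - w s'\<close> by \<open>s - s'\<close> only enlarges the product,
  by monotonicity of the positive part. With \<open>e\<close>, \<open>e'\<close> the cutoff values
  and \<open>w\<close>, \<open>w'\<close> the truncations, the smaller product equals
  \<open>(e w - e' w')\<^sup>2 - w w' (e - e')\<^sup>2\<close>, and the last term is controlled by
  the slope of \<open>cut\<close>.\<close>

lemma caccioppoli_jump:
  fixes s s' t t' k \<delta> :: real
  assumes \<delta>: "0 < \<delta>"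
  defines "w \<equiv> \<lambda>s. max 0 (s - k)"
  shows "(cut \<delta> t * w s - cut \<delta> t' * w s')\<^sup>2 \<le> (s - s') * ((cut \<delta> t)\<^sup>2 * w s - (cut \<delta> t')\<^sup>2 * w s')
    + ((w s)\<^sup>2 + (w s')\<^sup>2) * (t - t')\<^sup>2 / (2 * \<delta>\<^sup>2)"
proof -
  let ?e = "cut \<delta> t" let ?e' = "cut \<delta> t'" let ?w = "w s" let ?w' = "w s'"
  have w0: "0 \<le> ?w" "0 \<le> ?w'" by (auto simp: w_def)
  have 1: "(?w - ?w') * (?e\<^sup>2 * ?w - ?e'\<^sup>2 * ?w') \<le> (s - s') * (?e\<^sup>2 * ?w - ?e'\<^sup>2 * ?w')"
  proof -
    consider "k \<le> s" "k \<le> s'" | "k \<le> s" "s' < k" | "s < k" "k \<le> s'" | "s < k" "s' < k" by linarith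
    then show ?thesis
    proof cases
      case 2
      then have "?w \<le> s - s'" "?w' = 0" by (auto simp: w_def)
      then show ?thesis using w0 by (simp add: mult_right_mono)
    next
      case 3
      then have "?w' \<le> s' - s" "?w = 0" by (auto simp: w_def)
      then have "?w' * (?e'\<^sup>2 * ?w') \<le> (s' - s) * (?e'\<^sup>2 * ?w')" using w0 by (intro mult_right_mono) auto
      then show ?thesis using \<open>?w = 0\<close> by (simp add: algebra_simps)
    qed (auto simp: w_def)
  qed
  have 2: "(?w - ?w') * (?e\<^sup>2 * ?w - ?e'\<^sup>2 * ?w') = (?e * ?w - ?e' * ?w')\<^sup>2 - ?w * ?w' * (?e - ?e')\<^sup>2"
    by (simp add: power2_eq_square algebra_simps)
  have "?w * ?w' * (?e - ?e')\<^sup>2 \<le> ((?w\<^sup>2 + ?w'\<^sup>2) / 2) * ((t - t')\<^sup>2 / \<delta>\<^sup>2)"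
    using sum_squares_bound[of ?w ?w'] w0 by (intro mult_mono cut_props \<delta>) auto
  then show ?thesis using 1 2 by simp
qed

text \<open>For \<open>u = P t f\<close> the first term on the right is, up to a factor, the time
  derivative of the localised truncated mass, and the second is the cutoff error. In jump form
  \<open>K h (\<lambda>x. (w x)\<^sup>2)\<close> contributes exactly the error term of
  \<open>caccioppoli_jump\<close>.\<close>

lemma caccioppoli:
  assumes u: "u \<in> \<F>" and h: "h \<in> \<F>" and bd: "\<And>x. \<bar>u x\<bar> \<le> M" "\<And>x. \<bar>h x\<bar> \<le> M"
    and k: "0 \<le> k" and \<delta>: "0 < \<delta>"
  defines "w \<equiv> \<lambda>x. max 0 (u x - k)" and "\<eta> \<equiv> \<lambda>x. cut \<delta> (h x)"
  shows "\<E> (\<lambda>x. \<eta> x * w x) (\<lambda>x. \<eta> x * w x) \<le> \<E> u (\<lambda>x. (\<eta> x)\<^sup>2 * w x) + K h (\<lambda>x. (w x)\<^sup>2) / \<delta>\<^sup>2"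
    "(\<lambda>x. \<eta> x * w x) \<in> \<F>" "(\<lambda>x. (\<eta> x)\<^sup>2 * w x) \<in> \<F>"
proof -
  have m: "u \<in> borel_measurable \<mu>" "h \<in> borel_measurable \<mu>" using u h by (auto intro: F_meas)
  have wF: "w \<in> \<F>" and wb: "\<And>x. \<bar>w x\<bar> \<le> M" unfolding w_def using pos_part_F[OF u bd(1) k] by auto
  have eF: "\<eta> \<in> \<F>" and eb: "\<And>x. \<bar>\<eta> x\<bar> \<le> 1" unfolding \<eta>_def using F_cut[OF h bd(2) \<delta>] cut_props[OF \<delta>] by auto
  show ewF: "(\<lambda>x. \<eta> x * w x) \<in> \<F>" by (rule F_mult_bounded[OF eF wF eb wb])
  have e2b: "\<bar>(\<eta> x)\<^sup>2\<bar> \<le> 1" for x using eb[of x] by (simp add: abs_square_le_1)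
  show e2wF: "(\<lambda>x. (\<eta> x)\<^sup>2 * w x) \<in> \<F>" by (rule F_mult_bounded[OF F_sq[OF eF eb] wF e2b wb])
  have w2F: "(\<lambda>x. (w x)\<^sup>2) \<in> \<F>" by (rule F_sq[OF wF wb])
  have w2b: "\<bar>(w x)\<^sup>2\<bar> \<le> M\<^sup>2" for x using wb[of x] power_mono[of "\<bar>w x\<bar>" M 2] by simp
  have w2hF: "(\<lambda>x. (w x)\<^sup>2 * h x) \<in> \<F>" by (rule F_mult_bounded[OF w2F h w2b bd(2)])
  have h2F: "(\<lambda>x. (h x)\<^sup>2) \<in> \<F>" by (rule F_sq[OF h bd(2)])
  let ?w = "\<lambda>s. max 0 (s - k)"
  have c: "continuous_on Z (cut \<delta>)" for Z by (rule cut_props[OF \<delta>])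
  have "0 \<le> 1 * \<E> (\<lambda>x. u x) (\<lambda>x. (cut \<delta> (h x))\<^sup>2 * ?w (u x)) + (1 / \<delta>\<^sup>2) * \<E> (\<lambda>x. (?w (u x))\<^sup>2 * h x) (\<lambda>x. h x)
    + (- 1 / (2 * \<delta>\<^sup>2)) * \<E> (\<lambda>x. (h x)\<^sup>2) (\<lambda>x. (?w (u x))\<^sup>2) + (- 1) * \<E> (\<lambda>x. cut \<delta> (h x) * ?w (u x)) (\<lambda>x. cut \<delta> (h x) * ?w (u x))"
  proof (rule E_BD4[OF m bd, of "\<lambda>s t. s" "\<lambda>s t. (cut \<delta> t)\<^sup>2 * ?w s" "\<lambda>s t. (?w s)\<^sup>2 * t" "\<lambda>s t. t" "\<lambda>s t. t\<^sup>2" "\<lambda>s t. (?w s)\<^sup>2" "\<lambda>s t. cut \<delta> t * ?w s" "\<lambda>s t. cut \<delta> t * ?w s"])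
    show "0 \<le> 1 * ((s - s') * ((cut \<delta> t)\<^sup>2 * ?w s - (cut \<delta> t')\<^sup>2 * ?w s')) + 1 / \<delta>\<^sup>2 * (((?w s)\<^sup>2 * t - (?w s')\<^sup>2 * t') * (t - t'))
      + - 1 / (2 * \<delta>\<^sup>2) * ((t\<^sup>2 - t'\<^sup>2) * ((?w s)\<^sup>2 - (?w s')\<^sup>2)) + - 1 * ((cut \<delta> t * ?w s - cut \<delta> t' * ?w s') * (cut \<delta> t * ?w s - cut \<delta> t' * ?w s'))" for s t s' t' :: real
    proof -
      have "1 / \<delta>\<^sup>2 * (((?w s)\<^sup>2 * t - (?w s')\<^sup>2 * t') * (t - t')) + - 1 / (2 * \<delta>\<^sup>2) * ((t\<^sup>2 - t'\<^sup>2) * ((?w s)\<^sup>2 - (?w s')\<^sup>2))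
        = (((?w s)\<^sup>2 * t - (?w s')\<^sup>2 * t') * (t - t') - (t\<^sup>2 - t'\<^sup>2) * ((?w s)\<^sup>2 - (?w s')\<^sup>2) / 2) / \<delta>\<^sup>2"
        by (simp add: diff_divide_distrib)
      also have "\<dots> = ((?w s)\<^sup>2 + (?w s')\<^sup>2) * (t - t')\<^sup>2 / (2 * \<delta>\<^sup>2)" unfolding K_jump by simp
      finally show ?thesis using caccioppoli_jump[OF \<delta>, of t s k t' s'] by (simp add: power2_eq_square)
    qed
    show "0 \<le> 1 * (s * ((cut \<delta> t)\<^sup>2 * ?w s)) + 1 / \<delta>\<^sup>2 * ((?w s)\<^sup>2 * t * t) + - 1 / (2 * \<delta>\<^sup>2) * (t\<^sup>2 * (?w s)\<^sup>2) + - 1 * (cut \<delta> t * ?w s * (cut \<delta> t * ?w s))" for s t :: real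
    proof -
      have "?w s * ?w s \<le> s * ?w s" using k by (cases "s \<le> k") (auto intro: mult_right_mono)
      then have "(cut \<delta> t)\<^sup>2 * (?w s * ?w s) \<le> (cut \<delta> t)\<^sup>2 * (s * ?w s)" by (intro mult_left_mono) auto
      moreover have "1 / \<delta>\<^sup>2 * ((?w s)\<^sup>2 * t * t) + - 1 / (2 * \<delta>\<^sup>2) * (t\<^sup>2 * (?w s)\<^sup>2) = (t\<^sup>2 * (?w s)\<^sup>2) / (2 * \<delta>\<^sup>2)"
        by (simp add: power2_eq_square field_simps)
      moreover have "0 \<le> (t\<^sup>2 * (?w s)\<^sup>2) / (2 * \<delta>\<^sup>2)" by simp
      moreover have "s * ((cut \<delta> t)\<^sup>2 * ?w s) = (cut \<delta> t)\<^sup>2 * (s * ?w s)" "cut \<delta> t * ?w s * (cut \<delta> t * ?w s) = (cut \<delta> t)\<^sup>2 * (?w s * ?w s)"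
        by (simp_all add: power2_eq_square)
      ultimately show ?thesis by linarith
    qed
  qed (use ewF e2wF w2F w2hF h2F u h in \<open>auto simp: w_def \<eta>_def intro!: continuous_intros continuous_on_compose2[OF c[of UNIV]]\<close>)
  then show "\<E> (\<lambda>x. \<eta> x * w x) (\<lambda>x. \<eta> x * w x) \<le> \<E> u (\<lambda>x. (\<eta> x)\<^sup>2 * w x) + K h (\<lambda>x. (w x)\<^sup>2) / \<delta>\<^sup>2"
    by (simp add: K_def w_def \<eta>_def diff_divide_distrib)
qed

text \<open>Counterpart of \<open>caccioppoli\<close> for functions that solve no equation: the
  energy of \<open>f\<close> itself appears, with a factor 2.\<close>

lemma E_cut_mult:
  assumes f: "f \<in> \<F>" and h: "h \<in> \<F>" and bd: "\<And>x. \<bar>f x\<bar> \<le> M" "\<And>x. \<bar>h x\<bar> \<le> M" and \<delta>: "0 < \<delta>"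
  shows "\<E> (\<lambda>x. cut \<delta> (h x) * f x) (\<lambda>x. cut \<delta> (h x) * f x) \<le> 2 * \<E> f f + 2 * K h (\<lambda>x. (f x)\<^sup>2) / \<delta>\<^sup>2"
    "(\<lambda>x. cut \<delta> (h x) * f x) \<in> \<F>"
proof -
  have m: "f \<in> borel_measurable \<mu>" "h \<in> borel_measurable \<mu>" using f h by (auto intro: F_meas)
  have eF: "(\<lambda>x. cut \<delta> (h x)) \<in> \<F>" by (rule F_cut[OF h bd(2) \<delta>])
  show efF: "(\<lambda>x. cut \<delta> (h x) * f x) \<in> \<F>" by (rule F_mult_bounded[OF eF f cut_props(3)[OF \<delta>] bd(1)])
  have f2F: "(\<lambda>x. (f x)\<^sup>2) \<in> \<F>" by (rule F_sq[OF f bd(1)])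
  have f2b: "\<bar>(f x)\<^sup>2\<bar> \<le> M\<^sup>2" for x using bd(1)[of x] power_mono[of "\<bar>f x\<bar>" M 2] by simp
  have f2hF: "(\<lambda>x. (f x)\<^sup>2 * h x) \<in> \<F>" by (rule F_mult_bounded[OF f2F h f2b bd(2)])
  have h2F: "(\<lambda>x. (h x)\<^sup>2) \<in> \<F>" by (rule F_sq[OF h bd(2)])
  have c: "continuous_on Z (cut \<delta>)" for Z by (rule cut_props[OF \<delta>])
  have "0 \<le> 2 * \<E> (\<lambda>x. f x) (\<lambda>x. f x) + (2 / \<delta>\<^sup>2) * \<E> (\<lambda>x. (f x)\<^sup>2 * h x) (\<lambda>x. h x)
    + (- 1 / \<delta>\<^sup>2) * \<E> (\<lambda>x. (h x)\<^sup>2) (\<lambda>x. (f x)\<^sup>2) + (- 1) * \<E> (\<lambda>x. cut \<delta> (h x) * f x) (\<lambda>x. cut \<delta> (h x) * f x)"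
  proof (rule E_BD4[OF m bd, of "\<lambda>s t. s" "\<lambda>s t. s" "\<lambda>s t. s\<^sup>2 * t" "\<lambda>s t. t" "\<lambda>s t. t\<^sup>2" "\<lambda>s t. s\<^sup>2" "\<lambda>s t. cut \<delta> t * s" "\<lambda>s t. cut \<delta> t * s"])
    show "0 \<le> 2 * ((s - s') * (s - s')) + 2 / \<delta>\<^sup>2 * ((s\<^sup>2 * t - s'\<^sup>2 * t') * (t - t'))
      + - 1 / \<delta>\<^sup>2 * ((t\<^sup>2 - t'\<^sup>2) * (s\<^sup>2 - s'\<^sup>2)) + - 1 * ((cut \<delta> t * s - cut \<delta> t' * s') * (cut \<delta> t * s - cut \<delta> t' * s'))" for s t s' t' :: real
    proof -
      let ?e = "cut \<delta> t" let ?e' = "cut \<delta> t'"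
      have "2 / \<delta>\<^sup>2 * ((s\<^sup>2 * t - s'\<^sup>2 * t') * (t - t')) + - 1 / \<delta>\<^sup>2 * ((t\<^sup>2 - t'\<^sup>2) * (s\<^sup>2 - s'\<^sup>2))
        = 2 * ((s\<^sup>2 * t - s'\<^sup>2 * t') * (t - t') - (t\<^sup>2 - t'\<^sup>2) * (s\<^sup>2 - s'\<^sup>2) / 2) / \<delta>\<^sup>2"
        by (simp add: diff_divide_distrib)
      also have "\<dots> = (s\<^sup>2 + s'\<^sup>2) * ((t - t')\<^sup>2 / \<delta>\<^sup>2)" unfolding K_jump by simp
      finally have 1: "2 / \<delta>\<^sup>2 * ((s\<^sup>2 * t - s'\<^sup>2 * t') * (t - t')) + - 1 / \<delta>\<^sup>2 * ((t\<^sup>2 - t'\<^sup>2) * (s\<^sup>2 - s'\<^sup>2)) = (s\<^sup>2 + s'\<^sup>2) * ((t - t')\<^sup>2 / \<delta>\<^sup>2)" .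
      have 2: "(s\<^sup>2 + s'\<^sup>2) * (?e - ?e')\<^sup>2 \<le> (s\<^sup>2 + s'\<^sup>2) * ((t - t')\<^sup>2 / \<delta>\<^sup>2)" by (intro mult_left_mono cut_props \<delta>) simp
      \<comment> \<open>Symmetric product rule for differences: each increment is multiplied by the
        mean of the other factor, so that the squares match the jump form of
        \<open>K\<close>.\<close>
      define A where "A = (?e + ?e') / 2 * (s - s')"
      define B where "B = (s + s') / 2 * (?e - ?e')"
      have AB: "?e * s - ?e' * s' = A + B" by (simp add: A_def B_def field_simps)
      have "(A + B)\<^sup>2 \<le> 2 * A\<^sup>2 + 2 * B\<^sup>2" using sum_squares_bound[of A B] by (simp add: power2_sum)
      moreover have "A\<^sup>2 \<le> (s - s')\<^sup>2"
      proof -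
        have "\<bar>(?e + ?e') / 2\<bar> \<le> 1" using cut_props(1,2)[OF \<delta>, of t] cut_props(1,2)[OF \<delta>, of t'] by simp
        then have "\<bar>A\<bar> \<le> \<bar>s - s'\<bar>" unfolding A_def abs_mult by (rule mult_left_le_one_le[OF abs_ge_zero abs_ge_zero])
        then show ?thesis unfolding abs_le_square_iff .
      qed
      moreover have "2 * B\<^sup>2 \<le> (s\<^sup>2 + s'\<^sup>2) * (?e - ?e')\<^sup>2"
      proof -
        have "2 * B\<^sup>2 = ((s + s')\<^sup>2 / 2) * (?e - ?e')\<^sup>2" by (simp add: B_def power_mult_distrib power_divide)
        also have "\<dots> \<le> (s\<^sup>2 + s'\<^sup>2) * (?e - ?e')\<^sup>2"
          using sum_squares_bound[of s s'] by (intro mult_right_mono) (auto simp: power2_sum)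
        finally show ?thesis .
      qed
      ultimately have "(?e * s - ?e' * s')\<^sup>2 \<le> 2 * (s - s')\<^sup>2 + (s\<^sup>2 + s'\<^sup>2) * ((t - t')\<^sup>2 / \<delta>\<^sup>2)" using 2 unfolding AB by linarith
      then show ?thesis using 1 by (simp add: power2_eq_square)
    qed
    show "0 \<le> 2 * (s * s) + 2 / \<delta>\<^sup>2 * (s\<^sup>2 * t * t) + - 1 / \<delta>\<^sup>2 * (t\<^sup>2 * s\<^sup>2) + - 1 * (cut \<delta> t * s * (cut \<delta> t * s))" for s t :: real
    proof -
      have "\<bar>cut \<delta> t * s\<bar> \<le> \<bar>s\<bar>" unfolding abs_mult by (rule mult_left_le_one_le[OF abs_ge_zero abs_ge_zero]) (rule cut_props[OF \<delta>])
      then have "cut \<delta> t * s * (cut \<delta> t * s) \<le> s * s" unfolding abs_le_square_iff power2_eq_square .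
      moreover have "2 / \<delta>\<^sup>2 * (s\<^sup>2 * t * t) + - 1 / \<delta>\<^sup>2 * (t\<^sup>2 * s\<^sup>2) = t\<^sup>2 * s\<^sup>2 / \<delta>\<^sup>2" by (simp add: power2_eq_square field_simps)
      moreover have "0 \<le> t\<^sup>2 * s\<^sup>2 / \<delta>\<^sup>2" "0 \<le> s * s" by simp_all
      ultimately show ?thesis by linarith
    qed
  qed (use efF f2F f2hF h2F f h in \<open>auto intro!: continuous_intros continuous_on_compose2[OF c[of UNIV]]\<close>)
  then show "\<E> (\<lambda>x. cut \<delta> (h x) * f x) (\<lambda>x. cut \<delta> (h x) * f x) \<le> 2 * \<E> f f + 2 * K h (\<lambda>x. (f x)\<^sup>2) / \<delta>\<^sup>2"
    by (simp add: K_def diff_divide_distrib algebra_simps)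
qed

end

section \<open>Distance functions as cutoffs\<close>

locale doubling_setting = dirichlet_setting \<mu> L for \<mu> :: "'a::polish_space measure" and L +
  assumes ball_pos: "\<And>x r. 0 < r \<Longrightarrow> 0 < emeasure \<mu> (ball x r)"
    and ball_fin: "\<And>x r. emeasure \<mu> (ball x r) < \<infinity>"
    and doubling: "volume_doubling \<mu>"
begin

lemma sets_mu [measurable_cong, simp]: "sets \<mu> = sets borel"
  using hyp_H by (simp add: hyp_H_def borel_measure_hyp_def)

lemma space_mu [simp]: "space \<mu> = UNIV"
  using sets_eq_imp_space_eq[OF sets_mu] by simp

lemma cont_meas: "continuous_on UNIV f \<Longrightarrow> f \<in> borel_measurable \<mu>"
  unfolding measurable_cong_sets[OF sets_mu refl] by (rule borel_measurable_continuous_onI)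

lemma volume_pos: "0 < r \<Longrightarrow> 0 < volume \<mu> x r"
  unfolding volume_def using ball_pos[of r x] ball_fin[of x r]
  by (simp add: measure_def enn2real_positive_iff)

lemma volume_mono: "ball x r \<subseteq> ball y s \<Longrightarrow> volume \<mu> x r \<le> volume \<mu> y s"
  unfolding volume_def using ball_fin[of y s] by (intro measure_mono_fmeasurable fmeasurableI) auto

lemma volume_doubling_iterate:
  "\<exists>D\<ge>1. \<forall>k x r. 0 < r \<longrightarrow> volume \<mu> x (2 ^ k * r) \<le> D ^ k * volume \<mu> x r"
proof -
  obtain C where C: "0 < C" "\<And>x r. 0 < r \<Longrightarrow> volume \<mu> x (2 * r) \<le> C * volume \<mu> x r"
    using doubling by (auto simp: volume_doubling_def)
  have "volume \<mu> x (2 ^ k * r) \<le> (max 1 C) ^ k * volume \<mu> x r" if "0 < r" for k x r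
  proof (induction k)
    case (Suc k)
    have "volume \<mu> x (2 ^ Suc k * r) \<le> C * volume \<mu> x (2 ^ k * r)"
      using C(2)[of "2 ^ k * r" x] that by (simp add: mult.assoc)
    also have "\<dots> \<le> max 1 C * volume \<mu> x (2 ^ k * r)" by (intro mult_right_mono) (auto simp: volume_def)
    also have "\<dots> \<le> max 1 C * ((max 1 C) ^ k * volume \<mu> x r)" by (intro mult_left_mono Suc) auto
    finally show ?case by (simp add: mult.assoc)
  qed simp
  then show ?thesis by (intro exI[of _ "max 1 C"]) auto
qed

text \<open>Packing argument: half-radius balls around an \<open>e\<close>-separated set are
  disjoint and, by doubling, each carries a fixed fraction of the surrounding volume, so separated
  sets have bounded cardinality; one of maximal cardinality is a net. With completeness this makes
  closed balls compact.\<close>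

lemma totally_bounded_cball:
  fixes x :: 'a
  assumes "0 < e" shows "\<exists>k. finite k \<and> cball x r \<subseteq> (\<Union>y\<in>k. ball y e)"
proof (cases "0 \<le> r")
  case True
  obtain D where D: "1 \<le> D" "\<And>k x r. 0 < r \<Longrightarrow> volume \<mu> x (2 ^ k * r) \<le> D ^ k * volume \<mu> x r"
    using volume_doubling_iterate by blast
  \<comment> \<open>Enough doublings for the half-radius ball around any point of
    \<open>cball x r\<close> to swallow \<open>ball x (r + e)\<close>.\<close>
  obtain k where k: "(2 * r + 2 * e) / (e / 2) < 2 ^ k" using real_arch_pow[of 2] by auto
  define Sep where "Sep A \<longleftrightarrow> finite A \<and> A \<subseteq> cball x r \<and> (\<forall>y\<in>A. \<forall>z\<in>A. y \<noteq> z \<longrightarrow> e \<le> dist y z)" for A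
  have card: "card A \<le> nat \<lceil>D ^ k\<rceil>" if "Sep A" for A
  proof -
    have A: "finite A" "A \<subseteq> cball x r" "\<forall>y\<in>A. \<forall>z\<in>A. y \<noteq> z \<longrightarrow> e \<le> dist y z"
      using that by (auto simp: Sep_def)
    let ?V = "volume \<mu> x (r + e)"
    have V: "0 < ?V" using volume_pos True assms by simp
    have low: "?V \<le> D ^ k * volume \<mu> y (e / 2)" if "y \<in> A" for y
    proof -
      have "dist x y \<le> r" using A(2) \<open>y \<in> A\<close> by auto
      have "2 * r + 2 * e < 2 ^ k * (e / 2)" using k assms by (simp add: divide_less_eq)
      then have "ball x (r + e) \<subseteq> ball y (2 ^ k * (e / 2))"
      proof (intro subsetI)
        fix p assume "p \<in> ball x (r + e)"
        then show "p \<in> ball y (2 ^ k * (e / 2))"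
          using \<open>2 * r + 2 * e < 2 ^ k * (e / 2)\<close> \<open>dist x y \<le> r\<close> True assms dist_triangle3[of y p x] by simp
      qed
      then have "?V \<le> volume \<mu> y (2 ^ k * (e / 2))" by (rule volume_mono)
      also have "\<dots> \<le> D ^ k * volume \<mu> y (e / 2)" by (rule D(2)) (use assms in simp)
      finally show ?thesis .
    qed
    have "disjoint_family_on (\<lambda>y. ball y (e / 2)) A"
      unfolding disjoint_family_on_def
    proof (intro ballI impI)
      fix y z assume yz: "y \<in> A" "z \<in> A" "y \<noteq> z"
      then have d: "e \<le> dist y z" using A by auto
      show "ball y (e / 2) \<inter> ball z (e / 2) = {}"
      proof (rule ccontr)
        assume "\<not> ?thesis"
        then obtain p where "dist y p < e / 2" "dist z p < e / 2" by auto
        then show False using d dist_triangle2[of y z p] by linarith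
      qed
    qed
    then have "measure \<mu> (\<Union>y\<in>A. ball y (e / 2)) = (\<Sum>y\<in>A. measure \<mu> (ball y (e / 2)))"
      using A ball_fin by (intro measure_finite_Union) (auto simp: less_top)
    moreover have "measure \<mu> (\<Union>y\<in>A. ball y (e / 2)) \<le> ?V"
      unfolding volume_def
    proof (rule measure_mono_fmeasurable)
      show "(\<Union>y\<in>A. ball y (e / 2)) \<subseteq> ball x (r + e)"
      proof
        fix p assume "p \<in> (\<Union>y\<in>A. ball y (e / 2))"
        then obtain y where "y \<in> A" "dist y p < e / 2" by auto
        moreover have "dist x y \<le> r" using A \<open>y \<in> A\<close> by auto
        ultimately show "p \<in> ball x (r + e)" using dist_triangle[of x p y] assms by simp
      qed
      show "ball x (r + e) \<in> fmeasurable \<mu>" using ball_fin by (intro fmeasurableI) auto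
    qed (auto intro!: borel_open open_UN)
    ultimately have "(\<Sum>y\<in>A. volume \<mu> y (e / 2)) \<le> ?V" by (simp add: volume_def)
    then have "D ^ k * (\<Sum>y\<in>A. volume \<mu> y (e / 2)) \<le> D ^ k * ?V" using D(1) by (intro mult_left_mono) auto
    moreover have "real (card A) * ?V \<le> D ^ k * (\<Sum>y\<in>A. volume \<mu> y (e / 2))"
      unfolding sum_distrib_left using low by (intro sum_bounded_below[THEN order_trans[rotated]]) auto
    ultimately have "real (card A) * ?V \<le> D ^ k * ?V" by linarith
    then have "real (card A) \<le> D ^ k" using V by simp
    then show ?thesis by linarith
  qed
  have empty: "Sep {}" by (simp add: Sep_def)
  have "\<exists>A. Sep A \<and> (\<forall>B. Sep B \<longrightarrow> card B \<le> card A)"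
  proof (rule ex_has_greatest_nat[of Sep "{}" card "nat \<lceil>D ^ k\<rceil> + 1", OF empty], intro allI impI)
    fix B assume "Sep B"
    from card[OF this] show "card B < nat \<lceil>D ^ k\<rceil> + 1" by simp
  qed
  then obtain A where A: "Sep A" and max': "\<forall>B. Sep B \<longrightarrow> card B \<le> card A" by blast
  have "cball x r \<subseteq> (\<Union>y\<in>A. ball y e)"
  proof
    fix p assume p: "p \<in> cball x r"
    show "p \<in> (\<Union>y\<in>A. ball y e)"
    proof (rule ccontr)
      assume n: "p \<notin> (\<Union>y\<in>A. ball y e)"
      then have "p \<notin> A" using assms by auto
      moreover have "Sep (insert p A)" using A n p by (auto simp: Sep_def dist_commute not_less)
      ultimately have "card (insert p A) \<le> card A" using max' by blast
      then show False using A \<open>p \<notin> A\<close> by (simp add: Sep_def)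
    qed
  qed
  then show ?thesis using A Sep_def by blast
next
  case False
  then have "cball x r = {}" by simp
  then show ?thesis by (intro exI[of _ "{}"]) simp
qed

lemma compact_cball: "compact (cball (x :: 'a) r)"
  unfolding compact_eq_totally_bounded using totally_bounded_cball by (auto simp: complete_eq_closed)

lemma compact_subset_cball: assumes "closed A" "A \<subseteq> cball (x :: 'a) r" shows "compact A"
  using compact_Int_closed[OF compact_cball assms(1), of x r] assms(2) by (simp add: Int_absorb1)

lemma compact_closure_ball: "A \<subseteq> ball (x :: 'a) r \<Longrightarrow> compact (closure A)"
  by (rule compact_subset_cball[OF closed_closure, of _ x r])
    (meson ball_subset_cball closed_cball closure_minimal order_trans)

lemma cont_compact_support_I:
  fixes f :: "'a \<Rightarrow> real"
  assumes "continuous_on UNIV f" "\<And>y. r < dist x y \<Longrightarrow> f y = 0"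
  shows "f \<in> cont_compact_support"
proof -
  have "{y. f y \<noteq> 0} \<subseteq> cball x r" using assms(2) by (auto simp: not_less[symmetric])
  then have "closure {y. f y \<noteq> 0} \<subseteq> cball x r" by (rule closure_minimal) simp
  then have "compact (closure {y. f y \<noteq> 0})" by (rule compact_subset_cball[OF closed_closure])
  then show ?thesis using assms(1) by (simp add: cont_compact_support_def)
qed

lemma cont_compact_support_bounded:
  assumes "f \<in> cont_compact_support" shows "\<exists>M>0. \<forall>x. \<bar>f x\<bar> \<le> M"
proof -
  let ?C = "closure {x. f x \<noteq> 0}"
  have "compact (f ` ?C)"
    using assms by (intro compact_continuous_image) (auto simp: cont_compact_support_def intro: continuous_on_subset)
  then obtain M where M: "0 < M" "\<forall>y\<in>f ` ?C. norm y \<le> M"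
    using compact_imp_bounded bounded_pos by blast
  have "\<bar>f x\<bar> \<le> M" for x
  proof (cases "f x = 0")
    case False
    then have "f x \<in> f ` ?C" using closure_subset[of "{x. f x \<noteq> 0}"] by auto
    then show ?thesis using M(2) by auto
  qed (use M in simp)
  then show ?thesis using M(1) by blast
qed

lemma cont_compact_support_cont: "f \<in> cont_compact_support \<Longrightarrow> continuous_on UNIV f"
  by (simp add: cont_compact_support_def)

lemma cont_compact_support_mono:
  assumes "f \<in> cont_compact_support" "continuous_on UNIV g" "\<And>x. f x = 0 \<Longrightarrow> g x = 0"
  shows "g \<in> cont_compact_support"
proof -
  have "closure {x. g x \<noteq> 0} \<subseteq> closure {x. f x \<noteq> 0}" using assms(3) by (intro closure_mono) auto
  then have "compact (closure {x. g x \<noteq> 0})"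
    using compact_Int_closed[of "closure {x. f x \<noteq> 0}" "closure {x. g x \<noteq> 0}"] assms(1)
    by (simp add: cont_compact_support_def Int_absorb1)
  then show ?thesis using assms(2) by (simp add: cont_compact_support_def)
qed

lemma ess_support_subset: assumes "closed C" "\<And>x. x \<notin> C \<Longrightarrow> f x = 0" shows "ess_support \<mu> f \<subseteq> C"
proof -
  have "- C \<in> {U. open U \<and> (AE x in \<mu>. x \<in> U \<longrightarrow> f x = 0)}" using assms by (auto simp: open_Compl)
  then show ?thesis unfolding ess_support_def by blast
qed

lemma closed_ess_support: "closed (ess_support \<mu> f)"
  unfolding ess_support_def by (intro closed_Compl open_Union) auto

lemma compact_ess_support: 
  assumes "compact C" "\<And>x. x \<notin> C \<Longrightarrow> f x = 0" shows "compact (ess_support \<mu> f)"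
  using compact_Int_closed[OF assms(1) closed_ess_support[of f]] ess_support_subset[OF compact_imp_closed[OF assms(1)] assms(2)]
  by (simp add: Int_absorb1)

lemma compact_ess_support_cont: "f \<in> cont_compact_support \<Longrightarrow> compact (ess_support \<mu> f)"
  by (rule compact_ess_support[of "closure {x. f x \<noteq> 0}"])
    (use closure_subset[of "{x. f x \<noteq> 0}"] in \<open>auto simp: cont_compact_support_def\<close>)

lemma E_local:
  assumes f: "f \<in> \<F>" "f \<in> cont_compact_support" and g: "g \<in> \<F>" "compact C" "\<And>x. x \<notin> C \<Longrightarrow> g x = 0"
    and U: "open U" "C \<subseteq> U" "\<And>x. x \<in> U \<Longrightarrow> f x = a"
  shows "\<E> f g = 0"
proof -
  have sl: "strongly_local_form \<mu> \<F> \<E>" using hyp_H unfolding hyp_H_def by blast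
  have "ess_support \<mu> g \<subseteq> U" 
    by (rule order_trans[OF ess_support_subset[OF compact_imp_closed[OF g(2)] g(3)] U(2)])
  then have "\<exists>U a. open U \<and> ess_support \<mu> g \<subseteq> U \<and> (AE x in \<mu>. x \<in> U \<longrightarrow> f x = a)"
    using U by (intro exI[of _ U] exI[of _ a]) simp
  then show ?thesis
    using sl[unfolded strongly_local_form_def, rule_format, OF f(1) g(1)]
      compact_ess_support_cont[OF f(2)] compact_ess_support[OF g(2,3)] by simp
qed

text \<open>Regularity gives only uniform approximation. The profile \<open>b\<close> runs from 2 to
  0, so an approximant within \<open>1 / 2\<close>, lowered by \<open>1 / 2\<close> and clipped to
  \<open>[0, 1]\<close>, takes the values 1 and 0 exactly where \<open>b\<close> is 2 and 0.\<close>

lemma bump: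
  fixes x0 :: 'a
  assumes "0 < r"
  obtains \<psi> where "\<psi> \<in> \<F>" "\<psi> \<in> cont_compact_support" "\<And>x. 0 \<le> \<psi> x" "\<And>x. \<psi> x \<le> 1"
    "\<And>x. dist x0 x \<le> r \<Longrightarrow> \<psi> x = 1" "\<And>x. 2 * r \<le> dist x0 x \<Longrightarrow> \<psi> x = 0"
proof -
  define b where "b = (\<lambda>x. max 0 (min 2 (4 - 2 * dist x0 x / r)))"
  have "b \<in> cont_compact_support"
  proof (rule cont_compact_support_I[of _ "2 * r" x0])
    show "continuous_on UNIV b" unfolding b_def by (intro continuous_intros) (use assms in auto)
    show "b y = 0" if "2 * r < dist x0 y" for y
    proof -
      have "4 < 2 * dist x0 y / r" using that assms by (simp add: less_divide_eq)
      then show ?thesis by (simp add: b_def)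
    qed
  qed
  moreover have "regular_form \<mu> \<F> \<E>" using hyp_H unfolding hyp_H_def by blast
  ultimately obtain \<phi> where \<phi>: "\<phi> \<in> \<F>" "\<phi> \<in> cont_compact_support" and ap: "\<And>x. \<bar>b x - \<phi> x\<bar> < 1 / 2"
    unfolding regular_form_def by (metis IntD1 IntD2 half_gt_zero zero_less_one)
  obtain M where M: "\<And>x. \<bar>\<phi> x\<bar> \<le> M" using cont_compact_support_bounded[OF \<phi>(2)] by blast
  define \<psi> where "\<psi> = (\<lambda>x. min 1 (max 0 (\<phi> x - 1 / 2)))"
  have 1: "\<psi> \<in> \<F>"
    unfolding \<psi>_def by (rule F_contraction(1)[OF \<phi>(1) M, of "\<lambda>s. min 1 (max 0 (s - 1 / 2))"]) auto
  have 2: "\<psi> \<in> cont_compact_support"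
    unfolding \<psi>_def
    by (rule cont_compact_support_mono[OF \<phi>(2)])
      (use cont_compact_support_cont[OF \<phi>(2)] in \<open>auto intro!: continuous_intros\<close>)
  have 3: "\<psi> x = 1" if "dist x0 x \<le> r" for x
  proof -
    have "2 * dist x0 x / r \<le> 2" using that assms by (simp add: divide_le_eq)
    then have "b x = 2" by (simp add: b_def)
    then show ?thesis using ap[of x] unfolding \<psi>_def by linarith
  qed
  have 4: "\<psi> x = 0" if "2 * r \<le> dist x0 x" for x
  proof -
    have "4 \<le> 2 * dist x0 x / r" using that assms by (simp add: le_divide_eq)
    then have "b x = 0" by (simp add: b_def)
    then show ?thesis using ap[of x] unfolding \<psi>_def by linarith
  qed
  show ?thesis by (rule that[OF 1 2 _ _ 3 4]) (auto simp: \<psi>_def)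
qed

text \<open>\<open>dist x0\<close> is known to be in the form domain only locally. This tent lies in
  the form domain, and inside its ball it differs from \<open>- dist x0\<close> by a constant, so
  the two have the same energy there.\<close>

definition dcut :: "'a \<Rightarrow> real \<Rightarrow> 'a \<Rightarrow> real" where
  "dcut x0 r x = max 0 (r - dist x0 x)"

lemma dcut_props:
  shows "continuous_on Z (dcut x0 r)" "0 \<le> dcut x0 r x" "0 < r \<Longrightarrow> \<bar>dcut x0 r x\<bar> \<le> r"
    "r \<le> dist x0 x \<Longrightarrow> dcut x0 r x = 0" "dcut x0 r \<in> cont_compact_support"
proof -
  show c: "continuous_on Z (dcut x0 r)" for Z unfolding dcut_def by (intro continuous_intros)
  show "dcut x0 r \<in> cont_compact_support"
    by (rule cont_compact_support_I[OF c, of r x0]) (auto simp: dcut_def)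
qed (auto simp: dcut_def)

lemma dcut_F: assumes r: "0 < r" shows "dcut x0 r \<in> \<F>"
proof -
  let ?U = "ball x0 (3 * r)"
  have "dist x0 \<in> local_dom \<mu> \<F>" using hyp_H unfolding hyp_H_def by blast
  moreover have "compact (closure ?U)" by (rule compact_closure_ball[OF order_refl])
  ultimately obtain h where h: "h \<in> \<F>" and hU: "AE x in \<mu>. x \<in> ?U \<longrightarrow> dist x0 x = h x"
    unfolding local_dom_def by auto
  define h1 where "h1 = (\<lambda>x. (3 * r) * min 1 (max 0 ((1 / (3 * r)) * h x)))"
  have h1: "h1 \<in> \<F>"
    unfolding h1_def using markov F_cmult[OF h, of "1 / (3 * r)"]
    by (intro F_cmult) (simp add: markovian_form_def)
  have h1b: "0 \<le> h1 x" "h1 x \<le> 3 * r" for x using r by (auto simp: h1_def)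
  have h1U: "h1 x = h x" if "h x = dist x0 x" "x \<in> ?U" for x
    using that r by (simp add: h1_def min_def max_def divide_le_eq)
  obtain \<psi> where \<psi>: "\<psi> \<in> \<F>" "\<psi> \<in> cont_compact_support" "\<And>x. 0 \<le> \<psi> x" "\<And>x. \<psi> x \<le> 1"
    "\<And>x. dist x0 x \<le> r \<Longrightarrow> \<psi> x = 1" "\<And>x. 2 * r \<le> dist x0 x \<Longrightarrow> \<psi> x = 0"
    using bump[OF r, of x0] by metis
  \<comment> \<open>The constant \<open>r\<close> need not belong to the form domain, so
    \<open>r * \<psi>\<close> replaces it: at distance above \<open>r\<close> either
    \<open>h1\<close> exceeds \<open>r\<close> or \<open>\<psi>\<close> vanishes, and the positive
    part is 0 in both cases.\<close>
  have F: "(\<lambda>x. max 0 (r * \<psi> x - h1 x)) \<in> \<F>"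
  proof (rule F_contraction(1)[where T="\<lambda>s. max 0 s" and M="4 * r"])
    show "(\<lambda>x. r * \<psi> x - h1 x) \<in> \<F>" by (intro F_diff F_cmult \<psi> h1)
    show "\<bar>r * \<psi> x - h1 x\<bar> \<le> 4 * r" for x
    proof -
      have "0 \<le> r * \<psi> x" "r * \<psi> x \<le> r" using \<psi>(3,4)[of x] r by simp_all
      then show ?thesis using h1b[of x] r unfolding abs_le_iff by linarith
    qed
  qed auto
  show ?thesis
  proof (rule F_cong[OF F])
    show "dcut x0 r \<in> borel_measurable \<mu>" by (rule cont_meas[OF dcut_props(1)])
    show "AE x in \<mu>. max 0 (r * \<psi> x - h1 x) = dcut x0 r x"
      using hU
    proof eventually_elim
      case (elim x)
      have le: "r * \<psi> x \<le> r" using \<psi>(4)[of x] r by simp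
      consider "dist x0 x \<le> r" | "r < dist x0 x" "dist x0 x < 3 * r" | "3 * r \<le> dist x0 x" by linarith
      then show ?case
      proof cases
        case 1
        then have "x \<in> ?U" using r by simp
        then have "h1 x = dist x0 x" using h1U elim by simp
        then show ?thesis using \<psi>(5)[OF 1] by (simp add: dcut_def)
      next
        case 2
        then have "x \<in> ?U" by simp
        then have "h1 x = dist x0 x" using h1U elim by simp
        then show ?thesis using le 2 unfolding dcut_def by linarith
      next
        case 3
        then have "\<psi> x = 0" using \<psi>(6) r by simp
        then show ?thesis using h1b(1)[of x] 3 r by (simp add: dcut_def)
      qed
    qed
  qed
qed

end

section \<open>Energy of truncated distances, controlled by the measure\<close>

context doubling_setting
begin

text \<open>The function \<open>h = r * \<psi> - dcut x0 r\<close> lies in the form domain and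
  equals the distance on the ball, so the hypothesis on the energy measure of the distance controls
  \<open>K h \<phi>\<close>. Strong locality shows that \<open>h\<close> and
  \<open>dcut x0 r\<close> have the same \<open>K\<close> on test functions supported in the
  ball.\<close>

lemma K_dcut_le:
  assumes r: "0 < r" and \<phi>: "\<phi> \<in> \<F>" "\<phi> \<in> cont_compact_support" and pos: "\<And>x. 0 \<le> \<phi> x"
    and C: "compact C" "C \<subseteq> ball x0 r" "\<And>x. x \<notin> C \<Longrightarrow> \<phi> x = 0"
  shows "K (dcut x0 r) \<phi> \<le> (\<integral>x. \<phi> x \<partial>\<mu>)"
proof -
  obtain \<psi> where \<psi>: "\<psi> \<in> \<F>" "\<psi> \<in> cont_compact_support" "\<And>x. 0 \<le> \<psi> x" "\<And>x. \<psi> x \<le> 1"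
    "\<And>x. dist x0 x \<le> r \<Longrightarrow> \<psi> x = 1" "\<And>x. 2 * r \<le> dist x0 x \<Longrightarrow> \<psi> x = 0"
    using bump[OF r, of x0] by metis
  let ?d = "dcut x0 r" let ?U = "ball x0 r"
  have dF: "?d \<in> \<F>" by (rule dcut_F[OF r])
  define h where "h = (\<lambda>x. r * \<psi> x - ?d x)"
  have hF: "h \<in> \<F>" unfolding h_def by (intro F_diff F_cmult \<psi> dF)
  have hb: "\<bar>h x\<bar> \<le> r" for x
  proof -
    have "0 \<le> r * \<psi> x" "r * \<psi> x \<le> r" using \<psi>(3,4)[of x] r by simp_all
    moreover have "?d x \<le> r" "0 \<le> ?d x" using r by (auto simp: dcut_def)
    ultimately show ?thesis unfolding h_def abs_le_iff by linarith
  qed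
  have hU: "h x = dist x0 x" if "x \<in> ?U" for x using that \<psi>(5)[of x] by (simp add: h_def dcut_def)
  obtain M where M: "0 < M" "\<And>x. \<bar>\<phi> x\<bar> \<le> M" using cont_compact_support_bounded[OF \<phi>(2)] by blast
  have \<phi>c: "continuous_on UNIV \<phi>" by (rule cont_compact_support_cont[OF \<phi>(2)])
  have \<phi>m: "\<phi> \<in> borel_measurable borel" by (rule borel_measurable_continuous_onI[OF \<phi>c])
  have [measurable]: "\<phi> \<in> borel_measurable \<mu>" by (rule cont_meas[OF \<phi>c])
  have Cm [measurable]: "C \<in> sets borel" using C(1) by (simp add: borel_compact)
  have Cfin: "emeasure \<mu> C < \<infinity>"
    using emeasure_mono[OF C(2), of \<mu>] ball_fin[of x0 r] by (simp add: order.strict_trans1)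
  obtain \<nu> where \<nu>: "local_energy_measure \<mu> \<F> \<E> (dist x0) \<nu>" "\<And>B. B \<in> sets borel \<Longrightarrow> emeasure \<nu> B \<le> emeasure \<mu> B"
    using hyp_H unfolding hyp_H_def by blast
  have cU: "compact (closure ?U)" by (rule compact_closure_ball[OF order_refl])
  have "\<exists>\<rho>. energy_measure \<F> \<E> h \<rho> \<and> (\<forall>B\<in>sets borel. B \<subseteq> ?U \<longrightarrow> emeasure \<nu> B = emeasure \<rho> B)"
    using \<nu>(1)[unfolded local_energy_measure_def, THEN conjunct2, rule_format, OF hF, of ?U] cU hU by simp
  then obtain \<rho>0 where em: "energy_measure \<F> \<E> h \<rho>0" and \<rho>0: "\<And>B. B \<in> sets borel \<Longrightarrow> B \<subseteq> ?U \<Longrightarrow> emeasure \<nu> B = emeasure \<rho>0 B"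
    by blast
  obtain \<rho> where bem: "\<And>n. bounded_energy_measure \<F> \<E> (\<lambda>x. max (- real n) (min (real n) (h x))) (\<rho> n)"
    and lim: "\<And>B. B \<in> sets borel \<Longrightarrow> (\<lambda>n. emeasure (\<rho> n) B) \<longlonglongrightarrow> emeasure \<rho>0 B"
    using em unfolding energy_measure_def by blast
  obtain N where N: "r \<le> real N" using real_arch_simple by blast
  \<comment> \<open>Truncating \<open>h\<close> at a level above its bound does nothing, so for
    large \<open>n\<close> the measure \<open>\<rho> n\<close> represents
    \<open>K h\<close>.\<close>
  have int: "(\<integral>x. \<phi> x \<partial>\<rho> n) = K h \<phi>" "sets (\<rho> n) = sets borel" if "N \<le> n" for n
  proof -
    have "(\<lambda>x. max (- real n) (min (real n) (h x))) = h"
    proof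
      fix x show "max (- real n) (min (real n) (h x)) = h x"
        using hb[of x] N that by (auto simp: abs_le_iff min_def max_def)
    qed
    then have "bounded_energy_measure \<F> \<E> h (\<rho> n)" using bem[of n] by simp
    then show "(\<integral>x. \<phi> x \<partial>\<rho> n) = K h \<phi>" "sets (\<rho> n) = sets borel"
      using \<phi> by (auto simp: bounded_energy_measure_def K_def)
  qed
  \<comment> \<open>The measures \<open>\<rho> n\<close> converge setwise. The test function is
    therefore compared with the layer sum \<open>s\<close>, which rounds \<open>\<phi>\<close> up to
    a multiple of \<open>e\<close> and exceeds it by at most \<open>e\<close> on
    \<open>C\<close>.\<close>
  have bound: "K h \<phi> \<le> (\<integral>x. \<phi> x \<partial>\<mu>) + e * measure \<mu> C" if e: "0 < e" for e
  proof -
    define B where "B k = {x. real k * e < \<phi> x}" for k :: nat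
    have Bm [measurable]: "B k \<in> sets borel" for k
      unfolding B_def using open_Collect_less[OF continuous_on_const \<phi>c] by (intro borel_open)
    have BC: "B k \<subseteq> C" for k
    proof
      fix x assume "x \<in> B k"
      moreover have "0 \<le> real k * e" using e by simp
      ultimately have "\<phi> x \<noteq> 0" by (auto simp: B_def)
      then show "x \<in> C" using C(3) by blast
    qed
    obtain m :: nat where m: "M / e \<le> real m" using real_arch_simple by blast
    define s where "s x = (\<Sum>k<m. e * indicator (B k) x)" for x
    have s: "\<phi> x \<le> s x" "s x \<le> \<phi> x + e * indicator C x" for x
    proof -
      define j where "j = nat \<lceil>\<phi> x / e\<rceil>"
      have j0: "real j = of_int \<lceil>\<phi> x / e\<rceil>" using pos[of x] e unfolding j_def by (simp add: of_nat_nat)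
      have j1: "\<phi> x \<le> e * real j"
      proof -
        have "\<phi> x / e \<le> real j" unfolding j0 by simp
        then show ?thesis using e by (simp add: divide_le_eq mult.commute)
      qed
      have j2: "e * real j \<le> \<phi> x + e"
      proof -
        have "real j \<le> \<phi> x / e + 1" unfolding j0 by linarith
        then have "e * real j \<le> e * (\<phi> x / e + 1)" using e by (intro mult_left_mono) auto
        then show ?thesis using e by (simp add: distrib_left)
      qed
      have jm: "j \<le> m"
      proof -
        have "\<phi> x / e \<le> M / e" using M(2)[of x] e by (intro divide_right_mono) auto
        then have "\<phi> x / e \<le> real m" using m by linarith
        then have "\<lceil>\<phi> x / e\<rceil> \<le> int m" by (intro ceiling_le) (simp only: of_int_of_nat_eq)
        then show ?thesis unfolding j_def by linarith
      qed
      have "k < j \<longleftrightarrow> x \<in> B k" for k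
      proof -
        have "k < j \<longleftrightarrow> int k < \<lceil>\<phi> x / e\<rceil>" unfolding j_def by linarith
        also have "\<dots> \<longleftrightarrow> real k < \<phi> x / e" by (simp add: less_ceiling_iff)
        also have "\<dots> \<longleftrightarrow> x \<in> B k" using e by (simp add: B_def less_divide_eq)
        finally show ?thesis .
      qed
      then have "s x = (\<Sum>k<m. if k < j then e else 0)" unfolding s_def by (intro sum.cong) (auto simp: indicator_def)
      also have "\<dots> = (\<Sum>k\<in>{..<m} \<inter> {k. k < j}. e)"
        using sum.inter_restrict[of "{..<m}" "\<lambda>_. e" "{k. k < j}"] by simp
      also have "{..<m} \<inter> {k. k < j} = {..<j}" using jm by auto
      finally have sx: "s x = e * real j" by (simp add: mult.commute)
      show "\<phi> x \<le> s x" using j1 sx by simp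
      show "s x \<le> \<phi> x + e * indicator C x"
      proof (cases "x \<in> C")
        case True
        then show ?thesis using j2 sx by simp
      next
        case False
        then have "\<phi> x = 0" using C(3) by blast
        then have "j = 0" by (simp add: j_def)
        then show ?thesis using sx \<open>\<phi> x = 0\<close> e by simp
      qed
    qed
    have es: "ennreal (s x) = (\<Sum>k<m. ennreal e * indicator (B k) x)" for x
    proof -
      have "ennreal (s x) = (\<Sum>k<m. ennreal (e * indicator (B k) x))"
        unfolding s_def using e by (intro sum_ennreal[symmetric]) simp
      also have "\<dots> = (\<Sum>k<m. ennreal e * indicator (B k) x)"
        by (intro sum.cong) (simp_all add: indicator_def)
      finally show ?thesis .
    qed
    have "ennreal (K h \<phi>) \<le> (\<Sum>k<m. ennreal e * emeasure (\<rho> n) (B k))" if "N \<le> n" for n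
    proof -
      have [measurable_cong, simp]: "sets (\<rho> n) = sets borel" by (rule int(2)[OF that])
      have [measurable]: "\<phi> \<in> borel_measurable (\<rho> n)" using \<phi>m by measurable
      have "ennreal (K h \<phi>) = ennreal (enn2real (\<integral>\<^sup>+x. ennreal (\<phi> x) \<partial>\<rho> n))"
        using int(1)[OF that] pos by (subst (asm) integral_eq_nn_integral) auto
      \<comment> \<open>\<open>enn2real\<close> sends an infinite value to 0, which respects the
        inequality in this direction.\<close>
      also have "\<dots> \<le> (\<integral>\<^sup>+x. ennreal (\<phi> x) \<partial>\<rho> n)"
        by (cases "\<integral>\<^sup>+x. ennreal (\<phi> x) \<partial>\<rho> n") auto
      also have "\<dots> \<le> (\<integral>\<^sup>+x. (\<Sum>k<m. ennreal e * indicator (B k) x) \<partial>\<rho> n)"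
        using s by (intro nn_integral_mono) (simp add: es[symmetric] ennreal_leI)
      also have "\<dots> = (\<Sum>k<m. ennreal e * emeasure (\<rho> n) (B k))"
        by (subst nn_integral_sum) (auto simp: nn_integral_cmult_indicator)
      finally show ?thesis .
    qed
    moreover have "(\<lambda>n. \<Sum>k<m. ennreal e * emeasure (\<rho> n) (B k)) \<longlonglongrightarrow> (\<Sum>k<m. ennreal e * emeasure \<rho>0 (B k))"
      by (intro tendsto_sum ennreal_tendsto_cmult lim Bm) simp
    ultimately have "ennreal (K h \<phi>) \<le> (\<Sum>k<m. ennreal e * emeasure \<rho>0 (B k))"
      by (intro LIMSEQ_le_const) auto
    also have "\<dots> \<le> (\<Sum>k<m. ennreal e * emeasure \<mu> (B k))"
    proof (intro sum_mono mult_left_mono)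
      fix k
      have "B k \<subseteq> ?U" using BC C(2) by blast
      from \<rho>0[OF Bm this] show "emeasure \<rho>0 (B k) \<le> emeasure \<mu> (B k)" using \<nu>(2)[OF Bm, of k] by simp
    qed simp
    also have "\<dots> = (\<integral>\<^sup>+x. (\<Sum>k<m. ennreal e * indicator (B k) x) \<partial>\<mu>)"
      by (subst nn_integral_sum) (auto simp: nn_integral_cmult_indicator)
    also have "\<dots> \<le> (\<integral>\<^sup>+x. ennreal (\<phi> x + e * indicator C x) \<partial>\<mu>)"
      using s by (intro nn_integral_mono) (simp add: es[symmetric] ennreal_leI)
    also have "\<dots> = ennreal (\<integral>x. \<phi> x + e * indicator C x \<partial>\<mu>)"
    proof (rule nn_integral_eq_integral)
      have "integrable \<mu> (\<lambda>x. M * indicator C x)" using Cfin by simp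
      then have "integrable \<mu> \<phi>"
        by (rule Bochner_Integration.integrable_bound) (use M C(3) in \<open>auto simp: indicator_def\<close>)
      then show "integrable \<mu> (\<lambda>x. \<phi> x + e * indicator C x)" using Cfin by simp
      show "AE x in \<mu>. 0 \<le> \<phi> x + e * indicator C x" using pos e by (auto simp: add_nonneg_nonneg)
    qed
    finally have "ennreal (K h \<phi>) \<le> ennreal (\<integral>x. \<phi> x + e * indicator C x \<partial>\<mu>)" .
    moreover have nn: "0 \<le> (\<integral>x. \<phi> x + e * indicator C x \<partial>\<mu>)" using pos e by (intro integral_nonneg_AE) (auto simp: add_nonneg_nonneg)
    ultimately have "K h \<phi> \<le> (\<integral>x. \<phi> x + e * indicator C x \<partial>\<mu>)" by (simp add: ennreal_le_iff)
    also have "\<dots> = (\<integral>x. \<phi> x \<partial>\<mu>) + e * measure \<mu> C"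
    proof -
      have "integrable \<mu> (\<lambda>x. M * indicator C x)" using Cfin by simp
      then have "integrable \<mu> \<phi>"
        by (rule Bochner_Integration.integrable_bound) (use M C(3) in \<open>auto simp: indicator_def\<close>)
      then show ?thesis using Cfin by simp
    qed
    finally show ?thesis .
  qed
  have le: "K h \<phi> \<le> (\<integral>x. \<phi> x \<partial>\<mu>)"
  proof (rule field_le_epsilon)
    fix e :: real assume e: "0 < e"
    have "0 < e / (measure \<mu> C + 1)" using e measure_nonneg[of \<mu> C] by (intro divide_pos_pos) linarith+
    from bound[OF this] have "K h \<phi> \<le> (\<integral>x. \<phi> x \<partial>\<mu>) + e / (measure \<mu> C + 1) * measure \<mu> C" .
    also have "e / (measure \<mu> C + 1) * measure \<mu> C \<le> e"
    proof -
      have "measure \<mu> C / (measure \<mu> C + 1) \<le> 1"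
        using measure_nonneg[of \<mu> C] by (subst divide_le_eq_1_pos) linarith+
      from mult_left_mono[OF this, of e] show ?thesis using e by simp
    qed
    finally show "K h \<phi> \<le> (\<integral>x. \<phi> x \<partial>\<mu>) + e" by simp
  qed
  have \<phi>C: "\<phi> x * \<psi> x = \<phi> x" for x
  proof (cases "x \<in> C")
    case True
    then have "dist x0 x \<le> r" using C(2) by auto
    then show ?thesis using \<psi>(5) by simp
  qed (use C(3) in simp)
  have d\<psi>: "\<psi> x * ?d x = ?d x" for x
    using \<psi>(5)[of x] dcut_props(4)[of r x0 x] by (cases "dist x0 x \<le> r") auto
  have db: "\<bar>?d x\<bar> \<le> r" for x by (rule dcut_props(3)[OF r])
  have \<psi>b: "\<bar>\<psi> x\<bar> \<le> 1" for x using \<psi>(3,4)[of x] by simp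
  have \<phi>dF: "(\<lambda>x. \<phi> x * ?d x) \<in> \<F>" by (rule F_mult_bounded[OF \<phi>(1) dF M(2) db])
  have \<psi>2F: "(\<lambda>x. (\<psi> x)\<^sup>2) \<in> \<F>" by (rule F_sq[OF \<psi>(1) \<psi>b])
  have d2F: "(\<lambda>x. (?d x)\<^sup>2) \<in> \<F>" by (rule F_sq[OF dF db])
  have \<psi>1: "\<psi> x = 1" if "x \<in> ?U" for x using that \<psi>(5) by simp
  \<comment> \<open>\<open>\<psi>\<close> is constant on the open ball around the compact set
    \<open>C\<close>, so strong locality annihilates the cross terms that distinguish
    \<open>h\<close> from the tent.\<close>
  have z1: "\<E> \<psi> g = 0" if "g \<in> \<F>" "\<And>x. x \<notin> C \<Longrightarrow> g x = 0" for g
    by (rule E_local[OF \<psi>(1,2) that(1) C(1) that(2) open_ball C(2) \<psi>1])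
  have \<psi>2c: "(\<lambda>x. (\<psi> x)\<^sup>2) \<in> cont_compact_support"
    by (rule cont_compact_support_mono[OF \<psi>(2)]) (use cont_compact_support_cont[OF \<psi>(2)] in \<open>auto intro!: continuous_intros\<close>)
  have z2: "\<E> (\<lambda>x. (\<psi> x)\<^sup>2) \<phi> = 0"
    by (rule E_local[OF \<psi>2F \<psi>2c \<phi>(1) C(1,3) open_ball C(2), of 1]) (use \<psi>1 in auto)
  have e1: "(\<lambda>x. \<phi> x * h x) = (\<lambda>x. r * \<phi> x - \<phi> x * ?d x)"
    unfolding h_def using \<phi>C by (simp add: fun_eq_iff right_diff_distrib mult.left_commute[of _ r])
  have "(r * \<psi> x - ?d x)\<^sup>2 = r\<^sup>2 * (\<psi> x)\<^sup>2 - 2 * r * (\<psi> x * ?d x) + (?d x)\<^sup>2" for x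
    by (simp add: power2_eq_square algebra_simps)
  then have e2: "(\<lambda>x. (h x)\<^sup>2) = (\<lambda>x. (r\<^sup>2 * (\<psi> x)\<^sup>2 - 2 * r * ?d x) + (?d x)\<^sup>2)"
    unfolding h_def using d\<psi> by simp
  have "\<E> (\<lambda>x. \<phi> x * h x) h = \<E> (\<lambda>x. r * \<phi> x - \<phi> x * ?d x) (\<lambda>x. r * \<psi> x - ?d x)"
    unfolding e1 by (simp add: h_def[abs_def])
  also have "\<dots> = r * \<E> (\<lambda>x. r * \<phi> x - \<phi> x * ?d x) \<psi> - \<E> (\<lambda>x. r * \<phi> x - \<phi> x * ?d x) ?d"
    by (simp add: E_diff_r E_cmult_r F_diff F_cmult \<phi>(1) \<phi>dF \<psi>(1) dF)
  also have "\<E> (\<lambda>x. r * \<phi> x - \<phi> x * ?d x) \<psi> = \<E> \<psi> (\<lambda>x. r * \<phi> x - \<phi> x * ?d x)"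
    by (rule E_sym) (intro F_diff F_cmult \<phi>(1) \<phi>dF \<psi>(1))+
  also have "\<dots> = 0" by (rule z1) (use C(3) in \<open>auto intro!: F_diff F_cmult \<phi>(1) \<phi>dF\<close>)
  also have "\<E> (\<lambda>x. r * \<phi> x - \<phi> x * ?d x) ?d = r * \<E> \<phi> ?d - \<E> (\<lambda>x. \<phi> x * ?d x) ?d"
    by (simp add: E_diff E_cmult F_cmult \<phi>(1) \<phi>dF dF)
  finally have k1: "\<E> (\<lambda>x. \<phi> x * h x) h = \<E> (\<lambda>x. \<phi> x * ?d x) ?d - r * \<E> \<phi> ?d" by simp
  have "\<E> (\<lambda>x. (h x)\<^sup>2) \<phi> = r\<^sup>2 * \<E> (\<lambda>x. (\<psi> x)\<^sup>2) \<phi> - 2 * r * \<E> ?d \<phi> + \<E> (\<lambda>x. (?d x)\<^sup>2) \<phi>"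
    unfolding e2 by (simp add: E_add E_diff E_cmult F_diff F_cmult \<phi>(1) \<psi>2F dF d2F)
  then have k2: "\<E> (\<lambda>x. (h x)\<^sup>2) \<phi> = - 2 * r * \<E> ?d \<phi> + \<E> (\<lambda>x. (?d x)\<^sup>2) \<phi>" using z2 by simp
  have "K h \<phi> = K ?d \<phi>"
    unfolding K_def k1 k2 using E_sym[OF \<phi>(1) dF] by (simp add: diff_divide_distrib)
  with le show ?thesis by simp
qed

text \<open>Continuous compactly supported approximants are needed both for test functions of energy
  measures and for open superlevel sets. Clipping at \<open>M\<close> keeps the pointwise bound
  without raising energy; the last property is the sharp form of the crude energy bound, valid for
  late members.\<close>

lemma F_approx:
  assumes "w \<in> \<F>" and M: "\<And>x. \<bar>w x\<bar> \<le> M"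
  obtains u where "L2_lim u w" "\<And>n. u n \<in> \<F>" "\<And>n. u n \<in> cont_compact_support"
    "\<And>n. \<E> (u n) (u n) \<le> 2 * \<E> w w + 2" "\<And>n x. \<bar>u n x\<bar> \<le> M"
    "\<And>e. 0 < e \<Longrightarrow> \<exists>N. \<forall>n\<ge>N. \<E> (u n) (u n) \<le> \<E> w w + e"
proof -
  have M0: "0 \<le> M" using M[of undefined] by linarith
  have reg: "\<exists>\<phi>\<in>\<F> \<inter> cont_compact_support. form_energy1 \<mu> \<E> (\<lambda>x. w x - \<phi> x) < 1 / (real n + 1)" for n
  proof -
    have "regular_form \<mu> \<F> \<E>" using hyp_H unfolding hyp_H_def by blast
    then show ?thesis unfolding regular_form_def using assms(1) by simp
  qed
  then obtain p where p: "\<And>n. p n \<in> \<F>" "\<And>n. p n \<in> cont_compact_support"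
    "\<And>n. form_energy1 \<mu> \<E> (\<lambda>x. w x - p n x) < 1 / (real n + 1)"
    by (metis IntD1 IntD2)
  have small: "\<E> (\<lambda>x. w x - p n x) (\<lambda>x. w x - p n x) \<le> 1 / (real n + 1)"
    "ip (\<lambda>x. p n x - w x) (\<lambda>x. p n x - w x) \<le> 1 / (real n + 1)" for n
  proof -
    have "0 \<le> \<E> (\<lambda>x. w x - p n x) (\<lambda>x. w x - p n x)" by (intro E_pos F_diff assms(1) p)
    moreover have "ip (\<lambda>x. p n x - w x) (\<lambda>x. p n x - w x) = ip (\<lambda>x. w x - p n x) (\<lambda>x. w x - p n x)"
      by (simp add: ip_self power2_commute)
    ultimately show "\<E> (\<lambda>x. w x - p n x) (\<lambda>x. w x - p n x) \<le> 1 / (real n + 1)"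
      "ip (\<lambda>x. p n x - w x) (\<lambda>x. p n x - w x) \<le> 1 / (real n + 1)"
      using p(3)[of n] ip_ge0[of "\<lambda>x. w x - p n x"] unfolding form_energy1_def L2_norm_sq by linarith+
  qed
  have n0: "(\<lambda>n. 1 / (real n + 1)) \<longlonglongrightarrow> 0"
    using LIMSEQ_inverse_real_of_nat by (simp add: inverse_eq_divide add.commute)
  have plim: "L2_lim p w"
    unfolding L2_lim_def
  proof (intro conjI allI F_H p assms(1) Lim_null_comparison[OF always_eventually n0])
    show "norm (ip (\<lambda>x. p n x - w x) (\<lambda>x. p n x - w x)) \<le> 1 / (real n + 1)" for n
      using small(2)[of n] by simp
  qed
  define T where "T s = max (- M) (min M s)" for s :: real
  have T: "\<bar>T s - T s'\<bar> \<le> \<bar>s - s'\<bar>" "T 0 = 0" "\<bar>T s\<bar> \<le> M" for s s' using M0 by (auto simp: T_def)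
  have Tw: "T (w x) = w x" for x using M[of x] by (auto simp: T_def abs_le_iff)
  define u where "u n x = T (p n x)" for n x
  have uF: "u n \<in> \<F>" "\<E> (u n) (u n) \<le> \<E> (p n) (p n)" for n
  proof -
    obtain Mp where Mp: "\<And>x. \<bar>p n x\<bar> \<le> Mp" using cont_compact_support_bounded[OF p(2)] by blast
    show "u n \<in> \<F>" "\<E> (u n) (u n) \<le> \<E> (p n) (p n)"
      unfolding u_def by (rule F_contraction[OF p(1) Mp T(1,2)])+
  qed
  have uc: "u n \<in> cont_compact_support" for n
    unfolding u_def
    by (rule cont_compact_support_mono[OF p(2)[of n]])
      (use cont_compact_support_cont[OF p(2)[of n]] T(2) in \<open>auto intro!: continuous_intros simp: T_def\<close>)
  have ulim: "L2_lim u w"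
  proof (rule L2_lim_contraction[OF plim F_meas[OF uF(1)] F_H[OF assms(1)], where c=1], rule AE_I2)
    show "\<bar>u n x - w x\<bar> \<le> 1 * \<bar>p n x - w x\<bar>" for n x using T(1)[of "p n x" "w x"] Tw by (simp add: u_def)
  qed
  have en: "\<E> (p n) (p n) \<le> (sqrt (\<E> w w) + sqrt (1 / (real n + 1)))\<^sup>2" for n
  proof -
    let ?d = "\<lambda>x. w x - p n x"
    have dF: "?d \<in> \<F>" by (intro F_diff assms(1) p)
    have "\<E> (p n) (p n) = \<E> (\<lambda>x. w x - ?d x) (\<lambda>x. w x - ?d x)" by simp
    also have "\<dots> = \<E> w w - 2 * \<E> w ?d + \<E> ?d ?d" by (rule E_expand_diff[OF assms(1) dF])
    also have "- \<E> w ?d \<le> sqrt (\<E> w w) * sqrt (\<E> ?d ?d)"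
      unfolding real_sqrt_mult[symmetric] by (rule real_le_rsqrt) (use E_CS[OF assms(1) dF] in simp)
    then have "\<E> w w - 2 * \<E> w ?d + \<E> ?d ?d \<le> (sqrt (\<E> w w) + sqrt (\<E> ?d ?d))\<^sup>2"
      using E_pos[OF assms(1)] E_pos[OF dF] by (simp add: power2_sum)
    also have "\<dots> \<le> (sqrt (\<E> w w) + sqrt (1 / (real n + 1)))\<^sup>2"
      using small(1)[of n] E_pos[OF assms(1)] E_pos[OF dF] by (intro power_mono add_left_mono real_sqrt_le_mono) auto
    finally show ?thesis .
  qed
  have "(\<lambda>n. (sqrt (\<E> w w) + sqrt (1 / (real n + 1)))\<^sup>2) \<longlonglongrightarrow> (sqrt (\<E> w w) + sqrt 0)\<^sup>2"
    by (intro tendsto_power tendsto_add tendsto_const tendsto_real_sqrt n0)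
  then have enl: "(\<lambda>n. (sqrt (\<E> w w) + sqrt (1 / (real n + 1)))\<^sup>2) \<longlonglongrightarrow> \<E> w w"
    using E_pos[OF assms(1)] by simp
  have 4: "\<E> (u n) (u n) \<le> 2 * \<E> w w + 2" for n
  proof -
    have "(sqrt (\<E> w w) + sqrt (1 / (real n + 1)))\<^sup>2 \<le> 2 * (sqrt (\<E> w w))\<^sup>2 + 2 * (sqrt (1 / (real n + 1)))\<^sup>2"
      using sum_squares_bound[of "sqrt (\<E> w w)" "sqrt (1 / (real n + 1))"] by (simp add: power2_sum)
    also have "\<dots> \<le> 2 * \<E> w w + 2"
    proof -
      have "1 / (real n + 1) \<le> 1" by simp
      then have "(sqrt (1 / (real n + 1)))\<^sup>2 \<le> 1" by (subst real_sqrt_pow2) auto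
      moreover have "(sqrt (\<E> w w))\<^sup>2 = \<E> w w" using E_pos[OF assms(1)] by simp
      ultimately show ?thesis by linarith
    qed
    finally show ?thesis using uF(2)[of n] en[of n] by linarith
  qed
  have 6: "\<exists>N. \<forall>n\<ge>N. \<E> (u n) (u n) \<le> \<E> w w + e" if "0 < e" for e
  proof -
    have "\<forall>\<^sub>F n in sequentially. (sqrt (\<E> w w) + sqrt (1 / (real n + 1)))\<^sup>2 < \<E> w w + e"
      using order_tendstoD(2)[OF enl] that by simp
    then obtain N where N: "\<And>n. n \<ge> N \<Longrightarrow> (sqrt (\<E> w w) + sqrt (1 / (real n + 1)))\<^sup>2 < \<E> w w + e"
      by (auto simp: eventually_sequentially)
    have "\<E> (u n) (u n) \<le> \<E> w w + e" if "n \<ge> N" for n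
      using N[OF that] uF(2)[of n] en[of n] by linarith
    then show ?thesis by blast
  qed
  show ?thesis by (rule that[OF ulim uF(1) uc 4 _ 6]) (simp_all add: u_def T)
qed

text \<open>\<open>K_dcut_le\<close> wants a continuous test function supported inside the ball of
  the tent, while \<open>w\<close> is arbitrary and the tent of radius \<open>a\<close> fills its
  own ball. Enlarging the tent to radius \<open>b\<close> leaves room for a cutoff
  \<open>\<theta>\<close>, and approximation of \<open>w\<close> passes through
  \<open>E_weak_lim\<close>.\<close>

lemma K_dcut_sq_le:
  assumes a: "0 < a" "a < b" and w: "w \<in> \<F>" and M: "\<And>x. \<bar>w x\<bar> \<le> M"
  shows "K (dcut x0 a) (\<lambda>x. (w x)\<^sup>2) \<le> (\<integral>x. indicator (ball x0 b) x * (w x)\<^sup>2 \<partial>\<mu>)"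
proof -
  have M0: "0 \<le> M" using M[of undefined] by linarith
  \<comment> \<open>Third points of the interval from \<open>a\<close> to \<open>b\<close>:
    \<open>\<theta>\<close> is 1 up to \<open>a1\<close> and vanishes from \<open>b1\<close> on,
    with a margin on either side.\<close>
  define a1 where "a1 = (2 * a + b) / 3"
  define b1 where "b1 = (a + 2 * b) / 3"
  have ab: "0 < a1" "a < a1" "a1 < b1" "b1 < b" "0 < b1" "0 < b1 - a1" using a by (auto simp: a1_def b1_def)
  let ?h = "dcut x0 a"
  define \<theta> where "\<theta> x = cut (b1 - a1) (dcut x0 b1 x)" for x
  have hF: "?h \<in> \<F>" and hb: "\<And>x. \<bar>?h x\<bar> \<le> a" using dcut_F[OF a(1)] dcut_props(3)[OF a(1)] by auto
  have \<theta>F: "\<theta> \<in> \<F>" unfolding \<theta>_def by (rule F_cut[OF dcut_F[OF ab(5)] dcut_props(3)[OF ab(5)] ab(6)])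
  have \<theta>01: "0 \<le> \<theta> x" "\<theta> x \<le> 1" "\<bar>\<theta> x\<bar> \<le> 1" for x unfolding \<theta>_def by (rule cut_props[OF ab(6)])+
  have \<theta>c: "continuous_on UNIV \<theta>"
    unfolding \<theta>_def by (rule continuous_on_compose2[OF cut_props(6)[OF ab(6), of UNIV] dcut_props(1)]) simp
  have \<theta>1: "\<theta> x = 1" if "dist x0 x \<le> a1" for x
    using that ab by (simp add: \<theta>_def cut_def dcut_def le_divide_eq)
  have \<theta>0: "\<theta> x = 0" if "b1 \<le> dist x0 x" for x
    using dcut_props(4)[OF that] cut_props(7)[OF ab(6)] by (simp add: \<theta>_def)
  obtain u where u: "L2_lim u w" "\<And>n. u n \<in> \<F>" "\<And>n. u n \<in> cont_compact_support"
    "\<And>n. \<E> (u n) (u n) \<le> 2 * \<E> w w + 2" "\<And>n x. \<bar>u n x\<bar> \<le> M"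
    using F_approx[OF w M] by metis
  have sqw: "\<bar>(w x)\<^sup>2\<bar> \<le> M\<^sup>2" for x using M[of x] power_mono[of "\<bar>w x\<bar>" M 2] by simp
  have sqb: "\<bar>(u n x)\<^sup>2\<bar> \<le> M\<^sup>2" for n x using u(5)[of n x] power_mono[of "\<bar>u n x\<bar>" M 2] by simp
  have u2F: "(\<lambda>x. (u n x)\<^sup>2) \<in> \<F>" for n by (rule F_sq[OF u(2,5)])
  have u2E: "\<E> (\<lambda>x. (u n x)\<^sup>2) (\<lambda>x. (u n x)\<^sup>2) \<le> 2 * M\<^sup>2 * (2 * (2 * \<E> w w + 2))" for n
  proof -
    have "\<E> (\<lambda>x. (u n x)\<^sup>2) (\<lambda>x. (u n x)\<^sup>2) \<le> 2 * M\<^sup>2 * (\<E> (u n) (u n) + \<E> (u n) (u n))"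
      unfolding power2_eq_square[of "u n _"] by (rule F_mult(2)[OF u(2,2,5,5)])
    also have "\<dots> \<le> 2 * M\<^sup>2 * (2 * (2 * \<E> w w + 2))" using u(4)[of n] by (intro mult_left_mono) auto
    finally show ?thesis .
  qed
  have w2F: "(\<lambda>x. (w x)\<^sup>2) \<in> \<F>" by (rule F_sq[OF w M])
  have w2hF: "(\<lambda>x. (w x)\<^sup>2 * ?h x) \<in> \<F>" by (rule F_mult_bounded[OF w2F hF sqw hb])
  have u2hF: "(\<lambda>x. (u n x)\<^sup>2 * ?h x) \<in> \<F>" for n by (rule F_mult_bounded[OF u2F hF sqb hb])
  have h2F: "(\<lambda>x. (?h x)\<^sup>2) \<in> \<F>" by (rule F_sq[OF hF hb])
  have sqd: "\<bar>(u n x)\<^sup>2 - (w x)\<^sup>2\<bar> \<le> 2 * M * \<bar>u n x - w x\<bar>" for n x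
  proof -
    have "(u n x)\<^sup>2 - (w x)\<^sup>2 = (u n x + w x) * (u n x - w x)" by (simp add: power2_eq_square algebra_simps)
    moreover have "\<bar>u n x + w x\<bar> \<le> 2 * M" using u(5)[of n x] M[of x] by linarith
    ultimately show ?thesis by (simp add: abs_mult mult_right_mono)
  qed
  have l1: "L2_lim (\<lambda>n x. (u n x)\<^sup>2) (\<lambda>x. (w x)\<^sup>2)"
    by (rule L2_lim_contraction[OF u(1) F_meas[OF u2F] F_H[OF w2F], where c="2 * M"]) (rule AE_I2, rule sqd)
  have l2: "L2_lim (\<lambda>n x. (u n x)\<^sup>2 * ?h x) (\<lambda>x. (w x)\<^sup>2 * ?h x)"
    using L2_lim_bmult[OF l1 F_meas[OF hF] hb] by (simp add: mult.commute)
  define B where "B = max a (M\<^sup>2)"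
  have u2hE: "\<E> (\<lambda>x. (u n x)\<^sup>2 * ?h x) (\<lambda>x. (u n x)\<^sup>2 * ?h x) \<le> 2 * B\<^sup>2 * (2 * M\<^sup>2 * (2 * (2 * \<E> w w + 2)) + \<E> ?h ?h)" for n
  proof -
    have bb: "\<bar>(u n x)\<^sup>2\<bar> \<le> B" "\<bar>?h x\<bar> \<le> B" for x using sqb[of n x] hb[of x] by (auto simp: B_def)
    have "\<E> (\<lambda>x. (u n x)\<^sup>2 * ?h x) (\<lambda>x. (u n x)\<^sup>2 * ?h x) \<le> 2 * B\<^sup>2 * (\<E> (\<lambda>x. (u n x)\<^sup>2) (\<lambda>x. (u n x)\<^sup>2) + \<E> ?h ?h)"
      by (rule F_mult(2)[OF u2F hF bb])
    also have "\<dots> \<le> 2 * B\<^sup>2 * (2 * M\<^sup>2 * (2 * (2 * \<E> w w + 2)) + \<E> ?h ?h)"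
      using u2E[of n] by (intro mult_left_mono) auto
    finally show ?thesis .
  qed
  have Klim: "(\<lambda>n. K ?h (\<lambda>x. (u n x)\<^sup>2)) \<longlonglongrightarrow> K ?h (\<lambda>x. (w x)\<^sup>2)"
  proof -
    have "(\<lambda>n. \<E> (\<lambda>x. (u n x)\<^sup>2 * ?h x) ?h - \<E> (\<lambda>x. (u n x)\<^sup>2) (\<lambda>x. (?h x)\<^sup>2) / 2) \<longlonglongrightarrow>
      \<E> (\<lambda>x. (w x)\<^sup>2 * ?h x) ?h - \<E> (\<lambda>x. (w x)\<^sup>2) (\<lambda>x. (?h x)\<^sup>2) / 2"
      by (intro tendsto_diff tendsto_divide tendsto_const E_weak_lim[OF l2 u2hF u2hE hF] E_weak_lim[OF l1 u2F u2E h2F]) simp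
    then show ?thesis
      unfolding K_def using E_sym[OF u2F h2F] E_sym[OF w2F h2F] by simp
  qed
  have "K ?h (\<lambda>x. (u n x)\<^sup>2) \<le> ip (u n) (\<lambda>x. \<theta> x * u n x)" for n
  proof -
    let ?p = "\<lambda>x. (u n x)\<^sup>2" let ?q = "\<lambda>x. (u n x)\<^sup>2 * \<theta> x" let ?z = "\<lambda>x. (u n x)\<^sup>2 - (u n x)\<^sup>2 * \<theta> x"
    have qF: "?q \<in> \<F>" by (rule F_mult_bounded[OF u2F \<theta>F sqb \<theta>01(3)])
    have zF: "?z \<in> \<F>" by (intro F_diff u2F qF)
    have uc: "continuous_on UNIV (u n)" by (rule cont_compact_support_cont[OF u(3)])
    have qc: "?q \<in> cont_compact_support"
      by (rule cont_compact_support_mono[OF u(3)[of n]]) (use uc \<theta>c in \<open>auto intro!: continuous_intros\<close>)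
    have zc: "?z \<in> cont_compact_support"
      by (rule cont_compact_support_mono[OF u(3)[of n]]) (use uc \<theta>c in \<open>auto intro!: continuous_intros\<close>)
    have zh: "?z x * ?h x = 0" for x
      using \<theta>1[of x] dcut_props(4)[of a x0 x] ab by (cases "dist x0 x \<le> a1") auto
    have qhF: "(\<lambda>x. ?q x * ?h x) \<in> \<F>"
    proof (rule F_mult_bounded[OF qF hF _ hb])
      show "\<bar>?q x\<bar> \<le> M\<^sup>2 * 1" for x
        unfolding abs_mult by (intro mult_mono sqb u(5) \<theta>01) auto
    qed
    \<comment> \<open>The part removed by \<open>\<theta>\<close> vanishes on a neighbourhood of the
      support of the smaller tent, so it contributes nothing to \<open>K\<close>.\<close>
    have "\<E> ?z (\<lambda>x. (?h x)\<^sup>2) = 0"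
    proof (rule E_local[OF zF zc h2F compact_cball _ open_ball, of x0 a x0 a1 0])
      show "(?h x)\<^sup>2 = 0" if "x \<notin> cball x0 a" for x using that dcut_props(4)[of a x0 x] by simp
      show "?z x = 0" if "x \<in> ball x0 a1" for x using that \<theta>1[of x] by simp
    qed (use ab in auto)
    then have z1: "\<E> (\<lambda>x. (?h x)\<^sup>2) ?p = \<E> (\<lambda>x. (?h x)\<^sup>2) ?q"
      using E_sym[OF zF h2F] E_diff_r[OF u2F qF h2F] by simp
    have "(\<lambda>x. ?p x * ?h x) = (\<lambda>x. ?q x * ?h x)" using zh by (simp add: fun_eq_iff left_diff_distrib)
    then have "K ?h ?p = K ?h ?q" using z1 by (simp add: K_def)
    also have "\<dots> \<le> K (dcut x0 b) ?q"
    proof -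
      define Mx where "Mx = max b (M\<^sup>2)"
      have bF: "dcut x0 b \<in> \<F>" using a by (intro dcut_F) simp
      have bb: "\<bar>dcut x0 b x\<bar> \<le> Mx" "\<bar>?q x\<bar> \<le> Mx" for x
      proof -
        show "\<bar>dcut x0 b x\<bar> \<le> Mx" using dcut_props(3)[of b x0 x] a by (auto simp: Mx_def)
        have "\<bar>?q x\<bar> \<le> M\<^sup>2 * 1" unfolding abs_mult by (intro mult_mono sqb u(5) \<theta>01) auto
        then show "\<bar>?q x\<bar> \<le> Mx" by (auto simp: Mx_def)
      qed
      \<comment> \<open>The smaller tent is a normal contraction of the larger one, which lets
        \<open>K_contraction\<close> compare their energies.\<close>
      have "?h = (\<lambda>x. max 0 (dcut x0 b x - (b - a)))" using a by (auto simp: dcut_def fun_eq_iff max_def)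
      moreover have "K (\<lambda>x. max 0 (dcut x0 b x - (b - a))) ?q \<le> K (dcut x0 b) ?q"
        by (rule K_contraction[OF bF qF bb, of "\<lambda>s. max 0 (s - (b - a))"]) (use \<theta>01 a in auto)
      ultimately show ?thesis by simp
    qed
    also have "\<dots> \<le> (\<integral>x. ?q x \<partial>\<mu>)"
    proof (rule K_dcut_le[OF _ qF qc _ compact_cball[of x0 b1]])
      show "?q x = 0" if "x \<notin> cball x0 b1" for x using that \<theta>0[of x] by simp
    qed (use \<theta>01 ab a in auto)
    also have "\<dots> = ip (u n) (\<lambda>x. \<theta> x * u n x)"
      unfolding L2_inner_def by (simp add: power2_eq_square mult_ac)
    finally show ?thesis .
  qed
  then have "K ?h (\<lambda>x. (w x)\<^sup>2) \<le> ip w (\<lambda>x. \<theta> x * w x)"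
    using L2_lim_ip[OF u(1) L2_lim_bmult[OF u(1) F_meas[OF \<theta>F] \<theta>01(3)]] Klim by (intro LIMSEQ_le) auto
  also have "\<dots> \<le> (\<integral>x. indicator (ball x0 b) x * (w x)\<^sup>2 \<partial>\<mu>)"
    unfolding L2_inner_def
  proof (rule integral_mono)
    show "integrable \<mu> (\<lambda>x. w x * (\<theta> x * w x))"
      by (rule H_mult[OF F_H[OF w] H_bmult[OF F_H[OF w] F_meas[OF \<theta>F] \<theta>01(3)]])
    show "integrable \<mu> (\<lambda>x. indicator (ball x0 b) x * (w x)\<^sup>2)"
      using integrable_mult_indicator[OF _ H_sq[OF F_H[OF w]], of "ball x0 b"] by simp
    show "w x * (\<theta> x * w x) \<le> indicator (ball x0 b) x * (w x)\<^sup>2" for x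
    proof (cases "x \<in> ball x0 b")
      case True
      then show ?thesis using mult_right_mono[OF \<theta>01(2), of "(w x)\<^sup>2" x] by (simp add: power2_eq_square mult_ac)
    next
      case False
      then show ?thesis using \<theta>0[of x] ab by simp
    qed
  qed
  finally show ?thesis .
qed

end

section \<open>From the heat kernel bound to the Faber--Krahn inequality\<close>

locale weight_setting = doubling_setting \<mu> L for \<mu> :: "'a::polish_space measure" and L +
  fixes v :: "'a \<Rightarrow> real \<Rightarrow> real"
  assumes condA: "cond_A \<mu> v" and condDv: "cond_Dv \<mu> v" and condDv': "cond_Dv' v"
begin

lemma AE_ball_ex: 
  assumes "AE y in \<mu>. Q y" "0 < r" obtains y where "dist x y < r" "Q y"
proof -
  have "\<exists>y. dist x y < r \<and> Q y"
  proof (rule ccontr)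
    assume "\<not> ?thesis"
    then have "AE y in \<mu>. y \<notin> ball x r" using assms(1) by (auto elim: eventually_mono)
    then have "emeasure \<mu> (ball x r) = 0" by (subst (asm) AE_iff_measurable[of "ball x r"]) auto
    then show False using ball_pos[OF assms(2), of x] by simp
  qed
  then show ?thesis using that by blast
qed

text \<open>Condition \<open>(D'\<^sub>v)\<close> upgrades the almost-everywhere conditions to all points.\<close>

lemma v_regular:
  obtains D where "2 \<le> D" "\<And>x r. 0 < r \<Longrightarrow> 0 < v x r" "\<And>x y r. 0 < r \<Longrightarrow> dist x y \<le> r \<Longrightarrow> v y r \<le> D * v x r"
    "\<And>x r. 0 < r \<Longrightarrow> v x (2 * r) \<le> D * v x r" "\<And>x r s. 0 < r \<Longrightarrow> r \<le> s \<Longrightarrow> v x r \<le> D * v x s"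
proof -
  obtain C1 where C1: "0 < C1" "\<And>x y r. 0 < r \<Longrightarrow> dist x y \<le> r \<Longrightarrow> v y r \<le> C1 * v x r"
    using condDv' unfolding cond_Dv'_def by blast
  obtain C2 where C2: "0 < C2" "\<And>r. 0 < r \<Longrightarrow> AE x in \<mu>. v x (2 * r) \<le> C2 * v x r"
    using condDv unfolding cond_Dv_def by blast
  have pos: "0 < v x r" if r: "0 < r" for x r
  proof -
    have "AE y in \<mu>. 0 < v y r" using condA r unfolding cond_A_def by blast
    then obtain y where y: "dist x y < r" "0 < v y r" using AE_ball_ex r by blast
    then have "0 < C1 * v x r" using C1(2)[OF r, of x y] by simp
    then show ?thesis using C1(1) by (simp add: zero_less_mult_iff)
  qed
  have db: "v x (2 * r) \<le> (C1 * C2 * C1) * v x r" if r: "0 < r" for x r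
  proof -
    obtain y where y: "dist x y < r" "v y (2 * r) \<le> C2 * v y r" using AE_ball_ex[OF C2(2)[OF r] r] by blast
    have "v x (2 * r) \<le> C1 * v y (2 * r)" using y(1) r by (intro C1(2)) (auto simp: dist_commute)
    also have "\<dots> \<le> C1 * (C2 * v y r)" using y(2) C1(1) by simp
    also have "\<dots> \<le> C1 * (C2 * (C1 * v x r))" using C1 C2(1) y(1) r by (intro mult_left_mono C1(2)) auto
    finally show ?thesis by (simp add: mult_ac)
  qed
  have mono: "v x r \<le> (C1 * C1) * v x s" if r: "0 < r" "r \<le> s" for x r s
  proof -
    have "AE y in \<mu>. mono_on {0<..} (v y)" using condA unfolding cond_A_def by blast
    then obtain y where y: "dist x y < r" "mono_on {0<..} (v y)" using AE_ball_ex r(1) by blast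
    have "v x r \<le> C1 * v y r" using y(1) r by (intro C1(2)) (auto simp: dist_commute)
    also have "\<dots> \<le> C1 * v y s" using mono_onD[OF y(2), of r s] r C1(1) by simp
    also have "\<dots> \<le> C1 * (C1 * v x s)" using C1 y(1) r by (intro mult_left_mono C1(2)) auto
    finally show ?thesis by (simp add: mult_ac)
  qed
  define D where "D = max 2 (max C1 (max (C1 * C2 * C1) (C1 * C1)))"
  have D: "2 \<le> D" "C1 \<le> D" "C1 * C2 * C1 \<le> D" "C1 * C1 \<le> D" by (auto simp: D_def)
  show ?thesis
  proof (rule that[OF D(1) pos])
    show "v y r \<le> D * v x r" if "0 < r" "dist x y \<le> r" for x y r
      using C1(2)[OF that] mult_right_mono[OF D(2), of "v x r"] pos[OF that(1), of x] by linarith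
    show "v x (2 * r) \<le> D * v x r" if "0 < r" for x r
      using db[OF that, of x] mult_right_mono[OF D(3), of "v x r"] pos[OF that, of x] by linarith
    show "v x r \<le> D * v x s" if "0 < r" "r \<le> s" for x r s
      using mono[OF that, of x] mult_right_mono[OF D(4), of "v x s"] pos[of s x] that by linarith
  qed
qed

lemma v_pos: "0 < r \<Longrightarrow> 0 < v x r"
  by (rule v_regular) blast

lemma v_dyadic:
  assumes D: "2 \<le> D" "\<And>x r. 0 < r \<Longrightarrow> v x (2 * r) \<le> D * v x r" and r: "0 < r"
  shows "v x (2 ^ k * r) \<le> D ^ k * v x r"
proof (induction k)
  case (Suc k)
  have "v x (2 ^ Suc k * r) \<le> D * v x (2 ^ k * r)" using D(2)[of "2 ^ k * r" x] r by (simp add: mult.assoc)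
  also have "\<dots> \<le> D * (D ^ k * v x r)" using D(1) by (intro mult_left_mono Suc) auto
  finally show ?case by (simp add: mult.assoc)
qed simp

text \<open>Absorbs the constant inside the radius of the kernel bound: repeated doubling brings
  \<open>c * r\<close> above \<open>r\<close>, up to a multiplicative constant.\<close>

lemma v_scale:
  assumes "0 < c" obtains A where "1 \<le> A" "\<And>x r. 0 < r \<Longrightarrow> v x r \<le> A * v x (c * r)"
proof -
  obtain D where D: "2 \<le> D" "\<And>x r. 0 < r \<Longrightarrow> 0 < v x r" "\<And>x y r. 0 < r \<Longrightarrow> dist x y \<le> r \<Longrightarrow> v y r \<le> D * v x r"
    "\<And>x r. 0 < r \<Longrightarrow> v x (2 * r) \<le> D * v x r" "\<And>x r s. 0 < r \<Longrightarrow> r \<le> s \<Longrightarrow> v x r \<le> D * v x s"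
    by (rule v_regular) blast
  obtain k where k: "1 / c < 2 ^ k" using real_arch_pow[of 2] by auto
  show ?thesis
  proof (rule that)
    show "1 \<le> D ^ Suc k" using D(1) by (intro one_le_power) auto
    show "v x r \<le> D ^ Suc k * v x (c * r)" if r: "0 < r" for x r
    proof -
      have "1 \<le> 2 ^ k * c" using k assms by (simp add: divide_less_eq mult.commute)
      then have "r \<le> 2 ^ k * (c * r)" using r mult_right_mono[of 1 "2 ^ k * c" r] by (simp add: mult.assoc)
      then have "v x r \<le> D * v x (2 ^ k * (c * r))" using r by (rule D(5)[rotated])
      also have "\<dots> \<le> D * (D ^ k * v x (c * r))"
        using D(1) r assms by (intro mult_left_mono v_dyadic[OF D(1,4)]) auto
      finally show ?thesis by (simp add: mult.assoc)
    qed
  qed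
qed

text \<open>The complement of the support is a union of possibly uncountably many open sets on each
  of which \<open>f\<close> is a.e. zero; by Lindelof countably many suffice.\<close>

lemma ess_support_AE: "AE x in \<mu>. x \<notin> ess_support \<mu> f \<longrightarrow> f x = 0"
proof -
  let ?\<U> = "{U. open U \<and> (AE x in \<mu>. x \<in> U \<longrightarrow> f x = 0)}"
  obtain \<U>' where \<U>': "\<U>' \<subseteq> ?\<U>" "countable \<U>'" "\<Union>\<U>' = \<Union>?\<U>"
    using Lindelof[of ?\<U>] by auto
  have "AE x in \<mu>. \<forall>U\<in>\<U>'. x \<in> U \<longrightarrow> f x = 0"
    using \<U>' by (subst AE_ball_countable) auto
  then show ?thesis
  proof eventually_elim
    case (elim x)
    have "x \<notin> ess_support \<mu> f \<longleftrightarrow> x \<in> \<Union>\<U>'" unfolding \<U>'(3) ess_support_def by blast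
    then show ?case using elim by blast
  qed
qed

text \<open>The tangent line to the exponential at the spectral mean \<open>l\<close> lies below it,
  and its integral is exactly the left-hand side.\<close>

lemma heat_lower_bound:
  assumes f: "f \<in> \<F>" and pos: "0 < ip f f" and t: "0 < t"
  shows "exp (- (t * (\<E> f f / ip f f))) * ip f f \<le> ip (P t f) f"
proof -
  define l where "l = \<E> f f / ip f f"
  have fH: "f \<in> H" using F_H f .
  interpret fm: finite_measure "sm f" by (rule finite_measure_sm[OF fH])
  have i: "integrable (sm f) (\<lambda>s. exp (- (t * l)) * (1 + t * l - t * max 0 s))"
    using E_self(1)[OF f] by simp
  have m1: "(\<integral>s. 1 \<partial>sm f) = ip f f" using measure_sm_UNIV[OF fH] by simp
  have "(\<integral>s. exp (- (t * l)) * (1 + t * l - t * max 0 s) \<partial>sm f) \<le> (\<integral>s. hsym t s \<partial>sm f)"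
  proof (rule integral_mono[OF i])
    show "integrable (sm f) (hsym t)" using t by (intro integrable_sm fH bounded_borel_hsym) simp
    show "exp (- (t * l)) * (1 + t * l - t * max 0 s) \<le> hsym t s" for s
    proof -
      have "1 + (t * l - t * max 0 s) \<le> exp (t * l - t * max 0 s)" by (rule exp_ge_add_one_self)
      then have "exp (- (t * l)) * (1 + (t * l - t * max 0 s)) \<le> exp (- (t * l)) * exp (t * l - t * max 0 s)"
        by (rule mult_left_mono) simp
      also have "\<dots> = hsym t s" by (simp add: hsym_def exp_add[symmetric])
      finally show ?thesis by (simp add: algebra_simps)
    qed
  qed
  also have "(\<integral>s. exp (- (t * l)) * (1 + t * l - t * max 0 s) \<partial>sm f)
    = exp (- (t * l)) * ((1 + t * l) * ip f f - t * \<E> f f)"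
    using E_self[OF f] m1 by simp
  also have "\<dots> = exp (- (t * l)) * ip f f" using pos by (simp add: l_def algebra_simps)
  also have "(\<integral>s. hsym t s \<partial>sm f) = ip (P t f) f"
    unfolding P_def using t by (intro fc_quad[symmetric] bounded_borel_hsym fH) simp
  finally show ?thesis by (simp add: l_def)
qed

lemma L1_L2:
  assumes f: "f \<in> H" and \<Omega>: "\<Omega> \<in> sets \<mu>" "emeasure \<mu> \<Omega> < \<infinity>" and z: "AE x in \<mu>. x \<notin> \<Omega> \<longrightarrow> f x = 0"
  shows "integrable \<mu> f" "(\<integral>x. \<bar>f x\<bar> \<partial>\<mu>)\<^sup>2 \<le> measure \<mu> \<Omega> * ip f f"
proof -
  have [measurable]: "f \<in> borel_measurable \<mu>" using f by (rule H_meas)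
  have [measurable]: "\<Omega> \<in> sets \<mu>" by fact
  have IH: "indicator \<Omega> \<in> H" by (rule H_indicator[OF \<Omega>])
  have aH: "(\<lambda>x. \<bar>f x\<bar>) \<in> H" by (rule H_bound[OF f]) auto
  have ae: "AE x in \<mu>. \<bar>f x\<bar> * indicator \<Omega> x = \<bar>f x\<bar>" using z by eventually_elim (auto simp: indicator_def)
  have "integrable \<mu> (\<lambda>x. \<bar>f x\<bar>)"
    using H_mult[OF aH IH] by (rule integrable_cong_AE_imp) (use ae in auto)
  then show "integrable \<mu> f" by (subst (asm) integrable_abs_iff) auto
  have "ip (\<lambda>x. \<bar>f x\<bar>) (indicator \<Omega>) = (\<integral>x. \<bar>f x\<bar> \<partial>\<mu>)"
    unfolding L2_inner_def by (rule integral_cong_AE) (use ae in auto)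
  moreover have "ip (indicator \<Omega>) (indicator \<Omega>) = measure \<mu> \<Omega>"
    using \<Omega> by (simp add: L2_inner_def indicator_inter_arith[symmetric])
  moreover have "ip (\<lambda>x. \<bar>f x\<bar>) (\<lambda>x. \<bar>f x\<bar>) = ip f f" by (simp add: ip_self)
  ultimately show "(\<integral>x. \<bar>f x\<bar> \<partial>\<mu>)\<^sup>2 \<le> measure \<mu> \<Omega> * ip f f"
    using ip_CS_sq[OF aH IH] by (simp add: mult.commute)
qed

text \<open>Going from time \<open>r\<^sup>2 / 4 ^ j\<close> to the next one costs a factor
  \<open>D\<close> in the lower bound for \<open>v\<close> and divides the exponent
  \<open>r\<^sup>2 / 4 ^ j * l\<close> by 4. The best \<open>j\<close> therefore gives a power of
  \<open>1 + r\<^sup>2 * l\<close> with exponent \<open>\<gamma> = log 4 D\<close>, and the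
  Faber--Krahn exponent is \<open>1 / \<gamma>\<close>.\<close>

lemma DUE_imp_FK:
  assumes "DUE \<mu> L v" shows "FK_inhom \<mu> L v"
proof -
  obtain p C c where ker: "\<And>t. 0 < t \<Longrightarrow> integral_kernel \<mu> (heat_op \<mu> L t) (p t)"
    and Cc: "0 < C" "0 < c" and bound: "\<And>t. 0 < t \<Longrightarrow> AE (x, y) in \<mu> \<Otimes>\<^sub>M \<mu>.
      \<bar>p t x y\<bar> \<le> C * (v x (c * sqrt t) * v y (c * sqrt t)) powr (- (1 / 2))"
    using assms unfolding DUE_def by blast
  obtain D where D: "2 \<le> D" "\<And>x r. 0 < r \<Longrightarrow> 0 < v x r" "\<And>x y r. 0 < r \<Longrightarrow> dist x y \<le> r \<Longrightarrow> v y r \<le> D * v x r"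
    "\<And>x r. 0 < r \<Longrightarrow> v x (2 * r) \<le> D * v x r" "\<And>x r s. 0 < r \<Longrightarrow> r \<le> s \<Longrightarrow> v x r \<le> D * v x s"
    by (rule v_regular) blast
  obtain A where A: "1 \<le> A" "\<And>x r. 0 < r \<Longrightarrow> v x r \<le> A * v x (c * r)" using v_scale[OF Cc(2)] by blast
  define B where "B = exp 1 * (C * A * D ^ 2)"
  define \<gamma> where "\<gamma> = log 4 D"
  have B: "0 < B" using Cc A D(1) by (simp add: B_def)
  have \<gamma>: "0 < \<gamma>" unfolding \<gamma>_def using D(1) by simp
  have key: "(v x r / measure \<mu> \<Omega>) \<le> B * (1 + r\<^sup>2 * (\<E> f f / ip f f)) powr \<gamma>"
    if r: "0 < r" and \<Omega>: "open \<Omega>" "\<Omega> \<noteq> {}" "\<Omega> \<subseteq> ball x r"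
      and f: "f \<in> \<F>" "ess_support \<mu> f \<subseteq> \<Omega>" and fpos: "0 < ip f f" for x r \<Omega> f
  proof -
    have fH: "f \<in> H" using F_H f(1) .
    have [measurable]: "f \<in> borel_measurable \<mu>" using fH by (rule H_meas)
    have \<Omega>m: "\<Omega> \<in> sets \<mu>" using \<Omega>(1) by simp
    have \<Omega>fin: "emeasure \<mu> \<Omega> < \<infinity>"
      using emeasure_mono[OF \<Omega>(3), of \<mu>] ball_fin[of x r] by (simp add: order.strict_trans1)
    have \<Omega>pos: "0 < measure \<mu> \<Omega>"
    proof -
      obtain y where "y \<in> \<Omega>" using \<Omega>(2) by blast
      then obtain e where e: "0 < e" "ball y e \<subseteq> \<Omega>" using \<Omega>(1) open_contains_ball by blast
      have "0 < measure \<mu> (ball y e)" using volume_pos[OF e(1)] by (simp add: volume_def)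
      also have "\<dots> \<le> measure \<mu> \<Omega>"
        by (rule measure_mono_fmeasurable[OF e(2)]) (use \<Omega>m \<Omega>fin in \<open>auto intro: fmeasurableI\<close>)
      finally show ?thesis .
    qed
    have fz: "AE y in \<mu>. y \<notin> \<Omega> \<longrightarrow> f y = 0" using ess_support_AE[of f] by eventually_elim (use f(2) in blast)
    define l where "l = \<E> f f / ip f f"
    have l0: "0 \<le> l" using E_pos[OF f(1)] fpos by (simp add: l_def)
    have main: "exp (- (r\<^sup>2 / 4 ^ j * l)) \<le> C * A * D ^ Suc j * (measure \<mu> \<Omega> / v x r)" for j
    proof -
      define \<rho> where "\<rho> = r / 2 ^ j"
      define t where "t = \<rho>\<^sup>2"
      have \<rho>: "0 < \<rho>" using r by (simp add: \<rho>_def)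
      have t: "0 < t" "sqrt t = \<rho>" using \<rho> by (simp_all add: t_def)
      \<comment> \<open>Change of centre by \<open>(D'_v)\<close>, then \<open>j\<close> halvings of
        the radius, then the change from radius \<open>\<rho>\<close> to
        \<open>c * \<rho>\<close>.\<close>
      have vlow: "v x r \<le> (A * D ^ Suc j) * v y (c * \<rho>)" if "y \<in> \<Omega>" for y
      proof -
        have "dist y x \<le> r" using that \<Omega>(3) by (auto simp: dist_commute)
        then have "v x r \<le> D * v y r" by (rule D(3)[OF r])
        also have "v y r = v y (2 ^ j * \<rho>)" by (simp add: \<rho>_def)
        also have "D * v y (2 ^ j * \<rho>) \<le> D * (D ^ j * v y \<rho>)"
          using D(1) by (intro mult_left_mono v_dyadic[OF D(1,4) \<rho>]) auto
        also have "\<dots> \<le> D * (D ^ j * (A * v y (c * \<rho>)))"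
          using D(1) by (intro mult_left_mono A(2)[OF \<rho>]) auto
        finally show ?thesis by (simp add: mult_ac)
      qed
      define m where "m = v x r / (A * D ^ Suc j)"
      have AD: "0 < A * D ^ Suc j" using A(1) D(1) by (intro mult_pos_pos zero_less_power) auto
      have m: "0 < m" using D(2)[OF r] AD by (simp add: m_def)
      have vm: "m \<le> v y (c * \<rho>)" if "y \<in> \<Omega>" for y
        using vlow[OF that] AD by (simp add: m_def divide_le_eq mult.commute)
      \<comment> \<open>The kernel bound is given for almost every pair; Fubini turns it into an
        iterated statement that can be used inside the integral.\<close>
      have pb: "AE y in \<mu>. AE z in \<mu>. \<bar>p t y z\<bar> \<le> C * (v y (c * \<rho>) * v z (c * \<rho>)) powr (- (1 / 2))"
        using pair_sigma_finite.AE_pair[OF pair_sigma_finite.intro[OF sigma_finite_measure_axioms sigma_finite_measure_axioms] bound[OF t(1)]] t(2) by simp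
      have "AE y in \<mu>. integrable \<mu> (\<lambda>z. p t y z * f z) \<and> P t f y = (\<integral>z. p t y z * f z \<partial>\<mu>)"
        using ker[OF t(1)] heat_op_P[OF t(1) fH] unfolding integral_kernel_def by blast
      then have le: "AE y in \<mu>. P t f y * f y \<le> C / m * (\<integral>z. \<bar>f z\<bar> \<partial>\<mu>) * \<bar>f y\<bar>"
        using pb fz
      proof eventually_elim
        case (elim y)
        show ?case
        proof (cases "y \<in> \<Omega>")
          case True
          have "\<bar>P t f y\<bar> \<le> (\<integral>z. \<bar>p t y z * f z\<bar> \<partial>\<mu>)" using elim by simp
          also have "\<dots> \<le> (\<integral>z. C / m * \<bar>f z\<bar> \<partial>\<mu>)"
          proof (rule integral_mono_AE)
            show "integrable \<mu> (\<lambda>z. C / m * \<bar>f z\<bar>)" using L1_L2(1)[OF fH \<Omega>m \<Omega>fin fz] by simp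
            show "AE z in \<mu>. \<bar>p t y z * f z\<bar> \<le> C / m * \<bar>f z\<bar>"
              using elim(2) fz
            proof eventually_elim
              case (elim z)
              show ?case
              proof (cases "z \<in> \<Omega>")
                case z: True
                have "m * m \<le> v y (c * \<rho>) * v z (c * \<rho>)"
                  using vm[OF True] vm[OF z] m by (intro mult_mono) auto
                then have "(v y (c * \<rho>) * v z (c * \<rho>)) powr (- (1 / 2)) \<le> (m * m) powr (- (1 / 2))"
                  using m by (intro powr_mono2') auto
                also have "\<dots> = 1 / m" using m by (simp add: powr_minus powr_half_sqrt inverse_eq_divide)
                finally have "C * (v y (c * \<rho>) * v z (c * \<rho>)) powr (- (1 / 2)) \<le> C * (1 / m)"
                  using Cc(1) by (intro mult_left_mono) auto
                then have "\<bar>p t y z\<bar> \<le> C / m" using elim(1) by simp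
                then show ?thesis unfolding abs_mult by (rule mult_right_mono) simp
              qed (use elim in simp)
            qed
          qed (use elim in simp)
          finally have "\<bar>P t f y\<bar> \<le> C / m * (\<integral>z. \<bar>f z\<bar> \<partial>\<mu>)" by simp
          then have "\<bar>P t f y\<bar> * \<bar>f y\<bar> \<le> C / m * (\<integral>z. \<bar>f z\<bar> \<partial>\<mu>) * \<bar>f y\<bar>" by (rule mult_right_mono) simp
          then show ?thesis unfolding abs_mult[symmetric] by linarith
        qed (use elim in simp)
      qed
      have "exp (- (t * l)) * ip f f \<le> ip (P t f) f"
        unfolding l_def by (rule heat_lower_bound[OF f(1) fpos t(1)])
      also have "\<dots> \<le> (\<integral>y. C / m * (\<integral>z. \<bar>f z\<bar> \<partial>\<mu>) * \<bar>f y\<bar> \<partial>\<mu>)"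
        unfolding L2_inner_def
      proof (rule integral_mono_AE[OF H_mult[OF P_H[OF _ fH] fH] _ le])
        show "integrable \<mu> (\<lambda>y. C / m * (\<integral>z. \<bar>f z\<bar> \<partial>\<mu>) * \<bar>f y\<bar>)"
          using L1_L2(1)[OF fH \<Omega>m \<Omega>fin fz] by simp
      qed (use t(1) in simp)
      also have "\<dots> = C / m * (\<integral>z. \<bar>f z\<bar> \<partial>\<mu>)\<^sup>2" by (simp add: power2_eq_square)
      also have "\<dots> \<le> C / m * (measure \<mu> \<Omega> * ip f f)"
        using Cc(1) m by (intro mult_left_mono L1_L2(2)[OF fH \<Omega>m \<Omega>fin fz]) auto
      finally have "exp (- (t * l)) * ip f f \<le> (C / m * measure \<mu> \<Omega>) * ip f f" by simp
      then have "exp (- (t * l)) \<le> C / m * measure \<mu> \<Omega>" by (rule mult_right_le_imp_le[OF _ fpos])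
      moreover have "t = r\<^sup>2 / 4 ^ j" unfolding t_def \<rho>_def
        by (simp add: power_divide power_mult[symmetric] mult.commute[of _ 2]) (simp add: power_mult)
      ultimately show ?thesis by (simp add: m_def)
    qed
    define \<Lambda> where "\<Lambda> = r\<^sup>2 * l"
    have \<Lambda>0: "0 \<le> \<Lambda>" using l0 by (simp add: \<Lambda>_def)
    \<comment> \<open>Least number of quarterings after which the exponent is at most 1, so that the
      exponential is at least \<open>exp (- 1)\<close>, while \<open>4 ^ j\<close> overshoots by a
      factor 4 only.\<close>
    define j where "j = nat \<lceil>log 4 (1 + \<Lambda>)\<rceil>"
    have lg0: "0 \<le> log 4 (1 + \<Lambda>)" using \<Lambda>0 by simp
    have j1: "1 + \<Lambda> \<le> 4 ^ j"
    proof -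
      have "log 4 (1 + \<Lambda>) \<le> real j" unfolding j_def by linarith
      then have "1 + \<Lambda> \<le> 4 powr real j" using \<Lambda>0 by (simp add: log_le_iff)
      then show ?thesis by (simp add: powr_realpow)
    qed
    have j2: "(4::real) ^ j \<le> 4 * (1 + \<Lambda>)"
    proof -
      have "real j \<le> log 4 (1 + \<Lambda>) + 1" unfolding j_def using lg0 by linarith
      then have "4 powr real j \<le> 4 powr (log 4 (1 + \<Lambda>) + 1)" by (intro powr_mono) auto
      also have "\<dots> = 4 * (1 + \<Lambda>)" using \<Lambda>0 by (simp add: powr_add)
      finally show ?thesis by (simp add: powr_realpow)
    qed
    have "r\<^sup>2 / 4 ^ j * l \<le> 1"
    proof -
      have "\<Lambda> \<le> 4 ^ j" using j1 by linarith
      then show ?thesis by (simp add: \<Lambda>_def)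
    qed
    then have "exp (- 1) \<le> exp (- (r\<^sup>2 / 4 ^ j * l))" by simp
    also have "\<dots> \<le> C * A * D ^ Suc j * (measure \<mu> \<Omega> / v x r)" by (rule main)
    finally have le: "exp (- 1) * (v x r / measure \<mu> \<Omega>) \<le> C * A * D ^ Suc j"
      using D(2)[OF r] \<Omega>pos by (simp add: field_simps)
    have "v x r / measure \<mu> \<Omega> \<le> exp 1 * (C * A * D ^ Suc j)"
    proof -
      have "exp 1 * (exp (- 1) * (v x r / measure \<mu> \<Omega>)) \<le> exp 1 * (C * A * D ^ Suc j)"
        by (rule mult_left_mono[OF le]) simp
      moreover have "exp 1 * (exp (- 1) * (v x r / measure \<mu> \<Omega>)) = v x r / measure \<mu> \<Omega>"
        unfolding mult.assoc[symmetric] exp_add[symmetric] by simp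
      ultimately show ?thesis by (simp only:)
    qed
    also have "\<dots> = exp 1 * (C * A * D) * D ^ j" by simp
    also have "D ^ j = (4 ^ j) powr \<gamma>"
    proof -
      have "D ^ j = D powr real j" using D(1) by (simp add: powr_realpow)
      also have "\<dots> = (4 powr \<gamma>) powr real j" unfolding \<gamma>_def using D(1) by simp
      also have "\<dots> = (4 powr real j) powr \<gamma>" by (simp add: powr_powr mult.commute)
      finally show ?thesis by (simp add: powr_realpow)
    qed
    also have "exp 1 * (C * A * D) * (4 ^ j) powr \<gamma> \<le> exp 1 * (C * A * D) * (4 * (1 + \<Lambda>)) powr \<gamma>"
      using j2 \<gamma> Cc A D(1) by (intro mult_left_mono powr_mono2) auto
    also have "\<dots> = B * (1 + \<Lambda>) powr \<gamma>"
    proof -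
      have "(4 * (1 + \<Lambda>)) powr \<gamma> = D * (1 + \<Lambda>) powr \<gamma>"
        using \<Lambda>0 D(1) by (subst powr_mult) (simp_all add: \<gamma>_def)
      then show ?thesis by (simp add: B_def power2_eq_square)
    qed
    finally show ?thesis unfolding \<Lambda>_def l_def .
  qed
  show ?thesis
    unfolding FK_inhom_def
  proof (rule exI[of _ "1 / \<gamma>"], rule conjI[rotated], rule exI[of _ "(1 / B) powr (1 / \<gamma>)"], intro conjI allI impI)
    show "0 < 1 / \<gamma>" using \<gamma> by simp
    show "0 < (1 / B) powr (1 / \<gamma>)" using B by simp
    fix x :: 'a and r :: real and \<Omega> :: "'a set"
    assume r: "0 < r" and \<Omega>: "open \<Omega> \<and> \<Omega> \<noteq> {} \<and> compact (closure \<Omega>) \<and> \<Omega> \<subseteq> ball x r"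
    define q where "q = (1 / B) powr (1 / \<gamma>) * (v x r / measure \<mu> \<Omega>) powr (1 / \<gamma>)"
    \<comment> \<open>The bound on each Rayleigh quotient is solved for the quotient first, since
      the infimum is taken in the extended reals and is infinite when there is no admissible
      function.\<close>
    have "ereal ((q - 1) / r\<^sup>2) \<le> first_eigenvalue \<mu> L \<Omega>"
      unfolding first_eigenvalue_def
    proof (rule Inf_greatest)
      fix e assume "e \<in> {ereal (\<E> f f / (L2_norm \<mu> f)\<^sup>2) |f. f \<in> compactly_supported_dom \<mu> \<F> \<Omega> \<and> \<not> ae_eq \<mu> f (\<lambda>_. 0)}"
      then obtain f where e: "e = ereal (\<E> f f / ip f f)" and f: "f \<in> \<F>" "ess_support \<mu> f \<subseteq> \<Omega>"
        and nz: "\<not> (AE x in \<mu>. f x = 0)"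
        unfolding L2_norm_sq compactly_supported_dom_def ae_eq_def by blast
      have fpos: "0 < ip f f" using ip_self_zero[OF F_H[OF f(1)]] nz ip_ge0[of f] by linarith
      have l0: "0 \<le> \<E> f f / ip f f" using E_pos[OF f(1)] fpos by simp
      let ?X = "1 + r\<^sup>2 * (\<E> f f / ip f f)"
      have X: "0 < ?X" using l0 mult_nonneg_nonneg[of "r\<^sup>2" "\<E> f f / ip f f"] by simp
      have "v x r / measure \<mu> \<Omega> \<le> B * ?X powr \<gamma>" using key[OF r _ _ _ f fpos, of x] \<Omega> by blast
      then have "(v x r / measure \<mu> \<Omega>) powr (1 / \<gamma>) \<le> (B * ?X powr \<gamma>) powr (1 / \<gamma>)"
        using \<gamma> D(2)[OF r, of x] by (intro powr_mono2) (auto intro: divide_nonneg_nonneg less_imp_le)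
      also have "\<dots> = B powr (1 / \<gamma>) * ?X"
        using B X \<gamma> by (simp add: powr_mult powr_powr)
      finally have "q \<le> (1 / B) powr (1 / \<gamma>) * (B powr (1 / \<gamma>) * ?X)"
        unfolding q_def by (rule mult_left_mono) simp
      also have "\<dots> = ((1 / B) * B) powr (1 / \<gamma>) * ?X" using B by (simp only: powr_mult mult.assoc)
      also have "\<dots> = ?X" using B by simp
      finally have "(q - 1) / r\<^sup>2 \<le> \<E> f f / ip f f" using r by (simp add: divide_le_eq mult.commute)
      then show "ereal ((q - 1) / r\<^sup>2) \<le> e" unfolding e by simp
    qed
    then have "ereal (r\<^sup>2) * ereal ((q - 1) / r\<^sup>2) \<le> ereal (r\<^sup>2) * first_eigenvalue \<mu> L \<Omega>"
      by (rule ereal_mult_left_mono) simp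
    then have "ereal (q - 1) \<le> ereal (r\<^sup>2) * first_eigenvalue \<mu> L \<Omega>" using r by simp
    then have "ereal (q - 1) + 1 \<le> ereal (r\<^sup>2) * first_eigenvalue \<mu> L \<Omega> + 1" by (rule add_right_mono)
    then show "ereal (q) \<le> ereal (r\<^sup>2) * first_eigenvalue \<mu> L \<Omega> + 1" by (simp add: one_ereal_def)
  qed
qed

end

section \<open>A local Nash inequality\<close>

context weight_setting
begin

text \<open>From Faber--Krahn to a Nash inequality. With \<open>s = ip \<phi> \<phi> / (4 I)\<close>
  and \<open>I\<close> the integral of \<open>\<phi>\<close>, cutting at height \<open>s\<close>
  keeps at least half of the L2 mass, and by Chebyshev the set \<open>\<Omega>\<close> has measure
  at most \<open>2 I / s = 8 I\<^sup>2 / ip \<phi> \<phi>\<close>.\<close>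

lemma FK_level_set:
  assumes \<alpha>: "0 < \<alpha>" and c: "0 < c" and r: "0 < r"
    and fk: "\<And>\<Omega>. open \<Omega> \<Longrightarrow> \<Omega> \<noteq> {} \<Longrightarrow> compact (closure \<Omega>) \<Longrightarrow> \<Omega> \<subseteq> ball x r \<Longrightarrow>
      ereal (c * (v x r / measure \<mu> \<Omega>) powr \<alpha>) \<le> ereal (r\<^sup>2) * first_eigenvalue \<mu> L \<Omega> + 1"
    and \<phi>: "\<phi> \<in> \<F>" "\<phi> \<in> cont_compact_support" and pos: "\<And>y. 0 \<le> \<phi> y"
    and z: "\<And>y. y \<notin> ball x r \<Longrightarrow> \<phi> y = 0" and N: "0 < ip \<phi> \<phi>"
  shows "c / 2 * ip \<phi> \<phi> * (v x r * ip \<phi> \<phi> / (8 * (\<integral>y. \<phi> y \<partial>\<mu>)\<^sup>2)) powr \<alpha> \<le> r\<^sup>2 * \<E> \<phi> \<phi> + ip \<phi> \<phi>"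
proof -
  have \<phi>c: "continuous_on UNIV \<phi>" by (rule cont_compact_support_cont[OF \<phi>(2)])
  have [measurable]: "\<phi> \<in> borel_measurable \<mu>" by (rule cont_meas[OF \<phi>c])
  have \<phi>H: "\<phi> \<in> H" by (rule F_H[OF \<phi>(1)])
  obtain M where M: "\<And>y. \<bar>\<phi> y\<bar> \<le> M" using cont_compact_support_bounded[OF \<phi>(2)] by blast
  define I where "I = (\<integral>y. \<phi> y \<partial>\<mu>)"
  have int: "integrable \<mu> \<phi>"
    by (rule L1_L2(1)[OF \<phi>H, of "ball x r"]) (use z ball_fin in auto)
  have I0: "0 \<le> I" unfolding I_def using pos by (intro integral_nonneg_AE) auto
  have Ipos: "0 < I"
  proof (rule ccontr)
    assume "\<not> 0 < I"
    then have "(\<integral>y. \<phi> y \<partial>\<mu>) = 0" using I0 by (simp add: I_def)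
    then have "AE y in \<mu>. \<phi> y = 0" using integral_nonneg_eq_0_iff_AE[OF int] pos by simp
    then have "ip \<phi> \<phi> = 0" using ip_self_zero[OF \<phi>H] by simp
    then show False using N by simp
  qed
  define s where "s = ip \<phi> \<phi> / (4 * I)"
  have s: "0 < s" using N Ipos by (simp add: s_def)
  define f where "f y = max 0 (\<phi> y - s)" for y
  \<comment> \<open>Level \<open>s / 2\<close> instead of \<open>s\<close>: the support of
    \<open>f\<close> lies in the closed set where \<open>\<phi>\<close> is at least
    \<open>s\<close>, which this open set contains.\<close>
  define \<Omega> where "\<Omega> = {y. s / 2 < \<phi> y}"
  have \<Omega>o: "open \<Omega>" unfolding \<Omega>_def using open_Collect_less[OF continuous_on_const \<phi>c] .
  have \<Omega>b: "\<Omega> \<subseteq> ball x r"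
  proof
    fix y assume "y \<in> \<Omega>"
    then have "\<phi> y \<noteq> 0" using s by (auto simp: \<Omega>_def)
    then show "y \<in> ball x r" using z by blast
  qed
  have \<Omega>c: "compact (closure \<Omega>)" by (rule compact_closure_ball[OF \<Omega>b])
  have [measurable]: "\<Omega> \<in> sets \<mu>" using \<Omega>o by simp
  have \<Omega>fin: "emeasure \<mu> \<Omega> < \<infinity>"
    using emeasure_mono[OF \<Omega>b, of \<mu>] ball_fin[of x r] by (simp add: order.strict_trans1)
  have fF: "f \<in> \<F>" "\<E> f f \<le> \<E> \<phi> \<phi>" unfolding f_def using pos_part_F[OF \<phi>(1) M, of s] s by auto
  have fle: "0 \<le> f y" "f y \<le> \<phi> y" for y using pos[of y] s by (auto simp: f_def)
  have ff: "ip \<phi> \<phi> / 2 \<le> ip f f"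
  proof -
    have "(\<integral>y. (\<phi> y)\<^sup>2 - 2 * s * \<phi> y \<partial>\<mu>) \<le> ip f f"
      unfolding ip_self
    proof (rule integral_mono)
      show "integrable \<mu> (\<lambda>y. (\<phi> y)\<^sup>2 - 2 * s * \<phi> y)" using int H_sq[OF \<phi>H] by simp
      show "integrable \<mu> (\<lambda>y. (f y)\<^sup>2)" by (rule H_sq[OF F_H[OF fF(1)]])
      show "(\<phi> y)\<^sup>2 - 2 * s * \<phi> y \<le> (f y)\<^sup>2" for y
      proof (cases "s \<le> \<phi> y")
        case True
        then have "(f y)\<^sup>2 = (\<phi> y)\<^sup>2 - 2 * s * \<phi> y + s\<^sup>2" by (simp add: f_def power2_eq_square algebra_simps)
        then show ?thesis by simp
      next
        case False
        then have "\<phi> y * (\<phi> y - 2 * s) \<le> 0" using pos[of y] s by (intro mult_nonneg_nonpos) auto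
        then have "(\<phi> y)\<^sup>2 - 2 * s * \<phi> y \<le> 0" by (simp add: power2_eq_square algebra_simps)
        then show ?thesis using zero_le_power2[of "f y"] by linarith
      qed
    qed
    also have "(\<integral>y. (\<phi> y)\<^sup>2 - 2 * s * \<phi> y \<partial>\<mu>) = ip \<phi> \<phi> - 2 * s * I"
      using int H_sq[OF \<phi>H] by (simp add: I_def ip_self)
    also have "2 * s * I = ip \<phi> \<phi> / 2" using Ipos by (simp add: s_def)
    finally show ?thesis by simp
  qed
  have fpos: "0 < ip f f" using ff N by linarith
  have \<Omega>ne: "\<Omega> \<noteq> {}"
  proof
    assume "\<Omega> = {}"
    have "f y = 0" for y
    proof -
      have "y \<notin> \<Omega>" using \<open>\<Omega> = {}\<close> by simp
      then show ?thesis using s by (simp add: \<Omega>_def f_def)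
    qed
    then have "f = (\<lambda>_. 0)" by blast
    then show False using fpos by simp
  qed
  have m\<Omega>: "measure \<mu> \<Omega> \<le> 2 * I / s"
  proof -
    have "(\<integral>y. s / 2 * indicator \<Omega> y \<partial>\<mu>) \<le> I"
      unfolding I_def
    proof (rule integral_mono[OF _ int])
      show "integrable \<mu> (\<lambda>y. s / 2 * indicator \<Omega> y)" using \<Omega>fin \<Omega>o by (intro integrable_mult_right integrable_real_indicator) auto
      show "s / 2 * indicator \<Omega> y \<le> \<phi> y" for y using pos[of y] by (auto simp: \<Omega>_def indicator_def)
    qed
    then have "s / 2 * measure \<mu> \<Omega> \<le> I" using \<Omega>fin by simp
    then show ?thesis using s by (simp add: field_simps)
  qed
  have m\<Omega>pos: "0 < measure \<mu> \<Omega>"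
  proof -
    obtain y where "y \<in> \<Omega>" using \<Omega>ne by blast
    then obtain e where e: "0 < e" "ball y e \<subseteq> \<Omega>" using \<Omega>o open_contains_ball by blast
    have "0 < measure \<mu> (ball y e)" using volume_pos[OF e(1)] by (simp add: volume_def)
    also have "\<dots> \<le> measure \<mu> \<Omega>"
      by (rule measure_mono_fmeasurable[OF e(2)]) (use \<Omega>fin \<Omega>o in \<open>auto intro: fmeasurableI\<close>)
    finally show ?thesis .
  qed
  have es: "ess_support \<mu> f \<subseteq> \<Omega>" "compact (ess_support \<mu> f)"
  proof -
    have cl: "closed {y. s \<le> \<phi> y}" by (rule closed_Collect_le[OF continuous_on_const \<phi>c])
    have "ess_support \<mu> f \<subseteq> {y. s \<le> \<phi> y}" by (rule ess_support_subset[OF cl]) (auto simp: f_def)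
    also have "\<dots> \<subseteq> \<Omega>" using s by (auto simp: \<Omega>_def)
    finally show 1: "ess_support \<mu> f \<subseteq> \<Omega>" .
    show "compact (ess_support \<mu> f)"
      by (rule compact_subset_cball[OF closed_ess_support, of f x r]) (use 1 \<Omega>b in fastforce)
  qed
  define l where "l = \<E> f f / ip f f"
  have "first_eigenvalue \<mu> L \<Omega> \<le> ereal l"
    unfolding first_eigenvalue_def L2_norm_sq l_def
  proof (rule Inf_lower, rule CollectI, intro exI[of _ f] conjI refl)
    show "f \<in> compactly_supported_dom \<mu> \<F> \<Omega>" using es fF by (simp add: compactly_supported_dom_def)
    show "\<not> ae_eq \<mu> f (\<lambda>_. 0)" using fpos ip_self_zero[OF F_H[OF fF(1)]] by (auto simp: ae_eq_def)
  qed
  then have "ereal (r\<^sup>2) * first_eigenvalue \<mu> L \<Omega> + 1 \<le> ereal (r\<^sup>2) * ereal l + 1"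
    by (intro add_right_mono ereal_mult_left_mono) auto
  with fk[OF \<Omega>o \<Omega>ne \<Omega>c \<Omega>b] have "ereal (c * (v x r / measure \<mu> \<Omega>) powr \<alpha>) \<le> ereal (r\<^sup>2) * ereal l + 1"
    by (rule order_trans)
  then have 1: "c * (v x r / measure \<mu> \<Omega>) powr \<alpha> \<le> r\<^sup>2 * l + 1" by (simp add: one_ereal_def)
  have "v x r * ip \<phi> \<phi> / (8 * I\<^sup>2) \<le> v x r / measure \<mu> \<Omega>"
  proof -
    have "measure \<mu> \<Omega> * ip \<phi> \<phi> \<le> (2 * I / s) * ip \<phi> \<phi>" using m\<Omega> N by (intro mult_right_mono) auto
    also have "\<dots> = 8 * I\<^sup>2" using N Ipos by (simp add: s_def power2_eq_square)
    finally have "v x r * (measure \<mu> \<Omega> * ip \<phi> \<phi>) \<le> v x r * (8 * I\<^sup>2)"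
      using v_pos[OF r, of x] by (intro mult_left_mono) auto
    then show ?thesis using m\<Omega>pos Ipos by (simp add: field_simps)
  qed
  then have "(v x r * ip \<phi> \<phi> / (8 * I\<^sup>2)) powr \<alpha> \<le> (v x r / measure \<mu> \<Omega>) powr \<alpha>"
    using \<alpha> v_pos[OF r, of x] N by (intro powr_mono2) auto
  then have "c * (v x r * ip \<phi> \<phi> / (8 * I\<^sup>2)) powr \<alpha> \<le> r\<^sup>2 * l + 1"
    using 1 c mult_left_mono[of "(v x r * ip \<phi> \<phi> / (8 * I\<^sup>2)) powr \<alpha>" "(v x r / measure \<mu> \<Omega>) powr \<alpha>" c] by linarith
  then have "ip f f * (c * (v x r * ip \<phi> \<phi> / (8 * I\<^sup>2)) powr \<alpha>) \<le> ip f f * (r\<^sup>2 * l + 1)"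
    using fpos by (intro mult_left_mono) auto
  also have "\<dots> = r\<^sup>2 * \<E> f f + ip f f" using fpos by (simp add: l_def field_simps)
  also have "\<dots> \<le> r\<^sup>2 * \<E> \<phi> \<phi> + ip \<phi> \<phi>"
  proof (intro add_mono mult_left_mono fF)
    show "ip f f \<le> ip \<phi> \<phi>" unfolding ip_self
      using fle by (intro integral_mono H_sq F_H[OF fF(1)] \<phi>H power_mono) auto
  qed simp
  finally have "ip f f * (c * (v x r * ip \<phi> \<phi> / (8 * I\<^sup>2)) powr \<alpha>) \<le> r\<^sup>2 * \<E> \<phi> \<phi> + ip \<phi> \<phi>" .
  moreover have "ip \<phi> \<phi> / 2 * (c * (v x r * ip \<phi> \<phi> / (8 * I\<^sup>2)) powr \<alpha>) \<le> ip f f * (c * (v x r * ip \<phi> \<phi> / (8 * I\<^sup>2)) powr \<alpha>)"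
    using ff c by (intro mult_right_mono) auto
  moreover have "c / 2 * ip \<phi> \<phi> * (v x r * ip \<phi> \<phi> / (8 * I\<^sup>2)) powr \<alpha> = ip \<phi> \<phi> / 2 * (c * (v x r * ip \<phi> \<phi> / (8 * I\<^sup>2)) powr \<alpha>)"
    by simp
  ultimately show ?thesis unfolding I_def by linarith
qed

text \<open>The support of \<open>g\<close> is only measurable, so the hypothesis cannot be applied
  to it directly, and approximation does not preserve its measure. The Nash form involves only the
  energy and the L1 and L2 norms, which pass to the limit; at the end Cauchy--Schwarz bounds the L1
  norm of \<open>g\<close> through \<open>m\<close>. The constant 258 is 2 times
  \<open>129 = 128 + 1\<close>, with \<open>128 = 2 * 8\<^sup>2\<close> from the cutoff width
  \<open>r / 8\<close>.\<close>

lemma FK_measurable_sets: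
  assumes \<alpha>: "0 < \<alpha>" and c: "0 < c" and r: "0 < r"
    and fk: "\<And>\<Omega>. open \<Omega> \<Longrightarrow> \<Omega> \<noteq> {} \<Longrightarrow> compact (closure \<Omega>) \<Longrightarrow> \<Omega> \<subseteq> ball x r \<Longrightarrow>
      ereal (c * (v x r / measure \<mu> \<Omega>) powr \<alpha>) \<le> ereal (r\<^sup>2) * first_eigenvalue \<mu> L \<Omega> + 1"
    and g: "g \<in> \<F>" "\<And>y. 0 \<le> g y" "\<And>y. g y \<le> M" and z: "\<And>y. 3 * r / 4 \<le> dist x y \<Longrightarrow> g y = 0"
    and m: "0 < m" "measure \<mu> {y. g y \<noteq> 0} \<le> m"
  shows "c / (258 * 8 powr \<alpha>) * (v x r / m) powr \<alpha> * ip g g \<le> r\<^sup>2 * \<E> g g + ip g g"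
proof (cases "0 < ip g g")
  case False
  then have "ip g g = 0" using ip_ge0[of g] by linarith
  then show ?thesis using E_pos[OF g(1)] by simp
next
  case Npos: True
  have gH: "g \<in> H" by (rule F_H[OF g(1)])
  have [measurable]: "g \<in> borel_measurable \<mu>" using gH by (rule H_meas)
  have gM: "\<bar>g y\<bar> \<le> M" for y using g(2,3)[of y] by simp
  have M0: "0 \<le> M" using gM[of undefined] by linarith
  obtain u where u: "L2_lim u g" "\<And>n. u n \<in> \<F>" "\<And>n. u n \<in> cont_compact_support"
    "\<And>n. \<E> (u n) (u n) \<le> 2 * \<E> g g + 2" "\<And>n y. \<bar>u n y\<bar> \<le> M"
    "\<And>e. 0 < e \<Longrightarrow> \<exists>N. \<forall>n\<ge>N. \<E> (u n) (u n) \<le> \<E> g g + e"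
    by (rule F_approx[OF g(1) gM]) blast
  \<comment> \<open>The cutoff is 1 where \<open>g\<close> may live and vanishes from radius
    \<open>7 r / 8\<close> on; the remaining eighth is the enlargement that
    \<open>K_dcut_sq_le\<close> consumes.\<close>
  define a where "a = 7 * r / 8"
  define \<delta> where "\<delta> = r / 8"
  have a: "0 < a" "a < r" and \<delta>: "0 < \<delta>" using r by (auto simp: a_def \<delta>_def)
  let ?h = "dcut x a"
  have hF: "?h \<in> \<F>" by (rule dcut_F[OF a(1)])
  define \<psi> where "\<psi> y = cut \<delta> (?h y)" for y
  have \<psi>c: "continuous_on UNIV \<psi>"
    unfolding \<psi>_def by (rule continuous_on_compose2[OF cut_props(6)[OF \<delta>, of UNIV] dcut_props(1)]) simp
  have \<psi>01: "0 \<le> \<psi> y" "\<psi> y \<le> 1" "\<bar>\<psi> y\<bar> \<le> 1" for y unfolding \<psi>_def by (rule cut_props[OF \<delta>])+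
  have \<psi>1: "\<psi> y = 1" if "dist x y \<le> 3 * r / 4" for y
  proof -
    have "\<delta> \<le> ?h y" using that unfolding \<delta>_def a_def dcut_def by linarith
    then show ?thesis using \<delta> by (simp add: \<psi>_def cut_def le_divide_eq)
  qed
  have \<psi>0: "\<psi> y = 0" if "a \<le> dist x y" for y
    using dcut_props(4)[OF that] cut_props(7)[OF \<delta>] by (simp add: \<psi>_def)
  have \<psi>g: "\<psi> y * g y = g y" for y using z[of y] \<psi>1[of y] by (cases "3 * r / 4 \<le> dist x y") auto
  \<comment> \<open>Approximants of \<open>g\<close> may change sign and leave the ball; the
    absolute value and the cutoff repair both while fixing \<open>g\<close>, so the convergence
    survives.\<close>
  define \<phi> where "\<phi> n y = \<psi> y * \<bar>u n y\<bar>" for n y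
  have uaF: "(\<lambda>y. \<bar>u n y\<bar>) \<in> \<F>" "\<E> (\<lambda>y. \<bar>u n y\<bar>) (\<lambda>y. \<bar>u n y\<bar>) \<le> \<E> (u n) (u n)" for n
    by (rule F_contraction[OF u(2,5), of abs]; simp)+
  define B where "B = max M a"
  have B: "\<bar>\<bar>u n y\<bar>\<bar> \<le> B" "\<bar>?h y\<bar> \<le> B" for n y
    using u(5)[of n y] dcut_props(3)[OF a(1), of x y] by (auto simp: B_def)
  have \<phi>F: "\<phi> n \<in> \<F>" and \<phi>E: "r\<^sup>2 * \<E> (\<phi> n) (\<phi> n) \<le> 2 * r\<^sup>2 * \<E> (u n) (u n) + 128 * ip (u n) (u n)" for n
  proof -
    show "\<phi> n \<in> \<F>" unfolding \<phi>_def \<psi>_def by (rule E_cut_mult(2)[OF uaF(1) hF B \<delta>])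
    have "\<E> (\<phi> n) (\<phi> n) \<le> 2 * \<E> (\<lambda>y. \<bar>u n y\<bar>) (\<lambda>y. \<bar>u n y\<bar>) + 2 * K ?h (\<lambda>y. \<bar>u n y\<bar>\<^sup>2) / \<delta>\<^sup>2"
      unfolding \<phi>_def \<psi>_def by (rule E_cut_mult(1)[OF uaF(1) hF B \<delta>])
    also have "\<dots> \<le> 2 * \<E> (u n) (u n) + 2 * ip (u n) (u n) / \<delta>\<^sup>2"
    proof -
      have "K ?h (\<lambda>y. \<bar>u n y\<bar>\<^sup>2) \<le> (\<integral>y. indicator (ball x r) y * \<bar>u n y\<bar>\<^sup>2 \<partial>\<mu>)"
        by (rule K_dcut_sq_le[OF a uaF(1), of n M]) (use u(5) in simp)
      also have "\<dots> \<le> ip (u n) (u n)"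
        unfolding ip_self
      proof (rule integral_mono)
        show "integrable \<mu> (\<lambda>y. (u n y)\<^sup>2)" by (rule H_sq[OF F_H[OF u(2)]])
        then show "integrable \<mu> (\<lambda>y. indicator (ball x r) y * \<bar>u n y\<bar>\<^sup>2)"
          using integrable_mult_indicator[of "ball x r" \<mu> "\<lambda>y. (u n y)\<^sup>2"] by simp
        show "indicator (ball x r) y * \<bar>u n y\<bar>\<^sup>2 \<le> (u n y)\<^sup>2" for y by (auto simp: indicator_def)
      qed
      finally have "2 * K ?h (\<lambda>y. \<bar>u n y\<bar>\<^sup>2) / \<delta>\<^sup>2 \<le> 2 * ip (u n) (u n) / \<delta>\<^sup>2"
        by (intro divide_right_mono) auto
      then show ?thesis using uaF(2)[of n] by linarith
    qed
    finally have "r\<^sup>2 * \<E> (\<phi> n) (\<phi> n) \<le> r\<^sup>2 * (2 * \<E> (u n) (u n) + 2 * ip (u n) (u n) / \<delta>\<^sup>2)"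
      by (rule mult_left_mono) simp
    also have "\<dots> = 2 * r\<^sup>2 * \<E> (u n) (u n) + 128 * ip (u n) (u n)"
      using r by (simp add: \<delta>_def field_simps power2_eq_square)
    finally show "r\<^sup>2 * \<E> (\<phi> n) (\<phi> n) \<le> 2 * r\<^sup>2 * \<E> (u n) (u n) + 128 * ip (u n) (u n)" .
  qed
  have \<phi>c: "\<phi> n \<in> cont_compact_support" for n
    by (rule cont_compact_support_mono[OF u(3)[of n]])
      (use \<psi>c cont_compact_support_cont[OF u(3)[of n]] in \<open>auto intro!: continuous_intros simp: \<phi>_def\<close>)
  have \<phi>lim: "L2_lim \<phi> g"
  proof (rule L2_lim_contraction[OF u(1) F_meas[OF \<phi>F] gH, where c=1], rule AE_I2)
    fix n y
    have "\<bar>\<phi> n y - g y\<bar> = \<bar>\<psi> y * (\<bar>u n y\<bar> - g y)\<bar>" by (simp add: \<phi>_def right_diff_distrib \<psi>g)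
    also have "\<dots> \<le> \<bar>\<bar>u n y\<bar> - g y\<bar>" unfolding abs_mult by (rule mult_left_le_one_le) (use \<psi>01 in auto)
    also have "\<dots> \<le> \<bar>u n y - g y\<bar>" using g(2)[of y] by linarith
    finally show "\<bar>\<phi> n y - g y\<bar> \<le> 1 * \<bar>u n y - g y\<bar>" by simp
  qed
  have Nlim: "(\<lambda>n. ip (\<phi> n) (\<phi> n)) \<longlonglongrightarrow> ip g g" by (rule L2_lim_ip[OF \<phi>lim \<phi>lim])
  have ulim: "(\<lambda>n. ip (u n) (u n)) \<longlonglongrightarrow> ip g g" by (rule L2_lim_ip[OF u(1) u(1)])
  have bH: "indicator (ball x r) \<in> H" by (rule H_indicator) (use ball_fin in auto)
  have Ieq: "ip f (indicator (ball x r)) = (\<integral>y. f y \<partial>\<mu>)" if "\<And>y. a \<le> dist x y \<Longrightarrow> f y = 0" for f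
    unfolding L2_inner_def using that a by (intro Bochner_Integration.integral_cong) (auto simp: indicator_def)
  have \<phi>z: "\<phi> n y = 0" if "a \<le> dist x y" for n y using \<psi>0[OF that] by (simp add: \<phi>_def)
  have gz: "g y = 0" if "a \<le> dist x y" for y using that z[of y] r by (simp add: a_def)
  have Ilim: "(\<lambda>n. \<integral>y. \<phi> n y \<partial>\<mu>) \<longlonglongrightarrow> (\<integral>y. g y \<partial>\<mu>)"
    using L2_lim_ip_const[OF \<phi>lim bH] by (simp add: Ieq \<phi>z gz)
  define I where "I = (\<integral>y. g y \<partial>\<mu>)"
  have gint: "integrable \<mu> g" by (rule L1_L2(1)[OF gH, of "ball x r"]) (use gz a ball_fin in auto)
  have I0: "0 \<le> I" unfolding I_def using g(2) by (intro integral_nonneg_AE) auto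
  have Ipos: "0 < I"
  proof (rule ccontr)
    assume "\<not> 0 < I"
    then have "(\<integral>y. g y \<partial>\<mu>) = 0" using I0 by (simp add: I_def)
    then have "AE y in \<mu>. g y = 0" using integral_nonneg_eq_0_iff_AE[OF gint] g(2) by simp
    then show False using ip_self_zero[OF gH] Npos by simp
  qed
  have V: "0 < v x r" by (rule v_pos[OF r])
  let ?lhs = "c / 2 * ip g g * (v x r * ip g g / (8 * I\<^sup>2)) powr \<alpha>"
  have lhslim: "(\<lambda>n. c / 2 * ip (\<phi> n) (\<phi> n) * (v x r * ip (\<phi> n) (\<phi> n) / (8 * (\<integral>y. \<phi> n y \<partial>\<mu>)\<^sup>2)) powr \<alpha>) \<longlonglongrightarrow> ?lhs"
  proof -
    have "v x r * ip g g / (8 * I\<^sup>2) \<noteq> 0" "8 * I\<^sup>2 \<noteq> 0" using V Npos Ipos by auto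
    then show ?thesis
      by (intro tendsto_mult tendsto_powr tendsto_divide tendsto_const tendsto_power Nlim) (use Ilim in \<open>auto simp: I_def\<close>)
  qed
  have le: "?lhs \<le> 2 * r\<^sup>2 * (\<E> g g + e) + 129 * (ip g g + e)" if e: "0 < e" for e
  proof (rule LIMSEQ_le_const2[OF lhslim])
    obtain N1 where N1: "\<And>n. n \<ge> N1 \<Longrightarrow> \<E> (u n) (u n) \<le> \<E> g g + e" using u(6)[OF e] by blast
    have "\<forall>\<^sub>F n in sequentially. ip (u n) (u n) < ip g g + e" using order_tendstoD(2)[OF ulim] e by simp
    then obtain N2 where N2: "\<And>n. n \<ge> N2 \<Longrightarrow> ip (u n) (u n) < ip g g + e" by (auto simp: eventually_sequentially)
    have "\<forall>\<^sub>F n in sequentially. 0 < ip (\<phi> n) (\<phi> n)" using order_tendstoD(1)[OF Nlim] Npos by simp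
    then obtain N3 where N3: "\<And>n. n \<ge> N3 \<Longrightarrow> 0 < ip (\<phi> n) (\<phi> n)" by (auto simp: eventually_sequentially)
    have "c / 2 * ip (\<phi> n) (\<phi> n) * (v x r * ip (\<phi> n) (\<phi> n) / (8 * (\<integral>y. \<phi> n y \<partial>\<mu>)\<^sup>2)) powr \<alpha>
      \<le> 2 * r\<^sup>2 * (\<E> g g + e) + 129 * (ip g g + e)" if n: "n \<ge> max N1 (max N2 N3)" for n
    proof -
      have "c / 2 * ip (\<phi> n) (\<phi> n) * (v x r * ip (\<phi> n) (\<phi> n) / (8 * (\<integral>y. \<phi> n y \<partial>\<mu>)\<^sup>2)) powr \<alpha> \<le> r\<^sup>2 * \<E> (\<phi> n) (\<phi> n) + ip (\<phi> n) (\<phi> n)"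
        by (rule FK_level_set[OF \<alpha> c r fk \<phi>F \<phi>c]) (use N3[of n] n \<psi>01 \<phi>z a in \<open>auto simp: \<phi>_def\<close>)
      moreover have "ip (\<phi> n) (\<phi> n) \<le> ip (u n) (u n)"
        unfolding ip_self
      proof (intro integral_mono H_sq F_H \<phi>F u(2))
        show "(\<phi> n y)\<^sup>2 \<le> (u n y)\<^sup>2" for y
          unfolding abs_le_square_iff[symmetric] \<phi>_def abs_mult abs_abs by (rule mult_left_le_one_le) (use \<psi>01 in auto)
      qed
      moreover have "r\<^sup>2 * \<E> (u n) (u n) \<le> r\<^sup>2 * (\<E> g g + e)" using N1[of n] n by (intro mult_left_mono) auto
      ultimately show ?thesis using \<phi>E[of n] N2[of n] n by simp
    qed
    then show "\<exists>N. \<forall>n\<ge>N. c / 2 * ip (\<phi> n) (\<phi> n) * (v x r * ip (\<phi> n) (\<phi> n) / (8 * (\<integral>y. \<phi> n y \<partial>\<mu>)\<^sup>2)) powr \<alpha>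
      \<le> 2 * r\<^sup>2 * (\<E> g g + e) + 129 * (ip g g + e)" by blast
  qed
  have le0: "?lhs \<le> 2 * r\<^sup>2 * \<E> g g + 129 * ip g g"
  proof (rule field_le_epsilon)
    fix e :: real assume e: "0 < e"
    define e' where "e' = e / (2 * r\<^sup>2 + 129)"
    have p: "0 < 2 * r\<^sup>2 + 129" using zero_le_power2[of r] by linarith
    have "0 < e'" using e p by (simp add: e'_def)
    from le[OF this] have "?lhs \<le> 2 * r\<^sup>2 * \<E> g g + 129 * ip g g + (2 * r\<^sup>2 + 129) * e'" by (simp add: algebra_simps)
    also have "(2 * r\<^sup>2 + 129) * e' = e" using p by (simp add: e'_def)
    finally show "?lhs \<le> 2 * r\<^sup>2 * \<E> g g + 129 * ip g g + e" .
  qed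
  have "v x r / m / 8 \<le> v x r * ip g g / (8 * I\<^sup>2)"
  proof -
    have "{y\<in>space \<mu>. g y \<noteq> 0} \<in> sets \<mu>" by measurable
    then have gs: "{y. g y \<noteq> 0} \<in> sets \<mu>" by simp
    have "{y. g y \<noteq> 0} \<subseteq> ball x r" using gz a by (force simp: not_le[symmetric])
    then have gfin: "emeasure \<mu> {y. g y \<noteq> 0} < \<infinity>"
      using emeasure_mono[of "{y. g y \<noteq> 0}" "ball x r" \<mu>] ball_fin[of x r] by (simp add: order.strict_trans1)
    have "I\<^sup>2 \<le> measure \<mu> {y. g y \<noteq> 0} * ip g g"
      using L1_L2(2)[OF gH gs gfin] g(2) by (simp add: I_def)
    also have "\<dots> \<le> m * ip g g" using m(2) by (rule mult_right_mono) simp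
    finally have "v x r * I\<^sup>2 \<le> v x r * (m * ip g g)" using V by simp
    then show ?thesis using m(1) Ipos by (simp add: field_simps)
  qed
  then have "(v x r / m / 8) powr \<alpha> \<le> (v x r * ip g g / (8 * I\<^sup>2)) powr \<alpha>"
    using \<alpha> V m(1) by (intro powr_mono2) auto
  then have "c / 2 * ip g g * (v x r / m / 8) powr \<alpha> \<le> ?lhs" using c by (intro mult_left_mono) auto
  also have "\<dots> \<le> 2 * r\<^sup>2 * \<E> g g + 129 * ip g g" by (rule le0)
  also have "\<dots> \<le> 129 * (r\<^sup>2 * \<E> g g + ip g g)" using E_pos[OF g(1)] by simp
  finally have "c / 2 * ip g g * (v x r / m / 8) powr \<alpha> \<le> 129 * (r\<^sup>2 * \<E> g g + ip g g)" .
  moreover have "(v x r / m / 8) powr \<alpha> = (v x r / m) powr \<alpha> / 8 powr \<alpha>"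
    using V m(1) by (subst powr_divide) auto
  ultimately have A: "c / 2 * ip g g * ((v x r / m) powr \<alpha> / 8 powr \<alpha>) \<le> 129 * (r\<^sup>2 * \<E> g g + ip g g)" by (simp only:)
  have G: "c / (258 * 8 powr \<alpha>) * (v x r / m) powr \<alpha> * ip g g = (c / 2 * ip g g * ((v x r / m) powr \<alpha> / 8 powr \<alpha>)) / 129"
    by simp
  have "X / 129 \<le> Y" if "X \<le> 129 * Y" for X Y :: real using that by simp
  from this[OF A] show ?thesis unfolding G .
qed

end

section \<open>Ultracontractivity by parabolic De Giorgi iteration\<close>

text \<open>The square of the positive part is continuously differentiable with a 2-Lipschitz
  derivative. The quadratic remainder lets an integral of it inherit differentiability from the L2
  differentiability of the heat flow.\<close>

lemma sq_pos_part_taylor: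
  fixes a b k :: real
  shows "\<bar>(max 0 (a - k))\<^sup>2 - (max 0 (b - k))\<^sup>2 - 2 * max 0 (b - k) * (a - b)\<bar> \<le> (a - b)\<^sup>2"
proof -
  define p where "p = max 0 (a - k)"
  define q where "q = max 0 (b - k)"
  have lip: "\<bar>p - q\<bar> \<le> \<bar>a - b\<bar>" by (auto simp: p_def q_def)
  have "p\<^sup>2 - q\<^sup>2 - 2 * q * (a - b) = (p - q)\<^sup>2 + 2 * q * ((p - q) - (a - b))"
    by (simp add: power2_eq_square algebra_simps)
  moreover have "0 \<le> (p - q)\<^sup>2 + 2 * q * ((p - q) - (a - b)) \<and> (p - q)\<^sup>2 + 2 * q * ((p - q) - (a - b)) \<le> (a - b)\<^sup>2"
  proof (cases "b \<le> k")
    case True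
    then have "q = 0" by (simp add: q_def)
    then show ?thesis using lip by (simp add: abs_le_square_iff[symmetric])
  next
    case b: False
    then have q: "q = b - k" "0 < q" by (auto simp: q_def)
    show ?thesis
    proof (cases "a \<le> k")
      case True
      then have p: "p = 0" by (simp add: p_def)
      have e: "(p - q)\<^sup>2 + 2 * q * ((p - q) - (a - b)) = q * (q + 2 * (k - a))"
        unfolding p q(1) by (simp add: power2_eq_square algebra_simps)
      have "(a - b)\<^sup>2 = q * (q + 2 * (k - a)) + (k - a)\<^sup>2" unfolding q(1) by (simp add: power2_eq_square algebra_simps)
      then show ?thesis using e q(2) True by simp
    next
      case False
      then have "p - q = a - b" using b by (simp add: p_def q_def)
      then show ?thesis by simp
    qed
  qed
  ultimately show ?thesis unfolding p_def q_def by simp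
qed

lemma DERIV_quadratic_bound:
  fixes J :: "real \<Rightarrow> real"
  assumes e: "0 < e" and b: "\<And>h. \<bar>h\<bar> \<le> e \<Longrightarrow> \<bar>J (t + h) - J t - h * D\<bar> \<le> C * h\<^sup>2"
  shows "DERIV J t :> D"
  unfolding DERIV_def
proof (rule LIM_zero_cancel, rule Lim_null_comparison)
  show "\<forall>\<^sub>F h in at 0. norm ((J (t + h) - J t) / h - D) \<le> C * \<bar>h\<bar>"
    unfolding eventually_at
  proof (intro exI[of _ e] conjI ballI impI e)
    fix h :: real assume h: "h \<noteq> 0 \<and> dist h 0 < e"
    have "(J (t + h) - J t) / h - D = (J (t + h) - J t - h * D) / h" using h by (simp add: field_simps)
    then have "\<bar>(J (t + h) - J t) / h - D\<bar> = \<bar>J (t + h) - J t - h * D\<bar> / \<bar>h\<bar>" by (simp add: abs_divide)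
    also have "\<dots> \<le> C * h\<^sup>2 / \<bar>h\<bar>" using b[of h] h by (intro divide_right_mono) auto
    also have "\<dots> = C * \<bar>h\<bar>"
    proof -
      have "C * (a * a) / a = C * a" if "a \<noteq> 0" for a :: real using that by simp
      from this[of "\<bar>h\<bar>"] show ?thesis using h by (simp add: power2_eq_square)
    qed
    finally show "norm ((J (t + h) - J t) / h - D) \<le> C * \<bar>h\<bar>" by simp
  qed
  have "((\<lambda>h. C * \<bar>h\<bar>) \<longlongrightarrow> C * \<bar>0\<bar>) (at (0::real))" by (intro tendsto_intros)
  then show "((\<lambda>h. C * \<bar>h\<bar>) \<longlongrightarrow> 0) (at (0::real))" by simp
qed

lemma gronwall_decay:
  fixes J J' :: "real \<Rightarrow> real"
  assumes A: "0 < A" and st: "s \<le> t" and d: "\<And>\<tau>. s \<le> \<tau> \<Longrightarrow> \<tau> \<le> t \<Longrightarrow> DERIV J \<tau> :> J' \<tau>"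
    and le: "\<And>\<tau>. s \<le> \<tau> \<Longrightarrow> \<tau> \<le> t \<Longrightarrow> J' \<tau> \<le> - A * J \<tau> + B"
  shows "J t \<le> exp (- A * (t - s)) * (J s - B / A) + B / A"
proof -
  define G where "G \<tau> = exp (A * \<tau>) * (J \<tau> - B / A)" for \<tau>
  have "G t \<le> G s"
  proof (rule DERIV_nonpos_imp_nonincreasing[OF st])
    fix \<tau> assume \<tau>: "s \<le> \<tau>" "\<tau> \<le> t"
    have "DERIV G \<tau> :> exp (A * \<tau>) * A * (J \<tau> - B / A) + exp (A * \<tau>) * J' \<tau>"
      unfolding G_def by (auto intro!: derivative_eq_intros d[OF \<tau>])
    moreover have "exp (A * \<tau>) * A * (J \<tau> - B / A) + exp (A * \<tau>) * J' \<tau> = exp (A * \<tau>) * (A * J \<tau> - B + J' \<tau>)"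
      using A by (simp add: algebra_simps)
    moreover have "exp (A * \<tau>) * (A * J \<tau> - B + J' \<tau>) \<le> 0"
      using le[OF \<tau>] by (intro mult_nonneg_nonpos) auto
    ultimately show "\<exists>y. DERIV G \<tau> :> y \<and> y \<le> 0" by auto
  qed
  then have "exp (- (A * t)) * G t \<le> exp (- (A * t)) * G s" by (rule mult_left_mono) simp
  moreover have "exp (- (A * t)) * G t = J t - B / A"
    unfolding G_def mult.assoc[symmetric] exp_add[symmetric] by simp
  moreover have "exp (- (A * t)) * G s = exp (- A * (t - s)) * (J s - B / A)"
    unfolding G_def mult.assoc[symmetric] exp_add[symmetric] by (simp add: algebra_simps)
  ultimately show ?thesis by simp
qed

section \<open>Decay of the localised truncated mass along the heat flow\<close>

context weight_setting
begin

text \<open>The increment of the flow is \<open>- h * LP t f\<close> up to an L2 error quadratic in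
  \<open>h\<close>, by \<open>P_derivative\<close>, and the integrand has a quadratic remainder in
  the increment, so the total error is at most \<open>Cc * h\<^sup>2\<close>.\<close>

lemma truncated_mass_derivative:
  assumes t: "0 < t" and f: "f \<in> H" and k: "0 \<le> k" and \<eta>m: "\<eta> \<in> borel_measurable \<mu>" and \<eta>: "\<And>y. \<bar>\<eta> y\<bar> \<le> 1"
  shows "DERIV (\<lambda>t. \<integral>y. (\<eta> y)\<^sup>2 * (max 0 (P t f y - k))\<^sup>2 \<partial>\<mu>) t
    :> - 2 * ip (LP t f) (\<lambda>y. (\<eta> y)\<^sup>2 * max 0 (P t f y - k))"
proof -
  have [measurable]: "\<eta> \<in> borel_measurable \<mu>" by (rule \<eta>m)
  define w where "w \<tau> y = max 0 (P \<tau> f y - k)" for \<tau> y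
  define J where "J \<tau> = (\<integral>y. (\<eta> y)\<^sup>2 * (w \<tau> y)\<^sup>2 \<partial>\<mu>)" for \<tau>
  have \<eta>2: "\<bar>(\<eta> y)\<^sup>2\<bar> \<le> 1" for y using \<eta>[of y] by (simp add: abs_square_le_1)
  have PH: "P \<tau> f \<in> H" if "0 \<le> \<tau>" for \<tau> by (rule P_H[OF that f])
  have wH: "w \<tau> \<in> H" if "0 \<le> \<tau>" for \<tau>
    by (rule H_bound[OF PH[OF that]]) (use H_meas[OF PH[OF that]] k in \<open>auto simp: w_def[abs_def]\<close>)
  have Jint: "integrable \<mu> (\<lambda>y. (\<eta> y)\<^sup>2 * (w \<tau> y)\<^sup>2)" if "0 \<le> \<tau>" for \<tau>
    using H_mult[OF H_bmult[OF wH[OF that] \<eta>m \<eta>] H_bmult[OF wH[OF that] \<eta>m \<eta>]]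
    by (simp add: power2_eq_square mult_ac)
  have \<ell>: "LP t f \<in> H" by (rule LP_H[OF t f])
  define q where "q y = (\<eta> y)\<^sup>2 * w t y" for y
  have qH: "q \<in> H" unfolding q_def by (rule H_bmult[OF wH _ \<eta>2]) (use t in auto)
  define Cc where "Cc = 2 * ip (LP t f) (LP t f) + 2 * ((16 / t\<^sup>2)\<^sup>2 * (t\<^sup>2 / 4) * ip f f)
    + 2 * (sqrt (ip q q) * (16 / t\<^sup>2 * sqrt (ip f f)))"
  have "DERIV J t :> - 2 * ip (LP t f) q"
  proof (rule DERIV_quadratic_bound[of "t / 2" _ _ _ Cc])
    fix h :: real assume h: "\<bar>h\<bar> \<le> t / 2"
    define \<tau> where "\<tau> = t + h"
    have \<tau>0: "0 \<le> \<tau>" "0 \<le> t" using h t unfolding \<tau>_def by linarith+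
    have \<tau>t: "\<bar>\<tau> - t\<bar> \<le> t / 2" "\<tau> - t = h" using h by (auto simp: \<tau>_def)
    let ?d = "\<lambda>y. P \<tau> f y - P t f y"
    let ?e = "\<lambda>y. P \<tau> f y - P t f y + h * LP t f y"
    have dH: "?d \<in> H" by (intro H_diff PH \<tau>0)
    have eH: "?e \<in> H" by (intro H_add dH H_cmult \<ell>)
    have e4: "ip ?e ?e \<le> (16 / t\<^sup>2 * h\<^sup>2)\<^sup>2 * ip f f" using P_derivative[OF t \<tau>t(1) f] \<tau>t(2) by simp
    \<comment> \<open>Lowers the fourth-order bound \<open>e4\<close> to second order, uniformly for
      \<open>h\<close> in the admissible range.\<close>
    have h2: "h\<^sup>2 \<le> t\<^sup>2 / 4"
    proof -
      have "\<bar>h\<bar>\<^sup>2 \<le> (t / 2)\<^sup>2" by (rule power_mono[OF h]) simp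
      then show ?thesis by (simp add: power_divide)
    qed
    have e2: "ip ?e ?e \<le> (16 / t\<^sup>2)\<^sup>2 * (t\<^sup>2 / 4) * ip f f * h\<^sup>2"
    proof -
      have "(16 / t\<^sup>2 * h\<^sup>2)\<^sup>2 * ip f f = (16 / t\<^sup>2)\<^sup>2 * ip f f * h\<^sup>2 * h\<^sup>2" by (simp add: power2_eq_square)
      also have "\<dots> \<le> (16 / t\<^sup>2)\<^sup>2 * ip f f * h\<^sup>2 * (t\<^sup>2 / 4)" by (rule mult_left_mono[OF h2]) simp
      finally show ?thesis using e4 by (simp add: mult_ac)
    qed
    have dd: "ip ?d ?d \<le> 2 * ip (LP t f) (LP t f) * h\<^sup>2 + 2 * ((16 / t\<^sup>2)\<^sup>2 * (t\<^sup>2 / 4) * ip f f * h\<^sup>2)"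
    proof -
      have "?d = (\<lambda>y. ?e y - h * LP t f y)" by auto
      then have "ip ?d ?d \<le> 2 * ip ?e ?e + 2 * ip (\<lambda>y. h * LP t f y) (\<lambda>y. h * LP t f y)"
        using ip_triangle_diff[OF eH H_cmult[OF \<ell>, of h]] by simp
      also have "ip (\<lambda>y. h * LP t f y) (\<lambda>y. h * LP t f y) = ip (LP t f) (LP t f) * h\<^sup>2"
        by (simp add: ip_cmult ip_cmult_r power2_eq_square)
      finally show ?thesis using e2 by linarith
    qed
    have qe: "\<bar>ip q ?e\<bar> \<le> sqrt (ip q q) * (16 / t\<^sup>2 * sqrt (ip f f)) * h\<^sup>2"
    proof -
      have "sqrt (ip ?e ?e) \<le> sqrt ((16 / t\<^sup>2 * h\<^sup>2)\<^sup>2 * ip f f)" by (rule real_sqrt_le_mono[OF e4])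
      also have "\<dots> = 16 / t\<^sup>2 * h\<^sup>2 * sqrt (ip f f)" by (simp add: real_sqrt_mult real_sqrt_abs)
      finally have "sqrt (ip q q) * sqrt (ip ?e ?e) \<le> sqrt (ip q q) * (16 / t\<^sup>2 * h\<^sup>2 * sqrt (ip f f))"
        by (rule mult_left_mono) simp
      then show ?thesis using ip_CS[OF qH eH] by (simp add: mult_ac)
    qed
    have rem: "\<bar>J \<tau> - J t - 2 * ip q ?d\<bar> \<le> ip ?d ?d"
    proof -
      have eq: "J \<tau> - J t - 2 * ip q ?d = (\<integral>y. (\<eta> y)\<^sup>2 * (w \<tau> y)\<^sup>2 - (\<eta> y)\<^sup>2 * (w t y)\<^sup>2 - 2 * (q y * ?d y) \<partial>\<mu>)"
        unfolding J_def L2_inner_def using Jint[OF \<tau>0(1)] Jint[OF \<tau>0(2)] H_mult[OF qH dH] by simp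
      have "\<bar>J \<tau> - J t - 2 * ip q ?d\<bar> \<le> (\<integral>y. \<bar>(\<eta> y)\<^sup>2 * (w \<tau> y)\<^sup>2 - (\<eta> y)\<^sup>2 * (w t y)\<^sup>2 - 2 * (q y * ?d y)\<bar> \<partial>\<mu>)"
        unfolding eq by (rule integral_abs_bound)
      also have "\<dots> \<le> ip ?d ?d"
        unfolding ip_self
      proof (rule integral_mono)
        show "integrable \<mu> (\<lambda>y. \<bar>(\<eta> y)\<^sup>2 * (w \<tau> y)\<^sup>2 - (\<eta> y)\<^sup>2 * (w t y)\<^sup>2 - 2 * (q y * ?d y)\<bar>)"
          using Jint[OF \<tau>0(1)] Jint[OF \<tau>0(2)] H_mult[OF qH dH] by simp
        show "integrable \<mu> (\<lambda>y. (?d y)\<^sup>2)" by (rule H_sq[OF dH])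
        fix y
        have eq: "(\<eta> y)\<^sup>2 * (w \<tau> y)\<^sup>2 - (\<eta> y)\<^sup>2 * (w t y)\<^sup>2 - 2 * (q y * ?d y)
          = (\<eta> y)\<^sup>2 * ((w \<tau> y)\<^sup>2 - (w t y)\<^sup>2 - 2 * w t y * ?d y)" by (simp add: q_def algebra_simps)
        have "\<bar>(\<eta> y)\<^sup>2 * (w \<tau> y)\<^sup>2 - (\<eta> y)\<^sup>2 * (w t y)\<^sup>2 - 2 * (q y * ?d y)\<bar> \<le> \<bar>(w \<tau> y)\<^sup>2 - (w t y)\<^sup>2 - 2 * w t y * ?d y\<bar>"
          unfolding eq abs_mult[of "(\<eta> y)\<^sup>2"] by (rule mult_left_le_one_le) (use \<eta>2 in auto)
        also have "\<dots> \<le> (?d y)\<^sup>2" unfolding w_def by (rule sq_pos_part_taylor)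
        finally show "\<bar>(\<eta> y)\<^sup>2 * (w \<tau> y)\<^sup>2 - (\<eta> y)\<^sup>2 * (w t y)\<^sup>2 - 2 * (q y * ?d y)\<bar> \<le> (?d y)\<^sup>2" .
      qed
      finally show ?thesis .
    qed
    have "ip q ?e = ip q ?d + h * ip (LP t f) q"
      using ip_add_r[OF dH H_cmult[OF \<ell>, of h] qH] ip_cmult_r[of q h "LP t f"] ip_comm[of q "LP t f"] by simp
    then have "J (t + h) - J t - h * (- 2 * ip (LP t f) q) = (J \<tau> - J t - 2 * ip q ?d) + 2 * ip q ?e"
      by (simp add: \<tau>_def)
    then have "\<bar>J (t + h) - J t - h * (- 2 * ip (LP t f) q)\<bar> \<le> ip ?d ?d + 2 * (sqrt (ip q q) * (16 / t\<^sup>2 * sqrt (ip f f)) * h\<^sup>2)"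
      using rem qe by linarith
    also have "\<dots> \<le> Cc * h\<^sup>2" unfolding Cc_def using dd by (simp add: algebra_simps)
    finally show "\<bar>J (t + h) - J t - h * (- 2 * ip (LP t f) q)\<bar> \<le> Cc * h\<^sup>2" .
  qed (use t in simp)
  then show ?thesis unfolding J_def w_def q_def .
qed

text \<open>The hypothesis \<open>FK\<close> below is the Faber--Krahn inequality for measurable sets; the a priori
  bound \<open>Y\<close> enters twice, through the measure of the superlevel set and through the cutoff error.\<close>

lemma De_Giorgi_step:
  assumes \<alpha>: "0 < \<alpha>" and r: "0 < r"
    and FK: "\<And>g B m. g \<in> \<F> \<Longrightarrow> (\<And>y. 0 \<le> g y) \<Longrightarrow> (\<And>y. g y \<le> B) \<Longrightarrow> (\<And>y. 3 * r / 4 \<le> dist x y \<Longrightarrow> g y = 0) \<Longrightarrow>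
      0 < m \<Longrightarrow> measure \<mu> {y. g y \<noteq> 0} \<le> m \<Longrightarrow> c * (v x r / m) powr \<alpha> * ip g g \<le> r\<^sup>2 * \<E> g g + ip g g"
    and f: "f \<in> H" and fM: "AE y in \<mu>. \<bar>f y\<bar> \<le> M" and M: "0 < M"
    and k: "0 \<le> k" "k < k'" and \<rho>: "0 < \<rho>'" "\<rho>' < \<rho>" "\<rho> \<le> 3 * r / 4" and T: "0 < T0" "T0 < T1"
    and Y: "0 < Y" "\<And>t. T0 \<le> t \<Longrightarrow> t \<le> T \<Longrightarrow> (\<integral>y. indicator (ball x \<rho>) y * (max 0 (P t f y - k))\<^sup>2 \<partial>\<mu>) \<le> Y"
    and \<Lambda>: "\<Lambda> = c * (v x r / (Y / (k' - k)\<^sup>2)) powr \<alpha>" "2 \<le> \<Lambda>"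
    and t: "T1 \<le> t" "t \<le> T"
  shows "(\<integral>y. indicator (ball x \<rho>') y * (max 0 (P t f y - k'))\<^sup>2 \<partial>\<mu>)
    \<le> r\<^sup>2 / \<Lambda> * (1 / (T1 - T0) + 2 / ((\<rho> - \<rho>') / 2)\<^sup>2) * Y"
proof -
  \<comment> \<open>The gap between the radii is halved: the cutoff falls from 1 to 0 between
    \<open>\<rho>'\<close> and the midpoint \<open>a\<close>, and the other half is the enlargement
    in \<open>K_dcut_sq_le\<close>.\<close>
  define \<delta> where "\<delta> = (\<rho> - \<rho>') / 2"
  define a where "a = \<rho>' + \<delta>"
  have \<delta>: "0 < \<delta>" and a: "0 < a" "a < \<rho>" using \<rho> by (auto simp: \<delta>_def a_def field_simps)
  \<comment> \<open>Chebyshev bound: above level \<open>k'\<close> the truncation at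
    \<open>k\<close> is at least \<open>k' - k\<close>, and its squared mass is at most
    \<open>Y\<close>.\<close>
  define m where "m = Y / (k' - k)\<^sup>2"
  have m: "0 < m" using Y k by (simp add: m_def)
  let ?h = "dcut x a"
  have hF: "?h \<in> \<F>" by (rule dcut_F[OF a(1)])
  define \<eta> where "\<eta> y = cut \<delta> (?h y)" for y
  have \<eta>01: "0 \<le> \<eta> y" "\<eta> y \<le> 1" "\<bar>\<eta> y\<bar> \<le> 1" for y unfolding \<eta>_def by (rule cut_props[OF \<delta>])+
  have \<eta>c: "continuous_on UNIV \<eta>"
    unfolding \<eta>_def by (rule continuous_on_compose2[OF cut_props(6)[OF \<delta>, of UNIV] dcut_props(1)]) simp
  have \<eta>m [measurable]: "\<eta> \<in> borel_measurable \<mu>" by (rule cont_meas[OF \<eta>c])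
  have \<eta>1: "\<eta> y = 1" if "dist x y \<le> \<rho>'" for y
  proof -
    have "\<delta> \<le> ?h y" using that by (auto simp: a_def dcut_def)
    then show ?thesis using \<delta> by (simp add: \<eta>_def cut_def le_divide_eq)
  qed
  have \<eta>0: "\<eta> y = 0" if "a \<le> dist x y" for y
    using dcut_props(4)[OF that] cut_props(7)[OF \<delta>] by (simp add: \<eta>_def)
  have \<eta>ball: "(\<eta> y)\<^sup>2 \<le> indicator (ball x \<rho>) y" "indicator (ball x \<rho>') y \<le> (\<eta> y)\<^sup>2" for y
  proof -
    show "(\<eta> y)\<^sup>2 \<le> indicator (ball x \<rho>) y" using \<eta>01[of y] \<eta>0[of y] a by (cases "y \<in> ball x \<rho>") (auto simp: abs_square_le_1)
    show "indicator (ball x \<rho>') y \<le> (\<eta> y)\<^sup>2" using \<eta>1[of y] by (cases "y \<in> ball x \<rho>'") auto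
  qed
  have PH: "P \<tau> f \<in> H" if "0 \<le> \<tau>" for \<tau> by (rule P_H[OF that f])
  have wH: "(\<lambda>y. max 0 (P \<tau> f y - l)) \<in> H" if "0 \<le> \<tau>" "0 \<le> l" for \<tau> l
    by (rule H_bound[OF PH[OF that(1)]]) (use H_meas[OF PH[OF that(1)]] that(2) in auto)
  have bint: "integrable \<mu> (\<lambda>y. b y * (max 0 (P \<tau> f y - l))\<^sup>2)"
    if "0 \<le> \<tau>" "0 \<le> l" "b \<in> borel_measurable \<mu>" "\<And>y. \<bar>b y\<bar> \<le> 1" for b \<tau> l
    using H_mult[OF H_bmult[OF wH[OF that(1,2)] that(3,4)] wH[OF that(1,2)]]
    by (simp add: power2_eq_square mult_ac)
  have bim: "(indicator (ball x s) :: 'a \<Rightarrow> real) \<in> borel_measurable \<mu>" "\<bar>indicator (ball x s) y :: real\<bar> \<le> 1" for s y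
    by (rule borel_measurable_indicator) (simp_all add: indicator_def)
  have \<eta>2m: "(\<lambda>y. (\<eta> y)\<^sup>2) \<in> borel_measurable \<mu>" "\<bar>(\<eta> y)\<^sup>2\<bar> \<le> 1" for y using \<eta>01[of y] by (auto simp: abs_square_le_1)
  have k'0: "0 \<le> k'" using k by simp
  define J where "J \<tau> = (\<integral>y. (\<eta> y)\<^sup>2 * (max 0 (P \<tau> f y - k'))\<^sup>2 \<partial>\<mu>)" for \<tau>
  define J' where "J' \<tau> = - 2 * ip (LP \<tau> f) (\<lambda>y. (\<eta> y)\<^sup>2 * max 0 (P \<tau> f y - k'))" for \<tau>
  define A where "A = \<Lambda> / r\<^sup>2"
  define B where "B = 2 * Y / \<delta>\<^sup>2"
  have A: "0 < A" using \<Lambda>(2) r by (simp add: A_def)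
  have B: "0 \<le> B" using Y \<delta> by (simp add: B_def)
  have JY: "J \<tau> \<le> Y" if \<tau>: "T0 \<le> \<tau>" "\<tau> \<le> T" for \<tau>
  proof -
    have \<tau>0: "0 \<le> \<tau>" using \<tau> T by simp
    have "J \<tau> \<le> (\<integral>y. indicator (ball x \<rho>) y * (max 0 (P \<tau> f y - k))\<^sup>2 \<partial>\<mu>)"
      unfolding J_def
    proof (rule integral_mono[OF bint[OF \<tau>0 k'0 \<eta>2m] bint[OF \<tau>0 k(1) bim]])
      show "(\<eta> y)\<^sup>2 * (max 0 (P \<tau> f y - k'))\<^sup>2 \<le> indicator (ball x \<rho>) y * (max 0 (P \<tau> f y - k))\<^sup>2" for y
        using k by (intro mult_mono \<eta>ball power_mono) auto
    qed
    then show ?thesis using Y(2)[OF \<tau>] by simp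
  qed
  have dJ: "DERIV J \<tau> :> J' \<tau>" if "T0 \<le> \<tau>" for \<tau>
    unfolding J_def J'_def using that T by (intro truncated_mass_derivative f k'0 \<eta>m \<eta>01) auto
  have ineq: "J' \<tau> \<le> - A * J \<tau> + B" if \<tau>: "T0 \<le> \<tau>" "\<tau> \<le> T" for \<tau>
  proof -
    have \<tau>0: "0 < \<tau>" using \<tau> T by simp
    \<comment> \<open>The flow is bounded by \<open>M\<close> only almost everywhere; this version
      is bounded at every point, as the jump inequalities require.\<close>
    define u where "u y = max (- M) (min M (P \<tau> f y))" for y
    have ub: "\<bar>u y\<bar> \<le> M" for y using M by (auto simp: u_def)
    have Pm [measurable]: "P \<tau> f \<in> borel_measurable \<mu>" using PH \<tau>0 by (auto intro: H_meas)
    have um [measurable]: "u \<in> borel_measurable \<mu>" unfolding u_def by measurable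
    have uP: "AE y in \<mu>. P \<tau> f y = u y"
      using P_bounded[OF \<tau>0 f fM M] by eventually_elim (auto simp: u_def abs_le_iff min_def max_def)
    have uF: "u \<in> \<F>" by (rule F_cong[OF P_F[OF \<tau>0 f] um uP])
    define w where "w y = max 0 (u y - k')" for y
    define q where "q y = (\<eta> y)\<^sup>2 * w y" for y
    define g where "g y = \<eta> y * w y" for y
    define Mb where "Mb = max M a"
    have Mb: "\<bar>u y\<bar> \<le> Mb" "\<bar>?h y\<bar> \<le> Mb" for y using ub[of y] dcut_props(3)[OF a(1), of x y] by (auto simp: Mb_def)
    have gF: "g \<in> \<F>" and qF: "q \<in> \<F>" and
      cac: "\<E> g g \<le> \<E> u q + K ?h (\<lambda>y. (w y)\<^sup>2) / \<delta>\<^sup>2"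
      unfolding g_def q_def w_def \<eta>_def using caccioppoli[OF uF hF Mb k'0 \<delta>] by auto
    have wF: "w \<in> \<F>" and wb: "\<bar>w y\<bar> \<le> M" for y unfolding w_def using pos_part_F[OF uF ub k'0] by auto
    have wm [measurable]: "w \<in> borel_measurable \<mu>" using wF by (rule F_meas)
    have J'eq: "J' \<tau> = - 2 * \<E> u q"
    proof -
      have "\<E> u q = \<E> (P \<tau> f) q" by (rule E_cong[OF P_F[OF \<tau>0 f] um uP qF])
      also have "\<dots> = ip (LP \<tau> f) q" by (rule E_P[OF \<tau>0 f qF])
      also have "\<dots> = ip (LP \<tau> f) (\<lambda>y. (\<eta> y)\<^sup>2 * max 0 (P \<tau> f y - k'))"
      proof (rule ip_cong)
        show "AE y in \<mu>. q y = (\<eta> y)\<^sup>2 * max 0 (P \<tau> f y - k')" using uP by eventually_elim (simp add: q_def w_def)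
      qed (use H_meas[OF LP_H[OF \<tau>0 f]] F_meas[OF qF] in auto)
      finally show ?thesis by (simp add: J'_def)
    qed
    have Jeq: "J \<tau> = ip g g"
      unfolding J_def ip_self
    proof (rule integral_cong_AE)
      show "AE y in \<mu>. (\<eta> y)\<^sup>2 * (max 0 (P \<tau> f y - k'))\<^sup>2 = (g y)\<^sup>2"
        using uP by eventually_elim (simp add: g_def w_def power_mult_distrib)
    qed (use F_meas[OF gF] in auto)
    have Wk: "(\<integral>y. indicator (ball x \<rho>) y * (max 0 (u y - k))\<^sup>2 \<partial>\<mu>) \<le> Y"
    proof -
      have "(\<integral>y. indicator (ball x \<rho>) y * (max 0 (u y - k))\<^sup>2 \<partial>\<mu>) = (\<integral>y. indicator (ball x \<rho>) y * (max 0 (P \<tau> f y - k))\<^sup>2 \<partial>\<mu>)"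
      proof (rule integral_cong_AE)
        note [measurable] = bim(1)
        show "(\<lambda>y. indicator (ball x \<rho>) y * (max 0 (u y - k))\<^sup>2) \<in> borel_measurable \<mu>" by measurable
        show "(\<lambda>y. indicator (ball x \<rho>) y * (max 0 (P \<tau> f y - k))\<^sup>2) \<in> borel_measurable \<mu>" by measurable
      qed (use uP in \<open>auto elim: eventually_mono\<close>)
      then show ?thesis using Y(2)[OF \<tau>] by simp
    qed
    have wkF: "(\<lambda>y. max 0 (u y - k)) \<in> \<F>" by (rule pos_part_F(1)[OF uF ub k(1)])
    have Wint: "integrable \<mu> (\<lambda>y. indicator (ball x \<rho>) y * (max 0 (u y - k))\<^sup>2)"
      using integrable_mult_indicator[OF _ H_sq[OF F_H[OF wkF]], of "ball x \<rho>"] by simp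
    have "K ?h (\<lambda>y. (w y)\<^sup>2) \<le> (\<integral>y. indicator (ball x \<rho>) y * (w y)\<^sup>2 \<partial>\<mu>)"
      by (rule K_dcut_sq_le[OF a wF wb])
    also have "\<dots> \<le> (\<integral>y. indicator (ball x \<rho>) y * (max 0 (u y - k))\<^sup>2 \<partial>\<mu>)"
    proof (rule integral_mono[OF _ Wint])
      show "integrable \<mu> (\<lambda>y. indicator (ball x \<rho>) y * (w y)\<^sup>2)"
        using integrable_mult_indicator[OF _ H_sq[OF F_H[OF wF]], of "ball x \<rho>"] by simp
      show "indicator (ball x \<rho>) y * (w y)\<^sup>2 \<le> indicator (ball x \<rho>) y * (max 0 (u y - k))\<^sup>2" for y
        using k by (intro mult_left_mono power_mono) (auto simp: w_def)
    qed
    finally have "K ?h (\<lambda>y. (w y)\<^sup>2) \<le> Y" using Wk by linarith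
    then have "K ?h (\<lambda>y. (w y)\<^sup>2) / \<delta>\<^sup>2 \<le> Y / \<delta>\<^sup>2" by (rule divide_right_mono) simp
    then have Eg: "\<E> g g \<le> \<E> u q + Y / \<delta>\<^sup>2" using cac by linarith
    have g0: "0 \<le> g y" "g y \<le> M" for y
    proof -
      have "0 \<le> w y" by (simp add: w_def)
      then show "0 \<le> g y" using \<eta>01 by (simp add: g_def)
      have "\<eta> y * w y \<le> w y" using \<open>0 \<le> w y\<close> \<eta>01 by (intro mult_left_le_one_le) auto
      then show "g y \<le> M" using wb[of y] by (simp add: g_def)
    qed
    have meas: "measure \<mu> {y. g y \<noteq> 0} \<le> m"
    proof -
      have [measurable]: "g \<in> borel_measurable \<mu>" using gF by (rule F_meas)
      have "{y\<in>space \<mu>. g y \<noteq> 0} \<in> sets \<mu>" by measurable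
      then have gs: "{y. g y \<noteq> 0} \<in> sets \<mu>" by simp
      have sub: "{y. g y \<noteq> 0} \<subseteq> ball x \<rho>"
      proof
        fix y assume "y \<in> {y. g y \<noteq> 0}"
        then have "\<eta> y \<noteq> 0" by (auto simp: g_def)
        then show "y \<in> ball x \<rho>" using \<eta>0[of y] a by force
      qed
      have gfin: "emeasure \<mu> {y. g y \<noteq> 0} < \<infinity>"
        using emeasure_mono[OF sub, of \<mu>] ball_fin[of x \<rho>] by (simp add: order.strict_trans1)
      have "(\<integral>y. (k' - k)\<^sup>2 * indicator {y. g y \<noteq> 0} y \<partial>\<mu>) \<le> Y"
      proof (rule order_trans[OF integral_mono[OF _ Wint] Wk])
        show "integrable \<mu> (\<lambda>y. (k' - k)\<^sup>2 * indicator {y. g y \<noteq> 0} y)"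
          using gs gfin by (intro integrable_mult_right integrable_real_indicator) auto
        show "(k' - k)\<^sup>2 * indicator {y. g y \<noteq> 0} y \<le> indicator (ball x \<rho>) y * (max 0 (u y - k))\<^sup>2" for y
        proof (cases "g y \<noteq> 0")
          case True
          then have "k' < u y" by (auto simp: g_def w_def)
          then have "(k' - k)\<^sup>2 \<le> (max 0 (u y - k))\<^sup>2" using k by (intro power_mono) auto
          then show ?thesis using True sub by auto
        qed simp
      qed
      then have "(k' - k)\<^sup>2 * measure \<mu> {y. g y \<noteq> 0} \<le> Y" using gfin by simp
      then show ?thesis using k unfolding m_def by (simp add: field_simps)
    qed
    have "\<Lambda> * ip g g \<le> r\<^sup>2 * \<E> g g + ip g g"
      unfolding \<Lambda>(1) m_def[symmetric]
    proof (rule FK[OF gF g0 _ m meas])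
      show "g y = 0" if "3 * r / 4 \<le> dist x y" for y using \<eta>0[of y] that a \<rho> by (simp add: g_def)
    qed
    \<comment> \<open>The inhomogeneous term on the right of the Faber--Krahn inequality is absorbed
      here, which is what \<open>2 \<le> \<Lambda>\<close> is for.\<close>
    moreover have "\<Lambda> / 2 * ip g g \<le> (\<Lambda> - 1) * ip g g" using \<Lambda>(2) by (intro mult_right_mono) auto
    ultimately have "\<Lambda> * ip g g \<le> 2 * r\<^sup>2 * \<E> g g" by (simp add: algebra_simps)
    then have "A * J \<tau> \<le> 2 * \<E> g g" unfolding A_def Jeq using r by (simp add: field_simps)
    then show ?thesis unfolding J'eq B_def using Eg by simp
  qed
  have T0t: "T0 \<le> t" using t T by simp
  have "J t \<le> exp (- A * (t - T0)) * (J T0 - B / A) + B / A"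
    by (rule gronwall_decay[OF A T0t dJ ineq]) (use t in auto)
  also have "\<dots> \<le> exp (- A * (t - T0)) * Y + B / A"
  proof -
    have "0 \<le> B / A" using A B by simp
    moreover have "J T0 \<le> Y" using t T by (intro JY) auto
    ultimately have "J T0 - B / A \<le> Y" by linarith
    then show ?thesis by (intro add_right_mono mult_left_mono) auto
  qed
  \<comment> \<open>Exponential decay is weakened to \<open>exp (- z) \<le> 1 / z\<close>, so that
    both contributions are inversely proportional to \<open>\<Lambda>\<close>.\<close>
  also have "\<dots> \<le> 1 / (A * (T1 - T0)) * Y + B / A"
  proof -
    have z: "0 < A * (T1 - T0)" using A T by simp
    have "A * (T1 - T0) \<le> A * (t - T0)" using A t by (intro mult_left_mono) auto
    also have "\<dots> \<le> exp (A * (t - T0))" using exp_ge_add_one_self[of "A * (t - T0)"] by linarith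
    finally have "1 / exp (A * (t - T0)) \<le> 1 / (A * (T1 - T0))"
      using z by (intro divide_left_mono) auto
    moreover have "exp (- A * (t - T0)) = 1 / exp (A * (t - T0))"
      by (simp add: exp_minus inverse_eq_divide)
    ultimately have "exp (- A * (t - T0)) \<le> 1 / (A * (T1 - T0))" by simp
    then show ?thesis using Y by (intro add_right_mono mult_right_mono) auto
  qed
  also have "\<dots> = r\<^sup>2 / \<Lambda> * (1 / (T1 - T0) + 2 / \<delta>\<^sup>2) * Y"
    using \<Lambda>(2) r T \<delta> unfolding A_def B_def by (simp add: field_simps)
  finally have Jt: "J t \<le> r\<^sup>2 / \<Lambda> * (1 / (T1 - T0) + 2 / \<delta>\<^sup>2) * Y" .
  have t0: "0 \<le> t" using t T by simp
  have "(\<integral>y. indicator (ball x \<rho>') y * (max 0 (P t f y - k'))\<^sup>2 \<partial>\<mu>) \<le> J t"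
    unfolding J_def
  proof (rule integral_mono[OF bint[OF t0 k'0 bim] bint[OF t0 k'0 \<eta>2m]])
    show "indicator (ball x \<rho>') y * (max 0 (P t f y - k'))\<^sup>2 \<le> (\<eta> y)\<^sup>2 * (max 0 (P t f y - k'))\<^sup>2" for y
      by (intro mult_right_mono \<eta>ball) simp
  qed
  then show ?thesis using Jt unfolding \<delta>_def by linarith
qed

end

section \<open>The iteration and the pointwise heat bound\<close>

context weight_setting
begin

text \<open>The constants are tuned so that the Faber--Krahn factor at step \<open>n\<close> is
  exactly \<open>X * 4 ^ n\<close>. This growth compensates the shrinking gaps between times and
  radii, and the truncated masses decay like \<open>\<theta> ^ n\<close>. The bound \<open>M\<close>
  appears in no constant.\<close>

lemma heat_upper_half:
  assumes "FK_inhom \<mu> L v"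
  obtains \<kappa> where "0 < \<kappa>" "\<And>x r f M. 0 < r \<Longrightarrow> f \<in> H \<Longrightarrow> AE y in \<mu>. \<bar>f y\<bar> \<le> M \<Longrightarrow> 0 < M \<Longrightarrow>
    AE y in \<mu>. y \<in> ball x (r / 2) \<longrightarrow> P (r\<^sup>2) f y \<le> sqrt (\<kappa> * ip f f / v x r)"
proof -
  obtain \<alpha> c0 where \<alpha>: "0 < \<alpha>" and c0: "0 < c0" and fk0: "\<forall>x. \<forall>r>0. \<forall>\<Omega>.
      open \<Omega> \<and> \<Omega> \<noteq> {} \<and> compact (closure \<Omega>) \<and> \<Omega> \<subseteq> ball x r \<longrightarrow>
      ereal (c0 * (v x r / measure \<mu> \<Omega>) powr \<alpha>) \<le> ereal (r\<^sup>2) * first_eigenvalue \<mu> L \<Omega> + 1"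
    using assms unfolding FK_inhom_def by (elim exE conjE) (rule that)
  have fk: "\<And>x r \<Omega>. 0 < r \<Longrightarrow> open \<Omega> \<Longrightarrow> \<Omega> \<noteq> {} \<Longrightarrow>
      compact (closure \<Omega>) \<Longrightarrow> \<Omega> \<subseteq> ball x r \<Longrightarrow>
      ereal (c0 * (v x r / measure \<mu> \<Omega>) powr \<alpha>) \<le> ereal (r\<^sup>2) * first_eigenvalue \<mu> L \<Omega> + 1"
    by (rule fk0[rule_format]) simp_all
  define c where "c = c0 / (258 * 8 powr \<alpha>)"
  have c: "0 < c" using c0 by (simp add: c_def)
  \<comment> \<open>\<open>\<sigma>\<close> satisfies \<open>\<sigma> powr \<alpha> = 1 / 4\<close>,
    and the decay rate \<open>\<theta> = \<sigma> / 4\<close> compensates the factor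
    \<open>4 ^ n\<close> that the squared level gaps lose.\<close>
  define \<sigma> where "\<sigma> = 4 powr (- 1 / \<alpha>)"
  define \<theta> where "\<theta> = \<sigma> / 4"
  have \<sigma>: "0 < \<sigma>" "\<sigma> \<le> 1"
    using \<alpha> powr_mono[of "- 1 / \<alpha>" 0 4] by (auto simp: \<sigma>_def)
  have \<theta>: "0 < \<theta>" "\<theta> < 1" using \<sigma> by (auto simp: \<theta>_def)
  \<comment> \<open>A step multiplies the mass by at most
    \<open>(8 * 2 ^ n + 512 * 4 ^ n) / (X * 4 ^ n)\<close>, with 8 from the time gap and 512 from
    the cutoff; \<open>520 / \<theta>\<close> makes this at most \<open>\<theta>\<close>, and the
    added 2 keeps the Faber--Krahn factor at least 2.\<close>
  define X where "X = 520 / \<theta> + 2"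
  have X: "2 \<le> X" "520 \<le> \<theta> * X" using \<theta> by (auto simp: X_def field_simps)
  \<comment> \<open>The height that makes the factor of step 0 equal to \<open>X\<close>; the 4
    stems from the first level gap \<open>k / 2\<close>.\<close>
  define \<kappa> where "\<kappa> = 4 * (X / c) powr (1 / \<alpha>)"
  have \<kappa>: "0 < \<kappa>" using X c by (simp add: \<kappa>_def)
  have main: "AE y in \<mu>. y \<in> ball x (r / 2) \<longrightarrow> P (r\<^sup>2) f y \<le> sqrt (\<kappa> * ip f f / v x r)"
    if r: "0 < r" and f: "f \<in> H" and fM: "AE y in \<mu>. \<bar>f y\<bar> \<le> M" and M: "0 < M" for x r f M
  proof (cases "ip f f = 0")
    case True
    have PH: "P (r\<^sup>2) f \<in> H" by (rule P_H[OF _ f]) simp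
    have "ip (P (r\<^sup>2) f) (P (r\<^sup>2) f) \<le> 0" using P_contraction[OF _ f, of "r\<^sup>2"] True by simp
    then have "ip (P (r\<^sup>2) f) (P (r\<^sup>2) f) = 0" using ip_ge0[of "P (r\<^sup>2) f"] by linarith
    then have "AE y in \<mu>. P (r\<^sup>2) f y = 0" using ip_self_zero[OF PH] by simp
    then show ?thesis by eventually_elim (use True in simp)
  next
    case False
    define N where "N = ip f f"
    have N: "0 < N" using False ip_ge0[of f] unfolding N_def by linarith
    define V where "V = v x r"
    have V: "0 < V" unfolding V_def by (rule v_pos[OF r])
    define k where "k = sqrt (\<kappa> * N / V)"
    have k: "0 < k" "k\<^sup>2 = \<kappa> * N / V" using \<kappa> N V by (auto simp: k_def)
    \<comment> \<open>Levels rise from 0 to \<open>k\<close>, radii shrink from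
      \<open>3 r / 4\<close> to \<open>r / 2\<close>, and starting times rise from
      \<open>r\<^sup>2 / 4\<close> to \<open>r\<^sup>2 / 2\<close>, so time \<open>r\<^sup>2\<close>
      is admissible at every step.\<close>
    define kk where "kk n = k * (1 - 1 / 2 ^ n)" for n :: nat
    define \<rho> where "\<rho> n = r / 2 + r / (4 * 2 ^ n)" for n :: nat
    define T where "T n = r\<^sup>2 * (1 / 2 - 1 / (4 * 2 ^ n))" for n :: nat
    define Y where "Y n = N * \<theta> ^ n" for n
    have Y: "0 < Y n" for n using N \<theta> by (simp add: Y_def)
    have FK: "c * (v x r / m) powr \<alpha> * ip g g \<le> r\<^sup>2 * \<E> g g + ip g g"
      if "g \<in> \<F>" "\<And>y. 0 \<le> g y" "\<And>y. g y \<le> B" "\<And>y. 3 * r / 4 \<le> dist x y \<Longrightarrow> g y = 0"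
        "0 < m" "measure \<mu> {y. g y \<noteq> 0} \<le> m" for g B m
      unfolding c_def by (rule FK_measurable_sets[OF \<alpha> c0 r fk[OF r] that(1-6)])
    have claim: "T n \<le> t \<Longrightarrow> t \<le> r\<^sup>2 \<Longrightarrow> (\<integral>y. indicator (ball x (\<rho> n)) y * (max 0 (P t f y - kk n))\<^sup>2 \<partial>\<mu>) \<le> Y n" for n t
    proof (induction n arbitrary: t)
      case 0
      have "T 0 = r\<^sup>2 / 4" by (simp add: T_def)
      then have t: "0 \<le> t" using 0(1) zero_le_power2[of r] by linarith
      have PH: "P t f \<in> H" by (rule P_H[OF t f])
      have [measurable]: "P t f \<in> borel_measurable \<mu>" by (rule H_meas[OF PH])
      have "(\<integral>y. indicator (ball x (\<rho> 0)) y * (max 0 (P t f y - kk 0))\<^sup>2 \<partial>\<mu>) \<le> ip (P t f) (P t f)"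
        unfolding ip_self
      proof (rule integral_mono[OF _ H_sq[OF PH]])
        have wH: "(\<lambda>y. max 0 (P t f y - kk 0)) \<in> H" by (rule H_bound[OF PH]) (auto simp: kk_def)
        show "integrable \<mu> (\<lambda>y. indicator (ball x (\<rho> 0)) y * (max 0 (P t f y - kk 0))\<^sup>2)"
          using integrable_mult_indicator[OF _ H_sq[OF wH], of "ball x (\<rho> 0)"] by simp
        have "(max 0 (P t f y))\<^sup>2 \<le> (P t f y)\<^sup>2" for y by (simp add: abs_le_square_iff[symmetric])
        then show "indicator (ball x (\<rho> 0)) y * (max 0 (P t f y - kk 0))\<^sup>2 \<le> (P t f y)\<^sup>2" for y
          by (simp add: kk_def indicator_def)
      qed
      also have "\<dots> \<le> N" unfolding N_def by (rule P_contraction[OF t f])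
      finally show ?case by (simp add: Y_def)
    next
      case (Suc n)
      have r2: "0 < r\<^sup>2" using r by simp
      have p2: "(1::real) \<le> 2 ^ n" by simp
      have kd: "kk (Suc n) - kk n = k / 2 ^ Suc n" by (simp add: kk_def field_simps)
      have kdpos: "0 < kk (Suc n) - kk n" unfolding kd using k by simp
      have kn: "0 \<le> kk n" unfolding kk_def using k p2 by (intro mult_nonneg_nonneg) auto
      have \<rho>d: "\<rho> n - \<rho> (Suc n) = r / (8 * 2 ^ n)" by (simp add: \<rho>_def field_simps)
      have \<rho>dpos: "0 < \<rho> n - \<rho> (Suc n)" unfolding \<rho>d using r by simp
      have \<rho>pos: "0 < \<rho> (Suc n)" unfolding \<rho>_def using r by (intro add_pos_pos) auto
      have \<rho>le: "\<rho> n \<le> 3 * r / 4"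
      proof -
        have "r / (4 * 2 ^ n) \<le> r / 4" using r p2 by (intro divide_left_mono) auto
        then show ?thesis by (simp add: \<rho>_def)
      qed
      have Td: "T (Suc n) - T n = r\<^sup>2 / (8 * 2 ^ n)" by (simp add: T_def field_simps)
      have Tdpos: "0 < T (Suc n) - T n" unfolding Td using r2 by simp
      have Tpos: "0 < T n"
      proof -
        have "1 / (4 * 2 ^ n) \<le> (1 / 4 :: real)" using p2 by (intro divide_left_mono) auto
        then have "0 < 1 / 2 - 1 / (4 * 2 ^ n :: real)" by linarith
        then show ?thesis unfolding T_def using r2 by simp
      qed
      define \<Lambda> where "\<Lambda> = c * (v x r / (Y n / (kk (Suc n) - kk n)\<^sup>2)) powr \<alpha>"
      have "\<Lambda> = X * 4 ^ n"
      proof -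
        have "v x r / (Y n / (kk (Suc n) - kk n)\<^sup>2) = V * (k\<^sup>2 / (2 ^ Suc n)\<^sup>2) / (N * \<theta> ^ n)"
          unfolding kd Y_def V_def[symmetric] by (simp add: power_divide)
        also have "\<dots> = \<kappa> / (4 * 4 ^ n * \<theta> ^ n)"
        proof -
          have "((2::real) ^ Suc n)\<^sup>2 = 4 * 4 ^ n" by (simp add: power2_eq_square power_mult_distrib[symmetric])
          then show ?thesis unfolding k(2) using V N by simp
        qed
        also have "\<dots> = (X / c) powr (1 / \<alpha>) / \<sigma> ^ n"
        proof -
          have "4 ^ n * \<theta> ^ n = \<sigma> ^ n" unfolding power_mult_distrib[symmetric] by (simp add: \<theta>_def)
          then show ?thesis by (simp add: \<kappa>_def mult.assoc)
        qed
        finally have eq: "v x r / (Y n / (kk (Suc n) - kk n)\<^sup>2) = (X / c) powr (1 / \<alpha>) / \<sigma> ^ n" .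
        have "(v x r / (Y n / (kk (Suc n) - kk n)\<^sup>2)) powr \<alpha> = ((X / c) powr (1 / \<alpha>)) powr \<alpha> / (\<sigma> ^ n) powr \<alpha>"
          unfolding eq by (rule powr_divide)
        also have "((X / c) powr (1 / \<alpha>)) powr \<alpha> = X / c" using \<alpha> X c by (simp add: powr_powr)
        also have "(\<sigma> ^ n) powr \<alpha> = 1 / 4 ^ n"
        proof -
          have "(\<sigma> ^ n) powr \<alpha> = (\<sigma> powr \<alpha>) ^ n" using \<sigma> by (simp add: powr_realpow[symmetric] powr_powr mult.commute)
          also have "\<sigma> powr \<alpha> = 1 / 4"
          proof -
            have e: "- 1 / \<alpha> * \<alpha> = - 1" using \<alpha> by simp
            show ?thesis unfolding \<sigma>_def powr_powr e by (simp add: powr_minus_divide)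
          qed
          finally show ?thesis by (simp add: power_divide)
        qed
        finally show ?thesis unfolding \<Lambda>_def using c by simp
      qed
      have \<Lambda>2: "2 \<le> \<Lambda>"
      proof -
        have "2 * 1 \<le> X * 4 ^ n" using X by (intro mult_mono) auto
        then show ?thesis using \<open>\<Lambda> = X * 4 ^ n\<close> by simp
      qed
      have "(\<integral>y. indicator (ball x (\<rho> (Suc n))) y * (max 0 (P t f y - kk (Suc n)))\<^sup>2 \<partial>\<mu>)
        \<le> r\<^sup>2 / \<Lambda> * (1 / (T (Suc n) - T n) + 2 / ((\<rho> n - \<rho> (Suc n)) / 2)\<^sup>2) * Y n"
      proof (rule De_Giorgi_step[OF \<alpha> r FK f fM M kn _ \<rho>pos _ \<rho>le Tpos _ Y _ \<Lambda>_def \<Lambda>2 Suc.prems])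
        show "kk n < kk (Suc n)" "\<rho> (Suc n) < \<rho> n" "T n < T (Suc n)" using kdpos \<rho>dpos Tdpos by auto
        show "(\<integral>y. indicator (ball x (\<rho> n)) y * (max 0 (P t f y - kk n))\<^sup>2 \<partial>\<mu>) \<le> Y n" if "T n \<le> t" "t \<le> r\<^sup>2" for t
          by (rule Suc.IH[OF that])
      qed
      also have "r\<^sup>2 / \<Lambda> * (1 / (T (Suc n) - T n) + 2 / ((\<rho> n - \<rho> (Suc n)) / 2)\<^sup>2) = (8 * 2 ^ n + 512 * 4 ^ n) / (X * 4 ^ n)"
      proof -
        have "1 / (T (Suc n) - T n) = 8 * 2 ^ n / r\<^sup>2" unfolding Td by simp
        moreover have "2 / ((\<rho> n - \<rho> (Suc n)) / 2)\<^sup>2 = 512 * 4 ^ n / r\<^sup>2"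
        proof -
          have "((\<rho> n - \<rho> (Suc n)) / 2)\<^sup>2 = r\<^sup>2 / (256 * 4 ^ n)"
            unfolding \<rho>d by (simp add: power_divide power_mult_distrib power2_eq_square[of "2 ^ n"] power_mult_distrib[symmetric])
          then show ?thesis by simp
        qed
        ultimately show ?thesis using r2 \<open>\<Lambda> = X * 4 ^ n\<close> by (simp add: add_divide_distrib[symmetric])
      qed
      also have "(8 * 2 ^ n + 512 * 4 ^ n) / (X * 4 ^ n) * Y n \<le> \<theta> * Y n"
      proof (rule mult_right_mono)
        have "8 * 2 ^ n + 512 * 4 ^ n \<le> 520 * (4::real) ^ n" using power_mono[of "2::real" 4 n] by simp
        also have "\<dots> \<le> \<theta> * X * 4 ^ n" using X(2) by (intro mult_right_mono) auto
        finally show "(8 * 2 ^ n + 512 * 4 ^ n) / (X * 4 ^ n) \<le> \<theta>" using X(1) by (simp add: divide_le_eq mult.assoc)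
      qed (use Y[of n] in simp)
      finally show ?case by (simp add: Y_def mult.left_commute)
    qed
    define t where "t = r\<^sup>2"
    have t: "0 \<le> t" by (simp add: t_def)
    have PH: "P t f \<in> H" by (rule P_H[OF t f])
    have [measurable]: "P t f \<in> borel_measurable \<mu>" by (rule H_meas[OF PH])
    have wint: "integrable \<mu> (\<lambda>y. indicator (ball x s) y * (max 0 (P t f y - l))\<^sup>2)" if "0 \<le> l" for s l
    proof -
      have wH: "(\<lambda>y. max 0 (P t f y - l)) \<in> H" by (rule H_bound[OF PH]) (use that in auto)
      show ?thesis using integrable_mult_indicator[OF _ H_sq[OF wH], of "ball x s"] by simp
    qed
    have le: "(\<integral>y. indicator (ball x (r / 2)) y * (max 0 (P t f y - k))\<^sup>2 \<partial>\<mu>) \<le> Y n" for n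
    proof -
      have p2: "(1::real) \<le> 2 ^ n" by simp
      have kn: "0 \<le> kk n" "kk n \<le> k"
      proof -
        show "0 \<le> kk n" unfolding kk_def using k p2 by (intro mult_nonneg_nonneg) auto
        show "kk n \<le> k" unfolding kk_def using k by (simp add: mult_left_le)
      qed
      have "T n \<le> t"
      proof -
        have "r\<^sup>2 * (1 / 2 - 1 / (4 * 2 ^ n)) \<le> r\<^sup>2 * 1"
        proof (rule mult_left_mono)
          have "0 \<le> 1 / (4 * 2 ^ n :: real)" by simp
          then show "1 / 2 - 1 / (4 * 2 ^ n) \<le> (1 :: real)" by linarith
        qed simp
        then show ?thesis by (simp add: T_def t_def)
      qed
      have "(\<integral>y. indicator (ball x (r / 2)) y * (max 0 (P t f y - k))\<^sup>2 \<partial>\<mu>)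
        \<le> (\<integral>y. indicator (ball x (\<rho> n)) y * (max 0 (P t f y - kk n))\<^sup>2 \<partial>\<mu>)"
      proof (rule integral_mono[OF wint wint[OF kn(1)]])
        have "ball x (r / 2) \<subseteq> ball x (\<rho> n)" using r by (intro subset_ball) (simp add: \<rho>_def)
        then have "indicator (ball x (r / 2)) y \<le> (indicator (ball x (\<rho> n)) y :: real)" for y by (auto simp: indicator_def)
        then show "indicator (ball x (r / 2)) y * (max 0 (P t f y - k))\<^sup>2 \<le> indicator (ball x (\<rho> n)) y * (max 0 (P t f y - kk n))\<^sup>2" for y
          using kn(2) by (intro mult_mono power_mono) auto
      qed (use k in simp)
      also have "\<dots> \<le> Y n" by (rule claim[OF \<open>T n \<le> t\<close>]) (simp add: t_def)
      finally show ?thesis .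
    qed
    have "Y \<longlonglongrightarrow> N * 0" unfolding Y_def using \<theta> by (intro tendsto_mult tendsto_const LIMSEQ_power_zero) auto
    then have "(\<integral>y. indicator (ball x (r / 2)) y * (max 0 (P t f y - k))\<^sup>2 \<partial>\<mu>) \<le> 0"
      using LIMSEQ_le_const[of Y 0] le by auto
    moreover have "0 \<le> (\<integral>y. indicator (ball x (r / 2)) y * (max 0 (P t f y - k))\<^sup>2 \<partial>\<mu>)"
      by (intro integral_nonneg_AE) auto
    ultimately have "(\<integral>y. indicator (ball x (r / 2)) y * (max 0 (P t f y - k))\<^sup>2 \<partial>\<mu>) = 0" by linarith
    then have "AE y in \<mu>. indicator (ball x (r / 2)) y * (max 0 (P t f y - k))\<^sup>2 = 0"
      by (subst (asm) integral_nonneg_eq_0_iff_AE) (use wint k in auto)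
    then show ?thesis
    proof eventually_elim
      case (elim y)
      then show ?case unfolding t_def k_def N_def V_def by (auto simp: indicator_def)
    qed
  qed
  show ?thesis by (rule that[OF \<kappa> main])
qed

text \<open>In \<open>heat_upper_half\<close> both the null set and the bound depend on the centre.
  A countable dense set of centres reaches every \<open>y\<close>, \<open>(D'_v)\<close> replaces
  the value of \<open>v\<close> at the centre by that at \<open>y\<close>, and the same estimate for
  \<open>- f\<close> makes the bound two-sided.\<close>

lemma heat_ultracontractive:
  assumes "FK_inhom \<mu> L v"
  obtains C where "0 < C" "\<And>t f M. 0 < t \<Longrightarrow> f \<in> H \<Longrightarrow> AE y in \<mu>. \<bar>f y\<bar> \<le> M \<Longrightarrow> 0 < M \<Longrightarrow>
    AE y in \<mu>. (P t f y)\<^sup>2 \<le> C * ip f f / v y (sqrt t)"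
proof -
  obtain \<kappa> where \<kappa>: "0 < \<kappa>" and up: "\<And>x r f M. 0 < r \<Longrightarrow> f \<in> H \<Longrightarrow> AE y in \<mu>. \<bar>f y\<bar> \<le> M \<Longrightarrow> 0 < M \<Longrightarrow>
    AE y in \<mu>. y \<in> ball x (r / 2) \<longrightarrow> P (r\<^sup>2) f y \<le> sqrt (\<kappa> * ip f f / v x r)"
    using heat_upper_half[OF assms] by blast
  obtain D where D: "2 \<le> D" "\<And>x y r. 0 < r \<Longrightarrow> dist x y \<le> r \<Longrightarrow> v y r \<le> D * v x r"
    by (rule v_regular) blast
  show ?thesis
  proof (rule that)
    show "0 < \<kappa> * D" using \<kappa> D(1) by simp
    fix t f M assume t: "(0::real) < t" and f: "f \<in> H" and fM: "AE y in \<mu>. \<bar>f y\<bar> \<le> M" and M: "(0::real) < M"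
    define r where "r = sqrt t"
    have r: "0 < r" "r\<^sup>2 = t" using t by (auto simp: r_def)
    have abs: "AE y in \<mu>. y \<in> ball x (r / 2) \<longrightarrow> (P t f y)\<^sup>2 \<le> \<kappa> * ip f f / v x r" for x
    proof -
      have "AE y in \<mu>. y \<in> ball x (r / 2) \<longrightarrow> P t f y \<le> sqrt (\<kappa> * ip f f / v x r)"
        using up[OF r(1) f fM M] r(2) by simp
      moreover have "AE y in \<mu>. y \<in> ball x (r / 2) \<longrightarrow> P t (\<lambda>y. - f y) y \<le> sqrt (\<kappa> * ip f f / v x r)"
        using up[OF r(1) H_uminus[OF f] _ M, of x] fM r(2) by (simp add: ip_uminus ip_uminus_r)
      moreover have "AE y in \<mu>. P t (\<lambda>y. - f y) y = - P t f y"
        using P_lin[OF _ f f, of t "-1" 0] t by simp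
      ultimately show ?thesis
      proof eventually_elim
        case (elim y)
        show ?case
        proof
          assume "y \<in> ball x (r / 2)"
          then have "\<bar>P t f y\<bar> \<le> sqrt (\<kappa> * ip f f / v x r)" using elim by (simp add: abs_le_iff)
          then have "\<bar>P t f y\<bar>\<^sup>2 \<le> (sqrt (\<kappa> * ip f f / v x r))\<^sup>2" by (rule power_mono) simp
          also have "\<dots> = \<kappa> * ip f f / v x r" using \<kappa> v_pos[OF r(1), of x] by simp
          finally show "(P t f y)\<^sup>2 \<le> \<kappa> * ip f f / v x r" by simp
        qed
      qed
    qed
    obtain S0 :: "'a set" where S0: "countable S0" "\<And>U. open U \<Longrightarrow> U \<noteq> {} \<Longrightarrow> \<exists>d\<in>S0. d \<in> U"
      using countable_dense_setE by blast
    have "AE y in \<mu>. \<forall>x\<in>S0. y \<in> ball x (r / 2) \<longrightarrow> (P t f y)\<^sup>2 \<le> \<kappa> * ip f f / v x r"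
      using abs S0(1) by (simp add: AE_ball_countable)
    then show "AE y in \<mu>. (P t f y)\<^sup>2 \<le> \<kappa> * D * ip f f / v y (sqrt t)"
    proof eventually_elim
      case (elim y)
      have "open (ball y (r / 2))" "ball y (r / 2) \<noteq> {}" using r by auto
      then obtain x where x: "x \<in> S0" "x \<in> ball y (r / 2)" using S0(2) by blast
      then have "y \<in> ball x (r / 2)" by (simp add: dist_commute)
      then have "(P t f y)\<^sup>2 \<le> \<kappa> * ip f f / v x r" using elim x(1) by blast
      also have "\<dots> \<le> \<kappa> * D * ip f f / v y r"
      proof -
        have "v y r \<le> D * v x r" using x(2) r by (intro D(2)) (auto simp: dist_commute)
        then have "(\<kappa> * ip f f) * v y r \<le> (\<kappa> * ip f f) * (D * v x r)" using \<kappa> by (intro mult_left_mono) auto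
        then show ?thesis using v_pos[OF r(1), of x] v_pos[OF r(1), of y] by (simp add: field_simps)
      qed
      finally show ?case by (simp add: r_def)
    qed
  qed
qed

end

section \<open>The heat kernel\<close>

context l2_setting
begin

lemma ip_lincomb:
  "(\<And>i. i \<in> I \<Longrightarrow> f i \<in> H) \<Longrightarrow> h \<in> H \<Longrightarrow> ip (\<lambda>x. \<Sum>i\<in>I. c i * f i x) h = (\<Sum>i\<in>I. c i * ip (f i) h)"
  by (subst ip_sum) (auto intro: H_cmult simp: ip_cmult)

text \<open>Gram--Schmidt without normalisation. Division by 0 yields 0, so members of zero norm
  drop out of the later projections.\<close>

fun gs :: "(nat \<Rightarrow> 'a \<Rightarrow> real) \<Rightarrow> nat \<Rightarrow> 'a \<Rightarrow> real" where
  "gs F n = (\<lambda>x. F n x - (\<Sum>i<n. ip (F n) (gs F i) / ip (gs F i) (gs F i) * gs F i x))"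

declare gs.simps [simp del]

lemma gs_H: assumes "\<And>n. F n \<in> H" shows "gs F n \<in> H"
proof (induction n rule: less_induct)
  case (less n)
  then show ?case by (subst gs.simps) (intro H_diff H_sum H_cmult assms, auto)
qed

text \<open>Each member is a finite combination of bounded functions. Boundedness has to survive
  because the heat estimate is available for bounded functions.\<close>

lemma gs_bounded: assumes "\<And>n. \<exists>M. \<forall>x. \<bar>F n x\<bar> \<le> M" shows "\<exists>M. \<forall>x. \<bar>gs F n x\<bar> \<le> (M::real)"
proof (induction n rule: less_induct)
  case (less n)
  have "\<forall>i. \<exists>M. i < n \<longrightarrow> (\<forall>x. \<bar>gs F i x\<bar> \<le> M)" using less by blast
  then obtain M where M: "\<And>i x. i < n \<Longrightarrow> \<bar>gs F i x\<bar> \<le> M i" by metis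
  obtain M0 where M0: "\<And>x. \<bar>F n x\<bar> \<le> M0" using assms by blast
  let ?c = "\<lambda>i. ip (F n) (gs F i) / ip (gs F i) (gs F i)"
  have "\<bar>gs F n x\<bar> \<le> M0 + (\<Sum>i<n. \<bar>?c i\<bar> * M i)" for x
  proof -
    have "\<bar>gs F n x\<bar> \<le> \<bar>F n x\<bar> + \<bar>\<Sum>i<n. ?c i * gs F i x\<bar>"
      by (subst gs.simps) (rule abs_triangle_ineq4)
    also have "\<bar>\<Sum>i<n. ?c i * gs F i x\<bar> \<le> (\<Sum>i<n. \<bar>?c i * gs F i x\<bar>)" by (rule sum_abs)
    also have "\<dots> \<le> (\<Sum>i<n. \<bar>?c i\<bar> * M i)"
      unfolding abs_mult by (intro sum_mono mult_left_mono M) auto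
    finally show ?thesis using M0[of x] by linarith
  qed
  then show ?case by blast
qed

lemma gs_orth: assumes F: "\<And>n. F n \<in> H" and "i \<noteq> j" shows "ip (gs F i) (gs F j) = 0"
proof -
  have "\<forall>i<n. ip (gs F n) (gs F i) = 0" for n
  proof (induction n rule: less_induct)
    case (less n)
    show ?case
    proof (intro allI impI)
      fix i assume i: "i < n"
      let ?c = "\<lambda>j. ip (F n) (gs F j) / ip (gs F j) (gs F j)"
      have "ip (gs F n) (gs F i) = ip (F n) (gs F i) - ip (\<lambda>x. \<Sum>j<n. ?c j * gs F j x) (gs F i)"
        by (subst gs.simps) (intro ip_diff H_sum H_cmult F gs_H)
      also have "ip (\<lambda>x. \<Sum>j<n. ?c j * gs F j x) (gs F i) = (\<Sum>j<n. ?c j * ip (gs F j) (gs F i))"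
        by (intro ip_lincomb gs_H F)
      also have "\<dots> = (\<Sum>j<n. if j = i then ?c i * ip (gs F i) (gs F i) else 0)"
      proof (rule sum.cong)
        fix j assume "j \<in> {..<n}"
        then have j: "j < n" by simp
        consider "j = i" | "j < i" | "i < j" by linarith
        then show "?c j * ip (gs F j) (gs F i) = (if j = i then ?c i * ip (gs F i) (gs F i) else 0)"
        proof cases
          case 2
          have "ip (gs F i) (gs F j) = 0" using less[OF i] 2 by blast
          then have "ip (gs F j) (gs F i) = 0" unfolding ip_comm[of "gs F j"] .
          then show ?thesis using 2 by simp
        next
          case 3
          have "ip (gs F j) (gs F i) = 0" using less[OF j] 3 by blast
          then show ?thesis using 3 by simp
        qed simp
      qed simp
      also have "\<dots> = ?c i * ip (gs F i) (gs F i)" using i by simp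
      also have "\<dots> = ip (F n) (gs F i)"
      proof (cases "ip (gs F i) (gs F i) = 0")
        case True
        then have "(ip (F n) (gs F i))\<^sup>2 \<le> 0" using ip_CS_sq[OF F[of n] gs_H[of F i, OF F]] by simp
        then show ?thesis using True by simp
      qed simp
      finally show "ip (gs F n) (gs F i) = 0" by simp
    qed
  qed
  then show ?thesis using \<open>i \<noteq> j\<close> ip_comm by (metis nat_neq_iff)
qed

lemma gs_total:
  assumes F: "\<And>n. F n \<in> H" and h: "h \<in> H" "\<And>n. ip h (gs F n) = 0"
  shows "ip h (F n) = 0"
proof -
  let ?c = "\<lambda>j. ip (F n) (gs F j) / ip (gs F j) (gs F j)"
  have "F n = (\<lambda>x. gs F n x + (\<Sum>j<n. ?c j * gs F j x))" by (subst gs.simps) simp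
  then have "ip h (F n) = ip h (\<lambda>x. gs F n x + (\<Sum>j<n. ?c j * gs F j x))" by simp
  also have "\<dots> = ip h (gs F n) + ip h (\<lambda>x. \<Sum>j<n. ?c j * gs F j x)"
    by (intro ip_add_r H_sum H_cmult F gs_H h)
  also have "ip h (\<lambda>x. \<Sum>j<n. ?c j * gs F j x) = (\<Sum>j<n. ?c j * ip (gs F j) h)"
    unfolding ip_comm[of h] by (intro ip_lincomb gs_H F h)
  also have "\<dots> = 0" unfolding ip_comm[of _ h] using h by simp
  finally show ?thesis using h by simp
qed

text \<open>Vanishing members are allowed, since the Gram--Schmidt process produces them from dependent
  functions: \<open>1 / sqrt 0 = 0\<close>.\<close>

definition orthosys :: "(nat \<Rightarrow> 'a \<Rightarrow> real) \<Rightarrow> bool" where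
  "orthosys e \<longleftrightarrow> (\<forall>i. e i \<in> H) \<and> (\<forall>i j. i \<noteq> j \<longrightarrow> ip (e i) (e j) = 0) \<and> (\<forall>i. ip (e i) (e i) \<in> {0, 1})"

lemma orthosys_ip:
  assumes "orthosys e" "finite I"
  shows "ip (\<lambda>x. \<Sum>i\<in>I. c i * e i x) (\<lambda>x. \<Sum>i\<in>I. c i * e i x) = (\<Sum>i\<in>I. (c i)\<^sup>2 * ip (e i) (e i))"
proof -
  have e: "e i \<in> H" "i \<noteq> j \<Longrightarrow> ip (e i) (e j) = 0" for i j using assms by (auto simp: orthosys_def)
  have "ip (\<lambda>x. \<Sum>i\<in>I. c i * e i x) (\<lambda>x. \<Sum>i\<in>I. c i * e i x)
      = (\<Sum>i\<in>I. c i * ip (e i) (\<lambda>x. \<Sum>i\<in>I. c i * e i x))"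
    by (intro ip_lincomb H_sum H_cmult e)
  also have "\<dots> = (\<Sum>i\<in>I. (c i)\<^sup>2 * ip (e i) (e i))"
  proof (rule sum.cong)
    fix i assume i: "i \<in> I"
    have "ip (e i) (\<lambda>x. \<Sum>j\<in>I. c j * e j x) = (\<Sum>j\<in>I. c j * ip (e j) (e i))"
      unfolding ip_comm[of "e i"] by (intro ip_lincomb e)
    also have "\<dots> = (\<Sum>j\<in>I. if j = i then c i * ip (e i) (e i) else 0)"
      by (rule sum.cong) (auto simp: e)
    also have "\<dots> = c i * ip (e i) (e i)" using i assms by simp
    finally show "c i * ip (e i) (\<lambda>x. \<Sum>i\<in>I. c i * e i x) = (c i)\<^sup>2 * ip (e i) (e i)"
      by (simp add: power2_eq_square)
  qed simp
  finally show ?thesis .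
qed

lemma orthosys_ip_le:
  assumes "orthosys e" "finite I"
  shows "ip (\<lambda>x. \<Sum>i\<in>I. c i * e i x) (\<lambda>x. \<Sum>i\<in>I. c i * e i x) \<le> (\<Sum>i\<in>I. (c i)\<^sup>2)"
  unfolding orthosys_ip[OF assms]
proof (rule sum_mono)
  fix i show "(c i)\<^sup>2 * ip (e i) (e i) \<le> (c i)\<^sup>2"
  proof -
    have "ip (e i) (e i) = 0 \<or> ip (e i) (e i) = 1" using assms by (auto simp: orthosys_def)
    then show ?thesis by auto
  qed
qed

lemma orthosys_series:
  assumes e: "orthosys e" and c: "summable (\<lambda>i. (c i)\<^sup>2)"
  shows "\<exists>f. L2_lim (\<lambda>N x. \<Sum>i<N. c i * e i x) f"
proof (rule L2_complete)
  have eH: "e i \<in> H" for i using e by (auto simp: orthosys_def)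
  show "(\<lambda>x. \<Sum>i<n. c i * e i x) \<in> H" for n by (intro H_sum H_cmult eH)
  fix \<epsilon> :: real assume "0 < \<epsilon>"
  then obtain N where N: "\<And>m n. N \<le> m \<Longrightarrow> norm (\<Sum>i=m..<n. (c i)\<^sup>2) < \<epsilon>"
    using c unfolding summable_Cauchy by blast
  let ?s = "\<lambda>n x. \<Sum>i<n. c i * e i x"
  have d: "ip (\<lambda>x. ?s m x - ?s n x) (\<lambda>x. ?s m x - ?s n x) < \<epsilon>" if "N \<le> n" "n \<le> m" for m n
  proof -
    have "?s m x - ?s n x = (\<Sum>i=n..<m. c i * e i x)" for x
      using sum_diff_nat_ivl[of 0 n m "\<lambda>i. c i * e i x"] that by (simp add: lessThan_atLeast0)
    then have "ip (\<lambda>x. ?s m x - ?s n x) (\<lambda>x. ?s m x - ?s n x) \<le> (\<Sum>i=n..<m. (c i)\<^sup>2)"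
      using orthosys_ip_le[OF e, of "{n..<m}" c] by simp
    also have "\<dots> < \<epsilon>" using N[OF that(1), of m] by simp
    finally show ?thesis .
  qed
  have sym: "ip (\<lambda>x. ?s m x - ?s n x) (\<lambda>x. ?s m x - ?s n x) = ip (\<lambda>x. ?s n x - ?s m x) (\<lambda>x. ?s n x - ?s m x)" for m n
    by (simp add: L2_inner_def algebra_simps)
  have "ip (\<lambda>x. ?s m x - ?s n x) (\<lambda>x. ?s m x - ?s n x) < \<epsilon>" if "N \<le> m" "N \<le> n" for m n
  proof (cases "n \<le> m")
    case False
    then show ?thesis unfolding sym[of m n] using d[of m n] that by simp
  qed (use d that in auto)
  then show "\<exists>N. \<forall>m\<ge>N. \<forall>n\<ge>N. ip (\<lambda>x. ?s m x - ?s n x) (\<lambda>x. ?s m x - ?s n x) < \<epsilon>" by blast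
qed

lemma orthosys_expansion:
  assumes e: "orthosys e" and tot: "\<And>h. h \<in> H \<Longrightarrow> (\<And>n. ip h (e n) = 0) \<Longrightarrow> AE x in \<mu>. h x = 0"
    and g: "g \<in> H"
  shows "L2_lim (\<lambda>N x. \<Sum>i<N. ip g (e i) * e i x) g"
proof -
  let ?s = "\<lambda>N x. \<Sum>i<N. ip g (e i) * e i x"
  have eH: "e i \<in> H" and orth: "i \<noteq> j \<Longrightarrow> ip (e i) (e j) = 0" and n01: "ip (e i) (e i) = 0 \<or> ip (e i) (e i) = 1" for i j
    using e by (auto simp: orthosys_def)
  have sH: "?s N \<in> H" for N by (intro H_sum H_cmult eH)
  \<comment> \<open>Members of zero norm have zero coefficients by Cauchy--Schwarz, so they behave
    like normalised ones here.\<close>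
  have c: "ip g (e i) * ip (e i) (e i) = ip g (e i)" for i
    using n01[of i]
  proof
    assume z: "ip (e i) (e i) = 0"
    then have "(ip g (e i))\<^sup>2 \<le> 0" using ip_CS_sq[OF g eH, of i] by simp
    then show ?thesis using z by simp
  qed simp
  have c2: "(ip g (e i))\<^sup>2 * ip (e i) (e i) = (ip g (e i))\<^sup>2" for i
    using c[of i] by (simp add: power2_eq_square mult.assoc)
  have ss: "ip (?s N) (?s N) = (\<Sum>i<N. (ip g (e i))\<^sup>2)" for N
    unfolding orthosys_ip[OF e finite_lessThan] c2 ..
  have gsN: "ip g (?s N) = (\<Sum>i<N. (ip g (e i))\<^sup>2)" for N
  proof -
    have "ip g (?s N) = (\<Sum>i<N. ip g (e i) * ip (e i) g)"
      unfolding ip_comm[of g "?s N"] by (intro ip_lincomb eH g)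
    then show ?thesis by (simp add: power2_eq_square ip_comm[of _ g])
  qed
  have bessel: "(\<Sum>i<N. (ip g (e i))\<^sup>2) \<le> ip g g" for N
    using ip_ge0[of "\<lambda>x. g x - ?s N x"] unfolding ip_expand_diff[OF g sH] ss gsN by simp
  have "summable (\<lambda>i. (ip g (e i))\<^sup>2)"
    by (rule summableI_nonneg_bounded[of _ "ip g g"]) (auto intro: bessel)
  then obtain f where f: "L2_lim ?s f" using orthosys_series[OF e, of "\<lambda>i. ip g (e i)"] by blast
  note fH = L2_limD(2)[OF f]
  have fe: "ip f (e j) = ip g (e j)" for j
  proof -
    have "ip (?s N) (e j) = ip g (e j)" if "j < N" for N
    proof -
      have "ip (?s N) (e j) = (\<Sum>i<N. ip g (e i) * ip (e i) (e j))"
        by (intro ip_lincomb eH g)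
      also have "\<dots> = (\<Sum>i<N. if i = j then ip g (e j) * ip (e j) (e j) else 0)"
        by (rule sum.cong) (auto simp: orth)
      also have "\<dots> = ip g (e j)" using that c by simp
      finally show ?thesis .
    qed
    then have "\<forall>\<^sub>F N in sequentially. ip (?s N) (e j) = ip g (e j)"
      by (rule eventually_mono[OF eventually_gt_at_top[of j]])
    then have "(\<lambda>N. ip (?s N) (e j)) \<longlonglongrightarrow> ip g (e j)" by (rule tendsto_eventually)
    then show ?thesis using L2_lim_ip_const[OF f eH, of j] LIMSEQ_unique by blast
  qed
  have "AE x in \<mu>. f x - g x = 0"
    by (rule tot) (auto simp: H_diff fH g ip_diff eH fe)
  then have "AE x in \<mu>. f x = g x" by eventually_elim simp
  then show ?thesis
    using H_meas[OF sH] by (intro L2_lim_contraction[OF f, where c = 1]) (auto simp: g)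
qed

lemma orthosys_exists:
  assumes F: "\<And>n::nat. F n \<in> H" "\<And>n. \<exists>M. \<forall>x. \<bar>F n x\<bar> \<le> M"
    and tot: "\<And>h. h \<in> H \<Longrightarrow> (\<And>n. ip h (F n) = 0) \<Longrightarrow> AE x in \<mu>. h x = 0"
  obtains e where "orthosys e" "\<And>n. \<exists>M. \<forall>x. \<bar>e n x\<bar> \<le> M"
    "\<And>g. g \<in> H \<Longrightarrow> L2_lim (\<lambda>N x. \<Sum>i<N. ip g (e i) * e i x) g"
proof -
  define e where "e i = (\<lambda>x. 1 / sqrt (ip (gs F i) (gs F i)) * gs F i x)" for i
  have os: "orthosys e"
    unfolding orthosys_def
  proof (intro conjI allI impI)
    show "e i \<in> H" for i unfolding e_def by (intro H_cmult gs_H F)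
    show "ip (e i) (e j) = 0" if "i \<noteq> j" for i j
      unfolding e_def ip_cmult ip_cmult_r gs_orth[of F, OF F(1) that] by simp
    show "ip (e i) (e i) \<in> {0, 1}" for i
      unfolding e_def ip_cmult ip_cmult_r
      by (cases "ip (gs F i) (gs F i) = 0") (auto simp: field_simps)
  qed
  moreover have "\<exists>M. \<forall>x. \<bar>e n x\<bar> \<le> M" for n
  proof -
    obtain M where M: "\<And>x. \<bar>gs F n x\<bar> \<le> M" using gs_bounded[of F n, OF F(2)] by blast
    have "\<bar>e n x\<bar> \<le> \<bar>1 / sqrt (ip (gs F n) (gs F n))\<bar> * M" for x
      unfolding e_def abs_mult by (intro mult_left_mono M) auto
    then show ?thesis by blast
  qed
  moreover have "L2_lim (\<lambda>N x. \<Sum>i<N. ip g (e i) * e i x) g" if g: "g \<in> H" for g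
  proof (rule orthosys_expansion[OF os _ g])
    fix h assume h: "h \<in> H" and z: "\<And>n. ip h (e n) = 0"
    have "ip h (gs F n) = 0" for n
    proof (cases "ip (gs F n) (gs F n) = 0")
      case True
      have "(ip h (gs F n))\<^sup>2 \<le> 0" using ip_CS_sq[OF h gs_H[of F n, OF F(1)]] True by simp
      then show ?thesis by simp
    next
      case False
      then show ?thesis using z[of n] unfolding e_def ip_cmult_r by simp
    qed
    then show "AE x in \<mu>. h x = 0" using gs_total[of F, OF F(1) h] tot[OF h] by blast
  qed
  ultimately show ?thesis by (rule that)
qed

end

section \<open>The heat semigroup on finite combinations and L2 limits\<close>

context dirichlet_setting
begin

lemma P_sum:
  assumes "0 \<le> t" "\<And>i. i \<in> I \<Longrightarrow> f i \<in> H" "finite I"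
  shows "AE x in \<mu>. P t (\<lambda>x. \<Sum>i\<in>I. c i * f i x) x = (\<Sum>i\<in>I. c i * P t (f i) x)"
  using assms(3,2)
proof (induction I rule: finite_induct)
  case empty
  then show ?case using P_lin[OF assms(1) H_zero H_zero, of 0 0] by simp
next
  case (insert i I)
  have "AE x in \<mu>. P t (\<lambda>x. c i * f i x + 1 * (\<Sum>i\<in>I. c i * f i x)) x = c i * P t (f i) x + 1 * P t (\<lambda>x. \<Sum>i\<in>I. c i * f i x) x"
    using insert(4) by (intro P_lin assms(1) H_sum H_cmult) auto
  moreover have "AE x in \<mu>. P t (\<lambda>x. \<Sum>i\<in>I. c i * f i x) x = (\<Sum>i\<in>I. c i * P t (f i) x)"
    using insert by auto
  ultimately show ?case by eventually_elim (simp add: insert(1,2))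
qed

lemma P_L2_lim:
  assumes t: "0 \<le> t" and u: "L2_lim u f"
  shows "L2_lim (\<lambda>n. P t (u n)) (P t f)"
  unfolding L2_lim_def
proof (intro conjI allI)
  have m: "u n \<in> H" "f \<in> H" for n using u by (auto simp: L2_lim_def)
  then show "P t (u n) \<in> H" "P t f \<in> H" for n using t by (auto intro: P_H)
  have le: "ip (\<lambda>x. P t (u n) x - P t f x) (\<lambda>x. P t (u n) x - P t f x) \<le> ip (\<lambda>x. u n x - f x) (\<lambda>x. u n x - f x)" for n
  proof -
    have d: "(\<lambda>x. u n x - f x) \<in> H" by (intro H_diff m)
    have "AE x in \<mu>. P t (u n) x - P t f x = P t (\<lambda>x. u n x - f x) x"
      using P_lin[OF t m, of 1 n "-1"] by eventually_elim simp
    then have "ip (\<lambda>x. P t (u n) x - P t f x) (\<lambda>x. P t (u n) x - P t f x) = ip (P t (\<lambda>x. u n x - f x)) (P t (\<lambda>x. u n x - f x))"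
      by (intro ip_cong H_meas) (auto intro!: H_meas H_diff P_H t m)
    then show ?thesis using P_contraction[OF t d] by simp
  qed
  show "(\<lambda>n. ip (\<lambda>x. P t (u n) x - P t f x) (\<lambda>x. P t (u n) x - P t f x)) \<longlonglongrightarrow> 0"
    by (rule tendsto_sandwich[OF _ _ tendsto_const L2_limD(3)[OF u]]) (auto simp: le)
qed

end

section \<open>A countable total family of bounded functions\<close>

context doubling_setting
begin

text \<open>Indicators of finite intersections of basic open sets, cut down to balls for finite
  measure. If \<open>h\<close> is orthogonal to all of them, its integral over every Borel part of
  each ball vanishes by the induction for intersection-stable generators, hence \<open>h\<close> is
  a.e. zero.\<close>

lemma total_family:
  obtains F where "\<And>n::nat. F n \<in> H" "\<And>n x. \<bar>F n x\<bar> \<le> 1"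
    "\<And>h. h \<in> H \<Longrightarrow> (\<And>n. ip h (F n) = 0) \<Longrightarrow> AE x in \<mu>. h x = 0"
proof -
  obtain B :: "'a set set" where B: "countable B" "topological_basis B"
    using ex_countable_basis by blast
  \<comment> \<open>Finite intersections make the generator stable under intersection; the empty one
    puts the whole space into it, which the complement step uses.\<close>
  define G where "G = Inter ` {T. finite T \<and> T \<subseteq> B}"
  have cG: "countable G" unfolding G_def by (intro countable_image countable_Collect_finite_subset B)
  have GI: "Int_stable G"
    unfolding Int_stable_def G_def
  proof (intro ballI)
    fix X Y assume "X \<in> Inter ` {T. finite T \<and> T \<subseteq> B}" "Y \<in> Inter ` {T. finite T \<and> T \<subseteq> B}"
    then obtain T1 T2 where T: "finite T1" "T1 \<subseteq> B" "X = \<Inter>T1" "finite T2" "T2 \<subseteq> B" "Y = \<Inter>T2"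
      by (elim imageE CollectE conjE)
    have "X \<inter> Y = \<Inter>(T1 \<union> T2)" unfolding T by (rule Inter_Un_distrib[symmetric])
    then show "X \<inter> Y \<in> Inter ` {T. finite T \<and> T \<subseteq> B}" using T(1,2,4,5) by (intro image_eqI[of _ _ "T1 \<union> T2"]) simp_all
  qed
  have UG: "UNIV \<in> G" unfolding G_def by (rule image_eqI[of _ _ "{}"]) auto
  have BG: "B \<subseteq> G"
  proof
    fix U assume "U \<in> B"
    then show "U \<in> G" unfolding G_def by (intro image_eqI[of _ _ "{U}"]) auto
  qed
  have Gb: "U \<in> sets borel" if U: "U \<in> G" for U
  proof -
    obtain T where T: "finite T" "T \<subseteq> B" "U = \<Inter>T" using U unfolding G_def by auto
    have "open U" unfolding T(3) using T(1,2) B(2) by (intro open_Inter) (auto simp: topological_basis_open)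
    then show ?thesis by simp
  qed
  have sG: "sigma_sets UNIV G = sets borel"
  proof
    show "sigma_sets UNIV G \<subseteq> sets borel"
      using Gb sets.sigma_sets_subset[of G "borel :: 'a measure"] by auto
    have "sets borel = sigma_sets UNIV B" unfolding borel_eq_countable_basis[OF B] by simp
    then show "sets borel \<subseteq> sigma_sets UNIV G" using sigma_sets_mono'[OF BG] by simp
  qed
  define \<Phi> where "\<Phi> = (\<lambda>(U, m). indicator (U \<inter> ball (undefined :: 'a) (real m)) :: 'a \<Rightarrow> real) ` (G \<times> (UNIV :: nat set))"
  have \<Phi>: "countable \<Phi>" "\<Phi> \<noteq> {}" unfolding \<Phi>_def using cG UG by auto
  let ?F = "from_nat_into \<Phi>"
  have Fi: "?F n \<in> \<Phi>" for n by (rule from_nat_into[OF \<Phi>(2)])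
  have fin: "emeasure \<mu> (A \<inter> ball x r) < \<infinity>" if "A \<in> sets borel" for A x r
    by (rule le_less_trans[OF emeasure_mono ball_fin]) (use that in auto)
  have FH: "f \<in> H \<and> (\<forall>x. \<bar>f x\<bar> \<le> 1)" if f: "f \<in> \<Phi>" for f
  proof -
    obtain U m where "U \<in> G" "f = indicator (U \<inter> ball undefined (real m))" using f unfolding \<Phi>_def by auto
    then show ?thesis using fin Gb by (auto intro!: H_indicator simp: indicator_def)
  qed
  have "AE x in \<mu>. h x = 0" if h: "h \<in> H" and z: "\<And>n. ip h (?F n) = 0" for h
  proof -
    have zz: "ip h (indicator (U \<inter> ball undefined (real m))) = 0" if "U \<in> G" for U m
    proof -
      have "indicator (U \<inter> ball undefined (real m)) \<in> \<Phi>" unfolding \<Phi>_def using that by force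
      then obtain n where "?F n = indicator (U \<inter> ball undefined (real m))"
        using from_nat_into_surj[OF \<Phi>(1)] by blast
      then show ?thesis using z[of n] by simp
    qed
    have "AE x in \<mu>. h x * indicator (ball undefined (real m)) x = 0" for m
    proof -
      let ?h = "\<lambda>x. h x * indicator (ball undefined (real m)) x"
      have hi: "integrable \<mu> ?h" using fin[of UNIV] by (intro H_mult h H_indicator) (auto simp: ball_fin[unfolded infinity_ennreal_def])
      have si: "set_integrable \<mu> A ?h" if "A \<in> sets borel" for A
        unfolding set_integrable_def using integrable_mult_indicator[OF _ hi, of A] that by simp
      show ?thesis
      proof (rule density_zero[OF hi])
        fix A assume "A \<in> sets \<mu>"
        then have "A \<in> sigma_sets UNIV G" by (simp add: sG)
        have GP: "G \<subseteq> Pow UNIV" by simp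
        from GI GP \<open>A \<in> sigma_sets UNIV G\<close> show "set_lebesgue_integral \<mu> A ?h = 0"
        proof (induction rule: sigma_sets_induct_disjoint)
          fix U assume U: "U \<in> G"
          have "set_lebesgue_integral \<mu> U ?h = ip h (indicator (U \<inter> ball undefined (real m)))"
            unfolding set_lebesgue_integral_def L2_inner_def
            by (rule Bochner_Integration.integral_cong) (auto simp: indicator_def)
          then show "set_lebesgue_integral \<mu> U ?h = 0" using zz[OF U] by simp
        next
          show "set_lebesgue_integral \<mu> {} ?h = 0" by (simp add: set_lebesgue_integral_def)
        next
          fix A assume A: "A \<in> sigma_sets UNIV G" and z: "set_lebesgue_integral \<mu> A ?h = 0"
          have "set_lebesgue_integral \<mu> UNIV ?h = ip h (indicator (UNIV \<inter> ball undefined (real m)))"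
            unfolding set_lebesgue_integral_def L2_inner_def by simp
          then have u: "set_lebesgue_integral \<mu> UNIV ?h = 0" using zz[OF UG] by simp
          have Ab: "A \<in> sets borel" using A sG by simp
          have "set_lebesgue_integral \<mu> (A \<union> (UNIV - A)) ?h = set_lebesgue_integral \<mu> A ?h + set_lebesgue_integral \<mu> (UNIV - A) ?h"
            using Ab by (intro set_integral_Un si) auto
          then show "set_lebesgue_integral \<mu> (UNIV - A) ?h = 0" using u z by simp
        next
          fix A :: "nat \<Rightarrow> 'a set"
          assume A: "disjoint_family A" "range A \<subseteq> sigma_sets UNIV G" "\<And>i. set_lebesgue_integral \<mu> (A i) ?h = 0"
          have Ab: "A i \<in> sets borel" for i using A(2) sG by auto
          have "set_lebesgue_integral \<mu> (\<Union>i. A i) ?h = (\<Sum>i. set_lebesgue_integral \<mu> (A i) ?h)"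
            using Ab A(1) by (intro lebesgue_integral_countable_add si) (auto simp: disjoint_family_on_def)
          then show "set_lebesgue_integral \<mu> (\<Union>i. A i) ?h = 0" using A(3) by simp
        qed
      qed
    qed
    then have "AE x in \<mu>. \<forall>m. h x * indicator (ball undefined (real m)) x = 0" unfolding AE_all_countable by blast
    then show ?thesis
    proof eventually_elim
      case (elim x)
      obtain m where "dist undefined x < real m" using reals_Archimedean2 by blast
      then show ?case using elim[rule_format, of m] by simp
    qed
  qed
  then show ?thesis using that[of ?F] FH[OF Fi] by blast
qed

end

section \<open>The summed heat bound and the kernel\<close>

context weight_setting
begin

text \<open>Duality: at a fixed point the pointwise bound for all combinations of the
  \<open>e i\<close> controls the vector of the values \<open>P \<tau> (e i) x\<close>. Choosing
  this vector itself as coefficients gives \<open>S\<^sup>2 \<le> (C / v) * S\<close> for its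
  squared length \<open>S\<close>, uniformly in the number of terms.\<close>

lemma orthosys_heat_bound:
  assumes C: "0 < C" and uc: "\<And>f M. f \<in> H \<Longrightarrow> AE y in \<mu>. \<bar>f y\<bar> \<le> M \<Longrightarrow> 0 < M \<Longrightarrow>
      AE y in \<mu>. (P \<tau> f y)\<^sup>2 \<le> C * ip f f / v y (sqrt \<tau>)"
    and \<tau>: "0 < \<tau>" and e: "orthosys e" and eb: "\<And>n. \<exists>M. \<forall>x. \<bar>e n x\<bar> \<le> M"
  shows "AE x in \<mu>. \<forall>N. (\<Sum>i<N. (P \<tau> (e i) x)\<^sup>2) \<le> C / v x (sqrt \<tau>)"
proof -
  have eH: "e i \<in> H" for i using e by (auto simp: orthosys_def)
  obtain M where M: "\<And>n x. \<bar>e n x\<bar> \<le> M n" using eb by metis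
  let ?q = "\<lambda>(q :: rat list) i. real_of_rat (q ! i)"
  \<comment> \<open>Coefficients are lists of rationals, so that they range over a countable type
    and a single null set serves all of them.\<close>
  have one: "AE x in \<mu>. (\<Sum>i<N. ?q q i * P \<tau> (e i) x)\<^sup>2 \<le> C * (\<Sum>i<N. (?q q i)\<^sup>2) / v x (sqrt \<tau>)" for N q
  proof -
    let ?f = "\<lambda>x. \<Sum>i<N. ?q q i * e i x"
    let ?B = "1 + (\<Sum>i<N. \<bar>?q q i\<bar> * M i)"
    have fH: "?f \<in> H" by (intro H_sum H_cmult eH)
    have M0: "0 \<le> M i" for i using M[of i undefined] by linarith
    have "\<bar>?f x\<bar> \<le> ?B" for x
    proof -
      have "\<bar>?f x\<bar> \<le> (\<Sum>i<N. \<bar>?q q i * e i x\<bar>)" by (rule sum_abs)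
      also have "\<dots> \<le> (\<Sum>i<N. \<bar>?q q i\<bar> * M i)" unfolding abs_mult by (intro sum_mono mult_left_mono M) auto
      finally show ?thesis by simp
    qed
    moreover have "0 < ?B" using sum_nonneg[of "{..<N}" "\<lambda>i. \<bar>?q q i\<bar> * M i"] M0 by (simp add: add_pos_nonneg)
    ultimately have "AE y in \<mu>. (P \<tau> ?f y)\<^sup>2 \<le> C * ip ?f ?f / v y (sqrt \<tau>)" by (intro uc[OF fH, of ?B]) simp_all
    moreover have "AE y in \<mu>. P \<tau> ?f y = (\<Sum>i<N. ?q q i * P \<tau> (e i) y)"
      using \<tau> by (intro P_sum eH) auto
    ultimately show ?thesis
    proof eventually_elim
      case (elim y)
      have "C * ip ?f ?f / v y (sqrt \<tau>) \<le> C * (\<Sum>i<N. (?q q i)\<^sup>2) / v y (sqrt \<tau>)"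
        using C v_pos[of "sqrt \<tau>" y] \<tau> orthosys_ip_le[OF e, of "{..<N}" "?q q"]
        by (intro divide_right_mono mult_left_mono) auto
      then show ?case using elim by simp
    qed
  qed
  have "AE x in \<mu>. \<forall>N q. (\<Sum>i<N. ?q q i * P \<tau> (e i) x)\<^sup>2 \<le> C * (\<Sum>i<N. (?q q i)\<^sup>2) / v x (sqrt \<tau>)"
    using one by (simp add: AE_all_countable)
  then show ?thesis
  proof eventually_elim
    case (elim x)
    define a where "a i = P \<tau> (e i) x" for i
    show ?case
    proof
      fix N
      let ?S = "\<Sum>i<N. (a i)\<^sup>2" and ?w = "v x (sqrt \<tau>)"
      have w: "0 < ?w" using v_pos \<tau> by simp
      \<comment> \<open>Rational approximations of the values at the point; the coefficients wanted
        in the end are these values, which depend on the point and are known only outside the null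
        set.\<close>
      define r where "r n i = of_int \<lfloor>real (Suc n) * a i\<rfloor> / (of_nat (Suc n) :: rat)" for n i
      have rq: "real_of_rat (r n i) = of_int \<lfloor>real (Suc n) * a i\<rfloor> / real (Suc n)" for n i
        unfolding r_def of_rat_divide of_rat_of_int_eq of_rat_of_nat_eq ..
      have rl: "(\<lambda>n. real_of_rat (r n i)) \<longlonglongrightarrow> a i" for i
      proof (rule tendsto_sandwich[of "\<lambda>n. a i - 1 / real (Suc n)" _ _ "\<lambda>_. a i"])
        have "(\<lambda>n. a i - 1 / real (Suc n)) \<longlonglongrightarrow> a i - 0"
          by (intro tendsto_diff tendsto_const LIMSEQ_Suc[OF lim_1_over_n])
        then show "(\<lambda>n. a i - 1 / real (Suc n)) \<longlonglongrightarrow> a i" by simp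
        have "real (Suc n) * a i - 1 \<le> of_int \<lfloor>real (Suc n) * a i\<rfloor>" for n by linarith
        then have "(real (Suc n) * a i - 1) / real (Suc n) \<le> real_of_rat (r n i)" for n
          unfolding rq by (rule divide_right_mono) simp
        then show "\<forall>\<^sub>F n in sequentially. a i - 1 / real (Suc n) \<le> real_of_rat (r n i)"
          by (simp add: diff_divide_distrib)
        have "of_int \<lfloor>real (Suc n) * a i\<rfloor> \<le> real (Suc n) * a i" for n by linarith
        then have "real_of_rat (r n i) \<le> (real (Suc n) * a i) / real (Suc n)" for n
          unfolding rq by (rule divide_right_mono) simp
        then show "\<forall>\<^sub>F n in sequentially. real_of_rat (r n i) \<le> a i" by simp
      qed simp
      have le: "(\<Sum>i<N. real_of_rat (r n i) * a i)\<^sup>2 \<le> C * (\<Sum>i<N. (real_of_rat (r n i))\<^sup>2) / ?w" for n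
      proof -
        have "(\<Sum>i<N. ?q (map (r n) [0..<N]) i * a i) = (\<Sum>i<N. real_of_rat (r n i) * a i)"
          "(\<Sum>i<N. (?q (map (r n) [0..<N]) i)\<^sup>2) = (\<Sum>i<N. (real_of_rat (r n i))\<^sup>2)"
          by (intro sum.cong; simp)+
        then show ?thesis using elim[THEN spec[of _ N], THEN spec[of _ "map (r n) [0..<N]"]] unfolding a_def[symmetric] by simp
      qed
      have "(\<lambda>n. (\<Sum>i<N. real_of_rat (r n i) * a i)\<^sup>2) \<longlonglongrightarrow> (\<Sum>i<N. a i * a i)\<^sup>2"
        by (intro tendsto_power tendsto_sum tendsto_mult rl tendsto_const)
      moreover have "(\<lambda>n. C * (\<Sum>i<N. (real_of_rat (r n i))\<^sup>2) / ?w) \<longlonglongrightarrow> C * ?S / ?w"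
        by (intro tendsto_divide tendsto_power tendsto_sum tendsto_mult rl tendsto_const) (use w in auto)
      ultimately have "(\<Sum>i<N. a i * a i)\<^sup>2 \<le> C * ?S / ?w"
        by (rule LIMSEQ_le) (use le in blast)
      then have sq: "?S * ?S \<le> (C / ?w) * ?S" by (simp add: power2_eq_square)
      have "?S \<le> C / ?w"
      proof (cases "?S = 0")
        case True
        then show ?thesis using C w by simp
      next
        case False
        then have "0 < ?S" using sum_nonneg[of "{..<N}" "\<lambda>i. (a i)\<^sup>2"] by (simp add: order_less_le)
        then show ?thesis using sq by (simp only: mult_le_cancel_right_pos)
      qed
      then show "(\<Sum>i<N. (P \<tau> (e i) x)\<^sup>2) \<le> C / ?w" unfolding a_def .
    qed
  qed
qed

text \<open>Splitting the time in halves writes the kernel as an inner product of two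
  square-summable sequences, whose lengths \<open>orthosys_heat_bound\<close> controls;
  Cauchy--Schwarz gives convergence and the product form of the bound at once. The radius constant
  \<open>sqrt (1 / 2)\<close> records the half time.\<close>

lemma FK_imp_DUE:
  assumes "FK_inhom \<mu> L v" shows "DUE \<mu> L v"
proof -
  obtain C where C: "0 < C" and uc: "\<And>t f M. 0 < t \<Longrightarrow> f \<in> H \<Longrightarrow> AE y in \<mu>. \<bar>f y\<bar> \<le> M \<Longrightarrow> 0 < M \<Longrightarrow>
    AE y in \<mu>. (P t f y)\<^sup>2 \<le> C * ip f f / v y (sqrt t)"
    by (rule heat_ultracontractive[OF assms]) blast
  obtain F where F: "\<And>n::nat. F n \<in> H" "\<And>n x. \<bar>F n x\<bar> \<le> 1"
    "\<And>h. h \<in> H \<Longrightarrow> (\<And>n. ip h (F n) = 0) \<Longrightarrow> AE x in \<mu>. h x = 0" by (rule total_family) blast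
  have F2: "\<exists>M. \<forall>x. \<bar>F n x\<bar> \<le> M" for n using F(2) by blast
  obtain e where e: "orthosys e" "\<And>n. \<exists>M. \<forall>x. \<bar>e n x\<bar> \<le> M"
    "\<And>g. g \<in> H \<Longrightarrow> L2_lim (\<lambda>N x. \<Sum>i<N. ip g (e i) * e i x) g"
    by (rule orthosys_exists[of F, OF F(1) F2 F(3)]) blast+
  have eH: "e i \<in> H" for i using e by (auto simp: orthosys_def)
  define p where "p t x y = (\<Sum>i. P (t / 2) (e i) x * P (t / 2) (e i) y)" for t x y
  define c where "c = sqrt (1 / 2 :: real)"
  have c: "0 < c" "sqrt (t / 2) = c * sqrt t" for t by (simp_all add: c_def real_sqrt_mult[symmetric])
  have aH: "P (t / 2) (e i) \<in> H" if "0 < t" for t i using that by (intro P_H eH) auto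
  have good: "AE x in \<mu>. \<forall>N. (\<Sum>i<N. (P (t / 2) (e i) x)\<^sup>2) \<le> C / v x (c * sqrt t)" if t: "0 < t" for t
    using orthosys_heat_bound[OF C uc _ e(1,2), of "t / 2"] t unfolding c by simp
  have conv: "(\<lambda>N. \<Sum>i<N. a i * b i) \<longlonglongrightarrow> (\<Sum>i. a i * b i)" "\<bar>\<Sum>i. a i * b i\<bar> \<le> sqrt A * sqrt B"
    if "\<And>N. (\<Sum>i<N. (a i)\<^sup>2) \<le> A" "\<And>N. (\<Sum>i<N. (b i)\<^sup>2) \<le> B" for a b :: "nat \<Rightarrow> real" and A B
  proof -
    have sa: "summable (\<lambda>i. (a i)\<^sup>2)" "summable (\<lambda>i. (b i)\<^sup>2)"
      by (rule summableI_nonneg_bounded[OF _ that(1)], simp) (rule summableI_nonneg_bounded[OF _ that(2)], simp)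
    have "norm (a i * b i) \<le> (a i)\<^sup>2 + (b i)\<^sup>2" for i
    proof -
      have "2 * \<bar>a i * b i\<bar> \<le> (a i)\<^sup>2 + (b i)\<^sup>2"
        using sum_squares_bound[of "\<bar>a i\<bar>" "\<bar>b i\<bar>"] by (simp add: abs_mult mult.assoc)
      then show ?thesis unfolding real_norm_def by linarith
    qed
    then have "summable (\<lambda>i. a i * b i)"
      by (intro summable_comparison_test'[OF summable_add[OF sa], of 0])
    then show l: "(\<lambda>N. \<Sum>i<N. a i * b i) \<longlonglongrightarrow> (\<Sum>i. a i * b i)" by (rule summable_LIMSEQ)
    have "\<bar>\<Sum>i<N. a i * b i\<bar> \<le> sqrt A * sqrt B" for N
    proof -
      have "(\<Sum>i<N. a i * b i)\<^sup>2 \<le> (\<Sum>i<N. (a i)\<^sup>2) * (\<Sum>i<N. (b i)\<^sup>2)"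
        by (rule Cauchy_Schwarz_ineq_sum)
      also have "\<dots> \<le> A * B" using that[of 0] that by (intro mult_mono sum_nonneg) auto
      finally have "sqrt ((\<Sum>i<N. a i * b i)\<^sup>2) \<le> sqrt (A * B)" by (rule real_sqrt_le_mono)
      then show ?thesis by (simp add: real_sqrt_mult)
    qed
    then show "\<bar>\<Sum>i. a i * b i\<bar> \<le> sqrt A * sqrt B"
      by (intro LIMSEQ_le_const2[OF tendsto_rabs[OF l]]) auto
  qed
  have "integral_kernel \<mu> (heat_op \<mu> L t) (p t)" if t: "0 < t" for t
  proof -
    define a where "a i = P (t / 2) (e i)" for i
    have aH': "a i \<in> H" for i unfolding a_def by (rule aH[OF t])
    have am [measurable]: "a i \<in> borel_measurable \<mu>" for i by (rule H_meas[OF aH'])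
    have t2: "0 \<le> t / 2" using t by simp
    have pt: "p t x y = (\<Sum>i. a i x * a i y)" for x y by (simp add: p_def a_def)
    have pm: "case_prod (p t) \<in> borel_measurable (\<mu> \<Otimes>\<^sub>M \<mu>)"
      unfolding pt[abs_def] by measurable
    have gd: "AE x in \<mu>. \<forall>N. (\<Sum>i<N. (a i x)\<^sup>2) \<le> C / v x (c * sqrt t)"
      unfolding a_def by (rule good[OF t])
    have ser: "AE y in \<mu>. \<forall>N. P (t / 2) (\<lambda>x. \<Sum>i<N. d i * e i x) y = (\<Sum>i<N. d i * a i y)" for d
      unfolding AE_all_countable a_def by (intro allI P_sum t2 eH) auto
    have key: "AE x in \<mu>. integrable \<mu> (\<lambda>y. p t x y * f y) \<and> g x = (\<integral>y. p t x y * f y \<partial>\<mu>)"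
      if fg: "(f, g) \<in> heat_op \<mu> L t" for f g
    proof -
      have f: "f \<in> H" by (rule heat_op_dom[OF fg])
      have g: "AE x in \<mu>. g x = P t f x" using heat_op_unique[OF t f fg] by blast
      \<comment> \<open>For a fixed good \<open>x\<close> the values \<open>a i x\<close> are
        square-summable, so they are the coefficients of some \<open>h\<close> in \<open>H\<close>,
        and \<open>p t x\<close> is a version of \<open>P (t / 2) h\<close>. Hence it lies in
        \<open>H\<close>, and pairing with \<open>f\<close> can be done termwise.\<close>
      have int: "integrable \<mu> (\<lambda>y. p t x y * f y) \<and> (\<lambda>N. \<Sum>i<N. a i x * ip (a i) f) \<longlonglongrightarrow> (\<integral>y. p t x y * f y \<partial>\<mu>)"
        if x: "\<forall>N. (\<Sum>i<N. (a i x)\<^sup>2) \<le> C / v x (c * sqrt t)" for x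
      proof -
        have "summable (\<lambda>i. (a i x)\<^sup>2)" using x by (auto intro: summableI_nonneg_bounded)
        then obtain h where h: "L2_lim (\<lambda>N y. \<Sum>i<N. a i x * e i y) h"
          using orthosys_series[OF e(1), of "\<lambda>i. a i x"] by blast
        let ?k = "\<lambda>N. P (t / 2) (\<lambda>y. \<Sum>i<N. a i x * e i y)"
        have l: "L2_lim ?k (P (t / 2) h)" by (rule P_L2_lim[OF t2 h])
        have px: "p t x \<in> borel_measurable \<mu>" unfolding pt[abs_def] by measurable
        have "AE y in \<mu>. (\<lambda>N. ?k N y) \<longlonglongrightarrow> p t x y"
          using gd ser[of "\<lambda>i. a i x"]
        proof eventually_elim
          case (elim y)
          have "(\<lambda>N. \<Sum>i<N. a i x * a i y) \<longlonglongrightarrow> p t x y"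
            unfolding pt using x elim(1) by (intro conv(1)) (rule spec; assumption)+
          then show ?case using elim(2) by simp
        qed
        then have ae: "AE y in \<mu>. P (t / 2) h y = p t x y" by (rule L2_lim_AE_lim[OF l px])
        have pH: "p t x \<in> H" by (rule H_cong[OF L2_limD(2)[OF l] px ae])
        have "ip (?k N) f = (\<Sum>i<N. a i x * ip (a i) f)" for N
        proof -
          have "AE y in \<mu>. ?k N y = (\<Sum>i<N. a i x * a i y)" using ser[of "\<lambda>i. a i x"] by eventually_elim simp
          then have "ip (?k N) f = ip (\<lambda>y. \<Sum>i<N. a i x * a i y) f"
            using H_meas[OF L2_limD(1)[OF l]] H_meas[OF f] by (intro ip_cong) auto
          then show ?thesis using ip_lincomb[of "{..<N}" a f "\<lambda>i. a i x"] aH' f by simp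
        qed
        moreover have "ip (P (t / 2) h) f = ip (p t x) f"
          using H_meas[OF L2_limD(2)[OF l]] H_meas[OF f] px ae by (intro ip_cong) auto
        ultimately have "(\<lambda>N. \<Sum>i<N. a i x * ip (a i) f) \<longlonglongrightarrow> ip (p t x) f"
          using L2_lim_ip_const[OF l f] by simp
        then show ?thesis using H_mult[OF pH f] by (simp add: L2_inner_def)
      qed
      let ?g = "P (t / 2) f"
      have gH: "?g \<in> H" by (rule P_H[OF t2 f])
      let ?u = "\<lambda>N. P (t / 2) (\<lambda>x. \<Sum>i<N. ip ?g (e i) * e i x)"
      \<comment> \<open>\<open>lim\<close> is a total function, which gives measurability; its value
        matters only at good points, where the series converges.\<close>
      let ?G = "\<lambda>x. lim (\<lambda>N. \<Sum>i<N. a i x * ip (a i) f)"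
      \<comment> \<open>One half of the semigroup is expanded in the orthonormal system and the
        other half applied term by term; by symmetry the coefficients are
        \<open>ip (a i) f\<close>.\<close>
      have u: "L2_lim ?u (P (t / 2) ?g)" by (rule P_L2_lim[OF t2 e(3)[OF gH]])
      have ie: "ip ?g (e i) = ip (a i) f" for i
        unfolding a_def using P_sym[OF t2 f eH] by (simp add: L2_inner_def mult.commute)
      have "AE x in \<mu>. (\<lambda>N. ?u N x) \<longlonglongrightarrow> ?G x"
        using gd ser[of "\<lambda>i. ip ?g (e i)"]
      proof eventually_elim
        case (elim x)
        have "(\<lambda>N. \<Sum>i<N. a i x * ip (a i) f) \<longlonglongrightarrow> ?G x"
          using int[OF elim(1)] convergent_LIMSEQ_iff convergentI by blast
        then show ?case using elim(2) by (simp add: ie mult.commute)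
      qed
      then have "AE x in \<mu>. P (t / 2) ?g x = ?G x" by (intro L2_lim_AE_lim[OF u]) measurable
      moreover have "AE x in \<mu>. P (t / 2) ?g x = P (t / 2 + t / 2) f x" by (rule P_semigroup[OF t2 t2 f])
      ultimately show ?thesis
        using g gd
      proof eventually_elim
        case (elim x)
        note i = int[OF elim(4)]
        have "?G x = (\<integral>y. p t x y * f y \<partial>\<mu>)" using i by (intro limI) blast
        then show ?case using i elim by simp
      qed
    qed
    show ?thesis unfolding integral_kernel_def using pm key by blast
  qed
  moreover have "AE (x, y) in \<mu> \<Otimes>\<^sub>M \<mu>. \<bar>p t x y\<bar> \<le> C * (v x (c * sqrt t) * v y (c * sqrt t)) powr (- (1 / 2))"
    if t: "0 < t" for t
  proof -
    interpret pp: pair_sigma_finite \<mu> \<mu> by unfold_locales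
    have ct: "0 < c * sqrt t" using c t by simp
    define a where "a i = P (t / 2) (e i)" for i
    have [measurable]: "a i \<in> borel_measurable \<mu>" for i unfolding a_def by (rule H_meas[OF aH[OF t]])
    have [measurable]: "(\<lambda>x. v x (c * sqrt t)) \<in> borel_measurable \<mu>" using condA ct by (auto simp: cond_A_def)
    have pt: "p t x y = (\<Sum>i. a i x * a i y)" for x y by (simp add: p_def a_def)
    have gd: "AE x in \<mu>. \<forall>N. (\<Sum>i<N. (a i x)\<^sup>2) \<le> C / v x (c * sqrt t)"
      unfolding a_def by (rule good[OF t])
    show ?thesis
      unfolding pt
    \<comment> \<open>The estimate holds for almost every \<open>x\<close> and then almost every
      \<open>y\<close>; measurability of the set of good pairs turns this into a statement on the
      product.\<close>
    proof (rule pp.AE_pair_measure)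
      show "{x \<in> space (\<mu> \<Otimes>\<^sub>M \<mu>). case x of (x, y) \<Rightarrow>
          \<bar>\<Sum>i. a i x * a i y\<bar> \<le> C * (v x (c * sqrt t) * v y (c * sqrt t)) powr (- (1 / 2))} \<in> sets (\<mu> \<Otimes>\<^sub>M \<mu>)"
        by measurable
      show "AE x in \<mu>. AE y in \<mu>. case (x, y) of (x, y) \<Rightarrow>
          \<bar>\<Sum>i. a i x * a i y\<bar> \<le> C * (v x (c * sqrt t) * v y (c * sqrt t)) powr (- (1 / 2))"
        using gd
      proof eventually_elim
        case (elim x)
        note x = elim
        show ?case using gd
        proof eventually_elim
          case (elim y)
          have w: "0 < v x (c * sqrt t)" "0 < v y (c * sqrt t)" using v_pos[OF ct] by auto
          have "\<bar>\<Sum>i. a i x * a i y\<bar> \<le> sqrt (C / v x (c * sqrt t)) * sqrt (C / v y (c * sqrt t))"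
            using x elim by (intro conv(2)) auto
          also have "\<dots> = C * (1 / sqrt (v x (c * sqrt t) * v y (c * sqrt t)))"
            using C by (simp add: real_sqrt_divide real_sqrt_mult)
          also have "1 / sqrt (v x (c * sqrt t) * v y (c * sqrt t)) = (v x (c * sqrt t) * v y (c * sqrt t)) powr (- (1 / 2))"
            using w by (simp add: powr_minus powr_half_sqrt inverse_eq_divide)
          finally show ?case by simp
        qed
      qed
    qed
  qed
  ultimately show ?thesis unfolding DUE_def using C c(1) by blast
qed

end

theorem theorem3p3p3:
  fixes \<mu> :: "'a::polish_space measure"
    and L :: "'a op_graph"
    and v :: "'a \<Rightarrow> real \<Rightarrow> real"
  assumes "\<forall>x. \<forall>r>0. 0 < emeasure \<mu> (ball x r) \<and> emeasure \<mu> (ball x r) < \<infinity>"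
    and "hyp_H \<mu> L"
    and "volume_doubling \<mu>"
    and "\<forall>x. \<forall>r>0. 0 \<le> v x r"
    and "cond_A \<mu> v"
    and "cond_Dv \<mu> v"
    and "cond_Dv' v"
  shows "DUE \<mu> L v \<longleftrightarrow> FK_inhom \<mu> L v"
proof -
  have sets: "sets \<mu> = sets borel" using assms(2) by (simp add: hyp_H_def borel_measure_hyp_def)
  \<comment> \<open>Positive radii are covered by the assumption; balls of other radii are
    empty.\<close>
  have fin: "emeasure \<mu> (ball x r) < \<infinity>" for x r
    using assms(1) by (cases "0 < r") (auto simp: ball_empty)
  have "sigma_finite_measure \<mu>"
  proof
    have "\<exists>n. dist undefined x < real n" for x :: 'a by (rule reals_Archimedean2)
    then have "(\<Union>n. ball (undefined :: 'a) (real n)) = space \<mu>"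
      using sets_eq_imp_space_eq[OF sets] by (auto simp: set_eq_iff)
    then show "\<exists>A. countable A \<and> A \<subseteq> sets \<mu> \<and> \<Union>A = space \<mu> \<and> (\<forall>a\<in>A. emeasure \<mu> a \<noteq> \<infinity>)"
      using fin sets by (intro exI[of _ "range (\<lambda>n. ball (undefined :: 'a) (real n))"]) (auto simp: less_top)
  qed
  then interpret weight_setting \<mu> L v
    using assms fin by (simp add: weight_setting_def weight_setting_axioms_def doubling_setting_def
        doubling_setting_axioms_def dirichlet_setting_def dirichlet_setting_axioms_def l2_setting_def)
  show ?thesis using DUE_imp_FK FK_imp_DUE by blast
qed

end
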